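(* Assume the standing assumptions of the convergence analysis listed in the context, for some $l\in\{0,\dots,\lfloor T/\tau\rfloor-1\}$. Then for every $0\le m\le l$ and every finite element function $\phi_h$ (an $\mathbb R^2$-valued nodal vector, realized in $[S_h(\hat\Gamma_{h,*}^m)]^2$ and in $[S_h(\hat\Gamma_{h,*}^{m+1})]^2$), the discrete time derivatives of the consistency functionals $\mathscr D_{13}^m,\mathscr D_{22}^m,\mathscr D_{23}^m$ satisfy $$|\delta_\tau\mathscr D_{13}^m(\phi_h)|\lesssim h^2\|\phi_h\|_{H^1(\hat\Gamma_{h,*}^m)},\qquad |\delta_\tau\mathscr D_{22}^m(\phi_h)+\delta_\tau\mathscr D_{23}^m(\phi_h)|\lesssim h^2\|\phi_h\|_{H^1(\hat\Gamma_{h,*}^m)} .$$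
   Context: **Exact flow.** $\Gamma(t)\subset\mathbb R^2$, $t\in[0,T]$, is a smooth family of simple closed curves, $\Gamma^0=\Gamma(0)$, with outward unit normal $n$ and curvature $H$ given by $Hn=-\Delta_{\Gamma(t)}\mathrm{id}$, moving by curve-shortening flow: the flow map $X(\cdot,t):\Gamma^0\to\Gamma(t)$ satisfies $X(\cdot,0)=\mathrm{id}$ and $\partial_tX=-(Hn)\circ X$; $X(\cdot,t)$ and its inverse are sufficiently smooth uniformly in $t$. For a time step $\tau>0$, $t_m=m\tau$, $\Gamma^m=\Gamma(t_m)$, $n^m,H^m$ are $n,H$ at $t_m$; $X^m=X(\cdot,t_m)$ and $Y^{m+1}=X^{m+1}\circ(X^m)^{-1}:\Gamma^m\to\Gamma^{m+1}$. $a^m:U_\delta(\Gamma^m)\to\Gamma^m$ is the closest-point retraction from a tubular neighbourhood of fixed width $\delta$. **Polygonal curves and finite elements.** Polygonal curves are simple closed polygons whose edges $K$ are the elements; $\mathcal N(\cdot)$ is the set of vertices. $S_h(\Sigma)$ is the space of continuous, edgewise affine functions on the polygon $\Sigma$; $I_h$ is nodal interpolation. All polygons considered have corresponding nodes and edges, and a finite element function is identified with its nodal vector: the same nodal vector can be realized on each polygon, the domain of an integral or norm telling which realization is meant. Mass-lumped integral: $\int_\Sigma^hf=\sum_K\frac{|K|}2\sum_{p\in\mathcal N(K)}f|_K(p)$. $\nabla_\Sigma$ is the (edgewise) tangential gradient; dots between matrices denote the Frobenius product. **Scheme.** At a vertex $p$ with adjacent edges of lengths $\ell_-,\ell_+$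 and outward unit edge normals $n(p-),n(p+)$, set $\bar n(p)=\frac{\ell_+n(p-)+\ell_-n(p+)}{\ell_-+\ell_+}$; these nodal values define $\bar n_h^m\in[S_h(\Gamma_h^m)]^2$ on $\Gamma_h^m$. Starting from an initial polygon $\Gamma_h^0$ of mesh size $h$ with $X_h^0=\mathrm{id}$, given $\Gamma_h^m$ find $X_h^{m+1}\in[S_h(\Gamma_h^m)]^2$ with $$\int_{\Gamma_h^m}^h\frac{X_h^{m+1}-\mathrm{id}}{\tau}\cdot\bar n_h^m\,\phi_h\cdot\bar n_h^m+\int_{\Gamma_h^m}\nabla_{\Gamma_h^m}X_h^{m+1}\cdot\nabla_{\Gamma_h^m}\phi_h=\int_{\Gamma_h^m}\nabla_{\Gamma_h^m}\mathrm{id}\cdot\nabla_{\Gamma_h^m}I_h[\phi_h-(\phi_h\cdot\bar n_h^m)\bar n_h^m]$$ for all $\phi_h\in[S_h(\Gamma_h^m)]^2$, and set $\Gamma_h^{m+1}=X_h^{m+1}(\Gamma_h^m)$. $X_h^m$ also denotes the finite element function whose nodal vector $(x_1^m,\dots,x_J^m)$ consists of the vertices of $\Gamma_h^m$. **Projected curve and errors.** $\hat X_{h,*}^m$ is the finite element function with nodal vector $(a^m(x_1^m),\dots,a^m(x_J^m))$; $\hat\Gamma_{h,*}^m=\hat X_{h,*}^m(\Gamma_h^0)$; $a^m|_{\hat\Gamma_{h,*}^m}:\hat\Gamma_{h,*}^m\to\Gamma^m$ is bijective. Lift: $\phi^\ell=\phi\circ(a^m|_{\hat\Gamma_{h,*}^m})^{-1}$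 on $\Gamma^m$; inverse lift: $f^{-\ell}=f\circ a^m|_{\hat\Gamma_{h,*}^m}$. $X_{h,*}^{m+1}$ is the finite element function with $X_{h,*}^{m+1}(p)=Y^{m+1}(p)$ at the nodes $p\in\mathcal N(\hat\Gamma_{h,*}^m)$. $\hat e_h^m=X_h^m-\hat X_{h,*}^m$, $e_h^{m+1}=X_h^{m+1}-X_{h,*}^{m+1}$, $e_h^0:=\hat e_h^0$. Mesh regularity constant: $\kappa_l=\max_{0\le m\le l}\big(\|\hat X_{h,*}^m\|_{W^{1,\infty}(\Gamma_h^0)}+\|(\hat X_{h,*}^m)^{-1}\|_{W^{1,\infty}(\hat\Gamma_{h,*}^m)}\big)$. **Standing assumptions.** $\kappa_0\le C_{\rm sh}$; $c_{\rm q}h\le|K|\le C_{\rm q}h$ for all edges $K$ of $\Gamma_h^0$; $\hat e_h^0=0$; $\tau\le c_0h^2$; $h$ is sufficiently small (depending on $\kappa_l$ and the fixed constants); and for all $m=0,\dots,l$ the induction hypothesis holds: $$\|\hat e_h^m\|_{L^2}+\|e_h^m\|_{L^2}+\|\hat e_h^m\|_{L^\infty}+\|e_h^m\|_{L^\infty}+\|\hat e_h^m\|_{H^1}+\|e_h^m\|_{H^1}+h^{1/2}\big(\|\hat e_h^m\|_{W^{1,\infty}}+\|e_h^m\|_{W^{1,\infty}}\big)\le h^{7/4},$$ all norms over $\hat\Gamma_{h,*}^m$. $A\lesssim B$ means $A\le CB$ with $C$ independent of $h,\tau,m$ (and of $\phi_h$), possibly depending on $\kappa_l$, $T$, $c_0,c_{\rm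 q},C_{\rm q},C_{\rm sh}$ and the exact solution. **Consistency functionals.** For $\phi_h\in[S_h(\hat\Gamma_{h,*}^m)]^2$, $$\mathscr D_{13}^m(\phi_h)=-\Big(\int_{\hat\Gamma_{h,*}^m}^h-\int_{\hat\Gamma_{h,*}^m}\Big)(H^mn^m)^{-\ell}\cdot\phi_h,$$ $$\mathscr D_{22}^m(\phi_h)=\int_{\hat\Gamma_{h,*}^m}\nabla_{\hat\Gamma_{h,*}^m}\hat X_{h,*}^m\cdot\nabla_{\hat\Gamma_{h,*}^m}\phi_h-\int_{\Gamma^m}\nabla_{\Gamma^m}(\hat X_{h,*}^m)^\ell\cdot\nabla_{\Gamma^m}\phi_h^\ell,$$ $$\mathscr D_{23}^m(\phi_h)=\int_{\Gamma^m}\nabla_{\Gamma^m}\big[(I_ha^m|_{\hat\Gamma_{h,*}^m})^\ell-a^m\big]\cdot\nabla_{\Gamma^m}\phi_h^\ell ,$$ where $I_ha^m|_{\hat\Gamma_{h,*}^m}=\mathrm{id}=\hat X_{h,*}^m$ on $\hat\Gamma_{h,*}^m$ and $a^m=\mathrm{id}$ on $\Gamma^m$. The discrete time derivative is $\delta_\tau\mathscr D^m_{ij}(\phi_h)=\tau^{-1}\big(\mathscr D^{m+1}_{ij}(\phi_h)-\mathscr D^m_{ij}(\phi_h)\big)$, with $\phi_h$ having the same nodal values at both time levels. *)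

theory Defs
  imports "HOL-Analysis.Analysis"
begin

section \<open>Calculus along parametrised curves\<close>

text \<open>
  Curves are given by regular parametrisations \<open>c\<close> over \<open>{0..1}\<close>. Integrands are functions of the
  parameter. The tangential gradient of \<open>f\<close> is the matrix with entries (arc-length derivative of
  \<open>f\<^sub>i\<close>) times (\<open>k\<close>-th component of the unit tangent), the inner product on \<open>real^2^2\<close> is the
  Frobenius product, and none of these notions depends on the choice of \<open>c\<close>.
  Where \<open>f \<circ> c\<close> is not differentiable (finitely many parameters below) the value is irrelevant.
\<close>

definition curve_int :: "(real \<Rightarrow> real^2) \<Rightarrow> (real \<Rightarrow> real) \<Rightarrow> real" where
  "curve_int c g = integral {0..1} (\<lambda>s. g s * norm (vector_derivative c (at s)))"

definition tgrad :: "(real \<Rightarrow> real^2) \<Rightarrow> (real^2 \<Rightarrow> real^2) \<Rightarrow> real \<Rightarrow> real^2^2" where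
  "tgrad c f s =
     (let c' = vector_derivative c (at s); f' = vector_derivative (f \<circ> c) (at s)
      in \<chi> i k. (f' $ i / norm c') * (c' $ k / norm c'))"

definition laplace_beltrami :: "(real \<Rightarrow> real^2) \<Rightarrow> (real^2 \<Rightarrow> real^2) \<Rightarrow> real \<Rightarrow> real^2" where
  "laplace_beltrami c f s =
     vector_derivative
       (\<lambda>r. vector_derivative (f \<circ> c) (at r) /\<^sub>R norm (vector_derivative c (at r))) (at s)
     /\<^sub>R norm (vector_derivative c (at s))"

text \<open>\<open>\<nu>\<close> is the outward unit normal at the point \<open>p\<close> of the closed curve \<open>S\<close> with tangent direction \<open>d\<close>.\<close>

definition outward_unit_normal :: "(real^2) set \<Rightarrow> real^2 \<Rightarrow> real^2 \<Rightarrow> real^2 \<Rightarrow> bool" where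
  "outward_unit_normal S p d \<nu> \<longleftrightarrow>
     norm \<nu> = 1 \<and> \<nu> \<bullet> d = 0 \<and> (\<exists>\<epsilon>>0. \<forall>s\<in>{0<..<\<epsilon>}. p + s *\<^sub>R \<nu> \<in> outside S)"

section \<open>Exact curve-shortening flow\<close>

text \<open>
  \<open>C\<^sup>\<infinity>\<close> up to the boundary on the strip \<open>UNIV \<times> {0..T}\<close>; \<open>D i j\<close> is the partial derivative of
  order \<open>i\<close> in the first and \<open>j\<close> in the second variable.
\<close>

definition smooth_on_strip :: "real \<Rightarrow> (real \<Rightarrow> real \<Rightarrow> real^2) \<Rightarrow> bool" where
  "smooth_on_strip T f \<longleftrightarrow>
     (\<exists>D :: nat \<Rightarrow> nat \<Rightarrow> real \<Rightarrow> real \<Rightarrow> real^2. D 0 0 = f \<and>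
       (\<forall>i j. continuous_on (UNIV \<times> {0..T}) (\<lambda>(\<theta>, t). D i j \<theta> t) \<and>
         (\<forall>\<theta>. \<forall>t\<in>{0..T}.
            ((\<lambda>r. D i j r t) has_vector_derivative D (Suc i) j \<theta> t) (at \<theta>) \<and>
            ((\<lambda>r. D i j \<theta> r) has_vector_derivative D i (Suc j) \<theta> t) (at t within {0..T}))))"

text \<open>
  \<open>\<gamma>0\<close> is a 1-periodic parametrisation of the initial curve, \<open>X p t\<close> the flow map, \<open>n t\<close> and \<open>H t\<close>
  the normal and the curvature at time \<open>t\<close>. Only the values of \<open>X\<close>, \<open>n t\<close>, \<open>H t\<close> on the respective
  curves matter.
\<close>

definition flow_param :: "(real \<Rightarrow> real^2) \<Rightarrow> (real^2 \<Rightarrow> real \<Rightarrow> real^2) \<Rightarrow> real \<Rightarrow> real \<Rightarrow> real^2" where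
  "flow_param \<gamma>0 X t \<theta> = X (\<gamma>0 \<theta>) t"

definition flow_curve :: "(real \<Rightarrow> real^2) \<Rightarrow> (real^2 \<Rightarrow> real \<Rightarrow> real^2) \<Rightarrow> real \<Rightarrow> (real^2) set" where
  "flow_curve \<gamma>0 X t = (\<lambda>p. X p t) ` range \<gamma>0"

text \<open>
  Regularity of \<open>flow_param \<gamma>0 X t\<close> together with injectivity of \<open>X \<cdot> t\<close> makes the inverse of the
  flow map smooth, uniformly in \<open>t\<close> by compactness.
\<close>

definition exact_flow ::
  "(real \<Rightarrow> real^2) \<Rightarrow> (real^2 \<Rightarrow> real \<Rightarrow> real^2) \<Rightarrow> (real \<Rightarrow> real^2 \<Rightarrow> real^2) \<Rightarrow>
   (real \<Rightarrow> real^2 \<Rightarrow> real) \<Rightarrow> real \<Rightarrow> bool" where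
  "exact_flow \<gamma>0 X n H T \<longleftrightarrow>
     0 < T \<and>
     (\<forall>\<theta>. \<gamma>0 (\<theta> + 1) = \<gamma>0 \<theta>) \<and> inj_on \<gamma>0 {0..<1} \<and>
     (\<forall>p\<in>range \<gamma>0. X p 0 = p) \<and>
     smooth_on_strip T (\<lambda>\<theta> t. X (\<gamma>0 \<theta>) t) \<and>
     (\<forall>t\<in>{0..T}.
        inj_on (\<lambda>p. X p t) (range \<gamma>0) \<and>
        (\<forall>\<theta>. let c = flow_param \<gamma>0 X t in
           vector_derivative c (at \<theta>) \<noteq> 0 \<and>
           outward_unit_normal (flow_curve \<gamma>0 X t) (c \<theta>) (vector_derivative c (at \<theta>)) (n t (c \<theta>)) \<and>
           H t (c \<theta>) *\<^sub>R n t (c \<theta>) = - laplace_beltrami c id \<theta>) \<and>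
        (\<forall>p\<in>range \<gamma>0.
           ((\<lambda>r. X p r) has_vector_derivative - (H t (X p t) *\<^sub>R n t (X p t))) (at t within {0..T})))"

text \<open>The \<open>\<delta>\<close>-neighbourhoods admit a closest-point retraction, namely \<open>closest_point (flow_curve \<gamma>0 X t)\<close>.\<close>

definition tubular_width ::
  "(real \<Rightarrow> real^2) \<Rightarrow> (real^2 \<Rightarrow> real \<Rightarrow> real^2) \<Rightarrow> real \<Rightarrow> real \<Rightarrow> bool" where
  "tubular_width \<gamma>0 X T \<delta> \<longleftrightarrow>
     0 < \<delta> \<and>
     (\<forall>t\<in>{0..T}. \<forall>p. infdist p (flow_curve \<gamma>0 X t) < \<delta> \<longrightarrow>
        (\<exists>!q. q \<in> flow_curve \<gamma>0 X t \<and> dist p q = infdist p (flow_curve \<gamma>0 X t)))"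

text \<open>\<open>Y\<close> from time \<open>t\<close> to time \<open>t'\<close>.\<close>

definition flow_step ::
  "(real \<Rightarrow> real^2) \<Rightarrow> (real^2 \<Rightarrow> real \<Rightarrow> real^2) \<Rightarrow> real \<Rightarrow> real \<Rightarrow> real^2 \<Rightarrow> real^2" where
  "flow_step \<gamma>0 X t t' p = X (inv_into (range \<gamma>0) (\<lambda>q. X q t) p) t'"

section \<open>Polygons and finite elements\<close>

text \<open>
  A polygon with \<open>J\<close> vertices, as well as an \<open>\<real>\<^sup>2\<close>-valued finite element function, is given by its
  nodal vector \<open>nat \<Rightarrow> real^2\<close>, of which only the entries with index below \<open>J\<close> matter. Indices are
  cyclic and edge \<open>j\<close> runs from vertex \<open>j\<close> to its successor.
\<close>

definition nxt :: "nat \<Rightarrow> nat \<Rightarrow> nat" where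
  "nxt J j = Suc j mod J"

definition prv :: "nat \<Rightarrow> nat \<Rightarrow> nat" where
  "prv J j = (j + J - 1) mod J"

definition edge :: "nat \<Rightarrow> (nat \<Rightarrow> real^2) \<Rightarrow> nat \<Rightarrow> real \<Rightarrow> real^2" where
  "edge J x j = linepath (x j) (x (nxt J j))"

definition edge_len :: "nat \<Rightarrow> (nat \<Rightarrow> real^2) \<Rightarrow> nat \<Rightarrow> real" where
  "edge_len J x j = dist (x j) (x (nxt J j))"

definition polygon_set :: "nat \<Rightarrow> (nat \<Rightarrow> real^2) \<Rightarrow> (real^2) set" where
  "polygon_set J x = (\<Union>j<J. edge J x j ` {0..1})"

definition simple_closed_polygon :: "nat \<Rightarrow> (nat \<Rightarrow> real^2) \<Rightarrow> bool" where
  "simple_closed_polygon J x \<longleftrightarrow>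
     3 \<le> J \<and> inj_on (\<lambda>(j, s). edge J x j s) ({..<J} \<times> {0..<1})"

text \<open>Realisation of the nodal vector \<open>u\<close> as an edgewise affine function on the polygon \<open>x\<close>.\<close>

definition fe :: "nat \<Rightarrow> (nat \<Rightarrow> real^2) \<Rightarrow> (nat \<Rightarrow> real^2) \<Rightarrow> real^2 \<Rightarrow> real^2" where
  "fe J x u p = (THE v. \<exists>j<J. \<exists>s\<in>{0..1}. p = edge J x j s \<and> v = edge J u j s)"

definition nodal_interp :: "nat \<Rightarrow> (nat \<Rightarrow> real^2) \<Rightarrow> (real^2 \<Rightarrow> real^2) \<Rightarrow> real^2 \<Rightarrow> real^2" where
  "nodal_interp J x f = fe J x (\<lambda>j. f (x j))"

definition poly_int :: "nat \<Rightarrow> (nat \<Rightarrow> real^2) \<Rightarrow> (real^2 \<Rightarrow> real) \<Rightarrow> real" where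
  "poly_int J x f = (\<Sum>j<J. curve_int (edge J x j) (\<lambda>s. f (edge J x j s)))"

text \<open>Mass lumping is only applied to functions that are continuous on the whole polygon.\<close>

definition lumped_int :: "nat \<Rightarrow> (nat \<Rightarrow> real^2) \<Rightarrow> (real^2 \<Rightarrow> real) \<Rightarrow> real" where
  "lumped_int J x f = (\<Sum>j<J. edge_len J x j / 2 * (f (x j) + f (x (nxt J j))))"

definition poly_grad_int ::
  "nat \<Rightarrow> (nat \<Rightarrow> real^2) \<Rightarrow> (real^2 \<Rightarrow> real^2) \<Rightarrow> (real^2 \<Rightarrow> real^2) \<Rightarrow> real" where
  "poly_grad_int J x f g =
     (\<Sum>j<J. curve_int (edge J x j) (\<lambda>s. tgrad (edge J x j) f s \<bullet> tgrad (edge J x j) g s))"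

definition L2_norm_on :: "nat \<Rightarrow> (nat \<Rightarrow> real^2) \<Rightarrow> (real^2 \<Rightarrow> real^2) \<Rightarrow> real" where
  "L2_norm_on J x f = sqrt (poly_int J x (\<lambda>p. (norm (f p))\<^sup>2))"

definition H1_norm_on :: "nat \<Rightarrow> (nat \<Rightarrow> real^2) \<Rightarrow> (real^2 \<Rightarrow> real^2) \<Rightarrow> real" where
  "H1_norm_on J x f = sqrt ((L2_norm_on J x f)\<^sup>2 + poly_grad_int J x f f)"

text \<open>Suprema agree with essential suprema for the continuous, edgewise affine functions used here.\<close>

definition Linf_norm_on :: "nat \<Rightarrow> (nat \<Rightarrow> real^2) \<Rightarrow> (real^2 \<Rightarrow> real^2) \<Rightarrow> real" where
  "Linf_norm_on J x f = (SUP p\<in>polygon_set J x. norm (f p))"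

definition W1inf_norm_on :: "nat \<Rightarrow> (nat \<Rightarrow> real^2) \<Rightarrow> (real^2 \<Rightarrow> real^2) \<Rightarrow> real" where
  "W1inf_norm_on J x f =
     Linf_norm_on J x f + (SUP (j, s)\<in>{..<J} \<times> {0<..<1}. norm (tgrad (edge J x j) f s))"

section \<open>The fully discrete scheme\<close>

definition outward_edge_normals :: "nat \<Rightarrow> (nat \<Rightarrow> real^2) \<Rightarrow> (nat \<Rightarrow> real^2) \<Rightarrow> bool" where
  "outward_edge_normals J x \<nu> \<longleftrightarrow>
     (\<forall>j<J. \<forall>s\<in>{0<..<1}.
        outward_unit_normal (polygon_set J x) (edge J x j s) (x (nxt J j) - x j) (\<nu> j))"

definition avg_normal :: "nat \<Rightarrow> (nat \<Rightarrow> real^2) \<Rightarrow> (nat \<Rightarrow> real^2) \<Rightarrow> nat \<Rightarrow> real^2" where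
  "avg_normal J x \<nu> j =
     (let lm = edge_len J x (prv J j); lp = edge_len J x j
      in (lp *\<^sub>R \<nu> (prv J j) + lm *\<^sub>R \<nu> j) /\<^sub>R (lm + lp))"

text \<open>\<open>y\<close> is the nodal vector obtained from the polygon \<open>x\<close> by one time step.\<close>

definition scheme_step :: "nat \<Rightarrow> real \<Rightarrow> (nat \<Rightarrow> real^2) \<Rightarrow> (nat \<Rightarrow> real^2) \<Rightarrow> bool" where
  "scheme_step J \<tau> x y \<longleftrightarrow>
     (\<exists>\<nu>. outward_edge_normals J x \<nu> \<and>
       (let nb = fe J x (avg_normal J x \<nu>) in
        \<forall>u. let \<phi> = fe J x u in
          lumped_int J x (\<lambda>p. (((fe J x y p - p) /\<^sub>R \<tau>) \<bullet> nb p) * (\<phi> p \<bullet> nb p))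
            + poly_grad_int J x (fe J x y) \<phi>
          = poly_grad_int J x id (nodal_interp J x (\<lambda>p. \<phi> p - (\<phi> p \<bullet> nb p) *\<^sub>R nb p))))"

section \<open>Projected polygon, errors and standing assumptions\<close>

text \<open>
  \<open>x m\<close> is the nodal vector of the numerical solution at time level \<open>m\<close>. The error \<open>e\<close> at level 0
  is by convention the projected error.
\<close>

definition proj_nodes ::
  "(real \<Rightarrow> real^2) \<Rightarrow> (real^2 \<Rightarrow> real \<Rightarrow> real^2) \<Rightarrow> real \<Rightarrow> (nat \<Rightarrow> nat \<Rightarrow> real^2) \<Rightarrow> nat \<Rightarrow> nat \<Rightarrow> real^2" where
  "proj_nodes \<gamma>0 X \<tau> x m j = closest_point (flow_curve \<gamma>0 X (real m * \<tau>)) (x m j)"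

definition proj_err ::
  "(real \<Rightarrow> real^2) \<Rightarrow> (real^2 \<Rightarrow> real \<Rightarrow> real^2) \<Rightarrow> real \<Rightarrow> (nat \<Rightarrow> nat \<Rightarrow> real^2) \<Rightarrow> nat \<Rightarrow> nat \<Rightarrow> real^2" where
  "proj_err \<gamma>0 X \<tau> x m j = x m j - proj_nodes \<gamma>0 X \<tau> x m j"

fun flow_err ::
  "(real \<Rightarrow> real^2) \<Rightarrow> (real^2 \<Rightarrow> real \<Rightarrow> real^2) \<Rightarrow> real \<Rightarrow> (nat \<Rightarrow> nat \<Rightarrow> real^2) \<Rightarrow> nat \<Rightarrow> nat \<Rightarrow> real^2" where
  "flow_err \<gamma>0 X \<tau> x 0 j = proj_err \<gamma>0 X \<tau> x 0 j"
| "flow_err \<gamma>0 X \<tau> x (Suc m) j =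
     x (Suc m) j - flow_step \<gamma>0 X (real m * \<tau>) (real (Suc m) * \<tau>) (proj_nodes \<gamma>0 X \<tau> x m j)"

definition mesh_reg ::
  "(real \<Rightarrow> real^2) \<Rightarrow> (real^2 \<Rightarrow> real \<Rightarrow> real^2) \<Rightarrow> real \<Rightarrow> nat \<Rightarrow> (nat \<Rightarrow> nat \<Rightarrow> real^2) \<Rightarrow> nat \<Rightarrow> real" where
  "mesh_reg \<gamma>0 X \<tau> J x l =
     Max ((\<lambda>m. let xh = proj_nodes \<gamma>0 X \<tau> x m; Xh = fe J (x 0) xh in
             W1inf_norm_on J (x 0) Xh + W1inf_norm_on J xh (inv_into (polygon_set J (x 0)) Xh))
          ` {..l})"

definition induction_hyp ::
  "(real \<Rightarrow> real^2) \<Rightarrow> (real^2 \<Rightarrow> real \<Rightarrow> real^2) \<Rightarrow> real \<Rightarrow> real \<Rightarrow> nat \<Rightarrow> (nat \<Rightarrow> nat \<Rightarrow> real^2) \<Rightarrow> nat \<Rightarrow> bool" where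
  "induction_hyp \<gamma>0 X h \<tau> J x m \<longleftrightarrow>
     (let xh = proj_nodes \<gamma>0 X \<tau> x m;
          eh = fe J xh (proj_err \<gamma>0 X \<tau> x m);
          e = fe J xh (flow_err \<gamma>0 X \<tau> x m)
      in L2_norm_on J xh eh + L2_norm_on J xh e
         + Linf_norm_on J xh eh + Linf_norm_on J xh e
         + H1_norm_on J xh eh + H1_norm_on J xh e
         + h powr (1/2) * (W1inf_norm_on J xh eh + W1inf_norm_on J xh e)
         \<le> h powr (7/4))"

text \<open>
  The first group of conjuncts sets up the discrete objects on all time levels entering the
  functionals (polygons are simple, the nodes lie in the domain of the retraction, and the
  retraction is bijective from the projected polygon onto the curve); the second group contains
  the quantitative assumptions. Smallness of \<open>h\<close> is imposed in the theorem.
\<close>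

definition standing_assms ::
  "(real \<Rightarrow> real^2) \<Rightarrow> (real^2 \<Rightarrow> real \<Rightarrow> real^2) \<Rightarrow> real \<Rightarrow> real \<Rightarrow> real \<Rightarrow> real \<Rightarrow> real \<Rightarrow> real \<Rightarrow>
   real \<Rightarrow> real \<Rightarrow> nat \<Rightarrow> (nat \<Rightarrow> nat \<Rightarrow> real^2) \<Rightarrow> nat \<Rightarrow> bool" where
  "standing_assms \<gamma>0 X T \<delta> c0 cq Cq Csh h \<tau> J x l \<longleftrightarrow>
     0 < h \<and> 0 < \<tau> \<and> int l \<le> \<lfloor>T / \<tau>\<rfloor> - 1 \<and>
     (\<forall>m\<le>l. simple_closed_polygon J (x m) \<and> scheme_step J \<tau> (x m) (x (Suc m))) \<and>
     (\<forall>m\<le>Suc l. let G = flow_curve \<gamma>0 X (real m * \<tau>); xh = proj_nodes \<gamma>0 X \<tau> x m in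
        (\<forall>j<J. infdist (x m j) G < \<delta>) \<and>
        simple_closed_polygon J xh \<and>
        bij_betw (closest_point G) (polygon_set J xh) G) \<and>
     mesh_reg \<gamma>0 X \<tau> J x 0 \<le> Csh \<and>
     (\<forall>j<J. cq * h \<le> edge_len J (x 0) j \<and> edge_len J (x 0) j \<le> Cq * h) \<and>
     (\<forall>j<J. proj_err \<gamma>0 X \<tau> x 0 j = 0) \<and>
     \<tau> \<le> c0 * h\<^sup>2 \<and>
     (\<forall>m\<le>l. induction_hyp \<gamma>0 X h \<tau> J x m)"

section \<open>Consistency functionals\<close>

text \<open>In this section \<open>xh\<close> is the nodal vector of the projected polygon at time \<open>t\<close>, \<open>u\<close> that of the test function.\<close>

definition lift ::
  "(real \<Rightarrow> real^2) \<Rightarrow> (real^2 \<Rightarrow> real \<Rightarrow> real^2) \<Rightarrow> real \<Rightarrow> nat \<Rightarrow> (nat \<Rightarrow> real^2) \<Rightarrow>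
   (real^2 \<Rightarrow> real^2) \<Rightarrow> real^2 \<Rightarrow> real^2" where
  "lift \<gamma>0 X t J xh f = f \<circ> inv_into (polygon_set J xh) (closest_point (flow_curve \<gamma>0 X t))"

definition inv_lift ::
  "(real \<Rightarrow> real^2) \<Rightarrow> (real^2 \<Rightarrow> real \<Rightarrow> real^2) \<Rightarrow> real \<Rightarrow>
   (real^2 \<Rightarrow> real^2) \<Rightarrow> real^2 \<Rightarrow> real^2" where
  "inv_lift \<gamma>0 X t f = f \<circ> closest_point (flow_curve \<gamma>0 X t)"

definition flow_grad_int ::
  "(real \<Rightarrow> real^2) \<Rightarrow> (real^2 \<Rightarrow> real \<Rightarrow> real^2) \<Rightarrow> real \<Rightarrow>
   (real^2 \<Rightarrow> real^2) \<Rightarrow> (real^2 \<Rightarrow> real^2) \<Rightarrow> real" where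
  "flow_grad_int \<gamma>0 X t f g =
     (let c = flow_param \<gamma>0 X t in curve_int c (\<lambda>s. tgrad c f s \<bullet> tgrad c g s))"

definition D13 ::
  "(real \<Rightarrow> real^2) \<Rightarrow> (real^2 \<Rightarrow> real \<Rightarrow> real^2) \<Rightarrow> (real \<Rightarrow> real^2 \<Rightarrow> real^2) \<Rightarrow>
   (real \<Rightarrow> real^2 \<Rightarrow> real) \<Rightarrow> real \<Rightarrow> nat \<Rightarrow> (nat \<Rightarrow> real^2) \<Rightarrow> (nat \<Rightarrow> real^2) \<Rightarrow> real" where
  "D13 \<gamma>0 X n H t J xh u =
     (let F = (\<lambda>p. inv_lift \<gamma>0 X t (\<lambda>q. H t q *\<^sub>R n t q) p \<bullet> fe J xh u p)
      in - (lumped_int J xh F - poly_int J xh F))"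

definition D22 ::
  "(real \<Rightarrow> real^2) \<Rightarrow> (real^2 \<Rightarrow> real \<Rightarrow> real^2) \<Rightarrow> real \<Rightarrow> nat \<Rightarrow> (nat \<Rightarrow> real^2) \<Rightarrow>
   (nat \<Rightarrow> real^2) \<Rightarrow> real" where
  "D22 \<gamma>0 X t J xh u =
     poly_grad_int J xh (fe J xh xh) (fe J xh u)
     - flow_grad_int \<gamma>0 X t (lift \<gamma>0 X t J xh (fe J xh xh)) (lift \<gamma>0 X t J xh (fe J xh u))"

definition D23 ::
  "(real \<Rightarrow> real^2) \<Rightarrow> (real^2 \<Rightarrow> real \<Rightarrow> real^2) \<Rightarrow> real \<Rightarrow> nat \<Rightarrow> (nat \<Rightarrow> real^2) \<Rightarrow>
   (nat \<Rightarrow> real^2) \<Rightarrow> real" where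
  "D23 \<gamma>0 X t J xh u =
     (let a = closest_point (flow_curve \<gamma>0 X t) in
      flow_grad_int \<gamma>0 X t
        (\<lambda>p. lift \<gamma>0 X t J xh (nodal_interp J xh a) p - a p)
        (lift \<gamma>0 X t J xh (fe J xh u)))"

text \<open>Discrete time derivative of a functional \<open>D m\<close> acting on nodal vectors.\<close>

definition dtau :: "real \<Rightarrow> (nat \<Rightarrow> (nat \<Rightarrow> real^2) \<Rightarrow> real) \<Rightarrow> nat \<Rightarrow> (nat \<Rightarrow> real^2) \<Rightarrow> real" where
  "dtau \<tau> D m u = (D (Suc m) u - D m u) / \<tau>"

end

theory Submission
 imports Defs
begin

text \<open>
 Let \<open>crv th t\<close> parametrise the exact curve at time \<open>t\<close>, let \<open>th j\<close> be the parameter of the node \<open>j\<close> of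
 the projected polygon and \<open>d j\<close> the parameter increment over edge \<open>j\<close>. On every edge the closest-point
 projection is the inverse of an explicit function, so that both functionals are sums over the edges of \<open>d j^3\<close> or
 \<open>d j^2\<close>, times a bounded Lipschitz function of \<open>(th j, d j, t)\<close>, times nodal values or edge increments of
 the test function. It remains to see how far the parameters move in one step of length \<open>dt\<close>: if
 \<open>th j\<close> moves by \<open>dt * sg j\<close>, the claim follows from the Cauchy-Schwarz inequality once \<open>sg\<close> is bounded and the
 squares of its increments over the edges add up to \<open>O(h)\<close>. Orthogonality of the error to the curve at both time levels
 expresses \<open>sg j\<close> by the discrete velocity of node \<open>j\<close>, with weight \<open>O(h^(5/4))\<close> on the normal component. The
 velocity itself is estimated by testing the scheme with its error and with the tangential part of the error.
\<close>

section \<open>Bounded Lipschitz functions\<close>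

text \<open>The rate h^2 needs square-summable increments of \<open>sg\<close>, hence a discrete H^1
  bound for the tangential velocity. The scheme resists: its mass term sees one direction per node,
  and its gradient term carries a factor \<open>dt\<close> before the velocity, so the energy test
  says too little about the tangential part. With the test function \<open>A\<close> both the mass
  term and the right-hand side vanish, and the remaining identity can be divided by
  \<open>dt\<close>. It couples \<open>A\<close> to the normal error through differences of discrete
  curvature times tangential coordinate; these are affordable because neighbouring discrete
  curvatures differ by O(h^(1/4)). \<open>D22\<close> and \<open>D23\<close> are treated as one
  functional since the integrals quadratic in the derivative of the chord coordinate cancel in their
  sum. Two orientations are undetermined: nodes may be numbered against the parametrisation, which
  is handled by a reversed flow, and outward normals are quarter turns of edge directions up to a
  sign. That sign has to be the same on all edges, which rests on the Jordan curve theorem; its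
  value does not matter because normals enter quadratically.\<close>

definition BL :: "'p::metric_space set => ('p => 'b::real_normed_vector) => bool" where
 "BL S f \<longleftrightarrow> (\<exists>C. \<forall>p\<in>S. norm (f p) <= C \<and> (\<forall>q\<in>S. norm (f p - f q) <= C * dist p q))"

lemma BLE:
 assumes "BL S f"
 obtains C where "C \<ge> 1" "!!p. p \<in> S ==> norm (f p) <= C"
  "!!p q. p \<in> S ==> q \<in> S ==> norm (f p - f q) <= C * dist p q"
proof -
 obtain C where C: "\<forall>p\<in>S. norm (f p) <= C \<and> (\<forall>q\<in>S. norm (f p - f q) <= C * dist p q)"
  using assms unfolding BL_def by blast
 show ?thesis
 proof
  show "max 1 C \<ge> 1" by simp
  show "norm (f p) <= max 1 C" if "p \<in> S" for p using C that by (auto simp: le_max_iff_disj)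
  show "norm (f p - f q) <= max 1 C * dist p q" if "p \<in> S" "q \<in> S" for p q
  proof -
   have "norm (f p - f q) <= C * dist p q" using C that by blast
   also have "... <= max 1 C * dist p q" by (intro mult_right_mono) auto
   finally show ?thesis .
  qed
 qed
qed

lemma BLI:
 assumes "!!p. p \<in> S ==> norm (f p) <= C"
  "!!p q. p \<in> S ==> q \<in> S ==> norm (f p - f q) <= C' * dist p q"
 shows "BL S f"
 unfolding BL_def
proof (intro exI[of _ "max C C'"] ballI conjI)
 show "norm (f p) <= max C C'" if "p \<in> S" for p using assms(1)[OF that] by simp
 show "norm (f p - f q) <= max C C' * dist p q" if "p \<in> S" "q \<in> S" for p q
 proof -
  have "norm (f p - f q) <= C' * dist p q" using assms that by blast
  also have "... <= max C C' * dist p q" by (intro mult_right_mono) auto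
  finally show ?thesis .
 qed
qed

lemma BL_subset: "BL S f ==> R \<subseteq> S ==> BL R f"
 unfolding BL_def by blast

lemma BL_const: "BL S (%p. c)"
 by (rule BLI[of _ _ "norm c" 0]) auto

text \<open>Boundedness is built into \<open>BL\<close> because products of unbounded Lipschitz
  functions need not be Lipschitz. Stated for any bounded bilinear map, one argument serves scaling,
  products and inner products.\<close>

lemma BL_bilinear:
 assumes "bounded_bilinear m" "BL S f" "BL S g"
 shows "BL S (%p. m (f p) (g p))"
proof -
 interpret bounded_bilinear m by fact
 obtain K where K: "0 < K" "!!a b. norm (m a b) <= norm a * norm b * K" using pos_bounded by blast
 obtain C where C: "C \<ge> 1" "!!p. p \<in> S ==> norm (f p) <= C"
  "!!p q. p \<in> S ==> q \<in> S ==> norm (f p - f q) <= C * dist p q" using BLE[OF assms(2)] by blast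
 obtain D where D: "D \<ge> 1" "!!p. p \<in> S ==> norm (g p) <= D"
  "!!p q. p \<in> S ==> q \<in> S ==> norm (g p - g q) <= D * dist p q" using BLE[OF assms(3)] by blast
 show ?thesis
 proof (rule BLI)
  fix p assume "p \<in> S"
  then have "norm (f p) * norm (g p) * K <= C * D * K"
   using C D K by (intro mult_mono) auto
  then show "norm (m (f p) (g p)) <= C * D * K" using K(2) order_trans by blast
 next
  fix p q assume pq: "p \<in> S" "q \<in> S"
  have "m (f p) (g p) - m (f q) (g q) = m (f p - f q) (g p) + m (f q) (g p - g q)"
   by (simp add: diff_left diff_right)
  then have "norm (m (f p) (g p) - m (f q) (g q)) <= norm (m (f p - f q) (g p)) + norm (m (f q) (g p - g q))"
   by (simp add: norm_triangle_ineq)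
  also have "... <= norm (f p - f q) * norm (g p) * K + norm (f q) * norm (g p - g q) * K"
   using K(2) add_mono by blast
  also have "... <= (C * dist p q) * D * K + C * (D * dist p q) * K"
   using C D K pq by (intro add_mono mult_mono) auto
  finally show "norm (m (f p) (g p) - m (f q) (g q)) <= (2 * C * D * K) * dist p q"
   by (simp add: algebra_simps)
 qed
qed

lemmas BL_scaleR = BL_bilinear[OF bounded_bilinear_scaleR]
lemmas BL_mult = BL_bilinear[OF bounded_bilinear_mult[where 'a = real]]
lemmas BL_inner = BL_bilinear[OF bounded_bilinear_inner]

lemma BL_linear:
 assumes "bounded_linear m" "BL S f"
 shows "BL S (%p. m (f p))"
proof -
 obtain K where K: "0 < K" "!!a. norm (m a) <= norm a * K"
  using bounded_linear.pos_bounded[OF assms(1)] by blast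
 obtain C where C: "C \<ge> 1" "!!p. p \<in> S ==> norm (f p) <= C"
  "!!p q. p \<in> S ==> q \<in> S ==> norm (f p - f q) <= C * dist p q" using BLE[OF assms(2)] by blast
 show ?thesis
 proof (rule BLI)
  fix p assume "p \<in> S"
  then have "norm (f p) * K <= C * K" using C K by (intro mult_right_mono) auto
  then show "norm (m (f p)) <= C * K" using K(2) order_trans by blast
 next
  fix p q assume pq: "p \<in> S" "q \<in> S"
  have "norm (m (f p) - m (f q)) <= norm (f p - f q) * K"
   using K(2)[of "f p - f q"] by (simp add: linear_diff[OF bounded_linear.linear[OF assms(1)]])
  also have "... <= (C * dist p q) * K" using C pq K by (intro mult_right_mono) auto
  finally show "norm (m (f p) - m (f q)) <= (C * K) * dist p q" by (simp add: algebra_simps)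
 qed
qed

lemma BL_add:
 assumes "BL S f" "BL S g" shows "BL S (%p. f p + g p)"
proof -
 obtain C where C: "C \<ge> 1" "!!p. p \<in> S ==> norm (f p) <= C"
  "!!p q. p \<in> S ==> q \<in> S ==> norm (f p - f q) <= C * dist p q" using BLE[OF assms(1)] by blast
 obtain D where D: "D \<ge> 1" "!!p. p \<in> S ==> norm (g p) <= D"
  "!!p q. p \<in> S ==> q \<in> S ==> norm (g p - g q) <= D * dist p q" using BLE[OF assms(2)] by blast
 show ?thesis
 proof (rule BLI)
  fix p assume "p \<in> S"
  then show "norm (f p + g p) <= C + D" using C(2) D(2) norm_triangle_mono by blast
 next
  fix p q assume pq: "p \<in> S" "q \<in> S"
  have "norm (f p + g p - (f q + g q)) <= norm (f p - f q) + norm (g p - g q)"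
   by (metis add_diff_add norm_triangle_ineq)
  also have "... <= C * dist p q + D * dist p q" using C D pq add_mono by blast
  finally show "norm (f p + g p - (f q + g q)) <= (C + D) * dist p q" by (simp add: algebra_simps)
 qed
qed

lemma BL_minus: "BL S f ==> BL S (%p. - f p)"
 by (rule BL_linear[OF bounded_linear_minus[OF bounded_linear_ident]])

lemma BL_diff: "BL S f ==> BL S g ==> BL S (%p. f p - g p)"
 using BL_add[OF _ BL_minus] by fastforce

lemma BL_norm:
 assumes "BL S f" shows "BL S (%p. norm (f p))"
proof -
 obtain C where C: "C \<ge> 1" "!!p. p \<in> S ==> norm (f p) <= C"
  "!!p q. p \<in> S ==> q \<in> S ==> norm (f p - f q) <= C * dist p q" using BLE[OF assms(1)] by blast
 show ?thesis
  using C by (intro BLI[of _ _ C C]) (auto intro: order_trans[OF norm_triangle_ineq3])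
qed

lemma BL_inverse:
 fixes f :: "'p::metric_space => real"
 assumes "BL S f" "0 < c" "!!p. p \<in> S ==> c <= f p"
 shows "BL S (%p. 1 / f p)"
proof -
 obtain C where C: "C \<ge> 1" "!!p. p \<in> S ==> norm (f p) <= C"
  "!!p q. p \<in> S ==> q \<in> S ==> norm (f p - f q) <= C * dist p q" using BLE[OF assms(1)] by blast
 show ?thesis
 proof (rule BLI)
  fix p assume "p \<in> S"
  then show "norm (1 / f p) <= 1 / c" using assms(2) assms(3)[of p] by (auto simp: field_simps)
 next
  fix p q assume pq: "p \<in> S" "q \<in> S"
  have pos: "f p > 0" "f q > 0" using assms(2,3) pq by force+
  have "norm (1 / f p - 1 / f q) = \<bar>f q - f p\<bar> / (f p * f q)"
   using pos by (simp add: field_simps abs_mult)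
  also have "... <= (C * dist p q) / (c * c)"
   using C(3)[OF pq] assms(2,3) pq pos C(1)
   by (intro frac_le mult_mono) (auto simp: abs_minus_commute less_imp_le)
  finally show "norm (1 / f p - 1 / f q) <= (C / (c * c)) * dist p q" by (simp add: algebra_simps)
 qed
qed

lemma BL_compose:
 assumes "BL R f" "!!p. p \<in> S ==> g p \<in> R"
  "!!p q. p \<in> S ==> q \<in> S ==> dist (g p) (g q) <= L * dist p q"
 shows "BL S (%p. f (g p))"
proof -
 obtain C where C: "C \<ge> 1" "!!p. p \<in> R ==> norm (f p) <= C"
  "!!p q. p \<in> R ==> q \<in> R ==> norm (f p - f q) <= C * dist p q" using BLE[OF assms(1)] by blast
 show ?thesis
 proof (rule BLI)
  fix p assume "p \<in> S"
  then show "norm (f (g p)) <= C" using C assms by blast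
 next
  fix p q assume pq: "p \<in> S" "q \<in> S"
  have "norm (f (g p) - f (g q)) <= C * dist (g p) (g q)" using C assms pq by blast
  also have "... <= C * (L * dist p q)" using C(1) assms(3)[OF pq] by (intro mult_left_mono) auto
  finally show "norm (f (g p) - f (g q)) <= (C * L) * dist p q" by (simp add: algebra_simps)
 qed
qed

lemma BL_continuous_on:
 assumes "BL S f" shows "continuous_on S f"
proof -
 obtain C where C: "C \<ge> 1" "!!p. p \<in> S ==> norm (f p) <= C"
  "!!p q. p \<in> S ==> q \<in> S ==> norm (f p - f q) <= C * dist p q" using BLE[OF assms(1)] by blast
 have "C-lipschitz_on S f" using C by (intro lipschitz_onI) (auto simp: dist_norm)
 then show ?thesis by (rule lipschitz_on_continuous_on)
qed

text \<open>Differences of integrals are integrals of differences, so a Lipschitz constant survives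
  integration over the unit interval. This carries the integral remainders of Taylor expansions into
  \<open>BL\<close>.\<close>

lemma BL_integral:
 fixes f :: "'p::metric_space => real => 'b::banach"
 assumes "BL (S \<times> {0..1}) (%(p, y). f p y)"
 shows "BL S (%p. integral {0..1} (f p))"
proof -
 obtain C where C: "C \<ge> 1" "!!p y. p \<in> S ==> y \<in> {0..1} ==> norm (f p y) <= C"
  "!!p q y. p \<in> S ==> q \<in> S ==> y \<in> {0..1} ==> norm (f p y - f q y) <= C * dist p q"
 proof -
  obtain C where C: "C \<ge> 1" "!!p. p \<in> S \<times> {0..1} ==> norm ((%(p, y). f p y) p) <= C"
  "!!p q. p \<in> S \<times> {0..1} ==> q \<in> S \<times> {0..1} ==> norm ((%(p, y). f p y) p - (%(p, y). f p y) q) <= C * dist p q"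
   using BLE[OF assms] by blast
  have "norm (f p y - f q y) <= C * dist p q" if "p \<in> S" "q \<in> S" "y \<in> {0..1}" for p q y
   using C(3)[of "(p, y)" "(q, y)"] that by (simp add: dist_Pair_Pair)
  moreover have "norm (f p y) <= C" if "p \<in> S" "y \<in> {0..1}" for p y using C(2)[of "(p, y)"] that by simp
  ultimately show ?thesis using that C(1) by blast
 qed
 have cont: "continuous_on {0..1} (f p)" if "p \<in> S" for p
 proof -
  have "continuous_on {0..1} (%y. (%(p, y). f p y) (p, y))"
   using that by (intro continuous_on_compose2[OF BL_continuous_on[OF assms]]) (auto intro!: continuous_intros)
  then show ?thesis by simp
 qed
 show ?thesis
 proof (rule BLI)
  fix p assume p: "p \<in> S"
  then show "norm (integral {0..1} (f p)) <= C"
   using integral_bound[of 0 1 "f p" C] cont C by simp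
 next
  fix p q assume pq: "p \<in> S" "q \<in> S"
  have "norm (integral {0..1} (f p) - integral {0..1} (f q)) = norm (integral {0..1} (%y. f p y - f q y))"
   using cont pq by (simp add: integral_diff integrable_continuous_real)
  also have "... <= C * dist p q * (1 - 0)"
   using cont pq C(3)[OF pq] by (intro integral_bound) (auto intro!: continuous_intros)
  finally show "norm (integral {0..1} (f p) - integral {0..1} (f q)) <= C * dist p q" by simp
 qed
qed

section \<open>Taylor remainders\<close>

lemma BL_bounded_coord:
 fixes f :: "'p::metric_space => real"
 assumes "!!p. p \<in> S ==> \<bar>f p\<bar> <= M" "!!p q. \<bar>f p - f q\<bar> <= dist p q"
 shows "BL S f"
 using assms by (intro BLI[of _ _ M 1]) auto

lemma deriv_bound:
 fixes f :: "real => 'a::real_normed_vector"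
 assumes "convex S" "x \<in> S" "y \<in> S"
  and "!!r. r \<in> S ==> (f has_vector_derivative f' r) (at r within S)"
  and "!!r. r \<in> S ==> norm (f' r) <= B"
 shows "norm (f x - f y) <= B * \<bar>x - y\<bar>"
proof -
 have "onorm (%h::real. h *\<^sub>R v) = norm v" for v :: 'a
  using onorm_scaleR_left[OF bounded_linear_ident, of v] onorm_id[where 'a = real] by simp
 then show ?thesis
  using differentiable_bound[OF assms(1), of f "%r h. h *\<^sub>R f' r" B x y] assms
  by (auto simp: has_vector_derivative_def)
qed

definition strip2 :: "real => (real => real => 'a::real_normed_vector) => bool" where
 "strip2 T f \<longleftrightarrow> BL (UNIV \<times> {0..T}) (%p. f (fst p) (snd p))"

text \<open>The second variable is a parameter increment. It is confined to a bounded interval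
  because \<open>th + z * y\<close>, with \<open>y\<close> in the unit interval, is jointly
  Lipschitz only for bounded \<open>z\<close>.\<close>

definition strip3 :: "real => real => (real => real => real => 'a::real_normed_vector) => bool" where
 "strip3 M T f \<longleftrightarrow> BL (UNIV \<times> {-M..M} \<times> {0..T}) (%p. f (fst p) (fst (snd p)) (snd (snd p)))"

section \<open>Distances between parameter tuples; shifted and scaled arguments\<close>

lemma dist_quad_le:
 fixes a z t y :: real
 assumes "p = ((a, z, t), y)" "q = ((a', z', t'), y')"
 shows "\<bar>a - a'\<bar> <= dist p q" "\<bar>z - z'\<bar> <= dist p q" "\<bar>t - t'\<bar> <= dist p q" "\<bar>y - y'\<bar> <= dist p q"
proof -
 have "dist (fst p) (fst q) <= dist p q" "dist (snd p) (snd q) <= dist p q"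
  "dist (fst (fst p)) (fst (fst q)) <= dist (fst p) (fst q)"
  "dist (snd (fst p)) (snd (fst q)) <= dist (fst p) (fst q)"
  "dist (fst (snd (fst p))) (fst (snd (fst q))) <= dist (snd (fst p)) (snd (fst q))"
  "dist (snd (snd (fst p))) (snd (snd (fst q))) <= dist (snd (fst p)) (snd (fst q))"
  by (rule dist_fst_le dist_snd_le)+
 then show "\<bar>a - a'\<bar> <= dist p q" "\<bar>z - z'\<bar> <= dist p q" "\<bar>t - t'\<bar> <= dist p q" "\<bar>y - y'\<bar> <= dist p q"
  unfolding assms fst_conv snd_conv dist_real_def by linarith+
qed

lemma dist_prod_le: "dist (a, b) (c, d) <= dist a c + dist b d"
 unfolding dist_Pair_Pair by (rule real_sqrt_le_mono[THEN order_trans, OF _ order_refl, THEN order_trans])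
  (auto intro!: real_le_lsqrt simp: power2_sum)

lemma dist_mult_le:
 fixes a b c d :: real
 assumes "\<bar>a\<bar> <= A" "\<bar>d\<bar> <= B"
 shows "\<bar>a * b - c * d\<bar> <= A * \<bar>b - d\<bar> + B * \<bar>a - c\<bar>"
proof -
 have "a * b - c * d = a * (b - d) + d * (a - c)" by (simp add: algebra_simps)
 then have "\<bar>a * b - c * d\<bar> <= \<bar>a\<bar> * \<bar>b - d\<bar> + \<bar>d\<bar> * \<bar>a - c\<bar>"
  by (metis abs_mult abs_triangle_ineq)
 also have "... <= A * \<bar>b - d\<bar> + B * \<bar>a - c\<bar>" using assms by (intro add_mono mult_right_mono) auto
 finally show ?thesis .
qed

lemma strip3_shift:
 assumes "strip2 T G"
 shows "BL ((UNIV \<times> {-M..M} \<times> {0..T}) \<times> {0..1})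
  (%p. G (fst (fst p) + fst (snd (fst p)) * snd p) (snd (snd (fst p))))"
proof -
 have "BL ((UNIV \<times> {-M..M} \<times> {0..T}) \<times> {0..1})
  (%p. (%p. G (fst p) (snd p)) ((fst (fst p) + fst (snd (fst p)) * snd p), (snd (snd (fst p)))))"
 proof (rule BL_compose[OF assms[unfolded strip2_def]])
  fix p :: "(real \<times> real \<times> real) \<times> real" assume "p \<in> (UNIV \<times> {- M..M} \<times> {0..T}) \<times> {0..1::real}"
  then show "(fst (fst p) + fst (snd (fst p)) * snd p, snd (snd (fst p))) \<in> UNIV \<times> {0..T}" by auto
 next
  fix p q :: "(real \<times> real \<times> real) \<times> real" assume p: "p \<in> (UNIV \<times> {- M..M} \<times> {0..T}) \<times> {0..1::real}" and q: "q \<in> (UNIV \<times> {- M..M} \<times> {0..T}) \<times> {0..1::real}"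
  obtain a z t y where P: "p = ((a, z, t), y)" by (metis prod.exhaust)
  obtain a' z' t' y' where Q: "q = ((a', z', t'), y')" by (metis prod.exhaust)
  have b: "\<bar>z\<bar> <= M" "\<bar>y'\<bar> <= 1" using p q P Q by auto
  have d: "\<bar>a - a'\<bar> <= dist p q" "\<bar>z - z'\<bar> <= dist p q" "\<bar>t - t'\<bar> <= dist p q" "\<bar>y - y'\<bar> <= dist p q"
   using dist_quad_le[OF P Q] by auto
  have "dist (fst (fst p) + fst (snd (fst p)) * snd p, snd (snd (fst p))) (fst (fst q) + fst (snd (fst q)) * snd q, snd (snd (fst q)))
    <= \<bar>(a + z * y) - (a' + z' * y')\<bar> + \<bar>t - t'\<bar>"
   unfolding P Q by (rule order_trans[OF dist_prod_le]) (simp add: dist_real_def)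
  also have "... <= \<bar>a - a'\<bar> + \<bar>z * y - z' * y'\<bar> + \<bar>t - t'\<bar>" by linarith
  also have "\<bar>z * y - z' * y'\<bar> <= M * \<bar>y - y'\<bar> + 1 * \<bar>z - z'\<bar>" by (rule dist_mult_le[OF b])
  also have "\<bar>a - a'\<bar> + (M * \<bar>y - y'\<bar> + 1 * \<bar>z - z'\<bar>) + \<bar>t - t'\<bar> <= dist p q + (M * dist p q + 1 * dist p q) + dist p q"
   using d b by (intro add_mono mult_left_mono) auto
  also have "... = (M + 3) * dist p q" by (simp add: algebra_simps)
  finally show "dist (fst (fst p) + fst (snd (fst p)) * snd p, snd (snd (fst p))) (fst (fst q) + fst (snd (fst q)) * snd q, snd (snd (fst q)))
   <= (M + 3) * dist p q" by simp
 qed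
 then show ?thesis by simp
qed

lemma strip3_scale:
 assumes "strip3 M T R"
 shows "BL ((UNIV \<times> {-M..M} \<times> {0..T}) \<times> {0..1})
  (%p. R (fst (fst p)) (fst (snd (fst p)) * snd p) (snd (snd (fst p))))"
proof -
 have "BL ((UNIV \<times> {-M..M} \<times> {0..T}) \<times> {0..1})
  (%p. (%p. R (fst p) (fst (snd p)) (snd (snd p))) (fst (fst p), fst (snd (fst p)) * snd p, (snd (snd (fst p)))))"
 proof (rule BL_compose[OF assms[unfolded strip3_def]])
  fix p :: "(real \<times> real \<times> real) \<times> real" assume p: "p \<in> (UNIV \<times> {- M..M} \<times> {0..T}) \<times> {0..1::real}"
  obtain a z t y where P: "p = ((a, z, t), y)" by (metis prod.exhaust)
  have "\<bar>z * y\<bar> <= M * 1" unfolding abs_mult using p P by (intro mult_mono) auto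
  then show "(fst (fst p), fst (snd (fst p)) * snd p, snd (snd (fst p))) \<in> UNIV \<times> {-M..M} \<times> {0..T}" using p P by auto
 next
  fix p q :: "(real \<times> real \<times> real) \<times> real" assume p: "p \<in> (UNIV \<times> {- M..M} \<times> {0..T}) \<times> {0..1::real}" and q: "q \<in> (UNIV \<times> {- M..M} \<times> {0..T}) \<times> {0..1::real}"
  obtain a z t y where P: "p = ((a, z, t), y)" by (metis prod.exhaust)
  obtain a' z' t' y' where Q: "q = ((a', z', t'), y')" by (metis prod.exhaust)
  have b: "\<bar>z\<bar> <= M" "\<bar>y'\<bar> <= 1" using p q P Q by auto
  have d: "\<bar>a - a'\<bar> <= dist p q" "\<bar>z - z'\<bar> <= dist p q" "\<bar>t - t'\<bar> <= dist p q" "\<bar>y - y'\<bar> <= dist p q"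
   using dist_quad_le[OF P Q] by auto
  have "dist (fst (fst p), fst (snd (fst p)) * snd p, snd (snd (fst p))) (fst (fst q), fst (snd (fst q)) * snd q, snd (snd (fst q)))
    <= \<bar>a - a'\<bar> + (\<bar>z * y - z' * y'\<bar> + \<bar>t - t'\<bar>)"
   unfolding P Q by (rule order_trans[OF dist_prod_le]) (simp add: dist_real_def order_trans[OF dist_prod_le])
  also have "\<bar>z * y - z' * y'\<bar> <= M * \<bar>y - y'\<bar> + 1 * \<bar>z - z'\<bar>" by (rule dist_mult_le[OF b])
  also have "\<bar>a - a'\<bar> + (M * \<bar>y - y'\<bar> + 1 * \<bar>z - z'\<bar> + \<bar>t - t'\<bar>) <= dist p q + (M * dist p q + 1 * dist p q + dist p q)"
   using d b by (intro add_mono mult_left_mono) auto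
  also have "... = (M + 3) * dist p q" by (simp add: algebra_simps)
  finally show "dist (fst (fst p), fst (snd (fst p)) * snd p, snd (snd (fst p))) (fst (fst q), fst (snd (fst q)) * snd q, snd (snd (fst q)))
   <= (M + 3) * dist p q" by simp
 qed
 then show ?thesis by simp
qed

lemma strip2_cont:
 assumes "strip2 T G" "t \<in> {0..T}"
 shows "continuous_on S (%r. G r t)"
proof -
 have "continuous_on S (%r. (%p. G (fst p) (snd p)) (r, t))"
  using assms(2) by (intro continuous_on_compose2[OF BL_continuous_on[OF assms(1)[unfolded strip2_def]]])
    (auto intro!: continuous_intros)
 then show ?thesis by simp
qed

text \<open>The fundamental theorem along \<open>th + z * y\<close> produces the factor
  \<open>z\<close> explicitly. The remainder therefore makes sense across \<open>z = 0\<close> and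
  depends on its arguments in a Lipschitz way there, which a difference quotient would not
  show.\<close>

lemma hadamard_id:
 fixes F :: "real => 'a::banach"
 assumes "!!r. (F has_vector_derivative G r) (at r)" "continuous_on UNIV G"
 shows "F (th + z) - F th = z *\<^sub>R integral {0..1} (%y. G (th + z * y))"
proof -
 have "((%y. F (th + z * y)) has_vector_derivative z *\<^sub>R G (th + z * y)) (at y within {0..1})" for y
 proof -
  have "(F \<circ> (%y. th + z * y) has_vector_derivative z *\<^sub>R G (th + z * y)) (at y)"
   by (rule vector_diff_chain_at) (auto intro!: derivative_eq_intros assms(1))
  then show ?thesis by (simp add: o_def has_vector_derivative_at_within)
 qed
 then have "((%y. z *\<^sub>R G (th + z * y)) has_integral (F (th + z * 1) - F (th + z * 0))) {0..1}"
  by (intro fundamental_theorem_of_calculus) auto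
 then have "integral {0..1} (%y. z *\<^sub>R G (th + z * y)) = F (th + z) - F th"
  by (auto dest: integral_unique)
 then show ?thesis by (simp add: integral_cmul)
qed

lemma hadamard1:
 fixes F G :: "real => real => 'a::banach"
 assumes "!!r t. t \<in> {0..T} ==> ((%r. F r t) has_vector_derivative G r t) (at r)"
  and "strip2 T G"
 shows "\<exists>R. strip3 M T R \<and> (\<forall>th z. \<forall>t\<in>{0..T}. F (th + z) t = F th t + z *\<^sub>R R th z t)"
proof (intro exI conjI allI ballI)
 define R where "R = (%th z t. integral {0..1} (%y. G (th + z * y) t))"
 show "strip3 M T R" unfolding strip3_def R_def
  using BL_integral[of "UNIV \<times> {-M..M} \<times> {0..T}" "%p y. G (fst p + fst (snd p) * y) (snd (snd p))"]
   strip3_shift[OF assms(2), of M] by (simp add: case_prod_unfold)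
 fix th z t assume t: "t \<in> {0..T}"
 show "F (th + z) t = F th t + z *\<^sub>R R th z t"
  using hadamard_id[of "%r. F r t" "%r. G r t" th z] assms(1)[OF t] strip2_cont[OF assms(2) t]
  by (simp add: R_def algebra_simps)
qed

lemma strip3_cont:
 assumes "strip3 M T R" "t \<in> {0..T}" "\<bar>z\<bar> <= M"
 shows "continuous_on {0..1} (%y. R th (z * y) t)"
proof -
 have "continuous_on {0..1} (%y. (%p. R (fst (fst p)) (fst (snd (fst p)) * snd p) (snd (snd (fst p)))) ((th, z, t), y))"
  using assms(2,3) by (intro continuous_on_compose2[OF BL_continuous_on[OF strip3_scale[OF assms(1)]]])
    (auto intro!: continuous_intros)
 then show ?thesis by simp
qed

text \<open>The derivative inside the integral of \<open>hadamard_id\<close> is itself expanded by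
  \<open>hadamard1\<close>. Its remainder is taken at \<open>z * y\<close> with the extra weight
  \<open>y\<close>, which is why remainders at scaled increments are needed.\<close>

lemma hadamard2:
 fixes F G G2 :: "real => real => 'a::banach"
 assumes "!!r t. t \<in> {0..T} ==> ((%r. F r t) has_vector_derivative G r t) (at r)"
  and "!!r t. t \<in> {0..T} ==> ((%r. G r t) has_vector_derivative G2 r t) (at r)"
  and "strip2 T G" "strip2 T G2"
 shows "\<exists>R. strip3 M T R \<and> (\<forall>th z. \<forall>t\<in>{0..T}. \<bar>z\<bar> <= M \<longrightarrow> F (th + z) t = F th t + z *\<^sub>R G th t + z^2 *\<^sub>R R th z t)"
proof -
 obtain R1 where R1: "strip3 M T R1" "!!th z t. t\<in>{0..T} ==> G (th + z) t = G th t + z *\<^sub>R R1 th z t"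
  using hadamard1[OF assms(2) assms(4), of M] by blast
 define R where "R = (%th z t. integral {0..1} (%y. y *\<^sub>R R1 th (z * y) t))"
 have "BL ((UNIV \<times> {-M..M} \<times> {0..T}) \<times> {0..1})
  (%p. snd p *\<^sub>R R1 (fst (fst p)) (fst (snd (fst p)) * snd p) (snd (snd (fst p))))"
  by (intro BL_scaleR strip3_scale R1 BL_bounded_coord[of _ _ 1])
    (auto simp: dist_real_def[symmetric] dist_snd_le)
 then have "strip3 M T R" unfolding strip3_def R_def
  using BL_integral[of "UNIV \<times> {-M..M} \<times> {0..T}" "%p y. y *\<^sub>R R1 (fst p) (fst (snd p) * y) (snd (snd p))"]
  by (simp add: case_prod_unfold)
 moreover have "F (th + z) t = F th t + z *\<^sub>R G th t + z^2 *\<^sub>R R th z t" if t: "t \<in> {0..T}" and z: "\<bar>z\<bar> <= M" for th z t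
 proof -
  have "F (th + z) t - F th t = z *\<^sub>R integral {0..1} (%y. G (th + z * y) t)"
   using hadamard_id[of "%r. F r t" "%r. G r t" th z] assms(1)[OF t] strip2_cont[OF assms(3) t] by simp
  also have "integral {0..1} (%y. G (th + z * y) t) = integral {0..1} (%y. G th t + z *\<^sub>R (y *\<^sub>R R1 th (z * y) t))"
   using R1(2)[OF t] by (simp add: mult.commute)
  also have "... = G th t + z *\<^sub>R R th z t"
  proof -
   have "((%y. z *\<^sub>R (y *\<^sub>R R1 th (z * y) t)) has_integral z *\<^sub>R R th z t) {0..1}"
    unfolding R_def by (intro has_integral_cmul integrable_integral)
     (auto intro!: integrable_continuous_real continuous_intros strip3_cont[OF R1(1) t z])
   then have "((%y. G th t + z *\<^sub>R (y *\<^sub>R R1 th (z * y) t)) has_integral (G th t + z *\<^sub>R R th z t)) {0..1}"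
    using has_integral_const_real[of "G th t" 0 1] by (intro has_integral_add) auto
   then show ?thesis by (rule integral_unique)
  qed
  finally show ?thesis by (simp add: algebra_simps power2_eq_square)
 qed
 ultimately show ?thesis by blast
qed

lemma hadamard3:
 fixes F G G2 G3 :: "real => real => 'a::banach"
 assumes "!!r t. t \<in> {0..T} ==> ((%r. F r t) has_vector_derivative G r t) (at r)"
  and "!!r t. t \<in> {0..T} ==> ((%r. G r t) has_vector_derivative G2 r t) (at r)"
  and "!!r t. t \<in> {0..T} ==> ((%r. G2 r t) has_vector_derivative G3 r t) (at r)"
  and "strip2 T G" "strip2 T G2" "strip2 T G3"
 shows "\<exists>R. strip3 M T R \<and> (\<forall>th z. \<forall>t\<in>{0..T}. \<bar>z\<bar> <= M \<longrightarrow>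
   F (th + z) t = F th t + z *\<^sub>R G th t + (z^2 / 2) *\<^sub>R G2 th t + z^3 *\<^sub>R R th z t)"
proof -
 obtain R1 where R1: "strip3 M T R1"
  "!!th z t. t\<in>{0..T} ==> \<bar>z\<bar> <= M ==> G (th + z) t = G th t + z *\<^sub>R G2 th t + z^2 *\<^sub>R R1 th z t"
  using hadamard2[OF assms(2,3,5,6), of M] by blast
 define R where "R = (%th z t. integral {0..1} (%y. (y * y) *\<^sub>R R1 th (z * y) t))"
 have "BL ((UNIV \<times> {-M..M} \<times> {0..T}) \<times> {0..1})
  (%p. (snd p * snd p) *\<^sub>R R1 (fst (fst p)) (fst (snd (fst p)) * snd p) (snd (snd (fst p))))"
  by (intro BL_scaleR BL_mult strip3_scale R1 BL_bounded_coord[of _ _ 1])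
    (auto simp: dist_real_def[symmetric] dist_snd_le)
 then have "strip3 M T R" unfolding strip3_def R_def
  using BL_integral[of "UNIV \<times> {-M..M} \<times> {0..T}" "%p y. (y * y) *\<^sub>R R1 (fst p) (fst (snd p) * y) (snd (snd p))"]
  by (simp add: case_prod_unfold)
 moreover have "F (th + z) t = F th t + z *\<^sub>R G th t + (z^2 / 2) *\<^sub>R G2 th t + z^3 *\<^sub>R R th z t" if t: "t \<in> {0..T}" and z: "\<bar>z\<bar> <= M" for th z t
 proof -
  have zy: "\<bar>z * y\<bar> <= M" if "y \<in> {0..1}" for y
   using that z mult_mono[of "\<bar>z\<bar>" M "\<bar>y\<bar>" 1] by (auto simp: abs_mult)
  have "F (th + z) t - F th t = z *\<^sub>R integral {0..1} (%y. G (th + z * y) t)"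
   using hadamard_id[of "%r. F r t" "%r. G r t" th z] assms(1)[OF t] strip2_cont[OF assms(4) t] by simp
  also have "integral {0..1} (%y. G (th + z * y) t) =
    integral {0..1} (%y. G th t + (y *\<^sub>R (z *\<^sub>R G2 th t) + z^2 *\<^sub>R ((y * y) *\<^sub>R R1 th (z * y) t)))"
   using R1(2)[OF t zy] by (intro integral_cong) (simp add: power2_eq_square algebra_simps)
  also have "... = G th t + ((1/2) *\<^sub>R (z *\<^sub>R G2 th t) + z^2 *\<^sub>R R th z t)"
  proof -
   have i: "((%y::real. y) has_integral 1/2) {0..1}"
    using ident_has_integral[of 0 1] by simp
   have "((%y. y *\<^sub>R (z *\<^sub>R G2 th t)) has_integral (1/2) *\<^sub>R (z *\<^sub>R G2 th t)) {0..1}"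
    by (rule has_integral_scaleR_left[OF i])
   moreover have "((%y. z^2 *\<^sub>R ((y * y) *\<^sub>R R1 th (z * y) t)) has_integral z^2 *\<^sub>R R th z t) {0..1}"
    unfolding R_def by (intro has_integral_cmul integrable_integral)
     (auto intro!: integrable_continuous_real continuous_intros strip3_cont[OF R1(1) t z])
   ultimately have "((%y. G th t + (y *\<^sub>R (z *\<^sub>R G2 th t) + z^2 *\<^sub>R ((y * y) *\<^sub>R R1 th (z * y) t))) has_integral
     (G th t + ((1/2) *\<^sub>R (z *\<^sub>R G2 th t) + z^2 *\<^sub>R R th z t))) {0..1}"
    using has_integral_const_real[of "G th t" 0 1] by (intro has_integral_add) auto
   then show ?thesis by (rule integral_unique)
  qed
  finally show ?thesis by (simp add: algebra_simps power2_eq_square power3_eq_cube)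
 qed
 ultimately show ?thesis by blast
qed

section \<open>The flow and its derivatives\<close>

text \<open>\<open>D i j\<close> is the derivative of order \<open>i\<close> in the parameter and \<open>j\<close> in time of a parametrisation that
 follows the flow map. The flow equation is stated for the unit tangent because the unit normal need not
 be known to be a smooth function.\<close>

locale curve_flow =
 fixes T :: real and D :: "nat => nat => real => real => real^2"
 assumes T_pos: "0 < T"
  and periodic0: "!!th t. t \<in> {0..T} ==> D 0 0 (th + 1) t = D 0 0 th t"
  and D_cont: "!!i j. continuous_on (UNIV \<times> {0..T}) (%(th, t). D i j th t)"
  and D_space: "!!i j th t. t \<in> {0..T} ==> ((%r. D i j r t) has_vector_derivative D (Suc i) j th t) (at th)"
  and D_time: "!!i j th t. t \<in> {0..T} ==>
   ((%r. D i j th r) has_vector_derivative D i (Suc j) th t) (at t within {0..T})"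
  and D_inj: "!!th th' t. t \<in> {0..T} ==> D 0 0 th t = D 0 0 th' t ==> \<exists>k::int. th' = th + of_int k"
  and D_regular: "!!th t. t \<in> {0..T} ==> D 1 0 th t ~= 0"
  and D_csf: "!!th t. t \<in> {0..T} ==>
   ((%r. D 1 0 r t /\<^sub>R norm (D 1 0 r t)) has_vector_derivative norm (D 1 0 th t) *\<^sub>R D 0 1 th t) (at th)"

lemma periodic_int:
 fixes f :: "real => 'a"
 assumes "!!th. f (th + 1) = f th"
 shows "f (th + of_int k) = f th"
proof -
 have n: "f (th + of_nat n) = f th" for th n
 proof (induction n)
  case (Suc n)
  have "f (th + of_nat (Suc n)) = f ((th + of_nat n) + 1)" by (simp add: algebra_simps)
  then show ?case using assms Suc by metis
 qed simp
 show ?thesis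
 proof (cases "k \<ge> 0")
  case True
  then show ?thesis using n[of th "nat k"] by simp
 next
  case False
  then show ?thesis using n[of "th + of_int k" "nat (- k)"] by simp
 qed
qed

lemma exact_flow_curve_flow:
 assumes "exact_flow \<gamma>0 X n H T"
 obtains D where "curve_flow T D" "!!th t. D 0 0 th t = X (\<gamma>0 th) t"
  "!!th t. t \<in> {0..T} ==> D 0 1 th t = - (H t (X (\<gamma>0 th) t) *\<^sub>R n t (X (\<gamma>0 th) t))"
proof -
 note ex = assms[unfolded exact_flow_def Let_def]
 note T = conjunct1[OF ex] and ex2 = conjunct2[OF ex]
 note per = conjunct1[OF ex2, rule_format] and ex3 = conjunct2[OF ex2]
 note inj0 = conjunct1[OF ex3] and ex4 = conjunct2[OF conjunct2[OF ex3]]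
 note sm = conjunct1[OF ex4] and ex5 = bspec[OF conjunct2[OF ex4]]
 note injX = conjunct1[OF ex5] and ex6 = conjunct2[OF ex5]
 note ex7 = spec[OF conjunct1[OF ex6]] and vel = bspec[OF conjunct2[OF ex6]]
 note reg = conjunct1[OF ex7] and lap = conjunct2[OF conjunct2[OF ex7]]
 obtain D where D0: "D 0 0 = (%th t. X (\<gamma>0 th) t)" and D': "\<forall>i j. continuous_on (UNIV \<times> {0..T}) (%(th, t). D i j th t) \<and>
     (\<forall>th. \<forall>t\<in>{0..T}.
      ((%r. D i j r t) has_vector_derivative D (Suc i) j th t) (at th) \<and>
      ((%r. D i j th r) has_vector_derivative D i (Suc j) th t) (at t within {0..T}))"
  using sm unfolding smooth_on_strip_def by (elim exE) (erule conjE, rule that)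
 note Dc = conjunct1[OF D'[rule_format]]
 note Ds = conjunct1[OF bspec[OF spec[OF conjunct2[OF D'[THEN spec, THEN spec]]]]]
 note Dt = conjunct2[OF bspec[OF spec[OF conjunct2[OF D'[THEN spec, THEN spec]]]]]
 have fp: "flow_param \<gamma>0 X t = (%r. D 0 0 r t)" for t unfolding flow_param_def D0 by simp
 have D1: "vector_derivative (flow_param \<gamma>0 X t) (at th) = D 1 0 th t" if "t \<in> {0..T}" for t th
  using Ds[OF that, of 0 0] unfolding fp One_nat_def by (rule vector_derivative_at)
 have D01: "D 0 1 th t = - (H t (X (\<gamma>0 th) t) *\<^sub>R n t (X (\<gamma>0 th) t))" if t: "t \<in> {0..T}" for th t
 proof -
  have 1: "((%r. D 0 0 th r) has_vector_derivative D 0 1 th t) (at t within {0..T})"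
   using Dt[OF t, of 0 0 th] by simp
  have 2: "((%r. D 0 0 th r) has_vector_derivative - (H t (X (\<gamma>0 th) t) *\<^sub>R n t (X (\<gamma>0 th) t))) (at t within {0..T})"
   using vel[OF t, of "\<gamma>0 th"] unfolding D0 by simp
  \<comment> \<open>At the end times only one-sided derivatives exist; they are still unique within
    a nondegenerate closed interval.\<close>
  have "t \<in> cbox 0 T" using t by simp
  then show ?thesis
   by (rule vector_derivative_unique_within_closed_interval[OF T _ 1[unfolded cbox_interval[symmetric]] 2[unfolded cbox_interval[symmetric]]])
 qed
 have "curve_flow T D"
 proof
  show "0 < T" by fact
  show "D 0 0 (th + 1) t = D 0 0 th t" for th t unfolding D0 by (simp add: per)
  show "continuous_on (UNIV \<times> {0..T}) (%(th, t). D i j th t)" for i j by (rule Dc)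
  show "((%r. D i j r t) has_vector_derivative D (Suc i) j th t) (at th)" if "t \<in> {0..T}" for i j th t by (rule Ds[OF that])
  show "((%r. D i j th r) has_vector_derivative D i (Suc j) th t) (at t within {0..T})" if "t \<in> {0..T}" for i j th t by (rule Dt[OF that])
  show "D 1 0 th t ~= 0" if "t \<in> {0..T}" for th t using reg[OF that, of th] D1[OF that] by simp
  show "\<exists>k::int. th' = th + of_int k" if t: "t \<in> {0..T}" and eq: "D 0 0 th t = D 0 0 th' t" for th th' t
  proof -
   have "\<gamma>0 th = \<gamma>0 th'" using eq unfolding D0 by (rule inj_onD[OF injX[OF t]]) auto
   \<comment> \<open>\<open>\<gamma>0\<close> is injective on one period only, hence the reduction
     to fractional parts.\<close>
   moreover have "\<gamma>0 (frac th) = \<gamma>0 th" for th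
    using periodic_int[of \<gamma>0 "frac th" "\<lfloor>th\<rfloor>"] per by (simp add: frac_def)
   ultimately have "frac th = frac th'"
    using inj_onD[OF inj0, of "frac th" "frac th'"] by (simp add: frac_lt_1)
   then have "th' = th + of_int (\<lfloor>th'\<rfloor> - \<lfloor>th\<rfloor>)" by (simp add: frac_def)
   then show ?thesis by blast
  qed
  show "((%r. D 1 0 r t /\<^sub>R norm (D 1 0 r t)) has_vector_derivative norm (D 1 0 th t) *\<^sub>R D 0 1 th t) (at th)"
   if t: "t \<in> {0..T}" for th t
  proof -
   let ?F = "%r. D 1 0 r t /\<^sub>R norm (D 1 0 r t)"
   have nz: "D 1 0 r t ~= 0" for r using reg[OF t, of r] D1[OF t] by simp
   \<comment> \<open>\<open>vector_derivative\<close> determines the derivative only where one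
     exists, so differentiability of the unit tangent has to come first. The Laplace-Beltrami
     operator of the identity is then the derivative of the unit tangent divided by the
     speed.\<close>
   have "(%r. D 1 0 r t) differentiable at th"
    using Ds[OF t, of 1 0] by (auto intro: differentiableI_vector)
   moreover have "(%r. inverse (norm (D 1 0 r t))) differentiable at th"
    using differentiable_chain_at[OF calculation differentiable_norm_at[OF nz]] nz[of th]
    by (intro differentiable_inverse) (auto simp: o_def)
   ultimately have "?F differentiable at th" by (intro differentiable_scaleR)
   then have "(?F has_vector_derivative vector_derivative ?F (at th)) (at th)"
    using vector_derivative_works by blast
   moreover have "laplace_beltrami (flow_param \<gamma>0 X t) id th = vector_derivative ?F (at th) /\<^sub>R norm (D 1 0 th t)"
    unfolding laplace_beltrami_def by (simp add: D1[OF t])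
   then have "vector_derivative ?F (at th) = norm (D 1 0 th t) *\<^sub>R laplace_beltrami (flow_param \<gamma>0 X t) id th"
    using nz by simp
   then have "vector_derivative ?F (at th) = norm (D 1 0 th t) *\<^sub>R D 0 1 th t"
    using lap[OF t, of th] D01[OF t, of th] unfolding flow_param_def by simp
   ultimately show ?thesis by simp
  qed
 qed
 then show ?thesis using that[of D] D0 D01 by simp
qed

text \<open>Reduces polygons numbered against the parametrisation to the positively oriented case.
  Each derivative in the parameter contributes a sign; the flow equation survives because the unit
  tangent changes sign once and its differentiation once more.\<close>

lemma curve_flow_reverse:
 assumes "curve_flow T D"
 shows "curve_flow T (%i j th t. (-1)^i *\<^sub>R D i j (- th) t)"
proof -
 interpret curve_flow T D by fact
 show ?thesis
 proof
  show "0 < T" by (rule T_pos)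
  show "(-1)^0 *\<^sub>R D 0 0 (- (th + 1)) t = (-1)^0 *\<^sub>R D 0 0 (- th) t" if "t \<in> {0..T}" for th t
   using periodic0[OF that, of "- th - 1"] by simp
  show "continuous_on (UNIV \<times> {0..T}) (%(th, t). (-1)^i *\<^sub>R D i j (- th) t)" for i j
  proof -
   have "continuous_on (UNIV \<times> {0..T}) (%p. (%(th, t). D i j th t) (- fst p, snd p))"
    by (rule continuous_on_compose2[OF D_cont]) (auto intro!: continuous_intros)
   then show ?thesis by (auto simp: case_prod_unfold intro!: continuous_intros)
  qed
  show der: "((%r. (-1)^i *\<^sub>R D i j (- r) t) has_vector_derivative (-1)^(Suc i) *\<^sub>R D (Suc i) j (- th) t) (at th)"
   if "t \<in> {0..T}" for i j th t
  proof -
   have "((%r. D i j r t) \<circ> uminus has_vector_derivative (-1) *\<^sub>R D (Suc i) j (- th) t) (at th)"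
    by (rule vector_diff_chain_at) (auto intro!: derivative_eq_intros D_space that)
   then have "((%r. (-1)^i *\<^sub>R D i j (- r) t) has_vector_derivative (-1)^i *\<^sub>R ((-1) *\<^sub>R D (Suc i) j (- th) t)) (at th)"
    by (intro bounded_linear.has_vector_derivative[OF bounded_linear_scaleR_right]) (simp add: o_def)
   then show ?thesis by simp
  qed
  show "((%r. (-1)^i *\<^sub>R D i j (- th) r) has_vector_derivative (-1)^i *\<^sub>R D i (Suc j) (- th) t) (at t within {0..T})"
   if "t \<in> {0..T}" for i j th t by (intro bounded_linear.has_vector_derivative[OF bounded_linear_scaleR_right] D_time that)
  show "\<exists>k::int. th' = th + of_int k" if t: "t \<in> {0..T}" and eq: "(-1)^0 *\<^sub>R D 0 0 (- th) t = (-1)^0 *\<^sub>R D 0 0 (- th') t" for th th' t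
  proof -
   obtain k :: int where "- th' = - th + of_int k" using D_inj[OF t, of "- th" "- th'"] eq by auto
   then have "th' = th + of_int (- k)" by simp
   then show ?thesis by blast
  qed
  show "(-1)^1 *\<^sub>R D 1 0 (- th) t ~= 0" if "t \<in> {0..T}" for th t using D_regular[OF that] by simp
  show "((%r. (- 1)^1 *\<^sub>R D 1 0 (- r) t /\<^sub>R norm ((- 1)^1 *\<^sub>R D 1 0 (- r) t)) has_vector_derivative
     norm ((- 1)^1 *\<^sub>R D 1 0 (- th) t) *\<^sub>R ((- 1)^0 *\<^sub>R D 0 1 (- th) t)) (at th)" if t: "t \<in> {0..T}" for th t
  proof -
   let ?F = "%r. D 1 0 r t /\<^sub>R norm (D 1 0 r t)"
   have "(?F \<circ> uminus has_vector_derivative (-1) *\<^sub>R (norm (D 1 0 (- th) t) *\<^sub>R D 0 1 (- th) t)) (at th)"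
    using vector_diff_chain_at[of uminus "-1" th, OF _ D_csf[OF t]]
    by (auto simp: has_vector_derivative_def intro!: derivative_eq_intros)
   then have "((%r. - ?F (- r)) has_vector_derivative - ((-1) *\<^sub>R (norm (D 1 0 (- th) t) *\<^sub>R D 0 1 (- th) t))) (at th)"
    by (intro has_vector_derivative_minus) (simp add: o_def)
   then show ?thesis by simp
  qed
 qed
qed

context curve_flow
begin

lemma D_periodic1: "t \<in> {0..T} ==> D i j (th + 1) t = D i j th t"
proof (induction "i + j" arbitrary: i j th t)
 case 0
 then show ?case using periodic0 by simp
next
 case (Suc n)
 show ?case
 proof (cases i)
  case (Suc i')
  have IH: "D i' j (th + 1) t = D i' j th t" for th using Suc.hyps Suc Suc.prems by simp
  have "((%r. D i' j r t) \<circ> (%r. r + 1) has_vector_derivative 1 *\<^sub>R D (Suc i') j (th + 1) t) (at th)"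
   by (rule vector_diff_chain_at) (auto intro!: derivative_eq_intros D_space Suc.prems)
  then have "((%r. D i' j r t) has_vector_derivative D i j (th + 1) t) (at th)" by (simp add: o_def IH Suc)
  then show ?thesis using D_space[OF Suc.prems, of i' j th] Suc vector_derivative_unique_at by blast
 next
  case 0
  then obtain j' where j': "j = Suc j'" using Suc by (cases j) auto
  have IH: "D i j' (th + 1) t = D i j' th t" if "t \<in> {0..T}" for t using Suc.hyps j' that by simp
  have tc: "t \<in> cbox 0 T" using Suc.prems by simp
  have a: "((%r. D i j' (th + 1) r) has_vector_derivative D i j (th + 1) t) (at t within {0..T})"
   unfolding j' by (rule D_time[OF Suc.prems])
  have b: "((%r. D i j' th r) has_vector_derivative D i j (th + 1) t) (at t within {0..T})"
   using IH Suc.prems by (intro has_vector_derivative_transform[OF _ _ a]) auto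
  have c: "((%r. D i j' th r) has_vector_derivative D i j th t) (at t within {0..T})"
   unfolding j' by (rule D_time[OF Suc.prems])
  show ?thesis
   by (rule vector_derivative_unique_within_closed_interval[OF T_pos tc b[unfolded cbox_interval[symmetric]] c[unfolded cbox_interval[symmetric]]])
 qed
qed

lemma D_periodic: "t \<in> {0..T} ==> D i j (th + of_int k) t = D i j th t"
 using periodic_int[of "%th. D i j th t"] D_periodic1 by blast

lemma D_bounded: "\<exists>B. \<forall>th. \<forall>t\<in>{0..T}. norm (D i j th t) <= B"
proof -
 have "compact ((%(th, t). D i j th t) ` ({0..1} \<times> {0..T}))"
  by (intro compact_continuous_image continuous_on_subset[OF D_cont] compact_Times) auto
 then have "bounded ((%(th, t). D i j th t) ` ({0..1} \<times> {0..T}))" by (rule compact_imp_bounded)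
 then obtain B where B': "\<forall>x\<in>(%(th, t). D i j th t) ` ({0..1} \<times> {0..T}). norm x <= B"
  unfolding bounded_iff by (elim exE) (rule that)
 have B: "norm (D i j th t) <= B" if "th \<in> {0..1}" "t \<in> {0..T}" for th t
  using bspec[OF B' imageI[of "(th, t)"]] that by simp
 have "norm (D i j th t) <= B" if t: "t \<in> {0..T}" for th t
 proof -
  have "D i j th t = D i j (frac th) t"
   using D_periodic[OF t, of i j "frac th" "\<lfloor>th\<rfloor>"] by (simp add: frac_def)
  then show ?thesis using B[OF _ t, of "frac th"] by (simp add: less_imp_le frac_lt_1)
 qed
 then show ?thesis by blast
qed

lemma D_strip2: "strip2 T (D i j)"
proof -
 obtain B0 where B0: "!!th t. t \<in> {0..T} ==> norm (D i j th t) <= B0" using D_bounded by blast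
 obtain B1 where B1: "!!th t. t \<in> {0..T} ==> norm (D (Suc i) j th t) <= B1" using D_bounded by blast
 obtain B2 where B2: "!!th t. t \<in> {0..T} ==> norm (D i (Suc j) th t) <= B2" using D_bounded by blast
 have pos: "0 <= B1" "0 <= B2" using order_trans[OF norm_ge_zero B1] order_trans[OF norm_ge_zero B2] T_pos by (meson atLeastAtMost_iff order_refl less_imp_le)+
 show ?thesis unfolding strip2_def
 proof (rule BLI)
  show "norm (D i j (fst p) (snd p)) <= B0" if "p \<in> UNIV \<times> {0..T}" for p using B0 that by auto
 next
  fix p q :: "real \<times> real" assume "p \<in> UNIV \<times> {0..T}" "q \<in> UNIV \<times> {0..T}"
  then obtain th t th' t' where P: "p = (th, t)" "q = (th', t')" and t: "t \<in> {0..T}" "t' \<in> {0..T}" by auto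
  have "norm (D i j th t - D i j th' t) <= B1 * \<bar>th - th'\<bar>"
   using B1 t by (intro deriv_bound[of UNIV _ _ "%r. D i j r t" "%r. D (Suc i) j r t"]) (auto intro!: D_space)
  moreover have "norm (D i j th' t - D i j th' t') <= B2 * \<bar>t - t'\<bar>"
   using B2 t by (intro deriv_bound[of "{0..T}" _ _ "%r. D i j th' r" "%r. D i (Suc j) th' r"]) (auto intro!: D_time)
  ultimately have "norm (D i j th t - D i j th' t') <= B1 * \<bar>th - th'\<bar> + B2 * \<bar>t - t'\<bar>"
   using norm_triangle_ineq[of "D i j th t - D i j th' t" "D i j th' t - D i j th' t'"] by simp
  also have "... <= B1 * dist p q + B2 * dist p q"
   using pos dist_fst_le[of p q] dist_snd_le[of p q]
   by (intro add_mono mult_left_mono) (auto simp: P dist_real_def)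
  finally show "norm (D i j (fst p) (snd p) - D i j (fst q) (snd q)) <= (B1 + B2) * dist p q"
   by (simp add: P algebra_simps)
 qed
qed

end

section \<open>Expansions on a single edge\<close>

abbreviation (input) par_box :: "real => real => (real \<times> real \<times> real) set" where
 "par_box M T \<equiv> UNIV \<times> {-M..M} \<times> {0..T}"

lemma BL_fst: "BL S f ==> BL (S \<times> U) (%p. f (fst p))"
 by (rule BL_compose[where L = 1]) (auto intro: dist_fst_le)

lemma dist_triple_le:
 fixes a z t :: real
 assumes "p = (a, z, t)" "q = (a', z', t')"
 shows "\<bar>a - a'\<bar> <= dist p q" "\<bar>z - z'\<bar> <= dist p q" "\<bar>t - t'\<bar> <= dist p q"
proof -
 have "dist (fst p) (fst q) <= dist p q" "dist (snd p) (snd q) <= dist p q"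
  "dist (fst (snd p)) (fst (snd q)) <= dist (snd p) (snd q)"
  "dist (snd (snd p)) (snd (snd q)) <= dist (snd p) (snd q)"
  by (rule dist_fst_le dist_snd_le)+
 then show "\<bar>a - a'\<bar> <= dist p q" "\<bar>z - z'\<bar> <= dist p q" "\<bar>t - t'\<bar> <= dist p q"
  unfolding assms fst_conv snd_conv dist_real_def by linarith+
qed

lemma strip2_aff:
 assumes "strip2 T F"
 shows "BL (par_box M T) (%p. F (fst p + k * fst (snd p)) (snd (snd p)))"
proof -
 have "BL (par_box M T) (%p. (%p. F (fst p) (snd p)) (fst p + k * fst (snd p), snd (snd p)))"
 proof (rule BL_compose[OF assms[unfolded strip2_def], where L = "2 + \<bar>k\<bar>"])
  fix p q :: "real \<times> real \<times> real"
  obtain a z t where P: "p = (a, z, t)" by (metis prod.exhaust)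
  obtain a' z' t' where Q: "q = (a', z', t')" by (metis prod.exhaust)
  have "dist (fst p + k * fst (snd p), snd (snd p)) (fst q + k * fst (snd q), snd (snd q))
   <= \<bar>(a + k * z) - (a' + k * z')\<bar> + \<bar>t - t'\<bar>"
   unfolding P Q by (rule order_trans[OF dist_prod_le]) (simp add: dist_real_def)
  also have "(a + k * z) - (a' + k * z') = (a - a') + k * (z - z')" by (simp add: algebra_simps)
  also have "\<bar>(a - a') + k * (z - z')\<bar> <= \<bar>a - a'\<bar> + \<bar>k\<bar> * \<bar>z - z'\<bar>"
   using abs_triangle_ineq[of "a - a'" "k * (z - z')"] by (simp add: abs_mult)
  also have "\<bar>a - a'\<bar> + \<bar>k\<bar> * \<bar>z - z'\<bar> + \<bar>t - t'\<bar> <= dist p q + \<bar>k\<bar> * dist p q + dist p q"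
   using dist_triple_le[OF P Q] by (intro add_mono mult_left_mono) auto
  finally show "dist (fst p + k * fst (snd p), snd (snd p)) (fst q + k * fst (snd q), snd (snd q))
   <= (2 + \<bar>k\<bar>) * dist p q" by (simp add: algebra_simps)
 qed auto
 then show ?thesis by simp
qed

lemma strip3_aff:
 assumes "strip3 M T R" "\<bar>k\<bar> <= 1"
 shows "BL (par_box M T) (%p. R (fst p) (k * fst (snd p)) (snd (snd p)))"
proof -
 have "BL (par_box M T) (%p. (%p. R (fst p) (fst (snd p)) (snd (snd p))) (fst p, k * fst (snd p), snd (snd p)))"
 proof (rule BL_compose[OF assms(1)[unfolded strip3_def], where L = 3])
  fix p :: "real \<times> real \<times> real" assume "p \<in> par_box M T"
  then obtain a z t where P: "p = (a, z, t)" "\<bar>z\<bar> <= M" "t \<in> {0..T}" by auto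
  have "\<bar>k * z\<bar> <= 1 * M" unfolding abs_mult using P assms by (intro mult_mono) auto
  then show "(fst p, k * fst (snd p), snd (snd p)) \<in> par_box M T" using P by auto
 next
  fix p q :: "real \<times> real \<times> real"
  obtain a z t where P: "p = (a, z, t)" by (metis prod.exhaust)
  obtain a' z' t' where Q: "q = (a', z', t')" by (metis prod.exhaust)
  have "dist (fst p, k * fst (snd p), snd (snd p)) (fst q, k * fst (snd q), snd (snd q))
    <= \<bar>a - a'\<bar> + (\<bar>k * z - k * z'\<bar> + \<bar>t - t'\<bar>)"
   unfolding P Q by (rule order_trans[OF dist_prod_le]) (simp add: dist_real_def order_trans[OF dist_prod_le])
  also have "k * z - k * z' = k * (z - z')" by (simp add: algebra_simps)
  also have "\<bar>k * (z - z')\<bar> <= 1 * \<bar>z - z'\<bar>" unfolding abs_mult using assms by (intro mult_right_mono) auto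
  also have "\<bar>a - a'\<bar> + (1 * \<bar>z - z'\<bar> + \<bar>t - t'\<bar>) <= 3 * dist p q" using dist_triple_le[OF P Q] by auto
  finally show "dist (fst p, k * fst (snd p), snd (snd p)) (fst q, k * fst (snd q), snd (snd q)) <= 3 * dist p q" by simp
 qed
 then show ?thesis by simp
qed

lemma BL_slice_cont:
 assumes "BL (S \<times> {0..1}) f" "p \<in> S"
 shows "continuous_on {0..1::real} (%y. f (p, y))"
 using assms(2) by (intro continuous_on_compose2[OF BL_continuous_on[OF assms(1)]]) (auto intro!: continuous_intros)

lemma BL_coord_z: "BL (par_box M T) (%p. fst (snd p))"
proof (rule BL_bounded_coord[of _ _ M])
 show "\<bar>fst (snd p)\<bar> <= M" if "p \<in> par_box M T" for p using that by auto
 show "\<bar>fst (snd p) - fst (snd q)\<bar> <= dist p q" for p q :: "real \<times> real \<times> real"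
  using dist_triple_le(2)[of p "fst p" "fst (snd p)" "snd (snd p)" q "fst q" "fst (snd q)" "snd (snd q)"] by simp
qed

lemma BL_coord_y: "BL (S \<times> {0..1}) (%p. snd p :: real)"
 by (rule BL_bounded_coord[of _ _ 1]) (auto simp: dist_real_def[symmetric] dist_snd_le)

context curve_flow
begin

lemma speed_lower: "\<exists>c>0. \<forall>th. \<forall>t\<in>{0..T}. c <= norm (D 1 0 th t)"
proof -
 have c: "continuous_on ({0..1} \<times> {0..T}) (%p. norm ((%(th, t). D 1 0 th t) p))"
  by (intro continuous_on_norm continuous_on_subset[OF D_cont]) auto
 have "compact ({0..1::real} \<times> {0..T})" "({0..1::real} \<times> {0..T}) ~= {}" using T_pos by (auto intro!: compact_Times)
 from continuous_attains_inf[OF this c] obtain p where p: "p \<in> {0..1} \<times> {0..T}"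
  "\<forall>q\<in>{0..1} \<times> {0..T}. norm ((%(th, t). D 1 0 th t) p) <= norm ((%(th, t). D 1 0 th t) q)" by (elim bexE)
 show ?thesis
 proof (intro exI[of _ "norm ((%(th, t). D 1 0 th t) p)"] conjI allI ballI)
  show "0 < norm ((%(th, t). D 1 0 th t) p)" using p(1) D_regular by auto
  fix th t assume t: "t \<in> {0..T}"
  have "D 1 0 th t = D 1 0 (frac th) t"
   using D_periodic[OF t, of 1 0 "frac th" "\<lfloor>th\<rfloor>"] by (simp add: frac_def)
  then show "norm ((%(th, t). D 1 0 th t) p) <= norm (D 1 0 th t)"
   using p(2)[THEN bspec, of "(frac th, t)"] t by (simp add: less_imp_le frac_lt_1)
 qed
qed

definition tang :: "real => real => real^2" where
 "tang th t = (1 / norm (D 1 0 th t)) *\<^sub>R D 1 0 th t"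

text \<open>\<open>tang1\<close> and \<open>tang2\<close> are the first two parameter derivatives of
  \<open>tang\<close>. The flow equation expresses the first through the velocity, so the normalised
  tangent is never differentiated as a quotient.\<close>

definition tang1 :: "real => real => real^2" where
 "tang1 th t = norm (D 1 0 th t) *\<^sub>R D 0 1 th t"

definition tang2 :: "real => real => real^2" where
 "tang2 th t = ((D 1 0 th t \<bullet> D 2 0 th t) * (1 / norm (D 1 0 th t))) *\<^sub>R D 0 1 th t + norm (D 1 0 th t) *\<^sub>R D 1 1 th t"

lemma speed_BL: "strip2 T (%th t. norm (D 1 0 th t))"
 using D_strip2[of 1 0] unfolding strip2_def by (rule BL_norm)

lemma speed_inverse_BL: "strip2 T (%th t. 1 / norm (D 1 0 th t))"
proof -
 obtain c where "0 < c" "!!th t. t \<in> {0..T} ==> c <= norm (D 1 0 th t)" using speed_lower by blast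
 then show ?thesis using speed_BL unfolding strip2_def by (intro BL_inverse[of _ _ c]) auto
qed

lemma tang_BL: "strip2 T tang"
 using speed_inverse_BL D_strip2[of 1 0] unfolding strip2_def tang_def by (intro BL_scaleR) auto

lemma tang1_BL: "strip2 T tang1"
 using speed_BL D_strip2[of 0 1] unfolding strip2_def tang1_def by (intro BL_scaleR) auto

lemma tang2_BL: "strip2 T tang2"
 using speed_BL speed_inverse_BL D_strip2[of 1 0] D_strip2[of 2 0] D_strip2[of 0 1] D_strip2[of 1 1]
 unfolding strip2_def tang2_def by (intro BL_add BL_scaleR BL_mult BL_inner) auto

lemma norm_tang: "t \<in> {0..T} ==> norm (tang th t) = 1"
 unfolding tang_def using D_regular[of t th] by simp

lemma tang_deriv: "t \<in> {0..T} ==> ((%r. tang r t) has_vector_derivative tang1 th t) (at th)"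
 using D_csf[of t th] unfolding tang_def tang1_def by (simp add: inverse_eq_divide)

lemma tang1_deriv:
 assumes t: "t \<in> {0..T}"
 shows "((%r. tang1 r t) has_vector_derivative tang2 th t) (at th)"
proof -
 have d: "((%r. D 1 0 r t) has_vector_derivative D 2 0 th t) (at th)"
  using D_space[OF t, of 1 0 th] by (simp add: numeral_2_eq_2)
 have "((%r. norm (D 1 0 r t)) has_derivative (%h. h * ((D 1 0 th t \<bullet> D 2 0 th t) * (1 / norm (D 1 0 th t))))) (at th)"
 proof -
  have "(norm has_derivative (%h. h \<bullet> sgn (D 1 0 th t))) (at (D 1 0 th t))"
   by (rule has_derivative_norm[OF D_regular[OF t]])
  from diff_chain_at[OF d[unfolded has_vector_derivative_def] this]
  show ?thesis by (simp add: o_def sgn_div_norm inner_commute divide_simps mult.commute)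
 qed
 then have "((%r. norm (D 1 0 r t)) has_vector_derivative ((D 1 0 th t \<bullet> D 2 0 th t) * (1 / norm (D 1 0 th t)))) (at th)"
  unfolding has_vector_derivative_def by simp
 then have "((%r. norm (D 1 0 r t)) has_field_derivative ((D 1 0 th t \<bullet> D 2 0 th t) * (1 / norm (D 1 0 th t)))) (at th)"
  by (simp add: has_real_derivative_iff_has_vector_derivative)
 from has_vector_derivative_scaleR[OF this D_space[OF t, of 0 1 th]]
 show ?thesis unfolding tang1_def tang2_def by (simp add: add.commute)
qed

lemma D_der:
 assumes "t \<in> {0..T}"
 shows "((%r. D 0 0 r t) has_vector_derivative D 1 0 th t) (at th)"
  "((%r. D 1 0 r t) has_vector_derivative D 2 0 th t) (at th)"
  "((%r. D 2 0 r t) has_vector_derivative D 3 0 th t) (at th)"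
  "((%r. D 0 1 r t) has_vector_derivative D 1 1 th t) (at th)"
  "((%r. D 1 1 r t) has_vector_derivative D 2 1 th t) (at th)"
 using D_space[OF assms, of 0 0] D_space[OF assms, of 1 0] D_space[OF assms, of 2 0]
  D_space[OF assms, of 0 1] D_space[OF assms, of 1 1] by (simp_all add: numeral_2_eq_2 numeral_3_eq_3)

text \<open>On the chord from \<open>crv(th)\<close> to \<open>crv(th + d)\<close>, the point with affine coordinate \<open>chord_coord\<close> is the one
 whose normal projection is \<open>crv(th + d y)\<close>: the orthogonality relation is linear in that coordinate.\<close>

definition chord_coord :: "real => real => real => real => real" where
 "chord_coord th d t y = ((D 0 0 (th + d * y) t - D 0 0 th t) \<bullet> D 1 0 (th + d * y) t)
   / ((D 0 0 (th + d) t - D 0 0 th t) \<bullet> D 1 0 (th + d * y) t)"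

text \<open>Numerator and denominator of \<open>chord_coord\<close> both contain the factor
  \<open>d\<close>. Once it is cancelled, the denominator is close to the squared speed and bounded
  away from zero for small \<open>d\<close>, and the coordinate differs from \<open>y\<close> by
  \<open>d\<close> times a Lipschitz function.\<close>

lemma chord_expansion:
 obtains R d0 c g where "strip3 1 T R" "0 < d0" "d0 <= 1" "0 < c"
  "BL (par_box d0 T \<times> {0..1}) g"
  "!!th z t. t \<in> {0..T} ==> \<bar>z\<bar> <= 1 ==> D 0 0 (th + z) t = D 0 0 th t + z *\<^sub>R D 1 0 th t + z^2 *\<^sub>R R th z t"
  "!!th d t y. t \<in> {0..T} ==> \<bar>d\<bar> <= d0 ==> y \<in> {0..1} ==> c <= (D 1 0 th t + d *\<^sub>R R th d t) \<bullet> D 1 0 (th + d * y) t"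
  "!!th d t. t \<in> {0..T} ==> \<bar>d\<bar> <= d0 ==> c <= norm (D 1 0 th t + d *\<^sub>R R th d t)"
  "!!th d t y. t \<in> {0..T} ==> 0 < d ==> d <= d0 ==> y \<in> {0..1} ==> chord_coord th d t y = y + d * g ((th, d, t), y)"
proof -
 have d01: "((%r. D 0 0 r t) has_vector_derivative D 1 0 th t) (at th)" if "t \<in> {0..T}" for th t
  using D_space[OF that, of 0 0] by simp
 have d12: "((%r. D 1 0 r t) has_vector_derivative D 2 0 th t) (at th)" if "t \<in> {0..T}" for th t
  using D_space[OF that, of 1 0] by (simp add: numeral_2_eq_2)
 obtain R where R: "strip3 1 T R"
  "!!th z t. t \<in> {0..T} ==> \<bar>z\<bar> <= 1 ==> D 0 0 (th + z) t = D 0 0 th t + z *\<^sub>R D 1 0 th t + z^2 *\<^sub>R R th z t"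
  using hadamard2[OF d01 d12 D_strip2 D_strip2, where M = 1] by blast
 obtain c where c: "0 < c" "!!th t. t \<in> {0..T} ==> c <= norm (D 1 0 th t)" using speed_lower by blast
 define N where "N = (%p :: (real \<times> real \<times> real) \<times> real. (D 1 0 (fst (fst p)) (snd (snd (fst p)))
    + fst (snd (fst p)) *\<^sub>R R (fst (fst p)) (fst (snd (fst p))) (snd (snd (fst p))))
    \<bullet> D 1 0 (fst (fst p) + fst (snd (fst p)) * snd p) (snd (snd (fst p))))"
 have a1: "BL (par_box 1 T) (%p. D 1 0 (fst p) (snd (snd p)))"
  using strip2_aff[OF D_strip2, of 1 1 0 0] by simp
 have a2: "BL (par_box 1 T) (%p. R (fst p) (fst (snd p)) (snd (snd p)))"
  using R(1) unfolding strip3_def by simp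
 have a3: "BL (par_box 1 T) (%p. D 1 0 (fst p) (snd (snd p)) + fst (snd p) *\<^sub>R R (fst p) (fst (snd p)) (snd (snd p)))"
  by (intro BL_add BL_scaleR a1 a2 BL_coord_z)
 have N: "BL (par_box 1 T \<times> {0..1}) N"
  unfolding N_def using BL_fst[OF a3] by (intro BL_inner strip3_shift D_strip2) auto
 obtain C where C: "C \<ge> 1" "!!p q. p \<in> par_box 1 T \<times> {0..1} ==> q \<in> par_box 1 T \<times> {0..1} ==> norm (N p - N q) <= C * dist p q"
  using BLE[OF N] by metis
 obtain C' where C': "C' \<ge> 1" "!!p. p \<in> par_box 1 T ==> norm (R (fst p) (fst (snd p)) (snd (snd p))) <= C'"
  using BLE[OF a2] by metis
 \<comment> \<open>The entry with \<open>C\<close> keeps \<open>N\<close> within half of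
   \<open>c^2\<close> of its value at \<open>d = 0\<close>, which is the squared speed; the entry
   with \<open>C'\<close> keeps \<open>d\<close> times the remainder below half the speed.\<close>
 define d0 where "d0 = min 1 (min (c^2 / (2 * C)) (c / (2 * C')))"
 have d0: "0 < d0" "d0 <= 1" "d0 <= c^2 / (2 * C)" "d0 <= c / (2 * C')" unfolding d0_def using c C C' by auto
 have Nlow: "c^2 / 2 <= N ((th, d, t), y)" if "t \<in> {0..T}" "\<bar>d\<bar> <= d0" "y \<in> {0..1}" for th d t y
 proof -
  have "norm (N ((th, d, t), y) - N ((th, 0, t), y)) <= C * dist ((th, d, t), y) ((th, 0, t), y)"
   using that d0 by (intro C) auto
  also have "dist ((th, d, t), y) ((th, 0, t), y) = \<bar>d\<bar>" by (simp add: dist_Pair_Pair)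
  also have "C * \<bar>d\<bar> <= C * (c^2 / (2 * C))" using that d0 C by (intro mult_left_mono) auto
  also have "... = c^2 / 2" using C by simp
  finally have "\<bar>N ((th, d, t), y) - N ((th, 0, t), y)\<bar> <= c^2 / 2" unfolding real_norm_def .
  then have "N ((th, d, t), y) \<ge> N ((th, 0, t), y) - c^2 / 2" by linarith
  moreover have "N ((th, 0, t), y) = (norm (D 1 0 th t))^2" unfolding N_def by (simp add: power2_norm_eq_inner)
  moreover have "c^2 <= (norm (D 1 0 th t))^2" using c that by (intro power_mono) auto
  ultimately show ?thesis by simp
 qed
 have alow: "c / 2 <= norm (D 1 0 th t + d *\<^sub>R R th d t)" if "t \<in> {0..T}" "\<bar>d\<bar> <= d0" for th d t
 proof -
  have "- 1 <= d" "d <= 1" using that d0 by (auto simp: abs_le_iff)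
  then have "norm (d *\<^sub>R R th d t) <= d0 * C'" unfolding norm_scaleR using that d0 C'(2)[of "(th, d, t)"]
   by (intro mult_mono) auto
  also have "... <= c / (2 * C') * C'" using d0 C' by (intro mult_right_mono) auto
  also have "... = c / 2" using C' by simp
  finally show ?thesis using c(2)[of t th] that norm_diff_ineq[of "D 1 0 th t" "d *\<^sub>R R th d t"] by auto
 qed
 define g where "g = (%p :: (real \<times> real \<times> real) \<times> real.
   (((snd p * snd p) *\<^sub>R R (fst (fst p)) (fst (snd (fst p)) * snd p) (snd (snd (fst p)))
    - snd p *\<^sub>R R (fst (fst p)) (fst (snd (fst p))) (snd (snd (fst p))))
    \<bullet> D 1 0 (fst (fst p) + fst (snd (fst p)) * snd p) (snd (snd (fst p)))) * (1 / N p))"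
 have sub: "par_box d0 T \<times> {0..1} \<subseteq> par_box 1 T \<times> {0..1::real}" using d0 by auto
 have g: "BL (par_box d0 T \<times> {0..1}) g"
  unfolding g_def
 proof (intro BL_mult BL_inner)
  show "BL (par_box d0 T \<times> {0..1}) (%p. (snd p * snd p) *\<^sub>R R (fst (fst p)) (fst (snd (fst p)) * snd p) (snd (snd (fst p)))
    - snd p *\<^sub>R R (fst (fst p)) (fst (snd (fst p))) (snd (snd (fst p))))"
   using BL_fst[OF a2]
   by (intro BL_subset[OF _ sub] BL_diff BL_scaleR BL_mult BL_coord_y strip3_scale R(1)) auto
  show "BL (par_box d0 T \<times> {0..1}) (%p. D 1 0 (fst (fst p) + fst (snd (fst p)) * snd p) (snd (snd (fst p))))"
   by (intro strip3_shift D_strip2)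
  show "BL (par_box d0 T \<times> {0..1}) (%p. 1 / N p)"
  proof (rule BL_inverse[OF BL_subset[OF N sub]])
   show "0 < c^2 / 2" using c by simp
   fix p :: "(real \<times> real \<times> real) \<times> real" assume p: "p \<in> par_box d0 T \<times> {0..1}"
   obtain th d t y where P: "p = ((th, d, t), y)" by (metis prod.exhaust)
   show "c^2 / 2 <= N p" unfolding P by (rule Nlow) (use p P in auto)
  qed
 qed
 show ?thesis
 proof (rule that[OF R(1) d0(1,2) _ g R(2)])
  show "0 < min (c^2 / 2) (c / 2)" using c by simp
  show "min (c^2 / 2) (c / 2) <= (D 1 0 th t + d *\<^sub>R R th d t) \<bullet> D 1 0 (th + d * y) t"
   if "t \<in> {0..T}" "\<bar>d\<bar> <= d0" "y \<in> {0..1}" for th d t y using Nlow[OF that, of th] unfolding N_def by simp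
  show "min (c^2 / 2) (c / 2) <= norm (D 1 0 th t + d *\<^sub>R R th d t)" if "t \<in> {0..T}" "\<bar>d\<bar> <= d0" for th d t
   using alow[OF that, of th] by simp
  show "chord_coord th d t y = y + d * g ((th, d, t), y)" if "t \<in> {0..T}" "0 < d" "d <= d0" "y \<in> {0..1}" for th d t y
  proof -
   have Np: "0 < N ((th, d, t), y)" by (rule less_le_trans[OF _ Nlow]) (use that c in auto)
   have dy: "\<bar>d * y\<bar> <= 1" using that d0 mult_mono[of d 1 y 1] by auto
   let ?G = "D 1 0 (th + d * y) t"
   have e1: "D 0 0 (th + d * y) t - D 0 0 th t = d *\<^sub>R (y *\<^sub>R D 1 0 th t + (d * (y * y)) *\<^sub>R R th (d * y) t)"
    using R(2)[OF that(1) dy, of th] by (simp add: algebra_simps power2_eq_square)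
   have e2: "D 0 0 (th + d) t - D 0 0 th t = d *\<^sub>R (D 1 0 th t + d *\<^sub>R R th d t)"
    using R(2)[OF that(1), of d th] that d0 by (simp add: algebra_simps power2_eq_square)
   have "chord_coord th d t y = (d * ((y *\<^sub>R D 1 0 th t + (d * (y * y)) *\<^sub>R R th (d * y) t) \<bullet> ?G)) / (d * N ((th, d, t), y))"
    unfolding chord_coord_def e1 e2 by (simp add: N_def)
   also have "... = ((y *\<^sub>R D 1 0 th t + (d * (y * y)) *\<^sub>R R th (d * y) t) \<bullet> ?G) / N ((th, d, t), y)"
    using that by simp
   also have "(y *\<^sub>R D 1 0 th t + (d * (y * y)) *\<^sub>R R th (d * y) t) \<bullet> ?G = y * N ((th, d, t), y)
     + d * (((y * y) *\<^sub>R R th (d * y) t - y *\<^sub>R R th d t) \<bullet> ?G)"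
    unfolding N_def by (simp add: algebra_simps inner_add_left inner_diff_left)
   finally show ?thesis using Np by (simp add: g_def field_simps)
  qed
 qed
qed

text \<open>To leading order \<open>S\<close> is \<open>y\<close>, whose mean is 1/2. This value
  later cancels the first-order part of the trapezoidal rule and of the turning of the tangent. The
  corrections from \<open>g\<close> and from the variation of \<open>F\<close> are of order
  \<open>d\<close>.\<close>

lemma moment_expansion:
 fixes F F' F2 :: "real => real => 'a::euclidean_space"
 assumes F: "strip2 T F" "strip2 T F'" "!!r t. t \<in> {0..T} ==> ((%r. F r t) has_vector_derivative F' r t) (at r)"
  and g: "BL (par_box d0 T \<times> {0..1}) g" "0 < d0" "d0 <= 1"
  and S: "!!th d t y. t \<in> {0..T} ==> 0 < d ==> d <= d0 ==> y \<in> {0..1} ==> S th d t y = y + d * g ((th, d, t), y)"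
 obtains K where "BL (par_box d0 T) K"
  "!!th d t. t \<in> {0..T} ==> 0 < d ==> d <= d0 ==>
   integral {0..1} (%y. S th d t y *\<^sub>R F (th + d * y) t) = (1/2) *\<^sub>R F th t + d *\<^sub>R K (th, d, t)"
proof -
 obtain R where R: "strip3 d0 T R" "!!th z t. t\<in>{0..T} ==> F (th + z) t = F th t + z *\<^sub>R R th z t"
  using hadamard1[OF F(3,2), where M = d0] by blast
 define k where "k = (%p :: (real \<times> real \<times> real) \<times> real.
   g p *\<^sub>R F (fst (fst p) + fst (snd (fst p)) * snd p) (snd (snd (fst p)))
   + (snd p * snd p) *\<^sub>R R (fst (fst p)) (fst (snd (fst p)) * snd p) (snd (snd (fst p))))"
 have k: "BL (par_box d0 T \<times> {0..1}) k"
  unfolding k_def by (intro BL_add BL_scaleR BL_mult BL_coord_y strip3_scale strip3_shift R(1) F(1) g(1))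
 define K where "K = (%p. integral {0..1} (%y. k (p, y)))"
 show ?thesis
 proof
  show "BL (par_box d0 T) K" unfolding K_def by (rule BL_integral) (use k in simp)
  fix th d t assume t: "t \<in> {0..T}" and d: "0 < d" "d <= d0"
  have p: "(th, d, t) \<in> par_box d0 T" using t d by auto
  have "integral {0..1} (%y. S th d t y *\<^sub>R F (th + d * y) t) = integral {0..1} (%y. y *\<^sub>R F th t + d *\<^sub>R k ((th, d, t), y))"
  proof (rule integral_cong)
   fix y :: real assume y: "y \<in> {0..1}"
   show "S th d t y *\<^sub>R F (th + d * y) t = y *\<^sub>R F th t + d *\<^sub>R k ((th, d, t), y)"
    unfolding S[OF t d y] k_def by (simp add: R(2)[OF t, of th "d * y"] algebra_simps)
  qed
  also have "... = (1/2) *\<^sub>R F th t + d *\<^sub>R K (th, d, t)"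
  proof -
   have i: "((%y::real. y) has_integral 1/2) {0..1}" using ident_has_integral[of 0 1] by simp
   have "((%y. d *\<^sub>R k ((th, d, t), y)) has_integral d *\<^sub>R K (th, d, t)) {0..1}"
    unfolding K_def by (intro has_integral_cmul integrable_integral integrable_continuous_real BL_slice_cont[OF k p])
   from has_integral_add[OF has_integral_scaleR_left[OF i] this] show ?thesis by (rule integral_unique)
  qed
  finally show "integral {0..1} (%y. S th d t y *\<^sub>R F (th + d * y) t) = (1/2) *\<^sub>R F th t + d *\<^sub>R K (th, d, t)" .
 qed
qed

text \<open>Contributions of one edge to the functionals \<open>D22 + D23\<close> and \<open>D13\<close>, after substituting
 \<open>chord_coord\<close> in the integral over the edge and integrating by parts along the curve: they are paired
 with the increment of the test function over the edge (\<open>arc_gap\<close>, \<open>quad_gap1\<close>) and with its value at the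
 first vertex (\<open>quad_gap0\<close>).\<close>

definition arc_gap :: "real => real => real => real^2" where
 "arc_gap th d t = (1 / norm (D 0 0 (th + d) t - D 0 0 th t)) *\<^sub>R (D 0 0 (th + d) t - D 0 0 th t)
   - tang (th + d) t + d *\<^sub>R integral {0..1} (%y. chord_coord th d t y *\<^sub>R tang1 (th + d * y) t)"

definition quad_gap0 :: "real => real => real => real^2" where
 "quad_gap0 th d t = norm (D 0 0 (th + d) t - D 0 0 th t) *\<^sub>R
   ((1/2) *\<^sub>R (D 0 1 th t - D 0 1 (th + d) t) + d *\<^sub>R integral {0..1} (%y. chord_coord th d t y *\<^sub>R D 1 1 (th + d * y) t))"

definition quad_gap1 :: "real => real => real => real^2" where
 "quad_gap1 th d t = (norm (D 0 0 (th + d) t - D 0 0 th t) * d / 2) *\<^sub>R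
   integral {0..1} (%y. (chord_coord th d t y)^2 *\<^sub>R D 1 1 (th + d * y) t)"

text \<open>An exact identity rather than an estimate, because the coefficient of \<open>s\<close>
  has to be recognised as a Lipschitz function. The second term stems from the difference of the
  squared norms, which is \<open>s\<close> times the inner product of \<open>m\<close> and
  \<open>a + b\<close>.\<close>

lemma unit_vector_diff:
 fixes b m :: "'a::real_inner"
 assumes "a = b + s *\<^sub>R m" "a ~= 0" "b ~= 0"
 shows "(1 / norm a) *\<^sub>R a = (1 / norm b) *\<^sub>R b + s *\<^sub>R ((1 / norm a) *\<^sub>R m
   - ((m \<bullet> (a + b)) * (1 / norm a) * (1 / norm b) * (1 / (norm a + norm b))) *\<^sub>R b)"
proof -
 have pos: "norm a > 0" "norm b > 0" using assms by auto
 have "s * (m \<bullet> (a + b)) = (norm a)^2 - (norm b)^2"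
  unfolding power2_norm_eq_inner assms(1) by (simp add: algebra_simps inner_add_left inner_add_right inner_commute)
 also have "... = (norm a - norm b) * (norm a + norm b)" by (simp add: power2_eq_square algebra_simps)
 finally have e: "s * (m \<bullet> (a + b)) = (norm a - norm b) * (norm a + norm b)" .
 have "s *\<^sub>R (((m \<bullet> (a + b)) * (1 / norm a) * (1 / norm b) * (1 / (norm a + norm b))) *\<^sub>R b)
   = ((s * (m \<bullet> (a + b))) * ((1 / norm a) * (1 / norm b) * (1 / (norm a + norm b)))) *\<^sub>R b" by simp
 also have "(s * (m \<bullet> (a + b))) * ((1 / norm a) * (1 / norm b) * (1 / (norm a + norm b))) = 1 / norm b - 1 / norm a"
 proof -
  have "(p - q) * (p + q) * ((1 / p) * (1 / q) * (1 / (p + q))) = 1 / q - 1 / p" if "0 < p" "0 < q" for p q :: real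
  proof -
   have "p + q ~= 0" using that by linarith
   then have u: "(p + q) * (1 / (p + q)) = 1" by simp
   have "(p - q) * (p + q) * ((1 / p) * (1 / q) * (1 / (p + q))) = (p - q) * ((1 / p) * (1 / q)) * ((p + q) * (1 / (p + q)))"
    by (simp only: mult_ac)
   also have "... = (p - q) * ((1 / p) * (1 / q))" unfolding u by simp
   also have "... = 1 / q - 1 / p" using that by (simp add: field_simps)
   finally show ?thesis .
  qed
  then show ?thesis unfolding e using pos by blast
 qed
 finally have "s *\<^sub>R (((m \<bullet> (a + b)) * (1 / norm a) * (1 / norm b) * (1 / (norm a + norm b))) *\<^sub>R b) = (1 / norm b - 1 / norm a) *\<^sub>R b" .
 moreover have "s *\<^sub>R m = a - b" using assms(1) by simp
 then have "s *\<^sub>R ((1 / norm a) *\<^sub>R m) = (1 / norm a) *\<^sub>R (a - b)" by (metis scaleR_left_commute)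
 ultimately show ?thesis by (simp add: scaleR_right_diff_distrib scaleR_left_diff_distrib)
qed

text \<open>Two of the gaps gain one order by cancellation: in \<open>quad_gap0\<close> half the
  increment of \<open>D 0 1\<close> meets the first moment of \<open>D 1 1\<close>, in
  \<open>arc_gap\<close> the half turn of the chord direction and the moment of \<open>tang1\<close>
  meet the full turn of the tangent. \<open>quad_gap1\<close> is of second order through its
  prefactor.\<close>

lemma edge_expansions:
 obtains d0 g0 g1 g2 where "0 < d0" "d0 <= 1"
  "BL (par_box d0 T) g0" "BL (par_box d0 T) g1" "BL (par_box d0 T) g2"
  "!!th d t. t \<in> {0..T} ==> 0 < d ==> d <= d0 ==> quad_gap0 th d t = d^3 *\<^sub>R g0 (th, d, t)"
  "!!th d t. t \<in> {0..T} ==> 0 < d ==> d <= d0 ==> quad_gap1 th d t = d^2 *\<^sub>R g1 (th, d, t)"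
  "!!th d t. t \<in> {0..T} ==> 0 < d ==> d <= d0 ==> arc_gap th d t = d^2 *\<^sub>R g2 (th, d, t)"
proof -
 obtain R d0 c g where R: "strip3 1 T R" and d0: "0 < d0" "d0 <= 1" and c: "0 < c"
  and g: "BL (par_box d0 T \<times> {0..1}) g"
  and Rexp: "!!th z t. t \<in> {0..T} ==> \<bar>z\<bar> <= 1 ==> D 0 0 (th + z) t = D 0 0 th t + z *\<^sub>R D 1 0 th t + z^2 *\<^sub>R R th z t"
  and "!!th d t y. t \<in> {0..T} ==> \<bar>d\<bar> <= d0 ==> y \<in> {0..1} ==> c <= (D 1 0 th t + d *\<^sub>R R th d t) \<bullet> D 1 0 (th + d * y) t"
  and alow: "!!th d t. t \<in> {0..T} ==> \<bar>d\<bar> <= d0 ==> c <= norm (D 1 0 th t + d *\<^sub>R R th d t)"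
  and S: "!!th d t y. t \<in> {0..T} ==> 0 < d ==> d <= d0 ==> y \<in> {0..1} ==> chord_coord th d t y = y + d * g ((th, d, t), y)"
  by (rule chord_expansion) (rule that, assumption+)
 have sub: "par_box d0 T \<subseteq> par_box 1 T" using d0 by auto
 define a where "a = (%p. D 1 0 (fst p) (snd (snd p)) + fst (snd p) *\<^sub>R R (fst p) (fst (snd p)) (snd (snd p)))"
 have a: "BL (par_box d0 T) a"
  unfolding a_def using strip2_aff[OF D_strip2, of 1 1 0 0] strip3_aff[OF R, of 1]
  by (intro BL_add BL_scaleR BL_coord_z BL_subset[OF _ sub]) auto
 have anorm: "c <= norm (a p)" if "p \<in> par_box d0 T" for p
  unfolding a_def using that by (intro alow) auto
 have achord: "D 0 0 (th + d) t - D 0 0 th t = d *\<^sub>R a (th, d, t)" if "t \<in> {0..T}" "0 < d" "d <= d0" for th d t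
  using Rexp[of t d th] that d0 by (simp add: a_def algebra_simps power2_eq_square)
 have alen: "norm (D 0 0 (th + d) t - D 0 0 th t) = d * norm (a (th, d, t))" if "t \<in> {0..T}" "0 < d" "d <= d0" for th d t
  using achord[OF that] that by simp
 have ianorm: "BL (par_box d0 T) (%p. 1 / norm (a p))"
  by (rule BL_inverse[OF BL_norm[OF a] c anorm])

 obtain Rf where Rf: "strip3 d0 T Rf"
  "!!th z t. t \<in> {0..T} ==> \<bar>z\<bar> <= d0 ==> D 0 1 (th + z) t = D 0 1 th t + z *\<^sub>R D 1 1 th t + z^2 *\<^sub>R Rf th z t"
  using hadamard2[OF D_der(4) D_der(5) D_strip2 D_strip2, where M = d0] by blast
 obtain Kf where Kf: "BL (par_box d0 T) Kf" "!!th d t. t \<in> {0..T} ==> 0 < d ==> d <= d0 ==>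
   integral {0..1} (%y. chord_coord th d t y *\<^sub>R D 1 1 (th + d * y) t) = (1/2) *\<^sub>R D 1 1 th t + d *\<^sub>R Kf (th, d, t)"
  by (rule moment_expansion[OF D_strip2 D_strip2 D_der(5) g d0 S]) (assumption | rule that, assumption+)+
 define g0 where "g0 = (%p. norm (a p) *\<^sub>R (Kf p - (1/2) *\<^sub>R Rf (fst p) (fst (snd p)) (snd (snd p))))"
 have g0: "BL (par_box d0 T) g0"
  unfolding g0_def using Kf(1) Rf(1)[unfolded strip3_def] by (intro BL_scaleR BL_norm a BL_diff BL_const)
 have g0eq: "quad_gap0 th d t = d^3 *\<^sub>R g0 (th, d, t)" if "t \<in> {0..T}" "0 < d" "d <= d0" for th d t
 proof -
  have "\<bar>d\<bar> <= d0" using that by simp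
  show ?thesis unfolding quad_gap0_def alen[OF that] Kf(2)[OF that] Rf(2)[OF that(1) \<open>\<bar>d\<bar> <= d0\<close>] g0_def
   by (simp add: algebra_simps power2_eq_square power3_eq_cube)
 qed

 define s where "s = (%p :: (real \<times> real \<times> real) \<times> real. snd p + fst (snd (fst p)) * g p)"
 have s: "BL (par_box d0 T \<times> {0..1}) s"
  unfolding s_def by (intro BL_add BL_mult BL_coord_y g BL_fst[OF BL_coord_z])
 define k1 where "k1 = (%p. (s p * s p) *\<^sub>R D 1 1 (fst (fst p) + fst (snd (fst p)) * snd p) (snd (snd (fst p))))"
 have k1: "BL (par_box d0 T \<times> {0..1}) k1"
  unfolding k1_def by (intro BL_scaleR BL_mult s strip3_shift D_strip2)
 define g1 where "g1 = (%p. (norm (a p) * (1/2)) *\<^sub>R integral {0..1} (%y. k1 (p, y)))"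
 have g1: "BL (par_box d0 T) g1"
  unfolding g1_def using k1 by (intro BL_scaleR BL_mult BL_const BL_norm a BL_integral) simp
 have g1eq: "quad_gap1 th d t = d^2 *\<^sub>R g1 (th, d, t)" if "t \<in> {0..T}" "0 < d" "d <= d0" for th d t
 proof -
  have "integral {0..1} (%y. (chord_coord th d t y)^2 *\<^sub>R D 1 1 (th + d * y) t) = integral {0..1} (%y. k1 ((th, d, t), y))"
   using S[OF that] by (intro integral_cong) (simp add: k1_def s_def power2_eq_square)
  then show ?thesis unfolding quad_gap1_def alen[OF that] g1_def by (simp add: power2_eq_square)
 qed

 obtain R3 where R3: "strip3 1 T R3" "!!th z t. t \<in> {0..T} ==> \<bar>z\<bar> <= 1 ==>
   D 0 0 (th + z) t = D 0 0 th t + z *\<^sub>R D 1 0 th t + (z^2 / 2) *\<^sub>R D 2 0 th t + z^3 *\<^sub>R R3 th z t"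
  using hadamard3[OF D_der(1) D_der(2) D_der(3) D_strip2 D_strip2 D_strip2, where M = 1] by blast
 obtain Rb where Rb: "strip3 1 T Rb"
  "!!th z t. t \<in> {0..T} ==> \<bar>z\<bar> <= 1 ==> D 1 0 (th + z) t = D 1 0 th t + z *\<^sub>R D 2 0 th t + z^2 *\<^sub>R Rb th z t"
  using hadamard2[OF D_der(2) D_der(3) D_strip2 D_strip2, where M = 1] by blast
 obtain RT where RT: "strip3 1 T RT"
  "!!th z t. t \<in> {0..T} ==> \<bar>z\<bar> <= 1 ==> tang (th + z) t = tang th t + z *\<^sub>R tang1 th t + z^2 *\<^sub>R RT th z t"
  using hadamard2[of T tang tang1 tang2 1, OF tang_deriv tang1_deriv tang1_BL tang2_BL] by blast
 obtain KT where KT: "BL (par_box d0 T) KT" "!!th d t. t \<in> {0..T} ==> 0 < d ==> d <= d0 ==>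
   integral {0..1} (%y. chord_coord th d t y *\<^sub>R tang1 (th + d * y) t) = (1/2) *\<^sub>R tang1 th t + d *\<^sub>R KT (th, d, t)"
  by (rule moment_expansion[OF tang1_BL tang2_BL tang1_deriv g d0 S]) (assumption | rule that, assumption+)+
 \<comment> \<open>The derivative at the midpoint of the parameter arc. The chord divided by
   \<open>d\<close> agrees with it up to order \<open>d^2\<close>, so the chord direction is the
   unit tangent at the midpoint up to the same order.\<close>
 define b where "b = (%p. D 1 0 (fst p + (1/2) * fst (snd p)) (snd (snd p)))"
 have b: "BL (par_box d0 T) b" unfolding b_def by (rule strip2_aff[OF D_strip2])
 obtain cb where cb: "0 < cb" "!!th t. t \<in> {0..T} ==> cb <= norm (D 1 0 th t)"
  using speed_lower by blast
 then have cb: "0 < cb" "!!p. p \<in> par_box d0 T ==> cb <= norm (b p)"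
  unfolding b_def by auto
 have ibnorm: "BL (par_box d0 T) (%p. 1 / norm (b p))" by (rule BL_inverse[OF BL_norm[OF b] cb])
 have iabnorm: "BL (par_box d0 T) (%p. 1 / (norm (a p) + norm (b p)))"
  by (rule BL_inverse[OF BL_add[OF BL_norm[OF a] BL_norm[OF b]] c]) (use anorm in \<open>simp add: add_increasing2\<close>)
 define m where "m = (%p. R3 (fst p) (fst (snd p)) (snd (snd p)) - (1/4) *\<^sub>R Rb (fst p) ((1/2) * fst (snd p)) (snd (snd p)))"
 have m: "BL (par_box d0 T) m"
  unfolding m_def using R3(1)[unfolded strip3_def]
  by (intro BL_subset[OF _ sub] BL_diff BL_scaleR BL_const strip3_aff Rb(1)) auto
 define g2 where "g2 = (%p. (1/4) *\<^sub>R RT (fst p) ((1/2) * fst (snd p)) (snd (snd p))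
   + ((1 / norm (a p)) *\<^sub>R m p - ((m p \<bullet> (a p + b p)) * (1 / norm (a p)) * (1 / norm (b p)) * (1 / (norm (a p) + norm (b p)))) *\<^sub>R b p)
   - RT (fst p) (fst (snd p)) (snd (snd p)) + KT p)"
 have RT': "BL (par_box d0 T) (%p. RT (fst p) ((1/2) * fst (snd p)) (snd (snd p)))"
   "BL (par_box d0 T) (%p. RT (fst p) (fst (snd p)) (snd (snd p)))"
  using BL_subset[OF strip3_aff[OF RT(1), of "1/2"] sub] BL_subset[OF strip3_aff[OF RT(1), of 1] sub] by auto
 have g2: "BL (par_box d0 T) g2"
  unfolding g2_def by (intro BL_add BL_diff BL_scaleR BL_mult BL_inner BL_const RT' a b m ianorm ibnorm iabnorm KT)
 have g2eq: "arc_gap th d t = d^2 *\<^sub>R g2 (th, d, t)" if t: "t \<in> {0..T}" and d: "0 < d" "d <= d0" for th d t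
 proof -
  let ?p = "(th, d, t)"
  have p: "?p \<in> par_box d0 T" using t d by auto
  have d1: "\<bar>d\<bar> <= 1" "\<bar>d / 2\<bar> <= 1" using d d0 by auto
  have b2: "b ?p = D 1 0 th t + (d / 2) *\<^sub>R D 2 0 th t + (d / 2)^2 *\<^sub>R Rb th (d / 2) t"
   unfolding b_def using Rb(2)[OF t d1(2), of th] by simp
  have "d *\<^sub>R a ?p = d *\<^sub>R (b ?p + d^2 *\<^sub>R m ?p)"
   using achord[OF t d, of th] R3(2)[OF t d1(1), of th] unfolding b2 m_def
   by (simp add: algebra_simps power2_eq_square power3_eq_cube)
  then have ab: "a ?p = b ?p + d^2 *\<^sub>R m ?p" using d by simp
  have nz: "a ?p ~= 0" "b ?p ~= 0" using anorm[OF p] cb(2)[OF p] c cb(1) by auto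
  have u: "(1 / norm (a ?p)) *\<^sub>R a ?p = (1 / norm (b ?p)) *\<^sub>R b ?p + d^2 *\<^sub>R ((1 / norm (a ?p)) *\<^sub>R m ?p
   - ((m ?p \<bullet> (a ?p + b ?p)) * (1 / norm (a ?p)) * (1 / norm (b ?p)) * (1 / (norm (a ?p) + norm (b ?p)))) *\<^sub>R b ?p)"
   by (rule unit_vector_diff[OF ab nz])
  have chord: "(1 / norm (D 0 0 (th + d) t - D 0 0 th t)) *\<^sub>R (D 0 0 (th + d) t - D 0 0 th t) = (1 / norm (a ?p)) *\<^sub>R a ?p"
   unfolding alen[OF t d] unfolding achord[OF t d] using d by simp
  have bt: "(1 / norm (b ?p)) *\<^sub>R b ?p = tang th t + (d/2) *\<^sub>R tang1 th t + (d/2)^2 *\<^sub>R RT th (d/2) t"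
   using RT(2)[OF t d1(2), of th] unfolding b_def tang_def[of "th + d / 2"] by simp
  \<comment> \<open>Orders zero and one cancel, the latter as 1/2 - 1 + 1/2.\<close>
  have key: "x + (d/2) *\<^sub>R x1 + (d/2)^2 *\<^sub>R r2 + d^2 *\<^sub>R w - (x + d *\<^sub>R x1 + d^2 *\<^sub>R r) + d *\<^sub>R ((1/2) *\<^sub>R x1 + d *\<^sub>R k)
    = d^2 *\<^sub>R ((1/4) *\<^sub>R r2 + w - r + k)" for x x1 r2 w r k :: "real^2"
   unfolding vec_eq_iff by (simp add: field_simps power2_eq_square)
  show ?thesis
   unfolding arc_gap_def chord u bt KT(2)[OF t d] RT(2)[OF t d1(1)] g2_def
   by (subst key) simp
 qed
 show ?thesis by (rule that[OF d0 g0 g1 g2 g0eq g1eq g2eq])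
qed

end

section \<open>Nodal representation of finite element functions\<close>

lemma nxt_less [simp]: "0 < J ==> nxt J j < J" and prv_less [simp]: "0 < J ==> prv J j < J"
 by (simp_all add: nxt_def prv_def)

lemma nxt_prv [simp]:
 assumes "j < J" shows "nxt J (prv J j) = j"
proof (cases "j = 0")
 case True
 then show ?thesis using assms by (simp add: nxt_def prv_def)
next
 case False
 then have "prv J j = j - 1" using assms mod_add_self2[of "j - 1" J] by (simp add: prv_def)
 then show ?thesis using False assms by (simp add: nxt_def)
qed

lemma prv_nxt [simp]:
 assumes "j < J" shows "prv J (nxt J j) = j"
proof (cases "Suc j = J")
 case True
 then show ?thesis by (auto simp: nxt_def prv_def)
next
 case False
 then have "nxt J j = Suc j" using assms by (simp add: nxt_def)
 then show ?thesis using assms by (simp add: prv_def)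
qed

lemma nxt_neq: "j < J ==> 2 <= J ==> nxt J j ~= j"
 by (cases "Suc j = J") (auto simp: nxt_def)

lemma sum_nxt: "(\<Sum>j<J. f (nxt J j)) = (\<Sum>j<J. f j)"
 by (rule sum.reindex_bij_witness[of _ "prv J" "nxt J"]) auto

lemma sum_prv: "(\<Sum>j<J. f (prv J j)) = (\<Sum>j<J. f j)"
 by (rule sum.reindex_bij_witness[of _ "nxt J" "prv J"]) auto

lemma edge_0 [simp]: "edge J x j 0 = x j" and edge_1 [simp]: "edge J x j 1 = x (nxt J j)"
 by (simp_all add: edge_def linepath_def)

lemma edge_alt: "edge J x j s = x j + s *\<^sub>R (x (nxt J j) - x j)"
 by (simp add: edge_def linepath_def algebra_simps)

text \<open>\<open>simple_closed_polygon\<close> asserts injectivity on half-open edges only, so the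
  end point of an edge is read as the start of the next one.\<close>

lemma edge_normal_form:
 assumes "j < J" "s \<in> {0..1}"
 obtains i r where "i < J" "r \<in> {0..<1}" "!!u. edge J u j s = edge J u i r"
proof (cases "s = 1")
 case True
 then show ?thesis using that[of "nxt J j" 0] assms by simp
next
 case False
 then show ?thesis using that[of j s] assms by simp
qed

text \<open>Makes the definite description in \<open>fe\<close> well defined: two descriptions of
  one polygon point have the same normal form, hence give the same value for every nodal
  vector.\<close>

lemma edge_eq_transfer:
 assumes "simple_closed_polygon J x" "j < J" "i < J" "s \<in> {0..1}" "r \<in> {0..1}" "edge J x j s = edge J x i r"
 shows "edge J u j s = edge J u i r"
proof -
 obtain j' s' where 1: "j' < J" "s' \<in> {0..<1}" "!!u. edge J u j s = edge J u j' s'"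
  using edge_normal_form assms by metis
 obtain i' r' where 2: "i' < J" "r' \<in> {0..<1}" "!!u. edge J u i r = edge J u i' r'"
  using edge_normal_form assms by metis
 have "(j', s') = (i', r')"
  using assms(1) unfolding simple_closed_polygon_def
  by (elim conjE, elim inj_onD) (use assms 1 2 in auto)
 then show ?thesis using 1 2 by simp
qed

lemma edge_eqD:
 assumes "simple_closed_polygon J x" "j < J" "i < J" "s \<in> {0..<1}" "r \<in> {0..<1}" "edge J x j s = edge J x i r"
 shows "j = i" "s = r"
proof -
 have "(j, s) = (i, r)"
  using assms(1) unfolding simple_closed_polygon_def
  by (elim conjE, elim inj_onD) (use assms in auto)
 then show "j = i" "s = r" by auto
qed

text \<open>A predicate instead of the function \<open>fe\<close>, so that it also applies to the
  identity, to interpolants and to the inverse map occurring in \<open>mesh_reg\<close>.\<close>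

definition represents :: "nat => (nat => real^2) => (real^2 => real^2) => (nat => real^2) => bool" where
 "represents J x f u \<longleftrightarrow> (\<forall>j<J. \<forall>s\<in>{0..1}. f (edge J x j s) = edge J u j s)"

lemma representsD: "represents J x f u ==> j < J ==> s \<in> {0..1} ==> f (edge J x j s) = edge J u j s"
 unfolding represents_def by blast

lemma fe_represents:
 assumes "simple_closed_polygon J x"
 shows "represents J x (fe J x u) u"
 unfolding represents_def fe_def
proof (intro allI impI ballI the_equality)
 fix j s assume "j < J" "s \<in> {0..1::real}"
 then show "\<exists>i<J. \<exists>r\<in>{0..1}. edge J x j s = edge J x i r \<and> edge J u j s = edge J u i r"
  by (intro exI[of _ j] conjI bexI[of _ s]) auto
next
 fix j s v assume j: "j < J" "s \<in> {0..1::real}"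
  and "\<exists>i<J. \<exists>r\<in>{0..1}. edge J x j s = edge J x i r \<and> v = edge J u i r"
 then obtain i r where i: "i < J" "r \<in> {0..1}" "edge J x j s = edge J x i r" and v: "v = edge J u i r" by blast
 show "v = edge J u j s" unfolding v by (rule edge_eq_transfer[OF assms j(1) i(1) j(2) i(2,3), symmetric])
qed

lemma represents_node: "represents J x f u ==> j < J ==> f (x j) = u j"
 using representsD[of J x f u j 0] by simp

lemma polygon_nodes_distinct:
 assumes "simple_closed_polygon J x" "j < J"
 shows "x j ~= x (nxt J j)"
proof
 assume "x j = x (nxt J j)"
 then have e: "edge J x j 0 = edge J x (nxt J j) 0" by simp
 have J: "3 <= J" using assms unfolding simple_closed_polygon_def by simp
 have "j = nxt J j" by (rule edge_eqD(1)[OF assms _ _ _ e]) (use J in auto)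
 then show False using nxt_neq[OF assms(2)] J by simp
qed

lemma edge_len_pos: "simple_closed_polygon J x ==> j < J ==> 0 < edge_len J x j"
 using polygon_nodes_distinct unfolding edge_len_def by simp

lemma edge_len_norm: "edge_len J x j = norm (x (nxt J j) - x j)"
 by (simp add: edge_len_def dist_norm norm_minus_commute)

lemma edge_deriv: "(edge J x j has_vector_derivative (x (nxt J j) - x j)) (at s within S)"
 unfolding edge_alt[abs_def] by (auto intro!: derivative_eq_intros)

lemma represents_deriv:
 assumes "represents J x f u" "j < J" "s \<in> {0<..<1}"
 shows "(f \<circ> edge J x j has_vector_derivative (u (nxt J j) - u j)) (at s)"
proof (rule has_vector_derivative_transform_within_open[OF edge_deriv[where S = UNIV]])
 show "open {0<..<1::real}" "s \<in> {0<..<1}" using assms by auto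
 show "edge J u j r = (f \<circ> edge J x j) r" if "r \<in> {0<..<1}" for r
  using assms that unfolding represents_def by auto
qed

text \<open>Both matrices are of rank one with the same unit vector as right factor, whose squared
  length drops out. If the derivative of \<open>c\<close> vanishes, division by zero makes both
  sides 0.\<close>

lemma tgrad_inner:
 "tgrad c f s \<bullet> tgrad c g s = (vector_derivative (f \<circ> c) (at s) \<bullet> vector_derivative (g \<circ> c) (at s))
   / (norm (vector_derivative c (at s)))^2" (is "_ = ?a \<bullet> ?b / (norm ?c)^2")
proof (cases "?c = 0")
 case False
 then have n: "norm ?c > 0" by simp
 have n2: "(norm ?c)^2 = ?c $ 1 * ?c $ 1 + ?c $ 2 * ?c $ 2"
  unfolding power2_norm_eq_inner inner_vec_def by (simp add: sum_2)
 have "tgrad c f s \<bullet> tgrad c g s = (?a \<bullet> ?b) * (?c $ 1 * ?c $ 1 + ?c $ 2 * ?c $ 2) / (norm ?c)^4"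
  unfolding tgrad_def Let_def inner_vec_def using n by (simp add: sum_2 field_simps power4_eq_xxxx)
 also have "... = ?a \<bullet> ?b / (norm ?c)^2" unfolding n2[symmetric] using n by (simp add: field_simps power2_eq_square power4_eq_xxxx)
 finally show ?thesis .
qed (simp add: tgrad_def inner_vec_def)

lemma norm_tgrad: "norm (tgrad c f s) = norm (vector_derivative (f \<circ> c) (at s)) / norm (vector_derivative c (at s))"
 unfolding norm_eq_sqrt_inner[of "tgrad c f s"] tgrad_inner
 by (simp add: real_sqrt_divide norm_eq_sqrt_inner[symmetric])

lemma curve_int_edge: "curve_int (edge J x j) g = edge_len J x j * integral {0..1} g"
 unfolding curve_int_def vector_derivative_at[OF edge_deriv[where S = UNIV]] edge_len_norm
 by (simp add: mult.commute)

lemma poly_int_alt: "poly_int J x f = (\<Sum>j<J. edge_len J x j * integral {0..1} (%s. f (edge J x j s)))"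
 unfolding poly_int_def curve_int_edge ..

lemma poly_grad_int_represents:
 assumes x: "simple_closed_polygon J x" and f: "represents J x f u" and g: "represents J x g w"
 shows "poly_grad_int J x f g = (\<Sum>j<J. (u (nxt J j) - u j) \<bullet> (w (nxt J j) - w j) / edge_len J x j)"
 unfolding poly_grad_int_def
proof (rule sum.cong)
 fix j assume "j \<in> {..<J}"
 then have j: "j < J" by simp
 have pos: "0 < edge_len J x j" by (rule edge_len_pos[OF x j])
 let ?v = "(u (nxt J j) - u j) \<bullet> (w (nxt J j) - w j) / (edge_len J x j)^2"
 have "integral {0..1} (%s. tgrad (edge J x j) f s \<bullet> tgrad (edge J x j) g s) = integral {0..1} (%s::real. ?v)"
 proof (rule integral_spike[of "{0, 1}"])
  \<comment> \<open>At the end points the two-sided derivative involves parameters outside the unit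
    interval, where \<open>represents\<close> says nothing; they form a null set.\<close>
  fix s :: real assume "s \<in> {0..1} - {0, 1}"
  then have s: "s \<in> {0<..<1}" by auto
  show "?v = tgrad (edge J x j) f s \<bullet> tgrad (edge J x j) g s"
   unfolding tgrad_inner vector_derivative_at[OF edge_deriv[where S = UNIV]] edge_len_norm
    vector_derivative_at[OF represents_deriv[OF f j s]] vector_derivative_at[OF represents_deriv[OF g j s]] ..
 qed simp
 then show "curve_int (edge J x j) (%s. tgrad (edge J x j) f s \<bullet> tgrad (edge J x j) g s)
   = (u (nxt J j) - u j) \<bullet> (w (nxt J j) - w j) / edge_len J x j"
  unfolding curve_int_edge using pos by (simp add: power2_eq_square)
qed simp

lemma represents_id: "represents J x id x"
 unfolding represents_def by simp

section \<open>Lumped integrals and norms in terms of nodal values\<close>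

lemma lumped_int_nodal:
 assumes "!!j. j < J ==> f (x j) = F j"
 shows "lumped_int J x f = (\<Sum>j<J. edge_len J x j / 2 * (F j + F (nxt J j)))"
 unfolding lumped_int_def using assms by (intro sum.cong) auto

lemma integral_edge_square:
 fixes a b :: "real^2"
 shows "((%s. (norm (a + s *\<^sub>R (b - a)))^2) has_integral (a \<bullet> a + a \<bullet> b + b \<bullet> b) / 3) {0..1}"
proof -
 let ?F = "%s. a \<bullet> a * s + a \<bullet> (b - a) * s^2 + (1/3) * ((b - a) \<bullet> (b - a)) * s^3"
 have "((%s. (norm (a + s *\<^sub>R (b - a)))^2) has_integral (?F 1 - ?F 0)) {0..1}"
 proof (rule fundamental_theorem_of_calculus)
  fix s :: real assume "s \<in> {0..1}"
  have "(?F has_field_derivative (norm (a + s *\<^sub>R (b - a)))^2) (at s within {0..1})"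
   unfolding power2_norm_eq_inner
   by (auto intro!: derivative_eq_intros simp: inner_add_left inner_add_right inner_commute power2_eq_square algebra_simps)
  then show "(?F has_vector_derivative (norm (a + s *\<^sub>R (b - a)))^2) (at s within {0..1})"
   by (simp add: has_real_derivative_iff_has_vector_derivative)
 qed simp
 moreover have "?F 1 - ?F 0 = (a \<bullet> a + a \<bullet> b + b \<bullet> b) / 3"
  by (simp add: inner_diff_left inner_diff_right inner_commute field_simps)
 ultimately show ?thesis by (simp only:)
qed

lemma L2_norm_represents:
 assumes "simple_closed_polygon J x" "represents J x f u"
 shows "0 <= L2_norm_on J x f" "(\<Sum>j<J. edge_len J x j * (norm (u j))^2) / 6 <= (L2_norm_on J x f)^2"
proof -
 have e: "integral {0..1} (%s. (norm (f (edge J x j s)))^2) = (u j \<bullet> u j + u j \<bullet> u (nxt J j) + u (nxt J j) \<bullet> u (nxt J j)) / 3"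
  if "j < J" for j
 proof -
  have "integral {0..1} (%s. (norm (f (edge J x j s)))^2) = integral {0..1} (%s. (norm (u j + s *\<^sub>R (u (nxt J j) - u j)))^2)"
   using assms(2) that unfolding represents_def by (intro integral_cong) (simp add: edge_alt)
  then show ?thesis using integral_unique[OF integral_edge_square] by simp
 qed
 have i: "(norm (u j))^2 / 6 <= integral {0..1} (%s. (norm (f (edge J x j s)))^2)" if "j < J" for j
 proof -
  \<comment> \<open>The integral is a third of \<open>a.a + a.b + b.b\<close>. These squares show
    that this sum is at least half of \<open>a.a\<close>, which is the source of the factor
    1/6.\<close>
  have "0 <= (norm (u j + u (nxt J j)))^2 + (norm (u (nxt J j)))^2" by simp
  also have "... = (norm (u j))^2 + 2 * (u j \<bullet> u (nxt J j)) + 2 * (norm (u (nxt J j)))^2"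
   unfolding power2_norm_eq_inner by (simp add: inner_add_left inner_add_right inner_commute)
  finally show ?thesis unfolding e[OF that] by (simp add: power2_norm_eq_inner)
 qed
 have s: "(\<Sum>j<J. edge_len J x j * (norm (u j))^2) / 6 <= poly_int J x (%p. (norm (f p))^2)"
  unfolding poly_int_alt sum_divide_distrib
 proof (rule sum_mono)
  fix j assume "j \<in> {..<J}"
  then have "edge_len J x j * ((norm (u j))^2 / 6) <= edge_len J x j * integral {0..1} (%s. (norm (f (edge J x j s)))^2)"
   using i by (intro mult_left_mono) (auto simp: edge_len_def)
  then show "edge_len J x j * (norm (u j))^2 / 6 <= edge_len J x j * integral {0..1} (%s. (norm (f (edge J x j s)))^2)" by simp
 qed
 have "0 <= (\<Sum>j<J. edge_len J x j * (norm (u j))^2) / 6"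
  by (auto intro!: divide_nonneg_pos sum_nonneg simp: edge_len_def)
 then show "0 <= L2_norm_on J x f" "(\<Sum>j<J. edge_len J x j * (norm (u j))^2) / 6 <= (L2_norm_on J x f)^2"
  using s unfolding L2_norm_on_def by auto
qed

lemma H1_norm_represents:
 assumes "simple_closed_polygon J x" "represents J x f u"
 shows "0 <= H1_norm_on J x f"
  "(\<Sum>j<J. edge_len J x j * (norm (u j))^2) / 6 <= (H1_norm_on J x f)^2"
  "(\<Sum>j<J. (norm (u (nxt J j) - u j))^2 / edge_len J x j) <= (H1_norm_on J x f)^2"
proof -
 have g: "poly_grad_int J x f f = (\<Sum>j<J. (norm (u (nxt J j) - u j))^2 / edge_len J x j)"
  unfolding poly_grad_int_represents[OF assms(1,2,2)] by (simp add: power2_norm_eq_inner)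
 have g0: "0 <= poly_grad_int J x f f"
  unfolding g by (auto intro!: sum_nonneg divide_nonneg_nonneg simp: edge_len_def)
 have e: "(H1_norm_on J x f)^2 = (L2_norm_on J x f)^2 + poly_grad_int J x f f"
  unfolding H1_norm_on_def using g0 by simp
 show "0 <= H1_norm_on J x f" unfolding H1_norm_on_def using g0 by simp
 show "(\<Sum>j<J. edge_len J x j * (norm (u j))^2) / 6 <= (H1_norm_on J x f)^2"
  using L2_norm_represents(2)[OF assms] g0 e by linarith
 show "(\<Sum>j<J. (norm (u (nxt J j) - u j))^2 / edge_len J x j) <= (H1_norm_on J x f)^2"
  using e g by (simp add: zero_le_power2)
qed

lemma norm_edge_le:
 assumes "j < J" "s \<in> {0..1}"
 shows "norm (edge J u j s) <= (\<Sum>i<J. norm (u i)) + (\<Sum>i<J. norm (u i))"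
proof -
 have "norm (u i) <= (\<Sum>i<J. norm (u i))" if "i < J" for i
  using that member_le_sum[of i "{..<J}" "%i. norm (u i)"] by auto
 then have b: "norm (u j) <= (\<Sum>i<J. norm (u i))" "norm (u (nxt J j)) <= (\<Sum>i<J. norm (u i))" using assms by auto
 have "norm (edge J u j s) <= norm ((1 - s) *\<^sub>R u j) + norm (s *\<^sub>R u (nxt J j))"
  unfolding edge_def linepath_def by (rule norm_triangle_ineq)
 also have "... <= 1 * norm (u j) + 1 * norm (u (nxt J j))"
  unfolding norm_scaleR using assms by (intro add_mono mult_right_mono) auto
 finally show ?thesis using b by linarith
qed

lemma Linf_norm_represents:
 assumes "represents J x f u" "j < J"
 shows "norm (u j) <= Linf_norm_on J x f"
proof -
 have "bdd_above ((%p. norm (f p)) ` polygon_set J x)"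
  unfolding polygon_set_def using assms(1) norm_edge_le[of _ J _ u]
  by (intro bdd_aboveI[of _ "(\<Sum>i<J. norm (u i)) + (\<Sum>i<J. norm (u i))"]) (auto simp: represents_def)
 moreover have "x j \<in> polygon_set J x"
  unfolding polygon_set_def using assms(2) by (auto intro!: bexI[of _ j] image_eqI[of _ _ 0])
 ultimately have "norm (f (x j)) <= Linf_norm_on J x f" unfolding Linf_norm_on_def by (rule cSUP_upper[rotated])
 then show ?thesis using represents_node[OF assms] by simp
qed

lemma W1inf_norm_represents:
 assumes "simple_closed_polygon J x" "represents J x f u" "j < J"
 shows "norm (u (nxt J j) - u j) / edge_len J x j <= W1inf_norm_on J x f" "0 <= Linf_norm_on J x f" "0 <= W1inf_norm_on J x f"
proof -
 have v: "norm (tgrad (edge J x j) f s) = norm (u (nxt J j) - u j) / edge_len J x j" if "j < J" "s \<in> {0<..<1}" for j s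
  unfolding norm_tgrad vector_derivative_at[OF edge_deriv[where S = UNIV]] edge_len_norm
    vector_derivative_at[OF represents_deriv[OF assms(2) that]] ..
 let ?G = "%(j, s). norm (tgrad (edge J x j) f s)"
 have n0: "0 <= norm (u (nxt J i) - u i) / edge_len J x i" for i by (simp add: edge_len_def)
 have "bdd_above (?G ` ({..<J} \<times> {0<..<1}))"
 proof (rule bdd_aboveI[of _ "\<Sum>i<J. norm (u (nxt J i) - u i) / edge_len J x i"])
  fix z assume "z \<in> ?G ` ({..<J} \<times> {0<..<1})"
  then obtain i s where "i < J" "s \<in> {0<..<1}" "z = norm (tgrad (edge J x i) f s)" by auto
  then show "z <= (\<Sum>i<J. norm (u (nxt J i) - u i) / edge_len J x i)"
   using v[of i s] member_le_sum[of i "{..<J}" "%i. norm (u (nxt J i) - u i) / edge_len J x i"] n0 by auto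
 qed
 then have "?G (j, 1/2) <= (SUP (j, s)\<in>{..<J} \<times> {0<..<1}. norm (tgrad (edge J x j) f s))"
  using assms(3) by (intro cSUP_upper) auto
 then have s: "norm (u (nxt J j) - u j) / edge_len J x j <= (SUP (j, s)\<in>{..<J} \<times> {0<..<1}. norm (tgrad (edge J x j) f s))"
  using v[OF assms(3), of "1/2"] by simp
 show l: "0 <= Linf_norm_on J x f" using Linf_norm_represents[OF assms(2,3)] norm_ge_zero order_trans by blast
 show "norm (u (nxt J j) - u j) / edge_len J x j <= W1inf_norm_on J x f"
  using s l unfolding W1inf_norm_on_def by linarith
 then show "0 <= W1inf_norm_on J x f" using n0[of j] by linarith
qed

text \<open>All summands of the induction hypothesis are nonnegative, so each is bounded by the full
  right-hand side. The maximum, Lipschitz and H^1 norms then bound the nodal values, the edge slopes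
  and the sum over edges.\<close>

lemma induction_hyp_bounds:
 assumes "induction_hyp \<gamma>0 X h dt J x m" "simple_closed_polygon J (proj_nodes \<gamma>0 X dt x m)" "0 < h"
 defines "q \<equiv> proj_nodes \<gamma>0 X dt x m" and "e \<equiv> proj_err \<gamma>0 X dt x m"
 shows "!!j. j < J ==> norm (e j) <= h powr (7/4)"
  "!!j. j < J ==> h powr (1/2) * norm (e (nxt J j) - e j) <= h powr (7/4) * edge_len J q j"
  "(\<Sum>j<J. (norm (e (nxt J j) - e j))^2 / edge_len J q j) <= (h powr (7/4))^2"
proof -
 note q = assms(2)[folded q_def]
 define f where "f = flow_err \<gamma>0 X dt x m"
 have J: "0 < J" using q unfolding simple_closed_polygon_def by simp
 have re: "represents J q (fe J q e) e" and rf: "represents J q (fe J q f) f" by (rule fe_represents[OF q])+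
 have b: "L2_norm_on J q (fe J q e) + L2_norm_on J q (fe J q f)
     + Linf_norm_on J q (fe J q e) + Linf_norm_on J q (fe J q f)
     + H1_norm_on J q (fe J q e) + H1_norm_on J q (fe J q f)
     + h powr (1/2) * (W1inf_norm_on J q (fe J q e) + W1inf_norm_on J q (fe J q f)) <= h powr (7/4)"
  using assms(1) unfolding induction_hyp_def Let_def q_def e_def f_def .
 note nn = L2_norm_represents(1)[OF q re] L2_norm_represents(1)[OF q rf] H1_norm_represents(1)[OF q re]
  H1_norm_represents(1)[OF q rf] W1inf_norm_represents(2,3)[OF q re J] W1inf_norm_represents(2,3)[OF q rf J]
 have w: "0 <= h powr (1/2) * W1inf_norm_on J q (fe J q e)" "0 <= h powr (1/2) * W1inf_norm_on J q (fe J q f)"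
  using nn by auto
 have b1: "Linf_norm_on J q (fe J q e) <= h powr (7/4)" and b2: "H1_norm_on J q (fe J q e) <= h powr (7/4)"
  and b3: "h powr (1/2) * W1inf_norm_on J q (fe J q e) <= h powr (7/4)"
  using b nn w unfolding distrib_left by linarith+
 show "norm (e j) <= h powr (7/4)" if "j < J" for j
  using Linf_norm_represents[OF re that] b1 by linarith
 show "h powr (1/2) * norm (e (nxt J j) - e j) <= h powr (7/4) * edge_len J q j" if "j < J" for j
 proof -
  have "h powr (1/2) * (norm (e (nxt J j) - e j) / edge_len J q j) <= h powr (1/2) * W1inf_norm_on J q (fe J q e)"
   using W1inf_norm_represents(1)[OF q re that] by (intro mult_left_mono) auto
  then have "h powr (1/2) * (norm (e (nxt J j) - e j) / edge_len J q j) <= h powr (7/4)" using b3 by linarith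
  then show ?thesis using edge_len_pos[OF q that] by (simp add: field_simps)
 qed
 have "(H1_norm_on J q (fe J q e))^2 <= (h powr (7/4))^2" using b2 nn by (intro power_mono) auto
 then show "(\<Sum>j<J. (norm (e (nxt J j) - e j))^2 / edge_len J q j) <= (h powr (7/4))^2"
  using H1_norm_represents(3)[OF q re] by linarith
qed

text \<open>The map between the initial and the projected polygon and its inverse are edgewise
  affine, and their slopes are the two quotients of edge lengths.\<close>

lemma mesh_reg_bounds:
 assumes "mesh_reg \<gamma>0 X dt J x l <= \<kappa>" "m <= l" "simple_closed_polygon J (x 0)"
  "simple_closed_polygon J (proj_nodes \<gamma>0 X dt x m)" "j < J"
 defines "q \<equiv> proj_nodes \<gamma>0 X dt x m"
 shows "edge_len J q j <= \<kappa> * edge_len J (x 0) j" "edge_len J (x 0) j <= \<kappa> * edge_len J q j"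
proof -
 note q = assms(4)[folded q_def]
 have r1: "represents J (x 0) (fe J (x 0) q) q" by (rule fe_represents[OF assms(3)])
 have r2: "represents J q (inv_into (polygon_set J (x 0)) (fe J (x 0) q)) (x 0)"
  unfolding represents_def
 proof (intro allI impI ballI)
  fix i s assume i: "i < J" "s \<in> {0..1::real}"
  have inj: "inj_on (fe J (x 0) q) (polygon_set J (x 0))"
  proof (rule inj_onI)
   fix a b assume "a \<in> polygon_set J (x 0)" "b \<in> polygon_set J (x 0)" and eq: "fe J (x 0) q a = fe J (x 0) q b"
   then obtain i s k r where i: "i < J" "k < J" "s \<in> {0..1}" "r \<in> {0..1}" and ab: "a = edge J (x 0) i s" "b = edge J (x 0) k r"
    unfolding polygon_set_def by blast
   have "edge J q i s = edge J q k r"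
    using eq representsD[OF r1 i(1,3)] representsD[OF r1 i(2,4)] unfolding ab by simp
   then show "a = b" unfolding ab by (rule edge_eq_transfer[OF q i])
  qed
  have "edge J (x 0) i s \<in> polygon_set J (x 0)" using i unfolding polygon_set_def by blast
  from inv_into_f_f[OF inj this]
  show "inv_into (polygon_set J (x 0)) (fe J (x 0) q) (edge J q i s) = edge J (x 0) i s"
   using r1 i unfolding represents_def by auto
 qed
 have "W1inf_norm_on J (x 0) (fe J (x 0) q) + W1inf_norm_on J q (inv_into (polygon_set J (x 0)) (fe J (x 0) q)) <= mesh_reg \<gamma>0 X dt J x l"
  unfolding mesh_reg_def Let_def q_def using assms(2) by (intro Max_ge) auto
 then have "W1inf_norm_on J (x 0) (fe J (x 0) q) <= \<kappa>" "W1inf_norm_on J q (inv_into (polygon_set J (x 0)) (fe J (x 0) q)) <= \<kappa>"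
  using assms(1) W1inf_norm_represents(3)[OF assms(3) r1 assms(5)] W1inf_norm_represents(3)[OF q r2 assms(5)] by linarith+
 then have "norm (q (nxt J j) - q j) / edge_len J (x 0) j <= \<kappa>" "norm (x 0 (nxt J j) - x 0 j) / edge_len J q j <= \<kappa>"
  using W1inf_norm_represents(1)[OF assms(3) r1 assms(5)] W1inf_norm_represents(1)[OF q r2 assms(5)] by linarith+
 then show "edge_len J q j <= \<kappa> * edge_len J (x 0) j" "edge_len J (x 0) j <= \<kappa> * edge_len J q j"
  using edge_len_pos[OF assms(3,5)] edge_len_pos[OF q assms(5)] unfolding edge_len_norm by (auto simp: field_simps)
qed

section \<open>Closest points on the curve\<close>

context curve_flow
begin

abbreviation crv :: "real => real => real^2" where "crv \<equiv> D 0 0"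

definition \<Gamma> :: "real => (real^2) set" where "\<Gamma> t = range (%th. crv th t)"

text \<open>Small gaps are covered by the chord expansion, gaps away from the integers by
  compactness and injectivity of the curve. The integer is there because a point determines its
  parameter only modulo 1.\<close>

lemma bilipschitz_mod1:
 obtains c where "0 < c"
  "!!th th' t. t \<in> {0..T} ==> \<exists>k::int. c * \<bar>th' + of_int k - th\<bar> <= norm (crv th' t - crv th t)"
proof -
 obtain R d0 c where "strip3 1 T R" and d0: "0 < d0" "d0 <= 1" and c: "0 < c"
  and Rexp: "!!th z t. t \<in> {0..T} ==> \<bar>z\<bar> <= 1 ==> D 0 0 (th + z) t = D 0 0 th t + z *\<^sub>R D 1 0 th t + z^2 *\<^sub>R R th z t"
  and alow: "!!th d t. t \<in> {0..T} ==> \<bar>d\<bar> <= d0 ==> c <= norm (D 1 0 th t + d *\<^sub>R R th d t)"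
  apply (rule chord_expansion)
  subgoal for R d0 c g by (rule that[of R d0 c])
  done
 define z0 where "z0 = min d0 (1/2)"
 have z0: "0 < z0" "z0 <= d0" "z0 <= 1/2" unfolding z0_def using d0 by auto
 define K where "K = {0..1::real} \<times> {z0..1-z0} \<times> {0..T}"
 have cK: "compact K" unfolding K_def by (intro compact_Times) auto
 have nK: "K ~= {}" unfolding K_def using z0 T_pos by auto
 have cont: "continuous_on UNIV (%p::real\<times>real\<times>real. fst p + fst (snd p))" by (intro continuous_intros)
 have "continuous_on K (%p. norm ((%(th, t). D 0 0 th t) (fst p + fst (snd p), snd (snd p)) - (%(th, t). D 0 0 th t) (fst p, snd (snd p))))"
  by (intro continuous_intros continuous_on_compose2[OF D_cont]) (auto simp: K_def)
 from continuous_attains_inf[OF cK nK this] obtain p where p: "p \<in> K"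
  "!!q. q \<in> K ==> norm (crv (fst p + fst (snd p)) (snd (snd p)) - crv (fst p) (snd (snd p)))
    <= norm (crv (fst q + fst (snd q)) (snd (snd q)) - crv (fst q) (snd (snd q)))" by auto
 define \<mu> where "\<mu> = norm (crv (fst p + fst (snd p)) (snd (snd p)) - crv (fst p) (snd (snd p)))"
 have \<mu>: "0 < \<mu>"
 proof (rule ccontr)
  assume "\<not> 0 < \<mu>"
  then have eq: "crv (fst p) (snd (snd p)) = crv (fst p + fst (snd p)) (snd (snd p))" unfolding \<mu>_def by simp
  have "snd (snd p) \<in> {0..T}" using p(1) unfolding K_def by auto
  from D_inj[OF this eq] obtain k :: int where k: "fst (snd p) = of_int k" by auto
  have "0 < fst (snd p)" "fst (snd p) < 1" using p(1) z0 unfolding K_def by auto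
  then show False unfolding k by simp
 qed
 show ?thesis
 proof (rule that[of "min c \<mu>"])
  show "0 < min c \<mu>" using c \<mu> by simp
  fix th th' t :: real assume t: "t \<in> {0..T}"
  define z where "z = frac (th' - th)"
  define k where "k = - \<lfloor>th' - th\<rfloor>"
  have z: "z = th' + of_int k - th" "0 <= z" "z < 1" by (simp_all add: z_def k_def frac_lt_1) (simp add: frac_def)
  have near: "min c \<mu> * \<bar>w\<bar> <= norm (crv th' t - crv th t)" if w: "w = th' + of_int i - th" "\<bar>w\<bar> <= z0" for w :: real and i
  proof -
   have w1: "\<bar>w\<bar> <= d0" "\<bar>w\<bar> <= 1" using w z0 d0 by auto
   have "crv th' t = crv (th + w) t" using D_periodic[OF t, of 0 0 th' i] w by simp
   also have "... = crv th t + w *\<^sub>R (D 1 0 th t + w *\<^sub>R R th w t)"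
    using Rexp[OF t w1(2), of th] by (simp add: algebra_simps power2_eq_square)
   finally have "norm (crv th' t - crv th t) = \<bar>w\<bar> * norm (D 1 0 th t + w *\<^sub>R R th w t)" by simp
   also have "... \<ge> \<bar>w\<bar> * c" using alow[OF t w1(1)] by (intro mult_left_mono) auto
   also have "min c \<mu> * \<bar>w\<bar> <= \<bar>w\<bar> * c" using mult_right_mono[of "min c \<mu>" c "\<bar>w\<bar>"] by (simp add: mult.commute)
   finally show ?thesis by simp
  qed
  consider "z <= z0" | "z0 <= z" "z <= 1 - z0" | "1 - z0 <= z" by linarith
  then show "\<exists>k::int. min c \<mu> * \<bar>th' + of_int k - th\<bar> <= norm (crv th' t - crv th t)"
  proof cases
   case 1
   then show ?thesis using near[of z k] z by (intro exI[of _ k]) auto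
  next
   case 2
   have th: "crv th t = crv (frac th) t" using D_periodic[OF t, of 0 0 "frac th" "\<lfloor>th\<rfloor>"] by (simp add: frac_def)
   have th': "crv th' t = crv (frac th + z) t"
    using D_periodic[OF t, of 0 0 "frac th + z" "\<lfloor>th\<rfloor> - k"] by (simp add: frac_def z(1))
   have "\<mu> <= norm (crv th' t - crv th t)"
    unfolding th th' \<mu>_def using p(2)[of "(frac th, z, t)"] 2 t by (simp add: K_def less_imp_le frac_lt_1)
   moreover have "min c \<mu> * \<bar>z\<bar> <= \<mu> * 1" using z \<mu> c by (intro mult_mono) auto
   ultimately show ?thesis using z by (intro exI[of _ k]) auto
  next
   case 3
   \<comment> \<open>A gap slightly below 1 is a small negative gap after one more shift by a
     period.\<close>
   have e: "z - 1 = th' + of_int (k - 1) - th" using z(1) by simp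
   have "min c \<mu> * \<bar>z - 1\<bar> <= norm (crv th' t - crv th t)" by (rule near[OF e]) (use 3 z in linarith)
   then show ?thesis unfolding e by blast
  qed
 qed
qed

lemma \<Gamma>_closed: "t \<in> {0..T} ==> closed (\<Gamma> t)"
proof -
 assume t: "t \<in> {0..T}"
 have "\<Gamma> t = (%th. crv th t) ` {0..1}"
 proof
  show "\<Gamma> t \<subseteq> (%th. crv th t) ` {0..1}"
  proof
   fix p assume "p \<in> \<Gamma> t"
   then obtain th where "p = crv th t" unfolding \<Gamma>_def by auto
   then have "p = crv (frac th) t" using D_periodic[OF t, of 0 0 "frac th" "\<lfloor>th\<rfloor>"] by (simp add: frac_def)
   then show "p \<in> (%th. crv th t) ` {0..1}" by (auto simp: less_imp_le frac_lt_1)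
  qed
 qed (auto simp: \<Gamma>_def)
 moreover have "continuous_on {0..1} (%th. crv th t)" by (rule strip2_cont[OF D_strip2 t])
 ultimately show ?thesis by (metis compact_Icc compact_continuous_image compact_imp_closed)
qed

lemma orth_deriv:
 assumes "t \<in> {0..T}"
 shows "((%r. (p - crv r t) \<bullet> D 1 0 r t) has_field_derivative
   ((p - crv r t) \<bullet> D 2 0 r t - D 1 0 r t \<bullet> D 1 0 r t)) (at r)"
proof -
 have "((%r. (p - crv r t) \<bullet> D 1 0 r t) has_derivative
   (%h. (p - crv r t) \<bullet> (h *\<^sub>R D 2 0 r t) + (0 - h *\<^sub>R D 1 0 r t) \<bullet> D 1 0 r t)) (at r)"
  using D_der(1,2)[OF assms, of r] unfolding has_vector_derivative_def
  by (intro has_derivative_inner has_derivative_diff has_derivative_const)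
 then show ?thesis unfolding has_field_derivative_def
  by (rule has_derivative_eq_rhs) (auto simp: algebra_simps inner_diff_left)
qed

text \<open>The foot minimises the squared distance over all parameters, so the derivative of that
  distance, a multiple of the tangential component, vanishes. The factor 2 is the triangle
  inequality through \<open>p\<close> combined with minimality.\<close>

lemma closest_param:
 assumes t: "t \<in> {0..T}" and c: "\<exists>k::int. c * \<bar>th' + of_int k - th\<bar> <= norm (crv th' t - crv th t)"
  and "crv th' t = closest_point (\<Gamma> t) p"
 obtains ps where "closest_point (\<Gamma> t) p = crv ps t" "c * \<bar>ps - th\<bar> <= 2 * norm (p - crv th t)"
  "(p - crv ps t) \<bullet> D 1 0 ps t = 0" "norm (p - crv ps t) <= norm (p - crv th t)"
proof -
 obtain k :: int where k: "c * \<bar>th' + of_int k - th\<bar> <= norm (crv th' t - crv th t)" using c by blast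
 define ps where "ps = th' + of_int k"
 have v: "closest_point (\<Gamma> t) p = crv ps t" using assms(3) D_periodic[OF t, of 0 0 th' k] by (simp add: ps_def)
 have ne: "\<Gamma> t ~= {}" unfolding \<Gamma>_def by auto
 have min: "norm (p - crv ps t) <= norm (p - crv r t)" for r
  using closest_point_le[OF \<Gamma>_closed[OF t], of "crv r t" p] unfolding v by (simp add: \<Gamma>_def dist_norm)
 have "((%r. (p - crv r t) \<bullet> (p - crv r t)) has_derivative
   (%h. (p - crv ps t) \<bullet> (0 - h *\<^sub>R D 1 0 ps t) + (0 - h *\<^sub>R D 1 0 ps t) \<bullet> (p - crv ps t))) (at ps)"
  using D_der(1)[OF t, of ps] unfolding has_vector_derivative_def
  by (intro has_derivative_inner has_derivative_diff has_derivative_const)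
 then have d: "DERIV (%r. (p - crv r t) \<bullet> (p - crv r t)) ps :> - 2 * ((p - crv ps t) \<bullet> D 1 0 ps t)"
  unfolding has_field_derivative_def
  by (rule has_derivative_eq_rhs) (auto simp: algebra_simps inner_commute)
 have "- 2 * ((p - crv ps t) \<bullet> D 1 0 ps t) = 0"
 proof (rule DERIV_local_min[OF d])
  show "0 < (1::real)" by simp
  show "\<forall>r. \<bar>ps - r\<bar> < 1 \<longrightarrow> (p - crv ps t) \<bullet> (p - crv ps t) <= (p - crv r t) \<bullet> (p - crv r t)"
   using min by (simp add: norm_le)
 qed
 moreover have "c * \<bar>ps - th\<bar> <= 2 * norm (p - crv th t)"
 proof -
  have "c * \<bar>ps - th\<bar> <= norm (crv ps t - crv th t)" using k D_periodic[OF t, of 0 0 th' k] by (simp add: ps_def)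
  also have "... <= norm (p - crv th t) + norm (p - crv ps t)" using norm_triangle_ineq4[of "p - crv th t" "p - crv ps t"] by simp
  finally show ?thesis using min[of th] by linarith
 qed
 ultimately show ?thesis using that[OF v] min by simp
qed

lemma closest_near:
 obtains c where "0 < c"
  "!!th t p. t \<in> {0..T} ==> \<exists>ps. closest_point (\<Gamma> t) p = crv ps t \<and> c * \<bar>ps - th\<bar> <= norm (p - crv th t)
   \<and> (p - crv ps t) \<bullet> D 1 0 ps t = 0 \<and> norm (p - crv ps t) <= norm (p - crv th t)"
proof -
 obtain c where c: "0 < c"
  "!!th th' t. t \<in> {0..T} ==> \<exists>k::int. c * \<bar>th' + of_int k - th\<bar> <= norm (crv th' t - crv th t)"
  by (rule bilipschitz_mod1) (rule that, assumption+)
 show ?thesis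
 proof (rule that[of "c / 2"])
  show "0 < c / 2" using c by simp
  fix th t p assume t: "t \<in> {0..T}"
  have "closest_point (\<Gamma> t) p \<in> \<Gamma> t" by (rule closest_point_in_set[OF \<Gamma>_closed[OF t]]) (auto simp: \<Gamma>_def)
  then obtain th' where "crv th' t = closest_point (\<Gamma> t) p" unfolding \<Gamma>_def by auto
  from closest_param[OF t c(2)[OF t, of th' th] this] obtain ps where "closest_point (\<Gamma> t) p = crv ps t" "c * \<bar>ps - th\<bar> <= 2 * norm (p - crv th t)"
  "(p - crv ps t) \<bullet> D 1 0 ps t = 0" "norm (p - crv ps t) <= norm (p - crv th t)" by blast
  then show "\<exists>ps. closest_point (\<Gamma> t) p = crv ps t \<and> c / 2 * \<bar>ps - th\<bar> <= norm (p - crv th t)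
   \<and> (p - crv ps t) \<bullet> D 1 0 ps t = 0 \<and> norm (p - crv ps t) <= norm (p - crv th t)" by (intro exI[of _ ps]) auto
 qed
qed

lemma D_bound_ge1:
 obtains B where "1 <= B" "!!th t. t \<in> {0..T} ==> norm (D i j th t) <= B"
  "!!th th' t t'. t \<in> {0..T} ==> t' \<in> {0..T} ==> norm (D i j th t - D i j th' t') <= B * (\<bar>th - th'\<bar> + \<bar>t - t'\<bar>)"
proof -
 obtain B where B: "1 <= B" "!!p. p \<in> UNIV \<times> {0..T} ==> norm (D i j (fst p) (snd p)) <= B"
  "!!p q. p \<in> UNIV \<times> {0..T} ==> q \<in> UNIV \<times> {0..T} ==> norm (D i j (fst p) (snd p) - D i j (fst q) (snd q)) <= B * dist p q"
  by (rule BLE[OF D_strip2[unfolded strip2_def, of i j]]) (rule that, assumption+)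
 show ?thesis
 proof
  show "1 <= B" by fact
  show "norm (D i j th t) <= B" if "t \<in> {0..T}" for th t using B(2)[of "(th, t)"] that by simp
  show "norm (D i j th t - D i j th' t') <= B * (\<bar>th - th'\<bar> + \<bar>t - t'\<bar>)" if "t \<in> {0..T}" "t' \<in> {0..T}" for th th' t t'
  proof -
   have "norm (D i j th t - D i j th' t') <= B * dist (th, t) (th', t')" using B(3)[of "(th, t)" "(th', t')"] that by simp
   also have "... <= B * (\<bar>th - th'\<bar> + \<bar>t - t'\<bar>)"
    using B(1) dist_prod_le[of th t th' t'] by (intro mult_left_mono) (auto simp: dist_real_def)
   finally show ?thesis .
  qed
 qed
qed

text \<open>Near the curve the tangential component of \<open>p - crv r t\<close> is strictly
  decreasing in \<open>r\<close>: in its derivative the negative squared speed outweighs the product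
  of the short vector \<open>p - crv r t\<close> with \<open>D 2 0\<close>. A strictly monotone
  function has at most one zero.\<close>

lemma foot_unique:
 obtains \<rho> where "0 < \<rho>"
  "!!th ps1 ps2 t p. t \<in> {0..T} ==> norm (p - crv th t) <= \<rho> ==> \<bar>ps1 - th\<bar> <= \<rho> ==> \<bar>ps2 - th\<bar> <= \<rho> ==>
   (p - crv ps1 t) \<bullet> D 1 0 ps1 t = 0 ==> (p - crv ps2 t) \<bullet> D 1 0 ps2 t = 0 ==> ps1 = ps2"
proof -
 obtain c where c: "0 < c" "!!th t. t \<in> {0..T} ==> c <= norm (D 1 0 th t)" using speed_lower by blast
 obtain B where B: "1 <= B" "!!th t. t \<in> {0..T} ==> norm (D 2 0 th t) <= B"
  by (rule D_bound_ge1[of 2 0]) (rule that, assumption+)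
 obtain L where L: "1 <= L" "!!th th' t t'. t \<in> {0..T} ==> t' \<in> {0..T} ==> norm (crv th t - crv th' t') <= L * (\<bar>th - th'\<bar> + \<bar>t - t'\<bar>)"
  by (rule D_bound_ge1[of 0 0]) (rule that, assumption+)
 \<comment> \<open>Chosen such that \<open>(2 * L * \<rho>) * B\<close>, which bounds the product
   with \<open>D 2 0\<close>, equals half of \<open>c^2\<close>, the lower bound for the squared
   speed.\<close>
 define \<rho> where "\<rho> = c^2 / (4 * B * L)"
 have \<rho>: "0 < \<rho>" unfolding \<rho>_def using c(1) B(1) L(1) by simp
 have neg: "(p - crv r t) \<bullet> D 2 0 r t - D 1 0 r t \<bullet> D 1 0 r t < 0"
  if t: "t \<in> {0..T}" and p: "norm (p - crv th t) <= \<rho>" and r: "\<bar>r - th\<bar> <= \<rho>" for p th r t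
 proof -
  have "norm (crv th t - crv r t) <= L * \<rho>"
  proof -
   have "L * \<bar>th - r\<bar> <= L * \<rho>" using r L(1) by (intro mult_left_mono) auto
   then show ?thesis using L(2)[OF t t, of th r] by simp
  qed
  then have "norm (p - crv r t) <= \<rho> + L * \<rho>"
   using norm_triangle_ineq[of "p - crv th t" "crv th t - crv r t"] p by simp
  also have "... <= 2 * L * \<rho>" using \<rho> L(1) by (simp add: mult_right_mono algebra_simps)
  finally have n: "norm (p - crv r t) <= 2 * L * \<rho>" .
  have "(p - crv r t) \<bullet> D 2 0 r t <= norm (p - crv r t) * norm (D 2 0 r t)" by (rule norm_cauchy_schwarz)
  also have "... <= (2 * L * \<rho>) * B" using n B(2)[OF t] \<rho> L by (intro mult_mono) auto
  also have "... = c^2 / 2" unfolding \<rho>_def using B L by (simp add: field_simps)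
  also have "... < c^2" using c by simp
  also have "... <= (norm (D 1 0 r t))^2" using c(1) c(2)[OF t, of r] by (intro power_mono) auto
  finally show ?thesis by (simp add: power2_norm_eq_inner)
 qed
 have lt: False if t: "t \<in> {0..T}" and p: "norm (p - crv th t) <= \<rho>" and v: "\<bar>ps1 - th\<bar> <= \<rho>" "\<bar>ps2 - th\<bar> <= \<rho>"
  and z: "(p - crv ps1 t) \<bullet> D 1 0 ps1 t = 0" "(p - crv ps2 t) \<bullet> D 1 0 ps2 t = 0" and l: "ps1 < ps2" for th ps1 ps2 t p
 proof -
  have "(p - crv ps2 t) \<bullet> D 1 0 ps2 t < (p - crv ps1 t) \<bullet> D 1 0 ps1 t"
  proof (rule DERIV_neg_imp_decreasing[OF l])
   fix r assume "ps1 <= r" "r <= ps2"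
   then have "\<bar>r - th\<bar> <= \<rho>" using v by linarith
   then show "\<exists>y. DERIV (%r. (p - crv r t) \<bullet> D 1 0 r t) r :> y \<and> y < 0"
    using orth_deriv[OF t] neg[OF t p] by blast
  qed
  then show False using z by simp
 qed
 show ?thesis
 proof (rule that[OF \<rho>])
  fix th ps1 ps2 t p assume "t \<in> {0..T}" "norm (p - crv th t) <= \<rho>" "\<bar>ps1 - th\<bar> <= \<rho>" "\<bar>ps2 - th\<bar> <= \<rho>"
   "(p - crv ps1 t) \<bullet> D 1 0 ps1 t = 0" "(p - crv ps2 t) \<bullet> D 1 0 ps2 t = 0"
  then show "ps1 = ps2" using lt[of t p th ps1 ps2] lt[of t p th ps2 ps1] by (cases ps1 ps2 rule: linorder_cases) auto
 qed
qed

text \<open>Collects what substitution on one edge requires: \<open>chord_coord\<close> is an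
  increasing C^1 change of variables of the unit interval, and in this variable the closest-point
  map moves along the curve parameter linearly.\<close>

definition chord_ok :: "real => real => real => bool" where
 "chord_ok th d t \<longleftrightarrow> chord_coord th d t 0 = 0 \<and> chord_coord th d t 1 = 1
  \<and> strict_mono_on {0..1} (chord_coord th d t)
  \<and> (\<exists>S'. continuous_on {0..1} S' \<and> (\<forall>y\<in>{0..1}. (chord_coord th d t has_field_derivative S' y) (at y)))
  \<and> (\<forall>y\<in>{0..1}. closest_point (\<Gamma> t) (crv th t + chord_coord th d t y *\<^sub>R (crv (th + d) t - crv th t)) = crv (th + d * y) t)"

lemma chord_ok_small:
 obtains d1 where "0 < d1" "d1 <= 1" "!!th d t. t \<in> {0..T} ==> 0 < d ==> d <= d1 ==> chord_ok th d t"
proof -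
 obtain R d0 c g where "strip3 1 T R" and d0: "0 < d0" "d0 <= 1" and c: "0 < c"
  and g: "BL (par_box d0 T \<times> {0..1}) g"
  and Rexp: "!!th z t. t \<in> {0..T} ==> \<bar>z\<bar> <= 1 ==> D 0 0 (th + z) t = D 0 0 th t + z *\<^sub>R D 1 0 th t + z^2 *\<^sub>R R th z t"
  and den0: "!!th d t y. t \<in> {0..T} ==> \<bar>d\<bar> <= d0 ==> y \<in> {0..1} ==> c <= (D 1 0 th t + d *\<^sub>R R th d t) \<bullet> D 1 0 (th + d * y) t"
  and S: "!!th d t y. t \<in> {0..T} ==> 0 < d ==> d <= d0 ==> y \<in> {0..1} ==> chord_coord th d t y = y + d * g ((th, d, t), y)"
  apply (rule chord_expansion)
  subgoal for R d0 c g by (rule that[of R d0 c g])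
  done
 obtain C where C: "C \<ge> 1" "!!p q. p \<in> par_box d0 T \<times> {0..1} ==> q \<in> par_box d0 T \<times> {0..1} ==> norm (g p - g q) <= C * dist p q"
  by (rule BLE[OF g]) (rule that, assumption+)
 obtain cn where cn: "0 < cn"
  "!!th t p. t \<in> {0..T} ==> \<exists>ps. closest_point (\<Gamma> t) p = crv ps t \<and> cn * \<bar>ps - th\<bar> <= norm (p - crv th t)
   \<and> (p - crv ps t) \<bullet> D 1 0 ps t = 0 \<and> norm (p - crv ps t) <= norm (p - crv th t)"
  by (rule closest_near) (rule that, assumption+)
 obtain \<rho> where \<rho>: "0 < \<rho>"
  "!!th ps1 ps2 t p. t \<in> {0..T} ==> norm (p - crv th t) <= \<rho> ==> \<bar>ps1 - th\<bar> <= \<rho> ==> \<bar>ps2 - th\<bar> <= \<rho> ==>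
   (p - crv ps1 t) \<bullet> D 1 0 ps1 t = 0 ==> (p - crv ps2 t) \<bullet> D 1 0 ps2 t = 0 ==> ps1 = ps2"
  by (rule foot_unique) (rule that, assumption+)
 obtain L where L: "1 <= L" "!!th th' t t'. t \<in> {0..T} ==> t' \<in> {0..T} ==> norm (crv th t - crv th' t') <= L * (\<bar>th - th'\<bar> + \<bar>t - t'\<bar>)"
  by (rule D_bound_ge1[of 0 0]) (rule that, assumption+)
 \<comment> \<open>The first two entries secure the expansion and monotonicity. The entries with
   \<open>\<rho>\<close> make the edge so short that its points, the arc parameters and the feet all
   stay where feet are unique.\<close>
 define d1 where "d1 = min d0 (min (1 / (2 * C)) (min \<rho> (min (\<rho> / L) (\<rho> * cn / L))))"
 have d1: "0 < d1" "d1 <= d0" "d1 <= 1 / (2 * C)" "d1 <= \<rho>" "d1 <= \<rho> / L" "d1 <= \<rho> * cn / L"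
  unfolding d1_def using d0(1) C(1) \<rho>(1) L(1) cn(1) by auto
 show ?thesis
 proof (rule that)
  show "0 < d1" "d1 <= 1" using d1 d0 by auto
  fix th d t assume t: "t \<in> {0..T}" and d: "0 < d" "d <= d1"
  have dd: "d <= d0" "\<bar>d\<bar> <= d0" "\<bar>d\<bar> <= 1" using d d1 d0 by auto
  let ?S = "chord_coord th d t"
  let ?num = "%y. (crv (th + d * y) t - crv th t) \<bullet> D 1 0 (th + d * y) t"
  let ?den = "%y. (crv (th + d) t - crv th t) \<bullet> D 1 0 (th + d * y) t"
  have den: "0 < ?den y" if "y \<in> {0..1}" for y
  proof -
   have "crv (th + d) t - crv th t = d *\<^sub>R (D 1 0 th t + d *\<^sub>R R th d t)"
    using Rexp[OF t dd(3), of th] by (simp add: algebra_simps power2_eq_square)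
   then show ?thesis using den0[OF t dd(2) that, of th] c d by simp
  qed
  have S0: "?S 0 = 0" unfolding chord_coord_def by simp
  have S1: "?S 1 = 1" unfolding chord_coord_def using den[of 1] by simp
  have mono: "strict_mono_on {0..1} ?S"
  proof (rule strict_mono_onI)
   fix y z :: real assume y: "y \<in> {0..1}" and z: "z \<in> {0..1}" and l: "y < z"
   \<comment> \<open>\<open>chord_coord\<close> is \<open>y\<close> plus \<open>d * g\<close>, and
     \<open>d\<close> times the Lipschitz constant of \<open>g\<close> is at most 1/2, so the
     increment of \<open>y\<close> prevails.\<close>
   have "norm (g ((th, d, t), z) - g ((th, d, t), y)) <= C * dist ((th, d, t), z) ((th, d, t), y)"
    using t d dd y z by (intro C) auto
   also have "dist ((th, d, t), z) ((th, d, t), y) = z - y" using l by (simp add: dist_Pair_Pair dist_real_def)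
   finally have "d * \<bar>g ((th, d, t), z) - g ((th, d, t), y)\<bar> <= (1 / (2 * C)) * (C * (z - y))"
    using d d1 C by (intro mult_mono) auto
   also have "... = (z - y) / 2" using C by simp
   finally have "\<bar>d * g ((th, d, t), z) - d * g ((th, d, t), y)\<bar> <= (z - y) / 2"
    using d by (simp add: right_diff_distrib[symmetric] abs_mult)
   then have "d * g ((th, d, t), y) - d * g ((th, d, t), z) <= (z - y) / 2" by (rule order_trans[OF abs_ge_minus_self, rotated, of "d * g ((th, d, t), z) - d * g ((th, d, t), y)", simplified])
   moreover have "u < v" if "a - b <= (z - y) / 2" "u = y + a" "v = z + b" for u v a b :: real
    using that l by (simp add: field_simps)
   ultimately show "?S y < ?S z" using S[OF t d(1) dd(1) y, of th] S[OF t d(1) dd(1) z, of th] by blast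
  qed
  have der: "\<exists>S'. continuous_on {0..1} S' \<and> (\<forall>y\<in>{0..1}. (?S has_field_derivative S' y) (at y))"
  proof -
   let ?num' = "%y. d * (D 1 0 (th + d * y) t \<bullet> D 1 0 (th + d * y) t + (crv (th + d * y) t - crv th t) \<bullet> D 2 0 (th + d * y) t)"
   let ?den' = "%y. d * ((crv (th + d) t - crv th t) \<bullet> D 2 0 (th + d * y) t)"
   have cD: "continuous_on {0..1} (%y. D i j (th + d * y) t)" for i j
    by (rule continuous_on_compose2[OF strip2_cont[OF D_strip2 t, of UNIV]]) (auto intro!: continuous_intros)
   have sh: "((%y. D i 0 (th + d * y) t) has_derivative (%h. h *\<^sub>R (d *\<^sub>R D (Suc i) 0 (th + d * y) t))) (at y)" for i y
   proof -
    have "((%r. D i 0 r t) \<circ> (%y. th + d * y) has_vector_derivative d *\<^sub>R D (Suc i) 0 (th + d * y) t) (at y)"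
     by (rule vector_diff_chain_at[OF _ D_space[OF t]]) (auto intro!: derivative_eq_intros)
    then show ?thesis by (simp add: o_def has_vector_derivative_def)
   qed
   have sh0: "((%y. crv (th + d * y) t) has_derivative (%h. h *\<^sub>R (d *\<^sub>R D 1 0 (th + d * y) t))) (at y)"
    and sh1: "((%y. D 1 0 (th + d * y) t) has_derivative (%h. h *\<^sub>R (d *\<^sub>R D 2 0 (th + d * y) t))) (at y)" for y
    using sh[of 0 y] sh[of 1 y] by (simp_all add: numeral_2_eq_2)
   have n: "(?num has_field_derivative ?num' y) (at y)" for y
   proof -
    have "(?num has_derivative (%h. (crv (th + d * y) t - crv th t) \<bullet> (h *\<^sub>R (d *\<^sub>R D 2 0 (th + d * y) t))
      + (h *\<^sub>R (d *\<^sub>R D 1 0 (th + d * y) t) - 0) \<bullet> D 1 0 (th + d * y) t)) (at y)"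
     by (intro has_derivative_inner has_derivative_diff has_derivative_const sh0 sh1)
    then show ?thesis unfolding has_field_derivative_def
     by (rule has_derivative_eq_rhs) (auto simp: algebra_simps)
   qed
   have m: "(?den has_field_derivative ?den' y) (at y)" for y
   proof -
    have "(?den has_derivative (%h. (crv (th + d) t - crv th t) \<bullet> (h *\<^sub>R (d *\<^sub>R D 2 0 (th + d * y) t))
      + 0 \<bullet> D 1 0 (th + d * y) t)) (at y)"
     by (intro has_derivative_inner has_derivative_const sh1)
    then show ?thesis unfolding has_field_derivative_def
     by (rule has_derivative_eq_rhs) (auto simp: algebra_simps)
   qed
   show ?thesis
   proof (intro exI conjI ballI)
    have "?den y * ?den y ~= 0" if "y \<in> {0..1}" for y using den[OF that] by simp
    then show "continuous_on {0..1} (%y. (?num' y * ?den y - ?num y * ?den' y) / (?den y * ?den y))"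
     by (intro continuous_on_divide continuous_intros cD ballI)
    show "(?S has_field_derivative (?num' y * ?den y - ?num y * ?den' y) / (?den y * ?den y)) (at y)" if "y \<in> {0..1}" for y
     unfolding chord_coord_def[abs_def] using den[OF that] by (intro DERIV_divide n m) simp
   qed
  qed
  have cp: "closest_point (\<Gamma> t) (crv th t + ?S y *\<^sub>R (crv (th + d) t - crv th t)) = crv (th + d * y) t" if y: "y \<in> {0..1}" for y
  proof -
   have "0 <= ?S y" using strict_mono_onD[OF mono, of 0 y] S0 y by (cases "y = 0") auto
   moreover have "?S y <= 1" using strict_mono_onD[OF mono, of y 1] S1 y by (cases "y = 1") auto
   ultimately have Sb: "\<bar>?S y\<bar> <= 1" by simp
   let ?p = "crv th t + ?S y *\<^sub>R (crv (th + d) t - crv th t)"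
   have "norm (?p - crv th t) = \<bar>?S y\<bar> * norm (crv (th + d) t - crv th t)" by simp
   also have "... <= 1 * (L * d)" using Sb L(2)[OF t t, of "th + d" th] d by (intro mult_mono) auto
   finally have p: "norm (?p - crv th t) <= L * d" by simp
   have "d <= \<rho> / L" "d <= \<rho> * cn / L" using d d1 by linarith+
   then have Ld: "L * d <= \<rho>" "L * d <= \<rho> * cn"
    using L(1) by (simp_all add: field_simps)
   \<comment> \<open>The closest point and \<open>crv (th + d * y) t\<close> are both feet of
     \<open>?p\<close> with parameters near \<open>th\<close>; \<open>foot_unique\<close> identifies
     them.\<close>
   obtain ps where v: "closest_point (\<Gamma> t) ?p = crv ps t" "cn * \<bar>ps - th\<bar> <= norm (?p - crv th t)"
    "(?p - crv ps t) \<bullet> D 1 0 ps t = 0" using cn(2)[OF t, of ?p th] by blast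
   have "cn * \<bar>ps - th\<bar> <= cn * \<rho>" using v(2) p Ld by (simp add: mult.commute)
   then have v': "\<bar>ps - th\<bar> <= \<rho>" using cn(1) by simp
   have dy: "\<bar>(th + d * y) - th\<bar> <= \<rho>" using y d d1 mult_mono[of d d1 y 1] by auto
   have "(?p - crv (th + d * y) t) \<bullet> D 1 0 (th + d * y) t = ?S y * ?den y - ?num y"
    by (simp add: inner_diff_left inner_add_left algebra_simps)
   also have "... = 0" unfolding chord_coord_def using den[OF y] by simp
   finally have z2: "(?p - crv (th + d * y) t) \<bullet> D 1 0 (th + d * y) t = 0" .
   have "ps = th + d * y" by (rule \<rho>(2)[OF t _ v' dy v(3) z2]) (use p Ld in linarith)
   then show ?thesis using v(1) by simp
  qed
  show "chord_ok th d t" unfolding chord_ok_def by (intro conjI ballI S0 S1 mono der cp)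
 qed
qed

end

section \<open>Arcs cut out by the projected polygon\<close>

lemma has_integral_translate:
 fixes F :: "real => real"
 assumes "(F has_integral I) {a..b}"
 shows "((%x. F (x + c)) has_integral I) {a - c..b - c}"
 using has_integral_affinity'[of F I a b 1 c] assms by simp

lemma has_integral_periodic:
 fixes F :: "real => real"
 assumes per: "!!r. F (r + 1) = F r" and F: "(F has_integral I) {a..a + 1}"
 shows "(F has_integral I) {b..b + 1}"
proof -
 have per': "F (r + of_int k) = F r" for r k by (rule periodic_int[of F, OF per])
 define k where "k = \<lfloor>b - a\<rfloor>"
 define b' where "b' = b - of_int k"
 have b': "a <= b'" "b' <= a + 1" unfolding b'_def k_def by linarith+
 have int: "F integrable_on {a..a+1}" using F by blast
 obtain I1 where I1: "(F has_integral I1) {a..b'}"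
  using integrable_subinterval_real[OF int, of a b'] b' by auto
 obtain I2 where I2: "(F has_integral I2) {b'..a+1}"
  using integrable_subinterval_real[OF int, of b' "a+1"] b' by auto
 have s: "I = I1 + I2" using has_integral_combine[OF b' I1 I2] F has_integral_unique by blast
 have "((%x. F (x + (-1))) has_integral I1) {a - (-1)..b' - (-1)}" by (rule has_integral_translate[OF I1])
 then have I1': "(F has_integral I1) {a + 1..b' + 1}" using per'[of _ "-1"] by simp
 have "(F has_integral (I2 + I1)) {b'..b' + 1}" by (rule has_integral_combine[OF _ _ I2 I1']) (use b' in auto)
 then have "((%x. F (x + (- of_int k))) has_integral (I2 + I1)) {b' - (- of_int k)..b' + 1 - (- of_int k)}" by (rule has_integral_translate)
 then show ?thesis using per'[of _ "- k"] s unfolding b'_def by (simp add: algebra_simps)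
qed

lemma has_vd_translate:
 fixes f :: "real => 'a::real_normed_vector"
 assumes "(f has_vector_derivative v) (at (r + c))"
 shows "((%x. f (x + c)) has_vector_derivative v) (at r)"
proof -
 have "(f \<circ> (%x. x + c) has_vector_derivative 1 *\<^sub>R v) (at r)"
  by (rule vector_diff_chain_at[of "%x. x + c" 1 r f v, OF _ assms]) (auto intro!: derivative_eq_intros)
 then show ?thesis by (simp add: o_def)
qed

text \<open>Holds without any differentiability: \<open>vector_derivative\<close> chooses from the
  set of candidate derivatives, and this set is the same at both points.\<close>

lemma vector_derivative_periodic:
 fixes f :: "real => 'a::real_normed_vector"
 assumes "!!r. f (r + 1) = f r"
 shows "vector_derivative f (at (r + 1)) = vector_derivative f (at r)"
proof -
 have "(f has_vector_derivative v) (at (r + 1)) \<longleftrightarrow> (f has_vector_derivative v) (at r)" for v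
 proof
  assume "(f has_vector_derivative v) (at (r + 1))"
  from has_vd_translate[OF this] show "(f has_vector_derivative v) (at r)" using assms by simp
 next
  have m: "f (x + (-1)) = f x" for x using assms[of "x - 1"] by simp
  assume "(f has_vector_derivative v) (at r)"
  then have "(f has_vector_derivative v) (at ((r + 1) + (-1)))" by simp
  from has_vd_translate[OF this] show "(f has_vector_derivative v) (at (r + 1))" unfolding m .
 qed
 then show ?thesis unfolding vector_derivative_def by presburger
qed

section \<open>Signs of the parameter increments\<close>

context curve_flow
begin

text \<open>For negative \<open>d\<close> the chord is a positively oriented chord of the reversed
  flow.\<close>

lemma arc_hits:
 obtains d1 where "0 < d1" "!!th d t y. t \<in> {0..T} ==> d ~= 0 ==> \<bar>d\<bar> <= d1 ==> y \<in> {0<..<1} ==>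
  \<exists>s\<in>{0<..<1}. closest_point (\<Gamma> t) (crv th t + s *\<^sub>R (crv (th + d) t - crv th t)) = crv (th + d * y) t"
proof -
 interpret R: curve_flow T "%i j th t. (-1)^i *\<^sub>R D i j (- th) t"
  by (rule curve_flow_reverse) unfold_locales
 obtain d1 where d1: "0 < d1" "d1 <= 1" "!!th d t. t \<in> {0..T} ==> 0 < d ==> d <= d1 ==> chord_ok th d t"
  by (rule chord_ok_small) (rule that, assumption+)
 obtain d2 where d2: "0 < d2" "d2 <= 1" "!!th d t. t \<in> {0..T} ==> 0 < d ==> d <= d2 ==> R.chord_ok th d t"
  by (rule R.chord_ok_small) (rule that, assumption+)
 have R\<Gamma>: "R.\<Gamma> t = \<Gamma> t" for t
 proof -
  have "range (%th. crv (- th) t) = range (%th. crv th t)" proof (intro equalityI subsetI)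
   fix p assume "p \<in> range (%th. crv th t)"
   then obtain r where "p = crv (- (- r)) t" by auto
   then show "p \<in> range (%th. crv (- th) t)" by blast
  qed auto
  then show ?thesis unfolding R.\<Gamma>_def \<Gamma>_def by simp
 qed
 show ?thesis
 proof (rule that[of "min d1 d2"])
  show "0 < min d1 d2" using d1(1) d2(1) by simp
  fix th d t y :: real assume t: "t \<in> {0..T}" and d: "d ~= 0" "\<bar>d\<bar> <= min d1 d2" and y: "y \<in> {0<..<1}"
  have y3: "y \<in> {0..1}" "0 \<in> {0..1::real}" "1 \<in> {0..1::real}" "0 < y" "y < 1" using y by auto
  show "\<exists>s\<in>{0<..<1}. closest_point (\<Gamma> t) (crv th t + s *\<^sub>R (crv (th + d) t - crv th t)) = crv (th + d * y) t"
  proof (cases "0 < d")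
   case True
   then have "chord_ok th d t" using d by (intro d1(3)[OF t]) auto
   then have c: "chord_coord th d t 0 = 0" "chord_coord th d t 1 = 1" "strict_mono_on {0..1} (chord_coord th d t)"
    "\<forall>y\<in>{0..1}. closest_point (\<Gamma> t) (crv th t + chord_coord th d t y *\<^sub>R (crv (th + d) t - crv th t)) = crv (th + d * y) t"
    unfolding chord_ok_def by blast+
   have "chord_coord th d t y \<in> {0<..<1}"
    using strict_mono_onD[OF c(3) y3(2,1,4)] strict_mono_onD[OF c(3) y3(1,3,5)] c(1,2) by simp
   then show ?thesis using c(4) y3(1) by blast
  next
   case False
   then have "R.chord_ok (- th) (- d) t" using d by (intro d2(3)[OF t]) auto
   then have c: "R.chord_coord (- th) (- d) t 0 = 0" "R.chord_coord (- th) (- d) t 1 = 1" "strict_mono_on {0..1} (R.chord_coord (- th) (- d) t)"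
    "\<forall>y\<in>{0..1}. closest_point (R.\<Gamma> t) ((- 1)^0 *\<^sub>R crv (- (- th)) t + R.chord_coord (- th) (- d) t y *\<^sub>R ((- 1)^0 *\<^sub>R crv (- (- th + - d)) t - (- 1)^0 *\<^sub>R crv (- (- th)) t))
     = (- 1)^0 *\<^sub>R crv (- (- th + (- d) * y)) t"
    unfolding R.chord_ok_def by blast+
   have "R.chord_coord (- th) (- d) t y \<in> {0<..<1}"
    using strict_mono_onD[OF c(3) y3(2,1,4)] strict_mono_onD[OF c(3) y3(1,3,5)] c(1,2) by simp
   moreover have "closest_point (\<Gamma> t) (crv th t + R.chord_coord (- th) (- d) t y *\<^sub>R (crv (th + d) t - crv th t)) = crv (th + d * y) t"
    using c(4)[rule_format, OF y3(1)] unfolding R\<Gamma> by (simp add: add.commute)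
   ultimately show ?thesis by blast
  qed
 qed
qed

text \<open>\<open>d j\<close> leads from \<open>th j\<close> to some parameter of the next node,
  which may differ from \<open>th (nxt J j)\<close> by a whole number of periods. The sign of
  \<open>d j\<close> is left open.\<close>

definition arcs :: "real => nat => (nat => real^2) => (nat => real) => (nat => real) => bool" where
 "arcs t J q th d \<longleftrightarrow> t \<in> {0..T} \<and> simple_closed_polygon J q
   \<and> bij_betw (closest_point (\<Gamma> t)) (polygon_set J q) (\<Gamma> t)
   \<and> (\<forall>j<J. q j = crv (th j) t \<and> q (nxt J j) = crv (th j + d j) t)"

lemma closest_edge_eqD:
 assumes "arcs t J q th d" "j < J" "i < J" "s \<in> {0..<1}" "r \<in> {0..<1}"
  "closest_point (\<Gamma> t) (edge J q j s) = closest_point (\<Gamma> t) (edge J q i r)"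
 shows "j = i" "s = r"
proof -
 have inj: "inj_on (closest_point (\<Gamma> t)) (polygon_set J q)" and q: "simple_closed_polygon J q"
  using assms(1) unfolding arcs_def by (auto simp: bij_betw_def)
 have "edge J q j s \<in> polygon_set J q" "edge J q i r \<in> polygon_set J q"
  using assms(2-5) unfolding polygon_set_def by (auto intro!: bexI image_eqI[OF refl])
 then have e: "edge J q j s = edge J q i r" using inj_onD[OF inj assms(6)] by blast
 show "j = i" "s = r" using edge_eqD[OF q assms(2-5) e] by blast+
qed

lemma arcs_edge:
 assumes "arcs t J q th d" "j < J"
 shows "edge J q j s = crv (th j) t + s *\<^sub>R (crv (th j + d j) t - crv (th j) t)"
proof -
 have "q j = crv (th j) t" "q (nxt J j) = crv (th j + d j) t" using assms unfolding arcs_def by blast+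
 then show ?thesis by (simp only: edge_alt)
qed

lemma crv_shift_eq:
 assumes "t \<in> {0..T}" "crv a t = crv b t"
 shows "D i j (a + z) t = D i j (b + z) t"
proof -
 obtain k :: int where "b = a + of_int k" using D_inj[OF assms] by blast
 then show ?thesis using D_periodic[OF assms(1), of i j "a + z" k] by (simp add: algebra_simps)
qed

text \<open>If two consecutive increments had opposite signs, both edges would project onto the same
  piece of the curve beside their common node, against injectivity of the closest-point map on the
  polygon.\<close>

lemma arcs_same_sign:
 obtains d1 where "0 < d1" "!!t J q th d. arcs t J q th d ==> (!!j. j < J ==> d j ~= 0 \<and> \<bar>d j\<bar> <= d1)
   ==> (\<forall>j<J. 0 < d j) \<or> (\<forall>j<J. d j < 0)"
proof -
 obtain d1 where d1: "0 < d1" "!!th d t y. t \<in> {0..T} ==> d ~= 0 ==> \<bar>d\<bar> <= d1 ==> y \<in> {0<..<1} ==>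
  \<exists>s\<in>{0<..<1}. closest_point (\<Gamma> t) (crv th t + s *\<^sub>R (crv (th + d) t - crv th t)) = crv (th + d * y) t"
  by (rule arc_hits) (rule that, assumption+)
 show ?thesis
 proof (rule that[OF d1(1)])
  fix t J q th d assume a: "arcs t J q th d" and d: "!!j. j < J ==> d j ~= 0 \<and> \<bar>d j\<bar> <= d1"
  have t: "t \<in> {0..T}" and J: "3 <= J" using a unfolding arcs_def simple_closed_polygon_def by auto
  have step: "0 < d j \<longleftrightarrow> 0 < d (nxt J j)" if j: "j < J" for j
  proof (rule ccontr)
   assume opp: "\<not> (0 < d j \<longleftrightarrow> 0 < d (nxt J j))"
   let ?n = "nxt J j"
   have n: "?n < J" using J by simp
   \<comment> \<open>Half the shorter increment: the parameter at this distance from the common node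
     lies strictly inside both arcs.\<close>
   define m where "m = min \<bar>d j\<bar> \<bar>d ?n\<bar> / 2"
   have m: "0 < m" "m < \<bar>d j\<bar>" "m < \<bar>d ?n\<bar>" unfolding m_def using d[OF j] d[OF n] by auto
   define y where "y = 1 - m / \<bar>d j\<bar>"
   define y' where "y' = m / \<bar>d ?n\<bar>"
   have y: "y \<in> {0<..<1}" "y' \<in> {0<..<1}" unfolding y_def y'_def using m by auto
   have e: "d j * y = d j + d ?n * y'"
    unfolding y_def y'_def using opp d[OF j] d[OF n] by (cases "0 < d j") (auto simp: field_simps)
   obtain s where s: "s \<in> {0<..<1}" "closest_point (\<Gamma> t) (edge J q j s) = crv (th j + d j * y) t"
    using d1(2)[OF t _ _ y(1), of "d j" "th j"] d[OF j] arcs_edge[OF a j] by auto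
   obtain s' where s': "s' \<in> {0<..<1}" "closest_point (\<Gamma> t) (edge J q ?n s') = crv (th ?n + d ?n * y') t"
    using d1(2)[OF t _ _ y(2), of "d ?n" "th ?n"] d[OF n] arcs_edge[OF a n] by auto
   have "crv (th ?n) t = crv (th j + d j) t" using a j n unfolding arcs_def by metis
   from crv_shift_eq[OF t this, of 0 0 "d ?n * y'"]
   have "crv (th ?n + d ?n * y') t = crv (th j + d j * y) t" unfolding e by (simp add: algebra_simps)
   then have "closest_point (\<Gamma> t) (edge J q ?n s') = closest_point (\<Gamma> t) (edge J q j s)" using s s' by simp
   then have "?n = j" using s(1) s'(1) by (intro closest_edge_eqD(1)[OF a n j, of s' s]) auto
   then show False using nxt_neq[OF j] J by simp
  qed
  have "0 < d j \<longleftrightarrow> 0 < d 0" if "j < J" for j using that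
  proof (induction j)
   case (Suc j)
   then have "nxt J j = Suc j" by (simp add: nxt_def)
   then show ?case using step[of j] Suc by simp
  qed simp
  then show "(\<forall>j<J. 0 < d j) \<or> (\<forall>j<J. d j < 0)" using d by (cases "0 < d 0") (force, metis linorder_neqE_linordered_idom)
 qed
qed

section \<open>Positively oriented arcs cover one period exactly once\<close>

definition good_arcs :: "real => nat => (nat => real^2) => (nat => real) => (nat => real) => bool" where
 "good_arcs t J q th d \<longleftrightarrow> arcs t J q th d \<and> (\<forall>j<J. 0 < d j \<and> d j < 1 \<and> chord_ok (th j) (d j) t)"

lemma good_arcsD:
 assumes "good_arcs t J q th d"
 shows "arcs t J q th d" "t \<in> {0..T}" "simple_closed_polygon J q" "3 <= J" "0 < J"
  "bij_betw (closest_point (\<Gamma> t)) (polygon_set J q) (\<Gamma> t)"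
  "!!j. j < J ==> q j = crv (th j) t" "!!j. j < J ==> q (nxt J j) = crv (th j + d j) t"
  "!!j. j < J ==> 0 < d j" "!!j. j < J ==> d j < 1" "!!j. j < J ==> chord_ok (th j) (d j) t"
proof -
 have a: "arcs t J q th d" using assms unfolding good_arcs_def by blast
 then show "arcs t J q th d" .
 show "t \<in> {0..T}" and s: "simple_closed_polygon J q" and
  "bij_betw (closest_point (\<Gamma> t)) (polygon_set J q) (\<Gamma> t)"
  "!!j. j < J ==> q j = crv (th j) t" "!!j. j < J ==> q (nxt J j) = crv (th j + d j) t"
  using a unfolding arcs_def by blast+
 show "3 <= J" "0 < J" using s unfolding simple_closed_polygon_def by linarith+
 show "!!j. j < J ==> 0 < d j" "!!j. j < J ==> d j < 1" "!!j. j < J ==> chord_ok (th j) (d j) t"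
  using assms unfolding good_arcs_def by blast+
qed

lemma good_arcs_closest:
 assumes g: "good_arcs t J q th d" and j: "j < J" and y: "y \<in> {0..1}"
 shows "closest_point (\<Gamma> t) (edge J q j (chord_coord (th j) (d j) t y)) = crv (th j + d j * y) t"
  "chord_coord (th j) (d j) t y \<in> {0..1}" "y < 1 ==> chord_coord (th j) (d j) t y < 1" "0 < y ==> 0 < chord_coord (th j) (d j) t y"
proof -
 have c: "chord_coord (th j) (d j) t 0 = 0" "chord_coord (th j) (d j) t 1 = 1" "strict_mono_on {0..1} (chord_coord (th j) (d j) t)"
  "\<forall>y\<in>{0..1}. closest_point (\<Gamma> t) (crv (th j) t + chord_coord (th j) (d j) t y *\<^sub>R (crv (th j + d j) t - crv (th j) t)) = crv (th j + d j * y) t"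
  using good_arcsD(11)[OF g j] unfolding chord_ok_def by blast+
 show "closest_point (\<Gamma> t) (edge J q j (chord_coord (th j) (d j) t y)) = crv (th j + d j * y) t"
  unfolding arcs_edge[OF good_arcsD(1)[OF g] j] using c(4) y by blast
 show 1: "y < 1 ==> chord_coord (th j) (d j) t y < 1" using strict_mono_onD[OF c(3), of y 1] c(2) y by simp
 show 0: "0 < y ==> 0 < chord_coord (th j) (d j) t y" using strict_mono_onD[OF c(3), of 0 y] c(1) y by simp
 show "chord_coord (th j) (d j) t y \<in> {0..1}" using 0 1 c(1,2) y by (cases "y = 0"; cases "y = 1") auto
qed

text \<open>A lift of the node parameters to the real line, increasing for good arcs;
  \<open>th k\<close> itself agrees with it only modulo integers.\<close>

definition breaks :: "(nat => real) => (nat => real) => nat => real" where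
 "breaks th d k = th 0 + (\<Sum>i<k. d i)"

lemma breaks_Suc: "breaks th d (Suc k) = breaks th d k + d k"
 by (simp add: breaks_def)

lemma breaks_node:
 assumes g: "good_arcs t J q th d"
 shows "k < J ==> crv (breaks th d k) t = q k"
proof (induction k)
 case 0
 then show ?case using good_arcsD(7)[OF g, of 0] by (simp add: breaks_def)
next
 case (Suc k)
 then have e: "crv (breaks th d k) t = crv (th k) t" using good_arcsD(7)[OF g, of k] by simp
 have "nxt J k = Suc k" using Suc by (simp add: nxt_def)
 then show ?case
  using crv_shift_eq[OF good_arcsD(2)[OF g] e, of 0 0 "d k"] good_arcsD(8)[OF g, of k] Suc by (simp add: breaks_Suc)
qed

lemma breaks_shift:
 assumes g: "good_arcs t J q th d" and k: "k < J"
 shows "\<exists>i::int. breaks th d k = th k + of_int i" "D a b (breaks th d k + z) t = D a b (th k + z) t"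
proof -
 have e: "crv (th k) t = crv (breaks th d k) t" using breaks_node[OF g k] good_arcsD(7)[OF g k] by simp
 show "\<exists>i::int. breaks th d k = th k + of_int i" by (rule D_inj[OF good_arcsD(2)[OF g] e])
 show "D a b (breaks th d k + z) t = D a b (th k + z) t" by (rule crv_shift_eq[OF good_arcsD(2)[OF g] e[symmetric]])
qed

text \<open>The polygon closes, so the increments add up to an integer, which is positive. If it
  exceeded 1, some edge would pass the first node once more, and two points of the polygon would
  have the same closest point.\<close>

lemma breaks_total:
 assumes g: "good_arcs t J q th d"
 shows "breaks th d J = th 0 + 1"
proof -
 note G = good_arcsD[OF g]
 obtain J' where J': "J = Suc J'" using G(5) by (cases J) auto
 have "crv (breaks th d J) t = q (nxt J J')"
  unfolding J' breaks_Suc using breaks_shift(2)[OF g, of J' 0 0 "d J'"] G(8)[of J'] J' by simp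
 then have "crv (th 0) t = crv (breaks th d J) t" using G(7)[of 0] G(5) J' by (simp add: nxt_def)
 from D_inj[OF G(2) this] obtain N :: int where N: "breaks th d J = th 0 + of_int N" by blast
 have "0 < (\<Sum>i<J. d i)" using G(5,9) by (intro sum_pos) auto
 then have N0: "0 < N" using N unfolding breaks_def by simp
 have "\<not> 1 < N"
 proof
  assume "1 < N"
  then have big: "th 0 + 1 < breaks th d J" using N by simp
  \<comment> \<open>The first breakpoint beyond one full turn; the edge ending there contains a
    point that projects onto the first node.\<close>
  define k where "k = (LEAST k. th 0 + 1 < breaks th d k)"
  have k1: "th 0 + 1 < breaks th d k" unfolding k_def by (rule LeastI[of _ J]) (rule big)
  have k2: "k <= J" unfolding k_def by (rule Least_le) (rule big)
  have "k ~= 0" using k1 by (auto simp: breaks_def intro: ccontr)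
  then obtain j where j: "k = Suc j" by (cases k) auto
  have jJ: "j < J" using k2 j by simp
  have lo: "breaks th d j <= th 0 + 1" using not_less_Least[of j "%k. th 0 + 1 < breaks th d k"] j k_def by force
  define y where "y = (th 0 + 1 - breaks th d j) / d j"
  have y: "y \<in> {0..1}" "y < 1" "d j * y = th 0 + 1 - breaks th d j"
   unfolding y_def using lo k1 j G(9)[OF jJ] by (auto simp: breaks_Suc)
  let ?s = "chord_coord (th j) (d j) t y"
  have "closest_point (\<Gamma> t) (edge J q j ?s) = crv (th j + d j * y) t" by (rule good_arcs_closest(1)[OF g jJ y(1)])
  also have "... = crv (th 0 + 1) t" using breaks_shift(2)[OF g jJ, of 0 0 "d j * y"] y(3) by simp
  also have "... = crv (th 0 + d 0 * 0) t" using D_periodic1[OF G(2), of 0 0 "th 0"] by simp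
  also have "... = closest_point (\<Gamma> t) (edge J q 0 (chord_coord (th 0) (d 0) t 0))"
   by (rule good_arcs_closest(1)[OF g G(5), symmetric]) simp
  finally have e: "closest_point (\<Gamma> t) (edge J q j ?s) = closest_point (\<Gamma> t) (edge J q 0 (chord_coord (th 0) (d 0) t 0))" .
  have z: "chord_coord (th 0) (d 0) t 0 = 0" using G(11)[OF G(5)] unfolding chord_ok_def by blast
  have s: "?s \<in> {0..<1}" using good_arcs_closest(2,3)[OF g jJ y(1)] y(2) by auto
  \<comment> \<open>Injectivity makes this point the start of edge 0, whose breakpoint is
    \<open>th 0\<close> and not \<open>th 0 + 1\<close>.\<close>
  have "j = 0" "?s = 0" using closest_edge_eqD[OF G(1) jJ G(5) s _ e] z by auto
  then have "y = 0" using good_arcs_closest(4)[OF g jJ y(1)] y(1) by force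
  then have "breaks th d j = th 0 + 1" using y(3) by simp
  then show False using \<open>j = 0\<close> by (simp add: breaks_def)
 qed
 then have "N = 1" using N0 by linarith
 then show ?thesis using N by simp
qed

text \<open>The arcs fill one period without overlap. The integrand is only known in the coordinate
  of each arc, and periodicity removes the integer shifts between \<open>th\<close> and
  \<open>breaks\<close>.\<close>

lemma tile_integral:
 assumes g: "good_arcs t J q th d" and per: "!!r. F (r + 1) = F r"
  and I: "!!j. j < J ==> ((%y. d j * F (th j + d j * y)) has_integral I j) {0..1}"
 shows "(F has_integral (\<Sum>j<J. I j)) {0..1}"
proof -
 have per': "F (r + of_int k) = F r" for r k by (rule periodic_int[of F, OF per])
 have piece: "(F has_integral I j) {breaks th d j..breaks th d (Suc j)}" if j: "j < J" for j
 proof -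
  obtain i :: int where i: "breaks th d j = th j + of_int i" using breaks_shift(1)[OF g j] by blast
  have dp: "0 < d j" by (rule good_arcsD(9)[OF g j])
  have "((%x. d j * F (th j + d j * ((1 / d j) *\<^sub>R x + (- th j / d j)))) has_integral I j /\<^sub>R (1 / d j) ^ DIM(real))
    (cbox ((0 - (- th j / d j)) /\<^sub>R (1 / d j)) ((1 - (- th j / d j)) /\<^sub>R (1 / d j)))"
   using dp by (intro has_integral_affinity'[OF I[OF j, unfolded cbox_interval[symmetric]]]) auto
  moreover have "th j + d j * ((1 / d j) *\<^sub>R x + (- th j / d j)) = x" for x using dp by (simp add: field_simps)
  moreover have "(0 - (- th j / d j)) /\<^sub>R (1 / d j) = th j" "(1 - (- th j / d j)) /\<^sub>R (1 / d j) = th j + d j"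
    "I j /\<^sub>R (1 / d j) ^ DIM(real) = d j * I j" using dp by (auto simp: field_simps)
  ultimately have "((%x. d j * F x) has_integral d j * I j) {th j..th j + d j}" by simp
  then have "((%x. (1 / d j) * (d j * F x)) has_integral (1 / d j) * (d j * I j)) {th j..th j + d j}" by (rule has_integral_mult_right)
  then have "(F has_integral I j) {th j..th j + d j}" using dp by simp
  then have "((%x. F (x + (- of_int i))) has_integral I j) {th j - (- of_int i)..th j + d j - (- of_int i)}" by (rule has_integral_translate)
  moreover have "F (x + (- of_int i)) = F x" for x using per'[of x "- i"] by simp
  ultimately show ?thesis unfolding breaks_Suc i by (simp add: algebra_simps)
 qed
 have sums: "k <= J ==> breaks th d 0 <= breaks th d k \<and> (F has_integral (\<Sum>j<k. I j)) {breaks th d 0..breaks th d k}" for k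
 proof (induction k)
  case 0
  then show ?case by auto
 next
  case (Suc k)
  have "breaks th d k <= breaks th d (Suc k)" using good_arcsD(9)[OF g, of k] Suc.prems by (simp add: breaks_Suc)
  then show ?case
   using has_integral_combine[OF _ _ _ piece[of k], of "breaks th d 0" "\<Sum>j<k. I j"] Suc by auto
 qed
 have "(F has_integral (\<Sum>j<J. I j)) {th 0..th 0 + 1}" using sums[of J] breaks_total[OF g] by (simp add: breaks_def)
 then have "(F has_integral (\<Sum>j<J. I j)) {0..0 + 1}" by (rule has_integral_periodic[of F, OF per])
 then show ?thesis by simp
qed

end

section \<open>The functionals as sums over edges\<close>

context curve_flow
begin

definition lifted :: "real => nat => (nat => real^2) => (real^2 => real^2) => real^2 => real^2" where
 "lifted t J q f = f \<circ> inv_into (polygon_set J q) (closest_point (\<Gamma> t))"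

text \<open>The edge point with coordinate \<open>chord_coord\<close> is the only polygon point that
  projects to \<open>crv (th j + d j * y) t\<close>, so the inverse of the projection becomes
  explicit.\<close>

lemma lifted_arc:
 assumes g: "good_arcs t J q th d" and j: "j < J" and y: "y \<in> {0..1}" and f: "represents J q f u"
 shows "lifted t J q f (crv (th j + d j * y) t) = edge J u j (chord_coord (th j) (d j) t y)"
proof -
 note c = good_arcs_closest[OF g j y]
 let ?p = "edge J q j (chord_coord (th j) (d j) t y)"
 have p: "?p \<in> polygon_set J q" unfolding polygon_set_def using j c(2) by blast
 have inj: "inj_on (closest_point (\<Gamma> t)) (polygon_set J q)" using good_arcsD(6)[OF g] by (rule bij_betw_imp_inj_on)
 have "lifted t J q f (crv (th j + d j * y) t) = f (inv_into (polygon_set J q) (closest_point (\<Gamma> t)) (closest_point (\<Gamma> t) ?p))"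
  unfolding lifted_def c(1) by simp
 also have "... = f ?p" using inv_into_f_f[OF inj p] by simp
 also have "... = edge J u j (chord_coord (th j) (d j) t y)" by (rule representsD[OF f j c(2)])
 finally show ?thesis .
qed

lemma lifted_arc_deriv:
 assumes g: "good_arcs t J q th d" and j: "j < J" and y: "y \<in> {0<..<1}" and f: "represents J q f u"
  and s': "(chord_coord (th j) (d j) t has_field_derivative s') (at y)"
 shows "((%r. lifted t J q f (crv r t)) has_vector_derivative (s' / d j) *\<^sub>R (u (nxt J j) - u j)) (at (th j + d j * y))"
proof -
 have dp: "0 < d j" by (rule good_arcsD(9)[OF g j])
 let ?S = "chord_coord (th j) (d j) t"
 let ?h = "%r. (r - th j) / d j"
 have hy: "?h (th j + d j * y) = y" using dp by simp
 have "((%r. ?S (?h r)) has_field_derivative s' * (1 / d j)) (at (th j + d j * y))"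
  by (rule DERIV_chain2[of ?S s' ?h]) (use s' hy dp in \<open>auto intro!: derivative_eq_intros\<close>)
 then have "((%r. ?S (?h r)) has_vector_derivative s' / d j) (at (th j + d j * y))"
  by (simp add: has_real_derivative_iff_has_vector_derivative)
 from bounded_linear.has_vector_derivative[OF bounded_linear_scaleR_left[of "u (nxt J j) - u j"] this]
 have "((%r. u j + ?S (?h r) *\<^sub>R (u (nxt J j) - u j)) has_vector_derivative (s' / d j) *\<^sub>R (u (nxt J j) - u j)) (at (th j + d j * y))"
  using has_vector_derivative_add[OF has_vector_derivative_const] by fastforce
 then show ?thesis
 proof (rule has_vector_derivative_transform_within_open)
  show "open {th j<..<th j + d j}" by simp
  show "th j + d j * y \<in> {th j<..<th j + d j}" using y dp by simp
  fix r assume r: "r \<in> {th j<..<th j + d j}"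
  have h: "?h r \<in> {0..1}" using r dp by (simp add: field_simps)
  have "th j + d j * ?h r = r" using dp by simp
  then show "u j + ?S (?h r) *\<^sub>R (u (nxt J j) - u j) = lifted t J q f (crv r t)"
   using lifted_arc[OF g j h f] by (simp add: edge_alt)
 qed
qed

text \<open>The Frobenius product of two tangential gradients times the speed of the
  parametrisation; of the two speeds in the denominator one cancels.\<close>

definition gint :: "real => (real^2 => real^2) => (real^2 => real^2) => real => real" where
 "gint t f g r = (vector_derivative (%r. f (crv r t)) (at r) \<bullet> vector_derivative (%r. g (crv r t)) (at r)) / norm (D 1 0 r t)"

lemma gint_periodic: "t \<in> {0..T} ==> gint t f g (r + 1) = gint t f g r"
 unfolding gint_def
 using vector_derivative_periodic[of "%r. f (crv r t)" r] vector_derivative_periodic[of "%r. g (crv r t)" r]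
  D_periodic1[of t 0 0] D_periodic1[of t 1 0 r] by simp

lemma grad_int_tgrad:
 assumes t: "t \<in> {0..T}"
 shows "curve_int (%r. crv r t) (%s. tgrad (%r. crv r t) f s \<bullet> tgrad (%r. crv r t) g s) = integral {0..1} (gint t f g)"
proof -
 have "vector_derivative (%r. crv r t) (at s) = D 1 0 s t" for s by (rule vector_derivative_at[OF D_der(1)[OF t]])
 then show ?thesis
  unfolding curve_int_def tgrad_inner gint_def[abs_def] using D_regular[OF t]
  by (simp add: o_def power2_eq_square)
qed

section \<open>Calculus in the coordinate of one arc\<close>

lemma chord_D_cont: "t \<in> {0..T} ==> continuous_on S (%y. D i j (th + d * y) t)"
 by (rule continuous_on_compose2[OF strip2_cont[OF D_strip2, of t UNIV]]) (auto intro!: continuous_intros)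

lemma chord_tang_cont: "t \<in> {0..T} ==> continuous_on S (%y. tang (th + d * y) t)"
 "t \<in> {0..T} ==> continuous_on S (%y. tang1 (th + d * y) t)"
 by (rule continuous_on_compose2[OF strip2_cont[OF tang_BL, of t UNIV]]; auto intro!: continuous_intros)
  (rule continuous_on_compose2[OF strip2_cont[OF tang1_BL, of t UNIV]]; auto intro!: continuous_intros)

lemma has_vd_affine:
 fixes G :: "real => 'a::real_normed_vector"
 assumes "!!r. (G has_vector_derivative G' r) (at r)"
 shows "((%y. G (th + d * y)) has_vector_derivative d *\<^sub>R G' (th + d * y)) (at y)"
proof -
 have "(G \<circ> (%y. th + d * y) has_vector_derivative d *\<^sub>R G' (th + d * y)) (at y)"
  by (rule vector_diff_chain_at) (auto intro!: derivative_eq_intros assms)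
 then show ?thesis by (simp add: o_def)
qed

lemma has_vd_inner_const:
 fixes G :: "real => 'a::real_inner"
 assumes "(G has_vector_derivative v) (at y)"
 shows "((%y. G y \<bullet> w) has_field_derivative v \<bullet> w) (at y)"
 using bounded_linear.has_vector_derivative[OF bounded_linear_inner_left[of w] assms]
 by (simp add: has_real_derivative_iff_has_vector_derivative)

lemma chord_cont:
 assumes "chord_ok th d t"
 shows "continuous_on {0..1} (chord_coord th d t)"
proof -
 obtain S' where "\<forall>y\<in>{0..1}. (chord_coord th d t has_field_derivative S' y) (at y)"
  using assms unfolding chord_ok_def by blast
 then show ?thesis by (meson DERIV_isCont continuous_at_imp_continuous_on)
qed

text \<open>Integration by parts moves the derivative from \<open>chord_coord\<close> to the
  tangent; only the boundary term at \<open>y = 1\<close> remains since the coordinate vanishes at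
  0.\<close>

lemma tangential_part:
 assumes t: "t \<in> {0..T}" and ok: "chord_ok th d t"
  and S': "continuous_on {0..1} S'" "!!y. y \<in> {0..1} ==> (chord_coord th d t has_field_derivative S' y) (at y)"
 shows "((%y. S' y * (tang (th + d * y) t \<bullet> w)) has_integral
  (tang (th + d) t - d *\<^sub>R integral {0..1} (%y. chord_coord th d t y *\<^sub>R tang1 (th + d * y) t)) \<bullet> w) {0..1}"
proof -
 let ?S = "chord_coord th d t"
 have S01: "?S 0 = 0" "?S 1 = 1" using ok unfolding chord_ok_def by blast+
 have der: "((%y. ?S y * (tang (th + d * y) t \<bullet> w)) has_vector_derivative
   (?S y * (d *\<^sub>R tang1 (th + d * y) t \<bullet> w) + S' y * (tang (th + d * y) t \<bullet> w))) (at y within {0..1})" if "y \<in> {0..1}" for y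
 proof -
  have "((%y. ?S y * (tang (th + d * y) t \<bullet> w)) has_field_derivative
   (S' y * (tang (th + d * y) t \<bullet> w) + (d *\<^sub>R tang1 (th + d * y) t \<bullet> w) * ?S y)) (at y)"
   by (rule DERIV_mult[OF S'(2)[OF that] has_vd_inner_const[OF has_vd_affine[OF tang_deriv[OF t]]]])
  then show ?thesis
   by (simp add: has_real_derivative_iff_has_vector_derivative has_vector_derivative_at_within algebra_simps)
 qed
 have A: "((%y. ?S y * (d *\<^sub>R tang1 (th + d * y) t \<bullet> w) + S' y * (tang (th + d * y) t \<bullet> w)) has_integral
   (?S 1 * (tang (th + d * 1) t \<bullet> w) - ?S 0 * (tang (th + d * 0) t \<bullet> w))) {0..1}"
  by (rule fundamental_theorem_of_calculus[OF _ der]) auto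
 have "((%y. ?S y *\<^sub>R tang1 (th + d * y) t) has_integral integral {0..1} (%y. ?S y *\<^sub>R tang1 (th + d * y) t)) {0..1}"
  by (intro integrable_integral integrable_continuous_real continuous_intros chord_cont[OF ok] chord_tang_cont t)
 from has_integral_linear[OF this bounded_linear_inner_left[of "d *\<^sub>R w"]]
 have B: "((%y. ?S y * (d *\<^sub>R tang1 (th + d * y) t \<bullet> w)) has_integral
   (integral {0..1} (%y. ?S y *\<^sub>R tang1 (th + d * y) t) \<bullet> (d *\<^sub>R w))) {0..1}"
  by (simp add: o_def algebra_simps)
 from has_integral_diff[OF A B] show ?thesis by (simp add: S01 inner_diff_left)
qed

text \<open>The integrals of \<open>G\<close>, quadratic in the derivative of
  \<open>chord_coord\<close>, occur in both integrands and cancel; what remains is linear and can be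
  integrated by parts. The integrands are abstract so that the argument also applies after reversing
  the parametrisation.\<close>

lemma grad_functional_core:
 assumes g: "good_arcs t J q th d" and per: "!!r. F1 (r + 1) = F1 r" "!!r. F2 (r + 1) = F2 r"
  and F1: "!!j y s'. j < J ==> y \<in> {0<..<1} ==> (chord_coord (th j) (d j) t has_field_derivative s') (at y) ==>
    F1 (th j + d j * y) = (((s' / d j) *\<^sub>R (q (nxt J j) - q j)) \<bullet> ((s' / d j) *\<^sub>R (u (nxt J j) - u j))) / norm (D 1 0 (th j + d j * y) t)"
  and F2: "!!j y s'. j < J ==> y \<in> {0<..<1} ==> (chord_coord (th j) (d j) t has_field_derivative s') (at y) ==>
    F2 (th j + d j * y) = (((s' / d j) *\<^sub>R (q (nxt J j) - q j) - D 1 0 (th j + d j * y) t) \<bullet> ((s' / d j) *\<^sub>R (u (nxt J j) - u j))) / norm (D 1 0 (th j + d j * y) t)"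
 shows "\<exists>I1 I2. (F1 has_integral I1) {0..1} \<and> (F2 has_integral I2) {0..1} \<and>
   (\<Sum>j<J. (q (nxt J j) - q j) \<bullet> (u (nxt J j) - u j) / edge_len J q j) - I1 + I2
   = (\<Sum>j<J. arc_gap (th j) (d j) t \<bullet> (u (nxt J j) - u j))"
proof -
 have t: "t \<in> {0..T}" by (rule good_arcsD(2)[OF g])
 let ?w = "%j. u (nxt J j) - u j"
 have "\<exists>S'. continuous_on {0..1} S' \<and> (\<forall>y\<in>{0..1}. (chord_coord (th j) (d j) t has_field_derivative S' y) (at y))" if "j < J" for j
  using good_arcsD(11)[OF g that] unfolding chord_ok_def by blast
 then obtain S' where S': "!!j. j < J ==> continuous_on {0..1} (S' j)"
   "!!j y. j < J ==> y \<in> {0..1} ==> (chord_coord (th j) (d j) t has_field_derivative S' j y) (at y)"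
  by metis
 define G where "G = (%j y. ((S' j y)^2 / d j) * ((q (nxt J j) - q j) \<bullet> ?w j) / norm (D 1 0 (th j + d j * y) t))"
 define K where "K = (%j. (tang (th j + d j) t - d j *\<^sub>R integral {0..1} (%y. chord_coord (th j) (d j) t y *\<^sub>R tang1 (th j + d j * y) t)) \<bullet> ?w j)"
 have G: "(G j has_integral integral {0..1} (G j)) {0..1}" if j: "j < J" for j
 proof -
  have "d j ~= 0" using good_arcsD(9)[OF g j] by simp
  moreover have "norm (D 1 0 r t) ~= 0" for r using D_regular[OF t, of r] by simp
  ultimately have "continuous_on {0..1} (G j)"
   unfolding G_def by (intro continuous_on_divide continuous_on_mult continuous_intros S'(1)[OF j] chord_D_cont t ballI)
  then show ?thesis by (intro integrable_integral integrable_continuous_real)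
 qed
 have K: "((%y. S' j y * (tang (th j + d j * y) t \<bullet> ?w j)) has_integral K j) {0..1}" if j: "j < J" for j
  unfolding K_def by (rule tangential_part[OF t good_arcsD(11)[OF g j] S'(1)[OF j] S'(2)[OF j]])
 have e1: "d j * F1 (th j + d j * y) = G j y" and e2: "d j * F2 (th j + d j * y) = G j y - S' j y * (tang (th j + d j * y) t \<bullet> ?w j)"
  if j: "j < J" and y: "y \<in> {0..1} - {0, 1}" for j y
 proof -
  have y': "y \<in> {0<..<1}" "y \<in> {0..1}" using y by auto
  have dp: "0 < d j" by (rule good_arcsD(9)[OF g j])
  have n: "norm (D 1 0 (th j + d j * y) t) ~= 0" using D_regular[OF t] by simp
  show "d j * F1 (th j + d j * y) = G j y"
   unfolding F1[OF j y'(1) S'(2)[OF j y'(2)]] G_def using dp by (simp add: power2_eq_square)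
  show "d j * F2 (th j + d j * y) = G j y - S' j y * (tang (th j + d j * y) t \<bullet> ?w j)"
  proof -
   have "e * (((a / e) *\<^sub>R Q - V) \<bullet> ((a / e) *\<^sub>R w) / m) = (a^2 / e) * (Q \<bullet> w) / m - a * ((1 / m) *\<^sub>R V \<bullet> w)"
    if "e ~= 0" "m ~= 0" for e a m :: real and Q V w :: "real^2"
    unfolding inner_diff_left inner_scaleR_left inner_scaleR_right using that by (simp add: field_simps power2_eq_square)
   note alg = this
   show ?thesis unfolding F2[OF j y'(1) S'(2)[OF j y'(2)]] G_def tang_def by (rule alg) (use dp n in auto)
  qed
 qed
 \<comment> \<open>The nodes, where lifted functions may have kinks, are the values 0 and 1 of the
   arc coordinates and are discarded.\<close>
 have "(F1 has_integral (\<Sum>j<J. integral {0..1} (G j))) {0..1}"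
  by (rule tile_integral[where F = F1, OF g per(1)], rule has_integral_spike_finite[OF _ _ G, of "{0, 1}"]) (use e1 in auto)
 moreover have "(F2 has_integral (\<Sum>j<J. integral {0..1} (G j) - K j)) {0..1}"
  by (rule tile_integral[where F = F2, OF g per(2)], rule has_integral_spike_finite[OF _ _ has_integral_diff[OF G K], of "{0, 1}"]) (use e2 in auto)
 moreover have "(\<Sum>j<J. (q (nxt J j) - q j) \<bullet> ?w j / edge_len J q j) - (\<Sum>j<J. integral {0..1} (G j)) + (\<Sum>j<J. integral {0..1} (G j) - K j)
   = (\<Sum>j<J. arc_gap (th j) (d j) t \<bullet> ?w j)"
 proof -
  have "(\<Sum>j<J. (q (nxt J j) - q j) \<bullet> ?w j / edge_len J q j) - (\<Sum>j<J. integral {0..1} (G j)) + (\<Sum>j<J. integral {0..1} (G j) - K j)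
   = (\<Sum>j<J. (q (nxt J j) - q j) \<bullet> ?w j / edge_len J q j - K j)" by (simp add: sum_subtractf)
  also have "... = (\<Sum>j<J. arc_gap (th j) (d j) t \<bullet> ?w j)"
  proof (rule sum.cong)
   fix j assume "j \<in> {..<J}"
   then have j: "j < J" by simp
   show "(q (nxt J j) - q j) \<bullet> ?w j / edge_len J q j - K j = arc_gap (th j) (d j) t \<bullet> ?w j"
    unfolding arc_gap_def K_def edge_len_norm good_arcsD(7)[OF g j] good_arcsD(8)[OF g j]
    by (simp add: inner_diff_left inner_add_left)
  qed simp
  finally show ?thesis .
 qed
 ultimately show ?thesis by blast
qed

lemma closest_on_curve: "t \<in> {0..T} ==> closest_point (\<Gamma> t) (crv r t) = crv r t"
 by (rule closest_point_self) (simp add: \<Gamma>_def)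

lemma grad_functional_forward:
 assumes g: "good_arcs t J q th d" and f: "represents J q f q" "represents J q f' q" "represents J q h u"
 shows "poly_grad_int J q f h - integral {0..1} (gint t (lifted t J q f) (lifted t J q h))
   + integral {0..1} (gint t (%p. lifted t J q f' p - closest_point (\<Gamma> t) p) (lifted t J q h))
   = (\<Sum>j<J. arc_gap (th j) (d j) t \<bullet> (u (nxt J j) - u j))"
proof -
 note t = good_arcsD(2)[OF g]
 have "\<exists>I1 I2. (gint t (lifted t J q f) (lifted t J q h) has_integral I1) {0..1}
  \<and> (gint t (%p. lifted t J q f' p - closest_point (\<Gamma> t) p) (lifted t J q h) has_integral I2) {0..1} \<and>
   (\<Sum>j<J. (q (nxt J j) - q j) \<bullet> (u (nxt J j) - u j) / edge_len J q j) - I1 + I2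
   = (\<Sum>j<J. arc_gap (th j) (d j) t \<bullet> (u (nxt J j) - u j))"
 proof (rule grad_functional_core[OF g])
  show "gint t (lifted t J q f) (lifted t J q h) (r + 1) = gint t (lifted t J q f) (lifted t J q h) r"
   "gint t (%p. lifted t J q f' p - closest_point (\<Gamma> t) p) (lifted t J q h) (r + 1)
    = gint t (%p. lifted t J q f' p - closest_point (\<Gamma> t) p) (lifted t J q h) r" for r
   by (rule gint_periodic[OF t])+
  fix j y s' assume j: "j < J" and y: "y \<in> {0<..<1}" and s': "(chord_coord (th j) (d j) t has_field_derivative s') (at y)"
  note df = lifted_arc_deriv[OF g j y f(1) s'] and df' = lifted_arc_deriv[OF g j y f(2) s'] and dh = lifted_arc_deriv[OF g j y f(3) s']
  show "gint t (lifted t J q f) (lifted t J q h) (th j + d j * y)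
   = (((s' / d j) *\<^sub>R (q (nxt J j) - q j)) \<bullet> ((s' / d j) *\<^sub>R (u (nxt J j) - u j))) / norm (D 1 0 (th j + d j * y) t)"
   unfolding gint_def vector_derivative_at[OF df] vector_derivative_at[OF dh] ..
  have dd: "((%r. lifted t J q f' (crv r t) - closest_point (\<Gamma> t) (crv r t)) has_vector_derivative
    ((s' / d j) *\<^sub>R (q (nxt J j) - q j) - D 1 0 (th j + d j * y) t)) (at (th j + d j * y))"
   unfolding closest_on_curve[OF t] by (rule has_vector_derivative_diff[OF df' D_der(1)[OF t]])
  show "gint t (%p. lifted t J q f' p - closest_point (\<Gamma> t) p) (lifted t J q h) (th j + d j * y)
   = (((s' / d j) *\<^sub>R (q (nxt J j) - q j) - D 1 0 (th j + d j * y) t) \<bullet> ((s' / d j) *\<^sub>R (u (nxt J j) - u j))) / norm (D 1 0 (th j + d j * y) t)"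
   unfolding gint_def vector_derivative_at[OF dh] vector_derivative_at[OF dd] ..
 qed
 then obtain I1 I2 where I: "(gint t (lifted t J q f) (lifted t J q h) has_integral I1) {0..1}"
  "(gint t (%p. lifted t J q f' p - closest_point (\<Gamma> t) p) (lifted t J q h) has_integral I2) {0..1}"
  "(\<Sum>j<J. (q (nxt J j) - q j) \<bullet> (u (nxt J j) - u j) / edge_len J q j) - I1 + I2
   = (\<Sum>j<J. arc_gap (th j) (d j) t \<bullet> (u (nxt J j) - u j))" by blast
 show ?thesis
  unfolding poly_grad_int_represents[OF good_arcsD(3)[OF g] f(1,3)] integral_unique[OF I(1)] integral_unique[OF I(2)] by (rule I(3))
qed

text \<open>Continuity is assumed for the integrand in the arc coordinate, where it is visible. It
  passes to the edge coordinate because \<open>chord_coord\<close> is a homeomorphism of the unit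
  interval.\<close>

lemma substitute_chord:
 fixes H :: "real => real"
 assumes ok: "chord_ok th d t"
  and S': "!!y. y \<in> {0..1} ==> (chord_coord th d t has_field_derivative S' y) (at y)"
  and H: "continuous_on {0..1} (%y. H (chord_coord th d t y))"
 shows "((%y. S' y * H (chord_coord th d t y)) has_integral integral {0..1} H) {0..1}"
proof -
 let ?S = "chord_coord th d t"
 have S01: "?S 0 = 0" "?S 1 = 1" and mono: "strict_mono_on {0..1} ?S" using ok unfolding chord_ok_def by blast+
 have inj: "inj_on ?S {0..1}" using mono by (rule strict_mono_on_imp_inj_on)
 have contS: "continuous_on {0..1} ?S" by (rule chord_cont[OF ok])
 have sub: "?S ` {0..1} \<subseteq> {0..1}"
 proof
  fix s assume "s \<in> ?S ` {0..1}"
  then obtain y where y: "y \<in> {0..1}" "s = ?S y" by auto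
  show "s \<in> {0..1}" using strict_mono_onD[OF mono, of 0 y] strict_mono_onD[OF mono, of y 1] S01 y
   by (cases "y = 0"; cases "y = 1") auto
 qed
 have sup: "{0..1} \<subseteq> ?S ` {0..1}"
 proof
  fix s :: real assume "s \<in> {0..1}"
  then obtain y where "0 <= y" "y <= 1" "?S y = s" using IVT'[of ?S 0 s 1] S01 contS by auto
  then show "s \<in> ?S ` {0..1}" by (auto intro!: image_eqI[of _ _ y])
 qed
 have img: "?S ` {0..1} = {0..1}" using sub sup by blast
 have inv: "continuous_on (?S ` {0..1}) (inv_into {0..1} ?S)"
  by (rule continuous_on_inv[OF contS]) (use inj in auto)
 have "continuous_on (?S ` {0..1}) (%s. H (?S (inv_into {0..1} ?S s)))"
  by (rule continuous_on_compose2[OF H inv]) (rule image_subsetI, rule inv_into_into)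
 then have "continuous_on (?S ` {0..1}) H"
  by (rule continuous_on_eq) (simp add: f_inv_into_f)
 then have HC: "continuous_on {0..1} H" unfolding img .
 have "((%x. S' x *\<^sub>R H (?S x)) has_integral (integral {?S 0..?S 1} H)) {0..1}"
 proof (rule has_integral_substitution[OF _ _ sub HC])
  show "(?S has_field_derivative S' y) (at y within {0..1})" if "y \<in> {0..1}" for y
   by (rule has_field_derivative_at_within[OF S'[OF that]])
 qed (use S01 in auto)
 then show ?thesis by (simp add: S01)
qed

text \<open>On the curve \<open>f\<close> is minus the velocity, so after substitution the integrand
  on an edge is an explicit product. Integration by parts leaves end-point values, which meet those
  of the trapezoidal rule, and moments of \<open>D 1 1\<close>.\<close>

lemma quad_functional:
 assumes g: "good_arcs t J q th d" and f: "!!r. f (crv r t) = - D 0 1 r t" and h: "represents J q h u"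
 defines "F \<equiv> %p. f (closest_point (\<Gamma> t) p) \<bullet> h p"
 shows "- (lumped_int J q F - poly_int J q F)
   = (\<Sum>j<J. quad_gap0 (th j) (d j) t \<bullet> u j + quad_gap1 (th j) (d j) t \<bullet> (u (nxt J j) - u j))"
proof -
 note t = good_arcsD(2)[OF g]
 have node: "F (q j) = - D 0 1 (th j) t \<bullet> u j" if "j < J" for j
  unfolding F_def using good_arcsD(7)[OF g that] closest_on_curve[OF t] f represents_node[OF h that] by simp
 have node': "F (q (nxt J j)) = - D 0 1 (th j + d j) t \<bullet> u (nxt J j)" if "j < J" for j
 proof -
  have n: "nxt J j < J" using good_arcsD(5)[OF g] by simp
  show ?thesis unfolding F_def using good_arcsD(8)[OF g that] closest_on_curve[OF t] f[of "th j + d j"] represents_node[OF h n] by simp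
 qed
 have int: "integral {0..1} (%s. F (edge J q j s)) = - (D 0 1 (th j + d j) t \<bullet> (u j + (1/2) *\<^sub>R (u (nxt J j) - u j)))
   + d j * (integral {0..1} (%y. chord_coord (th j) (d j) t y *\<^sub>R D 1 1 (th j + d j * y) t) \<bullet> u j)
   + (d j / 2) * (integral {0..1} (%y. (chord_coord (th j) (d j) t y)^2 *\<^sub>R D 1 1 (th j + d j * y) t) \<bullet> (u (nxt J j) - u j))"
  if j: "j < J" for j
 proof -
  let ?S = "chord_coord (th j) (d j) t" and ?w = "u (nxt J j) - u j"
  have ok: "chord_ok (th j) (d j) t" by (rule good_arcsD(11)[OF g j])
  obtain S' where S': "continuous_on {0..1} S'" "!!y. y \<in> {0..1} ==> (?S has_field_derivative S' y) (at y)"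
   using ok unfolding chord_ok_def by blast
  have S01: "?S 0 = 0" "?S 1 = 1" using ok unfolding chord_ok_def by blast+
  have Fy: "F (edge J q j (?S y)) = - (D 0 1 (th j + d j * y) t \<bullet> (u j + ?S y *\<^sub>R ?w))" if y: "y \<in> {0..1}" for y
   unfolding F_def good_arcs_closest(1)[OF g j y] f representsD[OF h j good_arcs_closest(2)[OF g j y]] by (simp add: edge_alt)
  have cc: "continuous_on {0..1} (%y. F (edge J q j (?S y)))"
  proof (rule continuous_on_eq)
   show "continuous_on {0..1} (%y. - (D 0 1 (th j + d j * y) t \<bullet> (u j + ?S y *\<^sub>R ?w)))"
    by (intro continuous_intros chord_D_cont t chord_cont[OF ok])
  qed (simp add: Fy)
  have "((%y. S' y * F (edge J q j (?S y))) has_integral integral {0..1} (%s. F (edge J q j s))) {0..1}"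
   by (rule substitute_chord[OF ok S'(2) cc])
  then have A: "((%y. S' y * - (D 0 1 (th j + d j * y) t \<bullet> (u j + ?S y *\<^sub>R ?w))) has_integral integral {0..1} (%s. F (edge J q j s))) {0..1}"
   by (rule has_integral_eq[rotated]) (simp add: Fy)
  \<comment> \<open>With the velocity held fixed, this is the antiderivative of the integrand in the
    chord coordinate; differentiating the velocity as well yields the terms with
    \<open>D 1 1\<close>.\<close>
  let ?P = "%y. ?S y * (D 0 1 (th j + d j * y) t \<bullet> u j) + ((1/2) * (?S y)^2) * (D 0 1 (th j + d j * y) t \<bullet> ?w)"
  have der: "(?P has_vector_derivative (S' y * (D 0 1 (th j + d j * y) t \<bullet> (u j + ?S y *\<^sub>R ?w))
    + (?S y * (d j *\<^sub>R D 1 1 (th j + d j * y) t \<bullet> u j) + ((1/2) * (?S y)^2) * (d j *\<^sub>R D 1 1 (th j + d j * y) t \<bullet> ?w)))) (at y within {0..1})"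
   if y: "y \<in> {0..1}" for y
  proof -
   have dD: "((%y. D 0 1 (th j + d j * y) t \<bullet> w) has_field_derivative d j *\<^sub>R D 1 1 (th j + d j * y) t \<bullet> w) (at y)" for w
    by (rule has_vd_inner_const[OF has_vd_affine[OF D_der(4)[OF t]]])
   have "(?P has_field_derivative (S' y * (D 0 1 (th j + d j * y) t \<bullet> u j) + (d j *\<^sub>R D 1 1 (th j + d j * y) t \<bullet> u j) * ?S y
     + ((S' y * ?S y) * (D 0 1 (th j + d j * y) t \<bullet> ?w) + (d j *\<^sub>R D 1 1 (th j + d j * y) t \<bullet> ?w) * ((1/2) * (?S y)^2)))) (at y)"
    by (intro DERIV_add DERIV_mult S'(2)[OF y] dD) (use S'(2)[OF y] in \<open>auto intro!: derivative_eq_intros\<close>)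
   then show ?thesis
    by (simp add: has_real_derivative_iff_has_vector_derivative has_vector_derivative_at_within algebra_simps inner_add_right)
  qed
  have B: "((%y. S' y * (D 0 1 (th j + d j * y) t \<bullet> (u j + ?S y *\<^sub>R ?w))
    + (?S y * (d j *\<^sub>R D 1 1 (th j + d j * y) t \<bullet> u j) + ((1/2) * (?S y)^2) * (d j *\<^sub>R D 1 1 (th j + d j * y) t \<bullet> ?w)))
    has_integral (?P 1 - ?P 0)) {0..1}"
   by (rule fundamental_theorem_of_calculus[OF _ der]) auto
  have i1: "((%y. ?S y *\<^sub>R D 1 1 (th j + d j * y) t) has_integral integral {0..1} (%y. ?S y *\<^sub>R D 1 1 (th j + d j * y) t)) {0..1}"
   and i2: "((%y. (?S y)^2 *\<^sub>R D 1 1 (th j + d j * y) t) has_integral integral {0..1} (%y. (?S y)^2 *\<^sub>R D 1 1 (th j + d j * y) t)) {0..1}"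
   by (intro integrable_integral integrable_continuous_real continuous_intros chord_cont[OF ok] chord_D_cont t)+
  have C: "((%y. ?S y * (d j *\<^sub>R D 1 1 (th j + d j * y) t \<bullet> u j) + ((1/2) * (?S y)^2) * (d j *\<^sub>R D 1 1 (th j + d j * y) t \<bullet> ?w)) has_integral
    (integral {0..1} (%y. ?S y *\<^sub>R D 1 1 (th j + d j * y) t) \<bullet> (d j *\<^sub>R u j)
    + integral {0..1} (%y. (?S y)^2 *\<^sub>R D 1 1 (th j + d j * y) t) \<bullet> ((d j / 2) *\<^sub>R ?w))) {0..1}"
   using has_integral_add[OF has_integral_linear[OF i1 bounded_linear_inner_left[of "d j *\<^sub>R u j"]]
     has_integral_linear[OF i2 bounded_linear_inner_left[of "(d j / 2) *\<^sub>R ?w"]]]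
   by (simp add: o_def algebra_simps)
  have "integral {0..1} (%s. F (edge J q j s)) = - ((?P 1 - ?P 0) - (integral {0..1} (%y. ?S y *\<^sub>R D 1 1 (th j + d j * y) t) \<bullet> (d j *\<^sub>R u j)
    + integral {0..1} (%y. (?S y)^2 *\<^sub>R D 1 1 (th j + d j * y) t) \<bullet> ((d j / 2) *\<^sub>R ?w)))"
   using has_integral_unique[OF A, of "- ((?P 1 - ?P 0) - (integral {0..1} (%y. ?S y *\<^sub>R D 1 1 (th j + d j * y) t) \<bullet> (d j *\<^sub>R u j)
    + integral {0..1} (%y. (?S y)^2 *\<^sub>R D 1 1 (th j + d j * y) t) \<bullet> ((d j / 2) *\<^sub>R ?w)))"] has_integral_neg[OF has_integral_diff[OF B C]] by simp
  then show ?thesis by (simp add: S01 inner_add_right)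
 qed
 have "- (lumped_int J q F - poly_int J q F) = (\<Sum>j<J. - (edge_len J q j / 2 * (F (q j) + F (q (nxt J j))) - edge_len J q j * integral {0..1} (%s. F (edge J q j s))))"
  unfolding lumped_int_def poly_int_alt by (simp add: sum_negf sum_subtractf)
 also have "... = (\<Sum>j<J. quad_gap0 (th j) (d j) t \<bullet> u j + quad_gap1 (th j) (d j) t \<bullet> (u (nxt J j) - u j))"
 proof (rule sum.cong)
  fix j assume "j \<in> {..<J}"
  then have j: "j < J" by simp
  have len: "norm (crv (th j + d j) t - crv (th j) t) = edge_len J q j"
   unfolding edge_len_norm using good_arcsD(7,8)[OF g j] by simp
  \<comment> \<open>The value at the far vertex is split into the value at the near one and the
    increment, the form in which the two gaps are paired.\<close>
  have un: "u (nxt J j) = u j + (u (nxt J j) - u j)" by simp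
  show "- (edge_len J q j / 2 * (F (q j) + F (q (nxt J j))) - edge_len J q j * integral {0..1} (%s. F (edge J q j s)))
   = quad_gap0 (th j) (d j) t \<bullet> u j + quad_gap1 (th j) (d j) t \<bullet> (u (nxt J j) - u j)"
   unfolding node[OF j] node'[OF j] int[OF j] quad_gap0_def quad_gap1_def len
   by (subst un) (simp add: inner_add_left inner_add_right inner_diff_left inner_diff_right algebra_simps)
 qed simp
 finally show ?thesis .
qed

interpretation R: curve_flow T "%i j th t. (-1)^i *\<^sub>R D i j (- th) t"
 by (rule curve_flow_reverse) unfold_locales

lemma reverse_curve: "R.\<Gamma> t = \<Gamma> t"
proof -
 have "range (%th. crv (- th) t) = range (%th. crv th t)"
 proof (intro equalityI subsetI)
  fix p assume "p \<in> range (%th. crv th t)"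
  then obtain r where "p = crv (- (- r)) t" by auto
  then show "p \<in> range (%th. crv (- th) t)" by blast
 qed auto
 then show ?thesis unfolding R.\<Gamma>_def \<Gamma>_def by simp
qed

lemma has_vd_reflect:
 fixes F :: "real => 'a::real_normed_vector"
 assumes "((%r. F (- r)) has_vector_derivative v) (at \<rho>)"
 shows "(F has_vector_derivative - v) (at (- \<rho>))"
proof -
 have "((%r. F (- r)) has_vector_derivative v) (at (- (- \<rho>)))" using assms by simp
 then have "((%r. F (- r)) \<circ> uminus has_vector_derivative (-1) *\<^sub>R v) (at (- \<rho>))"
  by (intro vector_diff_chain_at) (auto intro!: derivative_eq_intros)
 then show ?thesis by (simp add: o_def)
qed

text \<open>The functional is written in the original parametrisation while the arcs belong to the
  reversed flow. Reflection changes the sign of both derivatives in \<open>gint\<close>, and the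
  integral over a full period is invariant under it.\<close>

lemma grad_functional_backward:
 assumes g: "R.good_arcs t J q th d" and f: "represents J q f q" "represents J q f' q" "represents J q h u"
 shows "poly_grad_int J q f h - integral {0..1} (gint t (lifted t J q f) (lifted t J q h))
   + integral {0..1} (gint t (%p. lifted t J q f' p - closest_point (\<Gamma> t) p) (lifted t J q h))
   = (\<Sum>j<J. R.arc_gap (th j) (d j) t \<bullet> (u (nxt J j) - u j))"
proof -
 note t = R.good_arcsD(2)[OF g]
 let ?G1 = "gint t (lifted t J q f) (lifted t J q h)"
 let ?G2 = "gint t (%p. lifted t J q f' p - closest_point (\<Gamma> t) p) (lifted t J q h)"
 have lift_eq: "R.lifted t J q k = lifted t J q k" for k
  unfolding R.lifted_def lifted_def reverse_curve ..
 have per: "?G1 (r + 1) = ?G1 r" "?G2 (r + 1) = ?G2 r" for r by (rule gint_periodic[OF t])+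
 have per': "?G1 (- (r + 1)) = ?G1 (- r)" "?G2 (- (r + 1)) = ?G2 (- r)" for r
  using per(1)[of "- r - 1"] per(2)[of "- r - 1"] by simp_all
 have "\<exists>I1 I2. ((%r. ?G1 (- r)) has_integral I1) {0..1} \<and> ((%r. ?G2 (- r)) has_integral I2) {0..1} \<and>
   (\<Sum>j<J. (q (nxt J j) - q j) \<bullet> (u (nxt J j) - u j) / edge_len J q j) - I1 + I2
   = (\<Sum>j<J. R.arc_gap (th j) (d j) t \<bullet> (u (nxt J j) - u j))"
 proof (rule R.grad_functional_core[OF g])
  show "?G1 (- (r + 1)) = ?G1 (- r)" "?G2 (- (r + 1)) = ?G2 (- r)" for r by (rule per')+
  fix j y s' assume j: "j < J" and y: "y \<in> {0<..<1}" and s': "(R.chord_coord (th j) (d j) t has_field_derivative s') (at y)"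
  have der: "((%r. lifted t J q k (crv r t)) has_vector_derivative - ((s' / d j) *\<^sub>R (w (nxt J j) - w j))) (at (- (th j + d j * y)))"
   if "represents J q k w" for k w
   by (rule has_vd_reflect) (use R.lifted_arc_deriv[OF g j y that s'] in \<open>simp add: lift_eq\<close>)
  note df = der[OF f(1)] and df' = der[OF f(2)] and dh = der[OF f(3)]
  show "?G1 (- (th j + d j * y)) = (((s' / d j) *\<^sub>R (q (nxt J j) - q j)) \<bullet> ((s' / d j) *\<^sub>R (u (nxt J j) - u j)))
    / norm ((- 1)^1 *\<^sub>R D 1 0 (- (th j + d j * y)) t)"
   unfolding gint_def vector_derivative_at[OF df] vector_derivative_at[OF dh] by simp
  have dd: "((%r. lifted t J q f' (crv r t) - closest_point (\<Gamma> t) (crv r t)) has_vector_derivative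
    (- ((s' / d j) *\<^sub>R (q (nxt J j) - q j)) - D 1 0 (- (th j + d j * y)) t)) (at (- (th j + d j * y)))"
   unfolding closest_on_curve[OF t] by (rule has_vector_derivative_diff[OF df' D_der(1)[OF t]])
  have neg: "(- a - b) \<bullet> (- c) = (a - (- 1)^1 *\<^sub>R b) \<bullet> c" for a b c :: "real^2"
   by (simp add: inner_diff_left inner_add_left)
  show "?G2 (- (th j + d j * y)) = (((s' / d j) *\<^sub>R (q (nxt J j) - q j) - (- 1)^1 *\<^sub>R D 1 0 (- (th j + d j * y)) t)
    \<bullet> ((s' / d j) *\<^sub>R (u (nxt J j) - u j))) / norm ((- 1)^1 *\<^sub>R D 1 0 (- (th j + d j * y)) t)"
   unfolding gint_def vector_derivative_at[OF dh] vector_derivative_at[OF dd] neg by simp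
 qed
 then obtain I1 I2 where I: "((%r. ?G1 (- r)) has_integral I1) {0..1}" "((%r. ?G2 (- r)) has_integral I2) {0..1}"
  "(\<Sum>j<J. (q (nxt J j) - q j) \<bullet> (u (nxt J j) - u j) / edge_len J q j) - I1 + I2
   = (\<Sum>j<J. R.arc_gap (th j) (d j) t \<bullet> (u (nxt J j) - u j))" by blast
 have flip: "(G has_integral I) {0..1}" if G: "!!r. G (r + 1) = G r" and I: "((%r. G (- r)) has_integral I) {0..1}" for G :: "real => real" and I
 proof -
  have "(G has_integral I) {-1..-1 + 1}" using I has_integral_reflect_real[of G I 0 "-1"] by simp
  then have "(G has_integral I) {0..0 + 1}" by (rule has_integral_periodic[of G, OF G])
  then show ?thesis by simp
 qed
 show ?thesis
  unfolding poly_grad_int_represents[OF R.good_arcsD(3)[OF g] f(1,3)]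
   integral_unique[OF flip[OF per(1) I(1)]] integral_unique[OF flip[OF per(2) I(2)]] by (rule I(3))
qed

end

section \<open>Orientation of the outward normals\<close>

text \<open>The counterclockwise quarter turn.\<close>

definition rot :: "real^2 => real^2" where
 "rot v = (\<chi> i. if i = 1 then - (v $ 2) else v $ 1)"

lemma rot_add: "rot (v + w) = rot v + rot w" and rot_diff: "rot (v - w) = rot v - rot w"
 and rot_scaleR: "rot (c *\<^sub>R v) = c *\<^sub>R rot v"
 unfolding rot_def vec_eq_iff by (auto simp: forall_2)

lemma inner_real2: "(v :: real^2) \<bullet> w = v $ 1 * w $ 1 + v $ 2 * w $ 2"
 by (simp add: inner_vec_def sum_2)

lemma rot_inner_self [simp]: "rot v \<bullet> v = 0" "v \<bullet> rot v = 0"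
 by (simp_all add: inner_real2 rot_def)

lemma rot_inner_swap: "rot v \<bullet> w = - (v \<bullet> rot w)" and rot_inner_rot [simp]: "rot v \<bullet> rot w = v \<bullet> w"
 by (simp_all add: inner_real2 rot_def)

lemma norm_rot [simp]: "norm (rot v) = norm v"
 by (simp add: norm_eq_sqrt_inner)

lemma frame_expansion:
 fixes v b :: "real^2"
 shows "(b \<bullet> b) *\<^sub>R v = (v \<bullet> b) *\<^sub>R b + (v \<bullet> rot b) *\<^sub>R rot b"
 unfolding vec_eq_iff forall_2 by (simp add: inner_real2 rot_def algebra_simps)

lemma orthogonal_unit_cases:
 fixes \<nu> b :: "real^2"
 assumes "norm \<nu> = 1" "norm b = 1" "\<nu> \<bullet> b = 0"
 shows "\<nu> = rot b \<or> \<nu> = - rot b"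
proof -
 have b: "b \<bullet> b = 1" using assms(2) by (simp add: norm_eq_1)
 have e: "\<nu> = (\<nu> \<bullet> rot b) *\<^sub>R rot b" using frame_expansion[of b \<nu>] b assms(3) by simp
 then have "norm \<nu> = \<bar>\<nu> \<bullet> rot b\<bar> * norm (rot b)" by (metis norm_scaleR)
 then have "\<nu> \<bullet> rot b = 1 \<or> \<nu> \<bullet> rot b = -1" using assms(1,2) by auto
 then show ?thesis using e by (metis scaleR_one scaleR_minus1_left)
qed

section \<open>Simple closed polygons and the Jordan curve theorem\<close>

lemma path_image_edge: "path_image (edge J x j) = edge J x j ` {0..1}"
 by (simp add: path_image_def)

lemma arc_edge: "simple_closed_polygon J x ==> j < J ==> arc (edge J x j)"
 unfolding edge_def using polygon_nodes_distinct by (intro arc_linepath) auto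

text \<open>Points with edge coordinate 1 are first rewritten as starting points of the following
  edge, where half-open injectivity applies.\<close>

lemma edges_meet:
 assumes x: "simple_closed_polygon J x" and j: "j < k" "k < J" and s: "s \<in> {0..1}" "r \<in> {0..1}"
  and e: "edge J x j s = edge J x k r"
 shows "(k = Suc j \<and> s = 1 \<and> r = 0) \<or> (j = 0 \<and> Suc k = J \<and> s = 0 \<and> r = 1)"
proof -
 have J: "3 <= J" using x unfolding simple_closed_polygon_def by simp
 have nj: "nxt J j = Suc j" using j by (simp add: nxt_def)
 show ?thesis
 proof (cases "s = 1")
  case True
  then have e': "edge J x (Suc j) 0 = edge J x k r" using e nj by simp
  show ?thesis
  proof (cases "r = 1")
   case True
   have "edge J x (Suc j) 0 = edge J x (nxt J k) 0" using e' True by simp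
   then have "Suc j = nxt J k" using j J by (intro edge_eqD(1)[OF x, of _ _ 0 0]) auto
   then have False using j by (cases "Suc k = J") (auto simp: nxt_def)
   then show ?thesis ..
  next
   case False
   have "Suc j = k \<and> 0 = r" using j s False edge_eqD[OF x _ _ _ _ e'] by auto
   then show ?thesis using \<open>s = 1\<close> by simp
  qed
 next
  case s1: False
  show ?thesis
  proof (cases "r = 1")
   case True
   have e': "edge J x j s = edge J x (nxt J k) 0" using e True by simp
   have "j = nxt J k" "s = 0" using edge_eqD[OF x _ _ _ _ e'] s s1 j J by auto
   moreover have "Suc k = J" using calculation(1) j by (cases "Suc k = J") (auto simp: nxt_def)
   ultimately show ?thesis using True by (simp add: nxt_def)
  next
   case False
   have "j = k" using edge_eqD(1)[OF x _ _ _ _ e] s s1 j False by auto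
   then show ?thesis using j by simp
  qed
 qed
qed

text \<open>All edges but the last are joined to an arc by induction, and the last one closes it.
  Each time, the next edge meets what has been built in shared vertices only.\<close>

lemma polygon_simple_path:
 assumes x: "simple_closed_polygon J x"
 obtains g where "simple_path g" "pathfinish g = pathstart g" "path_image g = polygon_set J x"
proof -
 have J: "3 <= J" using x unfolding simple_closed_polygon_def by simp
 have chain: "\<exists>g. arc g \<and> pathstart g = x 0 \<and> pathfinish g = x (Suc k) \<and> path_image g = (\<Union>j<Suc k. edge J x j ` {0..1})"
  if "Suc k < J" for k
  using that
 proof (induction k)
  case 0
  have "nxt J 0 = 1" using J by (simp add: nxt_def)
  then show ?case using arc_edge[OF x, of 0] J
   by (intro exI[of _ "edge J x 0"]) (auto simp: pathstart_def pathfinish_def path_image_edge)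
 next
  case (Suc k)
  then obtain g where g: "arc g" "pathstart g = x 0" "pathfinish g = x (Suc k)" "path_image g = (\<Union>j<Suc k. edge J x j ` {0..1})" by auto
  let ?e = "edge J x (Suc k)"
  have kJ: "Suc k < J" "Suc (Suc k) < J" using Suc.prems by auto
  have n: "nxt J (Suc k) = Suc (Suc k)" using kJ by (simp add: nxt_def)
  have st: "pathstart ?e = x (Suc k)" "pathfinish ?e = x (Suc (Suc k))" by (simp_all add: pathstart_def pathfinish_def n)
  have "path_image g \<inter> path_image ?e \<subseteq> {pathstart ?e}"
  proof
   fix p assume "p \<in> path_image g \<inter> path_image ?e"
   then obtain j s r where p: "j < Suc k" "s \<in> {0..1}" "r \<in> {0..1}" "p = edge J x j s" "p = ?e r"
    unfolding g(4) path_image_edge by auto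
   then have "r = 0" using edges_meet[OF x p(1) kJ(1) p(2,3)] kJ by auto
   then show "p \<in> {pathstart ?e}" using p(5) by (simp add: st)
  qed
  then have "arc (g +++ ?e)" using g(1,3) arc_edge[OF x kJ(1)] by (intro arc_join) (auto simp: st)
  moreover have "path_image (g +++ ?e) = (\<Union>j<Suc (Suc k). edge J x j ` {0..1})"
   using g(3,4) by (subst path_image_join) (auto simp: st path_image_edge lessThan_Suc)
  ultimately show ?case using g st by (intro exI[of _ "g +++ ?e"]) auto
 qed
 obtain k where k: "J = Suc (Suc k)" using that[of "J - 2"] J by simp
 obtain g where g: "arc g" "pathstart g = x 0" "pathfinish g = x (Suc k)" "path_image g = (\<Union>j<Suc k. edge J x j ` {0..1})"
  using chain[of k] k by auto
 let ?e = "edge J x (Suc k)"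
 have n: "nxt J (Suc k) = 0" unfolding k by (simp add: nxt_def)
 have st: "pathstart ?e = x (Suc k)" "pathfinish ?e = x 0" by (simp_all add: pathstart_def pathfinish_def n)
 have kJ: "Suc k < J" using k by simp
 have "path_image g \<inter> path_image ?e \<subseteq> {pathstart g, pathstart ?e}"
 proof
  fix p assume "p \<in> path_image g \<inter> path_image ?e"
  then obtain j s r where p: "j < Suc k" "s \<in> {0..1}" "r \<in> {0..1}" "p = edge J x j s" "p = ?e r"
   unfolding g(4) path_image_edge by auto
  then have "r = 0 \<or> r = 1" using edges_meet[OF x p(1) kJ p(2,3)] by auto
  then show "p \<in> {pathstart g, pathstart ?e}" using p(5) by (auto simp: st g n)
 qed
 then have "simple_path (g +++ ?e)" using g arc_edge[OF x kJ] by (intro simple_path_join_loop) (auto simp: st)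
 moreover have "path_image (g +++ ?e) = polygon_set J x"
 proof -
  have "{..<J} = insert (Suc k) {..<Suc k}" using k by auto
  then show ?thesis unfolding polygon_set_def using g(3,4) by (subst path_image_join) (auto simp: st path_image_edge)
 qed
 ultimately show ?thesis using that[of "g +++ ?e"] g st by simp
qed

text \<open>Jordan-Brouwer separation for a homeomorphic image of the circle. The inside is nonempty
  because the complement is disconnected whereas the outside alone is connected.\<close>

lemma polygon_separates:
 assumes x: "simple_closed_polygon J x"
 shows "compact (polygon_set J x)" "inside (polygon_set J x) ~= {}"
  "!!C. C \<in> components (- polygon_set J x) ==> frontier C = polygon_set J x"
proof -
 obtain g where g: "simple_path g" "pathfinish g = pathstart g" "path_image g = polygon_set J x"
  by (rule polygon_simple_path[OF x])
 show comp: "compact (polygon_set J x)" using compact_simple_path_image[OF g(1)] g(3) by simp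
 have "polygon_set J x homeomorphic sphere (0::complex) 1"
  using homeomorphic_simple_path_image_circle[OF g(1,2), of 1 0] g(3) by simp
 moreover have "sphere (0::complex) 1 homeomorphic sphere (0::real^2) 1"
  by (rule homeomorphic_spheres_gen) auto
 ultimately have hom: "polygon_set J x homeomorphic sphere (0::real^2) 1" by (rule homeomorphic_trans)
 show "frontier C = polygon_set J x" if "C \<in> components (- polygon_set J x)" for C
  by (rule Jordan_Brouwer_frontier[OF hom that]) simp
 have nc: "\<not> connected (- polygon_set J x)" by (rule Jordan_Brouwer_separation[OF hom]) simp
 have co: "connected (outside (polygon_set J x))" by (rule connected_outside[OF compact_imp_bounded[OF comp]]) simp
 show "inside (polygon_set J x) ~= {}"
 proof
  assume "inside (polygon_set J x) = {}"
  then have "outside (polygon_set J x) = - polygon_set J x" using inside_Un_outside[of "polygon_set J x"] by simp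
  then show False using nc co by simp
 qed
qed

lemma connected_outside_extend:
 assumes "connected A" "A \<inter> S = {}" "a \<in> A" "a \<in> outside S"
 shows "A \<subseteq> outside S"
proof
 fix y assume y: "y \<in> A"
 have "A \<subseteq> - S" using assms(2) by blast
 then have "connected_component (- S) a y" by (rule connected_componentI[OF assms(1) _ assms(3) y])
 then have "connected_component_set (- S) y = connected_component_set (- S) a" by (rule connected_component_eq[OF CollectI])
 moreover have "y \<notin> S" using assms(2) y by blast
 ultimately show "y \<in> outside S" using assms(4) unfolding outside_def by simp
qed

text \<open>A point of the polygon lies on the frontier of every complementary component, in
  particular of one inside. Hence no neighbourhood of it consists of outside points and polygon
  points alone.\<close>

lemma polygon_not_both_sides:
 assumes x: "simple_closed_polygon J x" and p: "p \<in> polygon_set J x" and r: "0 < r"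
  and AB: "ball p r - polygon_set J x \<subseteq> A \<union> B" "A \<subseteq> outside (polygon_set J x)" "B \<subseteq> outside (polygon_set J x)"
 shows False
proof -
 let ?S = "polygon_set J x"
 obtain z where z: "z \<in> inside ?S" using polygon_separates(2)[OF x] by blast
 define C where "C = connected_component_set (- ?S) z"
 have zS: "z \<notin> ?S" using z inside_no_overlap[of ?S] by blast
 have C: "C \<in> components (- ?S)" unfolding C_def components_def using zS by blast
 have "p \<in> frontier C" using polygon_separates(3)[OF x C] p by simp
 then have "p \<in> closure C" unfolding frontier_def by simp
 then obtain y where y: "y \<in> C" "dist y p < r" using r closure_approachable by blast
 have yS: "y \<notin> ?S" using y(1) C in_components_subset by blast
 then have "y \<in> outside ?S" using AB y(2) by (auto simp: dist_commute)
 moreover have "connected C" using C in_components_connected by blast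
 moreover have "C \<inter> ?S = {}" using C in_components_subset by blast
 ultimately have "C \<subseteq> outside ?S" using connected_outside_extend y(1) by blast
 moreover have "z \<in> C" unfolding C_def using zS by (simp add: connected_component_refl)
 ultimately show False using z inside_Int_outside[of ?S] by blast
qed

lemma near_edges_only:
 assumes x: "simple_closed_polygon J x" and I: "I \<subseteq> {..<J}" and p: "!!j. j \<in> {..<J} - I ==> p \<notin> edge J x j ` {0..1}"
 shows "\<exists>r>0. ball p r \<inter> polygon_set J x \<subseteq> (\<Union>j\<in>I. edge J x j ` {0..1})"
proof -
 let ?R = "\<Union>j\<in>{..<J} - I. edge J x j ` {0..1}"
 have "compact (edge J x j ` {0..1})" for j
  unfolding edge_def using compact_path_image[OF path_linepath] by (simp add: path_image_def)
 then have "closed ?R" by (intro compact_imp_closed compact_UN) auto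
 moreover have "p \<notin> ?R" using p by blast
 ultimately obtain r where r: "0 < r" "ball p r \<subseteq> - ?R"
  using open_contains_ball[of "- ?R"] by (metis ComplI open_Compl)
 then have "ball p r \<inter> polygon_set J x \<subseteq> (\<Union>j\<in>I. edge J x j ` {0..1})"
  unfolding polygon_set_def by blast
 then show ?thesis using r(1) by blast
qed

section \<open>The two sides of an edge and of a corner\<close>

definition edge_dir :: "nat => (nat => real^2) => nat => real^2" where
 "edge_dir J x j = (1 / edge_len J x j) *\<^sub>R (x (nxt J j) - x j)"

lemma edge_dir_norm: "simple_closed_polygon J x ==> j < J ==> norm (edge_dir J x j) = 1"
 using edge_len_pos[of J x j] unfolding edge_dir_def by (simp add: edge_len_norm)

lemma edge_dir_chord: "simple_closed_polygon J x ==> j < J ==> x (nxt J j) - x j = edge_len J x j *\<^sub>R edge_dir J x j"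
 using edge_len_pos[of J x j] unfolding edge_dir_def by simp

text \<open>Near an interior point of an edge the polygon is a straight segment, and its complement
  there consists of two connected half-discs. An outside point in each of them would put the whole
  neighbourhood outside, apart from the segment.\<close>

lemma edge_not_both_outside:
 assumes x: "simple_closed_polygon J x" and j: "j < J" and s: "s \<in> {0<..<1}"
  and out: "!!sg. sg \<in> {1, -1} ==> \<exists>\<epsilon>>0. \<forall>b\<in>{0<..<\<epsilon>}. edge J x j s + (b * sg) *\<^sub>R rot (edge_dir J x j) \<in> outside (polygon_set J x)"
 shows False
proof -
 let ?S = "polygon_set J x" and ?p = "edge J x j s" and ?dt = "edge_dir J x j" and ?l = "edge_len J x j"
 have l: "0 < ?l" by (rule edge_len_pos[OF x j])
 have dt: "?dt \<bullet> ?dt = 1" using edge_dir_norm[OF x j] by (simp add: norm_eq_1)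
 have s01: "s \<in> {0..1}" using s by auto
 have pS: "?p \<in> ?S" unfolding polygon_set_def using j s01 by blast
 have other: "?p \<notin> edge J x i ` {0..1}" if i: "i \<in> {..<J} - {j}" for i
 proof
  assume "?p \<in> edge J x i ` {0..1}"
  then obtain r where r: "r \<in> {0..1}" "?p = edge J x i r" by blast
  consider "j < i" | "i < j" using i by force
  then show False
  proof cases
   case 1
   have "(i = Suc j \<and> s = 1 \<and> r = 0) \<or> (j = 0 \<and> Suc i = J \<and> s = 0 \<and> r = 1)"
    by (rule edges_meet[OF x 1 _ s01 r]) (use i in simp)
   then show False using s by simp
  next
   case 2
   have "(j = Suc i \<and> r = 1 \<and> s = 0) \<or> (i = 0 \<and> Suc j = J \<and> r = 0 \<and> s = 1)"
    by (rule edges_meet[OF x 2 j r(1) s01 r(2)[symmetric]])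
   then show False using s by simp
  qed
 qed
 have "\<exists>r>0. ball ?p r \<inter> ?S \<subseteq> (\<Union>i\<in>{j}. edge J x i ` {0..1})"
  by (rule near_edges_only[OF x _ other]) (use j in simp)
 then obtain r0 where r0: "0 < r0" "ball ?p r0 \<inter> ?S \<subseteq> (\<Union>i\<in>{j}. edge J x i ` {0..1})" by blast
 \<comment> \<open>Small enough to see no edge but \<open>j\<close>, and not to reach beyond its end
   points.\<close>
 define r where "r = min r0 (min (s * ?l) ((1 - s) * ?l))"
 have r: "0 < r" "r <= r0" "r <= s * ?l" "r <= (1 - s) * ?l" unfolding r_def using r0(1) s l by auto
 define side where "side = (%sg. {y. 0 < sg *\<^sub>R rot ?dt \<bullet> (y - ?p)} \<inter> ball ?p r)"
 have pt: "edge J x j s' = ?p + ((s' - s) * ?l) *\<^sub>R ?dt" for s'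
  unfolding edge_alt edge_dir_chord[OF x j] by (simp add: algebra_simps)
 have disj: "side sg \<inter> ?S = {}" for sg
 proof (rule ccontr)
  assume "side sg \<inter> ?S ~= {}"
  then obtain y where y: "y \<in> side sg" "y \<in> ?S" by blast
  then have "y \<in> ball ?p r0 \<inter> ?S" using r unfolding side_def by auto
  then obtain s' where "y = edge J x j s'" using r0(2) by blast
  then have yp: "y - ?p = ((s' - s) * ?l) *\<^sub>R ?dt" using pt[of s'] by simp
  have z: "sg *\<^sub>R rot ?dt \<bullet> (y - ?p) = 0" unfolding yp by simp
  have "0 < sg *\<^sub>R rot ?dt \<bullet> (y - ?p)" using y(1) unfolding side_def by blast
  then show False unfolding z by simp
 qed
 have conn: "connected (side sg)" for sg
 proof -
  have "{y. 0 < sg *\<^sub>R rot ?dt \<bullet> (y - ?p)} = {y. sg *\<^sub>R rot ?dt \<bullet> y > sg *\<^sub>R rot ?dt \<bullet> ?p}"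
   by (auto simp: inner_diff_right)
  then show ?thesis unfolding side_def
   by (simp only:) (intro convex_connected convex_Int convex_halfspace_gt convex_ball)
 qed
 have sub: "side sg \<subseteq> outside ?S" if sg: "sg \<in> {1, -1}" for sg
 proof -
  obtain \<epsilon> where e: "0 < \<epsilon>" "\<forall>b\<in>{0<..<\<epsilon>}. ?p + (b * sg) *\<^sub>R rot ?dt \<in> outside ?S" using out[OF sg] by blast
  define b where "b = min \<epsilon> r / 2"
  have b: "0 < b" "b < \<epsilon>" "b < r" unfolding b_def using e r by auto
  let ?y = "?p + (b * sg) *\<^sub>R rot ?dt"
  have "?y \<in> side sg" unfolding side_def using sg b dt edge_dir_norm[OF x j] by (auto simp: dist_norm)
  moreover have "?y \<in> outside ?S" using e(2) b by simp
  ultimately show ?thesis using connected_outside_extend[OF conn disj] by blast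
 qed
 have cover: "ball ?p r - ?S \<subseteq> side 1 \<union> side (- 1)"
 proof
  fix y assume y: "y \<in> ball ?p r - ?S"
  have "rot ?dt \<bullet> (y - ?p) ~= 0"
  proof
   assume z: "rot ?dt \<bullet> (y - ?p) = 0"
   define c where "c = (y - ?p) \<bullet> ?dt"
   have "y - ?p = c *\<^sub>R ?dt"
    using frame_expansion[of ?dt "y - ?p"] dt z unfolding c_def by (simp add: inner_commute)
   then have yc: "y = ?p + c *\<^sub>R ?dt" by (simp add: algebra_simps)
   have "norm (c *\<^sub>R ?dt) < r" using y unfolding yc by (simp add: dist_norm)
   then have "\<bar>c\<bar> < r" using edge_dir_norm[OF x j] by simp
   then have c: "- (s * ?l) <= c" "c <= (1 - s) * ?l" using r by auto
   define s' where "s' = s + c / ?l"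
   have s': "s' \<in> {0..1}" unfolding s'_def using c l by (auto simp: field_simps)
   have "y = edge J x j s'" unfolding yc pt[of s'] using l by (simp add: s'_def)
   then show False using y s' j unfolding polygon_set_def by blast
  qed
  then show "y \<in> side 1 \<union> side (- 1)" unfolding side_def using y by (auto simp: linorder_neq_iff)
 qed
 show False by (rule polygon_not_both_sides[OF x pS r(1) cover sub sub]) auto
qed

text \<open>A broken line leads from one side of the first edge to the same side of the next through
  a point on the bisector of the corner; it misses both edges because the directions enclose less
  than a right angle.\<close>

lemma corner_same_side:
 assumes x: "simple_closed_polygon J x" and j: "j < J" and sg: "sg \<in> {1, -1::real}"
  and turn: "0 < edge_dir J x j \<bullet> edge_dir J x (nxt J j)"
  and out: "!!s. s \<in> {0<..<1} ==> \<exists>\<epsilon>>0. \<forall>b\<in>{0<..<\<epsilon>}. edge J x j s + (b * sg) *\<^sub>R rot (edge_dir J x j) \<in> outside (polygon_set J x)"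
 shows "\<exists>s\<in>{0<..<1}. \<exists>\<epsilon>>0. \<forall>b\<in>{0<..<\<epsilon>}. edge J x (nxt J j) s + (b * sg) *\<^sub>R rot (edge_dir J x (nxt J j)) \<in> outside (polygon_set J x)"
proof -
 let ?S = "polygon_set J x" and ?n = "nxt J j" and ?t = "edge_dir J x j" and ?t' = "edge_dir J x (nxt J j)"
 let ?l = "edge_len J x j" and ?l' = "edge_len J x (nxt J j)"
 have J: "3 <= J" using x unfolding simple_closed_polygon_def by simp
 have n: "?n < J" using J by simp
 have nj: "?n ~= j" using nxt_neq[OF j] J by simp
 have l: "0 < ?l" "0 < ?l'" using edge_len_pos[OF x j] edge_len_pos[OF x n] by auto
 have nt: "norm ?t = 1" "norm ?t' = 1" using edge_dir_norm[OF x j] edge_dir_norm[OF x n] by auto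
 then have tt: "?t \<bullet> ?t = 1" "?t' \<bullet> ?t' = 1" by (simp_all add: norm_eq_1)
 define v where "v = x ?n"
 have pt: "edge J x j s = v + (- ((1 - s) * ?l)) *\<^sub>R ?t" for s
 proof -
  have xn: "x ?n = x j + ?l *\<^sub>R ?t" using edge_dir_chord[OF x j] by (simp add: algebra_simps)
  show ?thesis unfolding v_def edge_alt edge_dir_chord[OF x j] by (subst xn) (simp add: algebra_simps)
 qed
 have pt': "edge J x ?n s = v + (s * ?l') *\<^sub>R ?t'" for s
  unfolding v_def edge_alt edge_dir_chord[OF x n] by simp
 have other: "v \<notin> edge J x i ` {0..1}" if i: "i \<in> {..<J} - {j, ?n}" for i
 proof
  assume "v \<in> edge J x i ` {0..1}"
  then obtain r where r: "r \<in> {0..1}" "edge J x ?n 0 = edge J x i r" unfolding v_def by auto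
  show False
  proof (cases "r = 1")
   case True
   have "edge J x ?n 0 = edge J x (nxt J i) 0" using r True by simp
   then have "?n = nxt J i" using n J by (intro edge_eqD(1)[OF x, of _ _ 0 0]) auto
   then have "j = i" using prv_nxt[OF j] prv_nxt[of i J] i by simp
   then show False using i by simp
  next
   case False
   then have "?n = i" using r n i by (intro edge_eqD(1)[OF x _ _ _ _ r(2)]) auto
   then show False using i by simp
  qed
 qed
 have "\<exists>r>0. ball v r \<inter> ?S \<subseteq> (\<Union>i\<in>{j, ?n}. edge J x i ` {0..1})"
  by (rule near_edges_only[OF x _ other]) (use j n in simp)
 then obtain r0 where r0: "0 < r0" "ball v r0 \<inter> ?S \<subseteq> (\<Union>i\<in>{j, ?n}. edge J x i ` {0..1})" by blast
 \<comment> \<open>The quarter of \<open>r0\<close> keeps all three vertices of the broken line in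
   the ball; half the edge lengths keep the base points inside the edges.\<close>
 define a where "a = min (r0 / 4) (min (?l / 2) (?l' / 2))"
 have a: "0 < a" "a <= r0 / 4" "a <= ?l / 2" "a <= ?l' / 2" unfolding a_def using r0(1) l by auto
 let ?tt = "?t \<bullet> ?t'"
 have turn': "\<bar>rot ?t \<bullet> ?t'\<bar> <= 1" using Cauchy_Schwarz_ineq2[of "rot ?t" ?t'] nt by simp
 define z where "z = v + (a * sg) *\<^sub>R rot (?t + ?t')"
 have sg2: "sg * sg = 1" "\<bar>sg\<bar> = 1" using sg by auto
 have sg4: "c * sg * (sg * e) = c * e" "c * sg * sg = c" for c e
 proof -
  have "c * sg * (sg * e) = (sg * sg) * (c * e)" "c * sg * sg = (sg * sg) * c" by (simp_all only: mult_ac)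
  then show "c * sg * (sg * e) = c * e" "c * sg * sg = c" unfolding sg2(1) by simp_all
 qed
 have sg3: "sg * (c * sg) = c" for c using sg2(1) by (simp add: mult.left_commute)
 have step: "v + (a *\<^sub>R ?t' + (b * sg) *\<^sub>R rot ?t') \<in> outside ?S"
  if b: "0 < b" "b <= a" "v + (- a *\<^sub>R ?t + (b * sg) *\<^sub>R rot ?t) \<in> outside ?S" for b
 proof -
  let ?P = "- a *\<^sub>R ?t + (b * sg) *\<^sub>R rot ?t" and ?Q = "a *\<^sub>R ?t' + (b * sg) *\<^sub>R rot ?t'" and ?Z = "(a * sg) *\<^sub>R rot (?t + ?t')"
  let ?A = "closed_segment (v + ?P) (v + ?Z) \<union> closed_segment (v + ?Z) (v + ?Q)"
  have db: "dist v (v + w) = norm w" for w by (simp add: dist_norm)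
  have inball: "v + ?P \<in> ball v r0" "v + ?Z \<in> ball v r0" "v + ?Q \<in> ball v r0"
  proof -
   have "norm ?P <= a + b" using norm_triangle_ineq[of "- a *\<^sub>R ?t" "(b * sg) *\<^sub>R rot ?t"] a b sg2 nt by (simp add: abs_mult)
   then show "v + ?P \<in> ball v r0" unfolding mem_ball db using a b by linarith
   have "norm ?Z <= a * 2" using norm_triangle_ineq[of ?t ?t'] a sg2 nt by (simp add: abs_mult)
   then show "v + ?Z \<in> ball v r0" unfolding mem_ball db using a b by linarith
   have "norm ?Q <= a + b" using norm_triangle_ineq[of "a *\<^sub>R ?t'" "(b * sg) *\<^sub>R rot ?t'"] a b sg2 nt by (simp add: abs_mult)
   then show "v + ?Q \<in> ball v r0" unfolding mem_ball db using a b by linarith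
  qed
  have convex_pos: "0 < (1 - \<omega>) * A + \<omega> * B" if "0 < A" "0 < B" "0 <= \<omega>" "\<omega> <= 1" for A B \<omega> :: real
   using that by (cases "\<omega> = 0") (auto intro!: add_nonneg_pos)
  have convex_nn: "0 <= (1 - \<omega>) * A + \<omega> * B" if "0 <= A" "0 <= B" "0 <= \<omega>" "\<omega> <= 1" for A B \<omega> :: real
   using that by simp
  have lin: "k \<bullet> ((1 - \<omega>) *\<^sub>R A + \<omega> *\<^sub>R B) = (1 - \<omega>) * (k \<bullet> A) + \<omega> * (k \<bullet> B)" for k A B :: "real^2" and \<omega>
   by (simp add: inner_add_right)
  have sP: "sg *\<^sub>R rot ?t \<bullet> ?P = b" using sg3 tt by (simp add: inner_add_right inner_diff_right)
  have sZ: "sg *\<^sub>R rot ?t \<bullet> ?Z = a * (1 + ?tt)" "sg *\<^sub>R rot ?t' \<bullet> ?Z = a * (1 + ?tt)"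
   using tt by (simp_all add: rot_add inner_add_right sg3 sg4 inner_commute distrib_left)
  have sQ: "sg *\<^sub>R rot ?t' \<bullet> ?Q = b" using sg3 tt by (simp add: inner_add_right inner_diff_right)
  have lZ: "(?t + ?t') \<bullet> ?Z = 0" by simp
  have bt: "\<bar>b * sg * (rot ?t \<bullet> ?t')\<bar> <= a * 1" unfolding abs_mult sg2 using b turn' by (intro mult_mono) auto
  have lP: "(?t + ?t') \<bullet> ?P <= 0"
  proof -
   have "(?t + ?t') \<bullet> ?P = - a * (1 + ?tt) + b * sg * (rot ?t \<bullet> ?t')"
    using tt by (simp add: inner_add_left inner_add_right inner_commute algebra_simps)
   moreover have "0 <= a * ?tt" using a turn by simp
   ultimately show ?thesis using bt by (simp add: algebra_simps)
  qed
  have lQ: "0 <= (?t + ?t') \<bullet> ?Q"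
  proof -
   have "(?t + ?t') \<bullet> ?Q = a * (1 + ?tt) - b * sg * (rot ?t \<bullet> ?t')"
    using tt rot_inner_swap[of ?t ?t'] by (simp add: inner_add_left inner_add_right inner_commute algebra_simps)
   moreover have "0 <= a * ?tt" using a turn by simp
   ultimately show ?thesis using bt by (simp add: algebra_simps)
  qed
  have tt1: "0 < 1 + ?tt" using turn by simp
  have zpos: "0 < a * (1 + ?tt)" using a tt1 by simp
  \<comment> \<open>Two linear functionals exclude the two edges: the normal one of the nearer edge
    is positive along the segment, while \<open>?t + ?t'\<close> has a sign there that the other
    edge can attain only at the corner \<open>v\<close>.\<close>
  have noS: "y \<notin> ?S" if yA: "y \<in> ?A" for y
  proof
   assume yS: "y \<in> ?S"
   have yb: "y \<in> ball v r0"
    using yA inball convex_ball[of v r0] closed_segment_subset by blast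
   then have "y \<in> (\<Union>i\<in>{j, ?n}. edge J x i ` {0..1})" using yS r0(2) by blast
   then consider s where "s \<in> {0..1}" "y = edge J x j s" | s where "s \<in> {0..1}" "y = edge J x ?n s" by blast
   then obtain \<mu> where \<mu>: "(y = v - \<mu> *\<^sub>R ?t \<and> 0 <= \<mu>) \<or> (y = v + \<mu> *\<^sub>R ?t' \<and> 0 <= \<mu>)"
   proof cases
    case (1 s)
    then show ?thesis using pt[of s] l that[of "(1 - s) * ?l"] by auto
   next
    case (2 s)
    then show ?thesis using pt'[of s] l that[of "s * ?l'"] by auto
   qed
   consider "y \<in> closed_segment (v + ?P) (v + ?Z)" | "y \<in> closed_segment (v + ?Z) (v + ?Q)" using yA by blast
   then show False
   proof cases
    case 1
    then obtain \<omega> where \<omega>: "0 <= \<omega>" "\<omega> <= 1" "y = (1 - \<omega>) *\<^sub>R (v + ?P) + \<omega> *\<^sub>R (v + ?Z)" by (auto simp: in_segment)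
    have yv: "y - v = (1 - \<omega>) *\<^sub>R ?P + \<omega> *\<^sub>R ?Z" unfolding \<omega>(3) by (simp add: algebra_simps)
    have i1: "0 < sg *\<^sub>R rot ?t \<bullet> (y - v)"
     unfolding yv lin sP sZ(1)
     by (rule convex_pos[OF b(1) zpos \<omega>(1,2)])
    have i2: "(?t + ?t') \<bullet> (y - v) <= 0"
     unfolding yv lin lZ
     using lP \<omega> by (simp add: mult_nonneg_nonpos)
    from \<mu> show False
    proof
     assume m: "y = v - \<mu> *\<^sub>R ?t \<and> 0 <= \<mu>"
     then have "sg *\<^sub>R rot ?t \<bullet> (y - v) = 0" by simp
     then show False using i1 by linarith
    next
     assume m: "y = v + \<mu> *\<^sub>R ?t' \<and> 0 <= \<mu>"
     then have "(?t + ?t') \<bullet> (y - v) = \<mu> * (1 + ?tt)" using tt by (simp add: inner_add_left algebra_simps)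
     then have "\<mu> * (1 + ?tt) <= 0" using i2 by linarith
     then have "\<mu> <= 0" using tt1 by (simp only: mult_le_0_iff) linarith
     then have "\<mu> = 0" using m by linarith
     then show False using i1 m by simp
    qed
   next
    case 2
    then obtain \<omega> where \<omega>: "0 <= \<omega>" "\<omega> <= 1" "y = (1 - \<omega>) *\<^sub>R (v + ?Z) + \<omega> *\<^sub>R (v + ?Q)" by (auto simp: in_segment)
    have yv: "y - v = (1 - \<omega>) *\<^sub>R ?Z + \<omega> *\<^sub>R ?Q" unfolding \<omega>(3) by (simp add: algebra_simps)
    have i1: "0 < sg *\<^sub>R rot ?t' \<bullet> (y - v)"
     unfolding yv lin sQ sZ(2)
     by (rule convex_pos[OF zpos b(1) \<omega>(1,2)])
    have i2: "0 <= (?t + ?t') \<bullet> (y - v)"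
     unfolding yv lin lZ
     using lQ \<omega> by simp
    from \<mu> show False
    proof
     assume m: "y = v + \<mu> *\<^sub>R ?t' \<and> 0 <= \<mu>"
     then have "sg *\<^sub>R rot ?t' \<bullet> (y - v) = 0" by simp
     then show False using i1 by linarith
    next
     assume m: "y = v - \<mu> *\<^sub>R ?t \<and> 0 <= \<mu>"
     then have yv': "y - v = - (\<mu> *\<^sub>R ?t)" by simp
     have "(?t + ?t') \<bullet> (y - v) = - (\<mu> * (1 + ?tt))" unfolding yv' using tt by (simp add: inner_add_left inner_commute algebra_simps)
     then have "\<mu> * (1 + ?tt) <= 0" using i2 by linarith
     then have "\<mu> <= 0" using tt1 by (simp only: mult_le_0_iff) linarith
     then have "\<mu> = 0" using m by linarith
     then show False using i1 m by simp
    qed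
   qed
  qed
  have "connected ?A" by (intro connected_Un) auto
  moreover have "?A \<inter> ?S = {}" using noS by blast
  ultimately have "?A \<subseteq> outside ?S" using b(3) by (intro connected_outside_extend[of ?A ?S "v + ?P"]) auto
  then show ?thesis by auto
 qed
 define s where "s = 1 - a / ?l"
 have s: "s \<in> {0<..<1}" unfolding s_def using a l by (auto simp: field_simps)
 define s' where "s' = a / ?l'"
 have s': "s' \<in> {0<..<1}" unfolding s'_def using a l by (auto simp: field_simps)
 obtain \<epsilon> where \<epsilon>: "0 < \<epsilon>" "\<forall>b\<in>{0<..<\<epsilon>}. edge J x j s + (b * sg) *\<^sub>R rot ?t \<in> outside ?S" using out[OF s] by blast
 have "edge J x ?n s' + (b * sg) *\<^sub>R rot ?t' \<in> outside ?S" if b: "b \<in> {0<..<min \<epsilon> a}" for b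
 proof -
  have "v + (- a *\<^sub>R ?t + (b * sg) *\<^sub>R rot ?t) \<in> outside ?S"
   using \<epsilon>(2)[rule_format, of b] b l unfolding pt s_def by (simp add: algebra_simps)
  then have "v + (a *\<^sub>R ?t' + (b * sg) *\<^sub>R rot ?t') \<in> outside ?S" using b by (intro step) auto
  then show ?thesis unfolding pt' s'_def using l by (simp add: add.assoc)
 qed
 moreover have "0 < min \<epsilon> a" using \<epsilon> a by simp
 ultimately show ?thesis using s' by blast
qed

text \<open>By \<open>corner_same_side\<close> the outer side of an edge continues around the
  corner. Were the next normal on the opposite side, the next edge would have the outside on both of
  its sides.\<close>

lemma outward_normals_oriented:
 assumes x: "simple_closed_polygon J x" and \<nu>: "outward_edge_normals J x \<nu>"
  and turn: "!!j. j < J ==> 0 < edge_dir J x j \<bullet> edge_dir J x (nxt J j)"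
 obtains \<epsilon> :: real where "\<epsilon> \<in> {1, -1}" "!!j. j < J ==> \<nu> j = \<epsilon> *\<^sub>R rot (edge_dir J x j)"
proof -
 have J: "3 <= J" using x unfolding simple_closed_polygon_def by simp
 have out: "norm (\<nu> j) = 1" "\<nu> j \<bullet> edge_dir J x j = 0"
  "!!s. s \<in> {0<..<1} ==> \<exists>\<epsilon>>0. \<forall>b\<in>{0<..<\<epsilon>}. edge J x j s + b *\<^sub>R \<nu> j \<in> outside (polygon_set J x)" if j: "j < J" for j
 proof -
  have o: "outward_unit_normal (polygon_set J x) (edge J x j s) (x (nxt J j) - x j) (\<nu> j)" if "s \<in> {0<..<1}" for s
   using \<nu> j that unfolding outward_edge_normals_def by blast
  show "norm (\<nu> j) = 1" "\<nu> j \<bullet> edge_dir J x j = 0" using o[of "1/2"] unfolding outward_unit_normal_def edge_dir_def by simp_all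
  show "\<exists>\<epsilon>>0. \<forall>b\<in>{0<..<\<epsilon>}. edge J x j s + b *\<^sub>R \<nu> j \<in> outside (polygon_set J x)" if "s \<in> {0<..<1}" for s
   using o[OF that] unfolding outward_unit_normal_def by blast
 qed
 have "\<exists>sg\<in>{1, -1::real}. \<nu> j = sg *\<^sub>R rot (edge_dir J x j)" if j: "j < J" for j
  using orthogonal_unit_cases[OF out(1)[OF j] edge_dir_norm[OF x j] out(2)[OF j]] by auto
 then obtain sg where sg: "!!j. j < J ==> sg j \<in> {1, -1::real}" "!!j. j < J ==> \<nu> j = sg j *\<^sub>R rot (edge_dir J x j)" by metis
 have step: "sg (nxt J j) = sg j" if j: "j < J" for j
 proof (rule ccontr)
  assume ne: "sg (nxt J j) ~= sg j"
  have n: "nxt J j < J" using J by simp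
  have oj: "\<exists>\<epsilon>>0. \<forall>b\<in>{0<..<\<epsilon>}. edge J x j s + (b * sg j) *\<^sub>R rot (edge_dir J x j) \<in> outside (polygon_set J x)" if "s \<in> {0<..<1}" for s
   using out(3)[OF j that] unfolding sg(2)[OF j] by simp
  obtain s where s: "s \<in> {0<..<1}" and o1: "\<exists>\<epsilon>>0. \<forall>b\<in>{0<..<\<epsilon>}. edge J x (nxt J j) s + (b * sg j) *\<^sub>R rot (edge_dir J x (nxt J j)) \<in> outside (polygon_set J x)"
   using corner_same_side[OF x j sg(1)[OF j] turn[OF j] oj] by blast
  have o2: "\<exists>\<epsilon>>0. \<forall>b\<in>{0<..<\<epsilon>}. edge J x (nxt J j) s + (b * sg (nxt J j)) *\<^sub>R rot (edge_dir J x (nxt J j)) \<in> outside (polygon_set J x)"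
   using out(3)[OF n s] unfolding sg(2)[OF n] by simp
  show False
  proof (rule edge_not_both_outside[OF x n s])
   fix \<rho> :: real assume "\<rho> \<in> {1, -1}"
   then have "\<rho> = sg j \<or> \<rho> = sg (nxt J j)" using sg(1)[OF j] sg(1)[OF n] ne by auto
   then show "\<exists>\<epsilon>>0. \<forall>b\<in>{0<..<\<epsilon>}. edge J x (nxt J j) s + (b * \<rho>) *\<^sub>R rot (edge_dir J x (nxt J j)) \<in> outside (polygon_set J x)"
    using o1 o2 by auto
  qed
 qed
 have "sg j = sg 0" if "j < J" for j using that
 proof (induction j)
  case (Suc j)
  then have "nxt J j = Suc j" by (simp add: nxt_def)
  then show ?case using step[of j] Suc by simp
 qed simp
 then have "\<nu> j = sg 0 *\<^sub>R rot (edge_dir J x j)" if "j < J" for j using sg(2)[OF that] that by metis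
 then show ?thesis using that[of "sg 0"] sg(1)[of 0] J by auto
qed

section \<open>The discrete velocity\<close>

text \<open>The tangential counterpart of \<open>avg_normal\<close>: each direction is weighted by
  the length of the other edge, and a quarter turn with the common sign of the normals gives the
  averaged normal.\<close>

definition avg_dir :: "nat => (nat => real^2) => nat => real^2" where
 "avg_dir J x j = (1 / (edge_len J x (prv J j) + edge_len J x j)) *\<^sub>R
   (edge_len J x j *\<^sub>R edge_dir J x (prv J j) + edge_len J x (prv J j) *\<^sub>R edge_dir J x j)"

definition node_mass :: "nat => (nat => real^2) => nat => real" where
 "node_mass J x j = (edge_len J x (prv J j) + edge_len J x j) / 2"

lemma sum_by_parts:
 fixes t ps :: "nat => real^2"
 shows "(\<Sum>j<J. t j \<bullet> (ps (nxt J j) - ps j)) = - (\<Sum>j<J. (t j - t (prv J j)) \<bullet> ps j)"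
proof -
 have "(\<Sum>j<J. t j \<bullet> ps (nxt J j)) = (\<Sum>j<J. t (prv J (nxt J j)) \<bullet> ps (nxt J j))"
  by (rule sum.cong) auto
 also have "... = (\<Sum>j<J. t (prv J j) \<bullet> ps j)" by (rule sum_nxt)
 finally show ?thesis by (simp add: inner_diff_left inner_diff_right sum_subtractf)
qed

text \<open>The gradient of \<open>x\<close> itself cancels between both sides except against the
  normal part of the test function, where summation by parts turns it into jumps of edge directions.
  Writing \<open>y\<close> as \<open>x\<close> plus \<open>dt\<close> times \<open>v\<close> leaves
  the factor \<open>dt\<close> before the gradient of the velocity.\<close>

lemma scheme_weak:
 assumes x: "simple_closed_polygon J x" and sch: "scheme_step J dt x y" and dt: "0 < dt"
  and turn: "!!j. j < J ==> 0 < edge_dir J x j \<bullet> edge_dir J x (nxt J j)"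
 defines "v \<equiv> %j. (1 / dt) *\<^sub>R (y j - x j)"
 obtains \<epsilon> :: real where "\<epsilon> \<in> {1, -1}"
  "!!\<phi>. (\<Sum>j<J. node_mass J x j * (v j \<bullet> (\<epsilon> *\<^sub>R rot (avg_dir J x j))) * (\<phi> j \<bullet> (\<epsilon> *\<^sub>R rot (avg_dir J x j))))
    + dt * (\<Sum>j<J. (v (nxt J j) - v j) \<bullet> (\<phi> (nxt J j) - \<phi> j) / edge_len J x j)
   = (\<Sum>j<J. ((edge_dir J x j - edge_dir J x (prv J j)) \<bullet> (\<epsilon> *\<^sub>R rot (avg_dir J x j))) * (\<phi> j \<bullet> (\<epsilon> *\<^sub>R rot (avg_dir J x j))))"
proof -
 have J: "3 <= J" using x unfolding simple_closed_polygon_def by simp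
 obtain \<nu> where \<nu>: "outward_edge_normals J x \<nu>" and eq: "!!u. lumped_int J x (%p. (((fe J x y p - p) /\<^sub>R dt) \<bullet> fe J x (avg_normal J x \<nu>) p) * (fe J x u p \<bullet> fe J x (avg_normal J x \<nu>) p))
      + poly_grad_int J x (fe J x y) (fe J x u)
     = poly_grad_int J x id (nodal_interp J x (%p. fe J x u p - (fe J x u p \<bullet> fe J x (avg_normal J x \<nu>) p) *\<^sub>R fe J x (avg_normal J x \<nu>) p))"
  using sch unfolding scheme_step_def Let_def by blast
 obtain \<epsilon> :: real where \<epsilon>: "\<epsilon> \<in> {1, -1}" "!!j. j < J ==> \<nu> j = \<epsilon> *\<^sub>R rot (edge_dir J x j)"
  using outward_normals_oriented[OF x \<nu> turn] by blast
 define nb where "nb = (%j. \<epsilon> *\<^sub>R rot (avg_dir J x j))"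
 have avg: "avg_normal J x \<nu> j = nb j" if j: "j < J" for j
 proof -
  have p: "prv J j < J" using J by simp
  show ?thesis unfolding avg_normal_def Let_def nb_def avg_dir_def \<epsilon>(2)[OF j] \<epsilon>(2)[OF p]
   by (simp add: rot_add rot_scaleR algebra_simps inverse_eq_divide)
 qed
 have weak: "(\<Sum>j<J. node_mass J x j * (v j \<bullet> nb j) * (\<phi> j \<bullet> nb j)) + dt * (\<Sum>j<J. (v (nxt J j) - v j) \<bullet> (\<phi> (nxt J j) - \<phi> j) / edge_len J x j)
   = (\<Sum>j<J. ((edge_dir J x j - edge_dir J x (prv J j)) \<bullet> nb j) * (\<phi> j \<bullet> nb j))" for \<phi>
 proof -
  let ?W = "%j. (v j \<bullet> nb j) * (\<phi> j \<bullet> nb j)" and ?ps = "%j. \<phi> j - (\<phi> j \<bullet> nb j) *\<^sub>R nb j"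
  have node: "fe J x u (x j) = u j" if "j < J" for u j by (rule represents_node[OF fe_represents[OF x] that])
  have L: "lumped_int J x (%p. (((fe J x y p - p) /\<^sub>R dt) \<bullet> fe J x (avg_normal J x \<nu>) p) * (fe J x \<phi> p \<bullet> fe J x (avg_normal J x \<nu>) p))
    = (\<Sum>j<J. edge_len J x j / 2 * (?W j + ?W (nxt J j)))"
   by (rule lumped_int_nodal) (simp add: node avg v_def inverse_eq_divide)
  have "(\<Sum>j<J. edge_len J x j / 2 * ?W (nxt J j)) = (\<Sum>j<J. edge_len J x (prv J (nxt J j)) / 2 * ?W (nxt J j))"
   by (rule sum.cong) auto
  also have "... = (\<Sum>j<J. edge_len J x (prv J j) / 2 * ?W j)" by (rule sum_nxt)
  finally have e: "(\<Sum>j<J. edge_len J x j / 2 * ?W (nxt J j)) = (\<Sum>j<J. edge_len J x (prv J j) / 2 * ?W j)" .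
  have L2: "(\<Sum>j<J. edge_len J x j / 2 * (?W j + ?W (nxt J j))) = (\<Sum>j<J. node_mass J x j * (v j \<bullet> nb j) * (\<phi> j \<bullet> nb j))"
  proof -
   have "(\<Sum>j<J. edge_len J x j / 2 * (?W j + ?W (nxt J j))) = (\<Sum>j<J. edge_len J x j / 2 * ?W j) + (\<Sum>j<J. edge_len J x j / 2 * ?W (nxt J j))"
    by (simp only: distrib_left sum.distrib)
   also have "... = (\<Sum>j<J. edge_len J x j / 2 * ?W j + edge_len J x (prv J j) / 2 * ?W j)" unfolding e by (simp only: sum.distrib)
   also have "... = (\<Sum>j<J. node_mass J x j * (v j \<bullet> nb j) * (\<phi> j \<bullet> nb j))"
    by (rule sum.cong) (simp_all add: node_mass_def algebra_simps add_divide_distrib)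
   finally show ?thesis .
  qed
  have G1: "poly_grad_int J x (fe J x y) (fe J x \<phi>) = (\<Sum>j<J. (y (nxt J j) - y j) \<bullet> (\<phi> (nxt J j) - \<phi> j) / edge_len J x j)"
   by (rule poly_grad_int_represents[OF x fe_represents[OF x] fe_represents[OF x]])
  have rep: "represents J x (nodal_interp J x (%p. fe J x \<phi> p - (fe J x \<phi> p \<bullet> fe J x (avg_normal J x \<nu>) p) *\<^sub>R fe J x (avg_normal J x \<nu>) p)) ?ps"
   (is "represents J x (nodal_interp J x ?f) _")
  proof -
   have "represents J x (nodal_interp J x ?f) (%j. ?f (x j))" unfolding nodal_interp_def by (rule fe_represents[OF x])
   moreover have "?f (x j) = ?ps j" if "j < J" for j using that by (simp add: node avg)
   ultimately show ?thesis unfolding represents_def edge_def using J by (simp add: linepath_def)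
  qed
  have G2: "poly_grad_int J x id (nodal_interp J x ?f) = (\<Sum>j<J. (x (nxt J j) - x j) \<bullet> (?ps (nxt J j) - ?ps j) / edge_len J x j)"
   by (rule poly_grad_int_represents[OF x represents_id rep])
  have main: "(\<Sum>j<J. node_mass J x j * (v j \<bullet> nb j) * (\<phi> j \<bullet> nb j)) + (\<Sum>j<J. (y (nxt J j) - y j) \<bullet> (\<phi> (nxt J j) - \<phi> j) / edge_len J x j)
    = (\<Sum>j<J. (x (nxt J j) - x j) \<bullet> (?ps (nxt J j) - ?ps j) / edge_len J x j)"
   using eq[of \<phi>] unfolding L L2 G1 G2 .
  have yv: "y j = x j + dt *\<^sub>R v j" for j unfolding v_def using dt by simp
  have S1: "(\<Sum>j<J. (y (nxt J j) - y j) \<bullet> (\<phi> (nxt J j) - \<phi> j) / edge_len J x j)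
    = (\<Sum>j<J. (x (nxt J j) - x j) \<bullet> (\<phi> (nxt J j) - \<phi> j) / edge_len J x j) + dt * (\<Sum>j<J. (v (nxt J j) - v j) \<bullet> (\<phi> (nxt J j) - \<phi> j) / edge_len J x j)"
   unfolding sum_distrib_left sum.distrib[symmetric]
  proof (rule sum.cong)
   fix j
   have "y (nxt J j) - y j = (x (nxt J j) - x j) + dt *\<^sub>R (v (nxt J j) - v j)" unfolding yv by (simp add: algebra_simps)
   then show "(y (nxt J j) - y j) \<bullet> (\<phi> (nxt J j) - \<phi> j) / edge_len J x j
    = (x (nxt J j) - x j) \<bullet> (\<phi> (nxt J j) - \<phi> j) / edge_len J x j + dt * ((v (nxt J j) - v j) \<bullet> (\<phi> (nxt J j) - \<phi> j) / edge_len J x j)"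
    by (simp add: inner_add_left add_divide_distrib)
  qed simp
  have S2: "(\<Sum>j<J. (x (nxt J j) - x j) \<bullet> (?ps (nxt J j) - ?ps j) / edge_len J x j)
   = (\<Sum>j<J. (x (nxt J j) - x j) \<bullet> (\<phi> (nxt J j) - \<phi> j) / edge_len J x j) - (\<Sum>j<J. edge_dir J x j \<bullet> ((\<phi> (nxt J j) \<bullet> nb (nxt J j)) *\<^sub>R nb (nxt J j) - (\<phi> j \<bullet> nb j) *\<^sub>R nb j))"
   unfolding sum_subtractf[symmetric]
  proof (rule sum.cong)
   fix j assume "j \<in> {..<J}"
   then have c: "x (nxt J j) - x j = edge_len J x j *\<^sub>R edge_dir J x j" and l: "0 < edge_len J x j"
    using edge_dir_chord[OF x] edge_len_pos[OF x] by auto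
   show "(x (nxt J j) - x j) \<bullet> (?ps (nxt J j) - ?ps j) / edge_len J x j
     = (x (nxt J j) - x j) \<bullet> (\<phi> (nxt J j) - \<phi> j) / edge_len J x j - edge_dir J x j \<bullet> ((\<phi> (nxt J j) \<bullet> nb (nxt J j)) *\<^sub>R nb (nxt J j) - (\<phi> j \<bullet> nb j) *\<^sub>R nb j)"
    unfolding c using l by (simp add: inner_diff_right inner_add_right field_simps)
  qed simp
  have S3: "(\<Sum>j<J. edge_dir J x j \<bullet> ((\<phi> (nxt J j) \<bullet> nb (nxt J j)) *\<^sub>R nb (nxt J j) - (\<phi> j \<bullet> nb j) *\<^sub>R nb j))
   = - (\<Sum>j<J. ((edge_dir J x j - edge_dir J x (prv J j)) \<bullet> nb j) * (\<phi> j \<bullet> nb j))"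
   unfolding sum_by_parts[of "edge_dir J x" "%j. (\<phi> j \<bullet> nb j) *\<^sub>R nb j" J] by (simp add: mult.commute)
  show ?thesis using main unfolding S1 S2 S3 by linarith
 qed
 show ?thesis by (rule that[OF \<epsilon>(1)]) (use weak in \<open>unfold nb_def\<close>)
qed

lemma total_variation:
 fixes A :: "nat => 'a::real_normed_vector"
 assumes "i < J" "j < J"
 shows "norm (A i - A j) <= (\<Sum>k<J. norm (A (nxt J k) - A k))"
proof -
 have le: "norm (A j - A i) <= (\<Sum>k\<in>{i..<j}. norm (A (nxt J k) - A k))" if "i <= j" "j < J" for i j
  using that
 proof (induction j)
  case (Suc j)
  show ?case
  proof (cases "i = Suc j")
   case False
   then have ij: "i <= j" "j < J" using Suc.prems by auto
   have "nxt J j = Suc j" using Suc.prems by (simp add: nxt_def)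
   then have "norm (A (Suc j) - A i) <= norm (A (nxt J j) - A j) + norm (A j - A i)"
    using norm_triangle_ineq[of "A (Suc j) - A j" "A j - A i"] by simp
   also have "... <= norm (A (nxt J j) - A j) + (\<Sum>k\<in>{i..<j}. norm (A (nxt J k) - A k))"
    using Suc.IH[OF ij] by simp
   also have "... = (\<Sum>k\<in>{i..<Suc j}. norm (A (nxt J k) - A k))" using ij by simp
   finally show ?thesis .
  qed simp
 qed simp
 have sub: "(\<Sum>k\<in>{i..<j}. norm (A (nxt J k) - A k)) <= (\<Sum>k<J. norm (A (nxt J k) - A k))" if "j < J" for i j
  using that by (intro sum_mono2) auto
 show ?thesis
 proof (cases "i <= j")
  case True
  then show ?thesis using le[OF True assms(2)] sub[OF assms(2), of i] by (simp add: norm_minus_commute)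
 next
  case False
  then show ?thesis using le[of j i] sub[OF assms(1), of j] assms by simp
 qed
qed

lemma cauchy_schwarz_sum:
 fixes a b :: "'i => real"
 assumes "(\<Sum>i\<in>I. (a i)^2) <= P^2" "(\<Sum>i\<in>I. (b i)^2) <= Q^2" "0 <= P" "0 <= Q"
 shows "(\<Sum>i\<in>I. \<bar>a i\<bar> * \<bar>b i\<bar>) <= P * Q"
proof (rule power2_le_imp_le)
 have "(\<Sum>i\<in>I. \<bar>a i\<bar> * \<bar>b i\<bar>)^2 <= (\<Sum>i\<in>I. (\<bar>a i\<bar>)^2) * (\<Sum>i\<in>I. (\<bar>b i\<bar>)^2)" by (rule Cauchy_Schwarz_ineq_sum)
 also have "... <= P^2 * Q^2" using assms by (intro mult_mono) (auto intro: sum_nonneg)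
 finally show "(\<Sum>i\<in>I. \<bar>a i\<bar> * \<bar>b i\<bar>)^2 <= (P * Q)^2" by (simp add: power_mult_distrib)
qed (use assms in simp)

text \<open>The mesh size is written as \<open>r^4\<close>, which turns the fractional powers of \<open>h\<close> into natural powers. Here
 \<open>V\<close> is the exact velocity at the nodes and \<open>v\<close> the discrete one. Testing with \<open>v - V\<close> controls the
 normal component \<open>\<eta>\<close>. Testing with its tangential part \<open>A\<close>, which the mass term does not see, controls
 \<open>Q\<close>, the discrete \<open>H\<^sup>1\<close> seminorm of \<open>A\<close>; \<open>A\<close> itself is then bounded because, by \<open>turns\<close>, it has a small
 component in every direction at some node.\<close>

locale velocity_data =
 fixes J :: nat and dt r K \<epsilon> :: real and l :: "nat => real" and t tb V v :: "nat => real^2"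
 assumes J: "0 < J" and r: "0 < r" "r <= 1" and K: "1 <= K" and dt: "0 < dt" "dt <= K * r^8"
  and \<epsilon>: "\<epsilon> \<in> {1, -1}"
  and weak: "!!\<phi>. (\<Sum>j<J. (l (prv J j) + l j) / 2 * (v j \<bullet> (\<epsilon> *\<^sub>R rot (tb j))) * (\<phi> j \<bullet> (\<epsilon> *\<^sub>R rot (tb j))))
    + dt * (\<Sum>j<J. (v (nxt J j) - v j) \<bullet> (\<phi> (nxt J j) - \<phi> j) / l j)
   = (\<Sum>j<J. ((t j - t (prv J j)) \<bullet> (\<epsilon> *\<^sub>R rot (tb j))) * (\<phi> j \<bullet> (\<epsilon> *\<^sub>R rot (tb j))))"
  and l: "!!j. j < J ==> r^4 / K <= l j" "!!j. j < J ==> l j <= K * r^4"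
  and V: "!!j. j < J ==> norm (V (nxt J j) - V j) <= K * r^4"
  and tb: "!!j. j < J ==> 1 / 4 <= tb j \<bullet> tb j" "!!j. j < J ==> norm (tb j) <= 1"
   "!!j. j < J ==> norm (tb (nxt J j) - tb j) <= K * r^4"
  and curv: "!!j. j < J ==> \<bar>rot (tb j) \<bullet> tb (nxt J j) / l j - rot (tb (prv J j)) \<bullet> tb j / l (prv J j)\<bar> <= K * r"
  and cons: "(\<Sum>j<J. (norm (t j - t (prv J j) - ((l (prv J j) + l j) / 2) *\<^sub>R V j))^2 / ((l (prv J j) + l j) / 2)) <= K * r^6"
  and JK: "real J * r^4 <= K"
  and turns: "!!e. norm e = 1 ==> \<exists>j<J. \<bar>tb j \<bullet> e\<bar> <= 1 / 4"
begin

definition "m j = (l (prv J j) + l j) / 2"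
definition "z j = v j - V j"
definition "nb j = \<epsilon> *\<^sub>R rot (tb j)"
definition "\<eta> j = z j \<bullet> nb j"
text \<open>\<open>\<alpha>\<close> and \<open>\<beta>\<close> are the coordinates of the error in
  the orthogonal frame of \<open>tb j\<close> and \<open>rot (tb j)\<close>. Averaged directions are
  not unit vectors, hence the normalisation.\<close>

definition "\<alpha> j = (z j \<bullet> tb j) / (tb j \<bullet> tb j)"
definition "\<beta> j = (z j \<bullet> rot (tb j)) / (tb j \<bullet> tb j)"
definition "A j = \<alpha> j *\<^sub>R tb j"

lemma idx [simp]: "prv J j < J" "nxt J j < J" using J by auto

lemma l_pos: "j < J ==> 0 < l j"
 by (rule less_le_trans[OF _ l(1)]) (use r K in auto)

lemma m_lower: "j < J ==> r^4 / K <= m j"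
 unfolding m_def using l(1)[of j] l(1)[OF idx(1), of j] by (simp add: field_simps)

lemma m_pos: "j < J ==> 0 < m j"
 by (rule less_le_trans[OF _ m_lower]) (use r K in auto)

lemma tb_pos: "j < J ==> 0 < tb j \<bullet> tb j"
 by (rule less_le_trans[OF _ tb(1)]) auto

lemma z_split: "j < J ==> z j = A j + \<beta> j *\<^sub>R rot (tb j)"
proof -
 assume j: "j < J"
 have p: "tb j \<bullet> tb j ~= 0" using tb_pos[OF j] by simp
 have "z j = (1 / (tb j \<bullet> tb j)) *\<^sub>R ((tb j \<bullet> tb j) *\<^sub>R z j)" using p by simp
 also have "... = A j + \<beta> j *\<^sub>R rot (tb j)"
  unfolding frame_expansion A_def \<alpha>_def \<beta>_def by (simp add: scaleR_right_distrib)
 finally show ?thesis .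
qed

lemma \<beta>_\<eta>: "j < J ==> \<bar>\<beta> j\<bar> <= 4 * \<bar>\<eta> j\<bar>"
proof -
 assume j: "j < J"
 have "\<bar>\<eta> j\<bar> = \<bar>z j \<bullet> rot (tb j)\<bar>" unfolding \<eta>_def nb_def using \<epsilon> by auto
 moreover have "\<bar>\<beta> j\<bar> <= \<bar>z j \<bullet> rot (tb j)\<bar> / (1/4)"
  unfolding \<beta>_def abs_divide using tb(1)[OF j] by (intro divide_left_mono) auto
 ultimately show ?thesis by simp
qed

lemma \<alpha>_A: "j < J ==> \<bar>\<alpha> j\<bar> <= 2 * norm (A j)"
proof -
 assume j: "j < J"
 have "(1/2)^2 <= (norm (tb j))^2" using tb(1)[OF j] unfolding power2_norm_eq_inner by (simp add: power2_eq_square)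
 then have "1/2 <= norm (tb j)" by (rule power2_le_imp_le) simp
 then have "\<bar>\<alpha> j\<bar> * (1/2) <= \<bar>\<alpha> j\<bar> * norm (tb j)" by (intro mult_left_mono) auto
 then show ?thesis unfolding A_def by simp
qed

section \<open>The normal component of the velocity error\<close>

lemma energy_identity:
 "(\<Sum>j<J. m j * (\<eta> j)^2) + dt * (\<Sum>j<J. (norm (z (nxt J j) - z j))^2 / l j)
  = (\<Sum>j<J. ((t j - t (prv J j) - m j *\<^sub>R V j) \<bullet> nb j) * \<eta> j) - dt * (\<Sum>j<J. (V (nxt J j) - V j) \<bullet> (z (nxt J j) - z j) / l j)"
proof -
 have w: "(\<Sum>j<J. m j * (v j \<bullet> nb j) * \<eta> j) + dt * (\<Sum>j<J. (v (nxt J j) - v j) \<bullet> (z (nxt J j) - z j) / l j)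
   = (\<Sum>j<J. ((t j - t (prv J j)) \<bullet> nb j) * \<eta> j)"
  using weak[of z] unfolding m_def nb_def \<eta>_def .
 have 1: "(\<Sum>j<J. m j * (v j \<bullet> nb j) * \<eta> j) = (\<Sum>j<J. m j * (\<eta> j)^2) + (\<Sum>j<J. m j * (V j \<bullet> nb j) * \<eta> j)"
  unfolding sum.distrib[symmetric]
  by (rule sum.cong) (simp_all add: \<eta>_def z_def inner_diff_left power2_eq_square algebra_simps)
 have 2: "(\<Sum>j<J. (v (nxt J j) - v j) \<bullet> (z (nxt J j) - z j) / l j) = (\<Sum>j<J. (norm (z (nxt J j) - z j))^2 / l j) + (\<Sum>j<J. (V (nxt J j) - V j) \<bullet> (z (nxt J j) - z j) / l j)"
  unfolding sum.distrib[symmetric]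
 proof (rule sum.cong)
  fix j
  have "v (nxt J j) - v j = (z (nxt J j) - z j) + (V (nxt J j) - V j)" unfolding z_def by simp
  then show "(v (nxt J j) - v j) \<bullet> (z (nxt J j) - z j) / l j = (norm (z (nxt J j) - z j))^2 / l j + (V (nxt J j) - V j) \<bullet> (z (nxt J j) - z j) / l j"
   by (simp add: inner_add_left power2_norm_eq_inner add_divide_distrib)
 qed simp
 have 3: "(\<Sum>j<J. ((t j - t (prv J j) - m j *\<^sub>R V j) \<bullet> nb j) * \<eta> j) = (\<Sum>j<J. ((t j - t (prv J j)) \<bullet> nb j) * \<eta> j) - (\<Sum>j<J. m j * (V j \<bullet> nb j) * \<eta> j)"
  unfolding sum_subtractf[symmetric] by (rule sum.cong) (simp_all add: inner_diff_left algebra_simps)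
 show ?thesis using w unfolding 1 2 3 by (simp add: algebra_simps)
qed

lemma V_energy: "(\<Sum>j<J. (norm (V (nxt J j) - V j))^2 / l j) <= K^4"
proof -
 have "(norm (V (nxt J j) - V j))^2 / l j <= K^3 * r^4" if j: "j < J" for j
 proof -
  have "(norm (V (nxt J j) - V j))^2 / l j <= (K * r^4)^2 / (r^4 / K)"
   using V[OF j] l(1)[OF j] r K by (intro frac_le power_mono) auto
  also have "... = K^3 * r^4" using r K by (simp add: power2_eq_square power3_eq_cube)
  finally show ?thesis .
 qed
 then have "(\<Sum>j<J. (norm (V (nxt J j) - V j))^2 / l j) <= (\<Sum>j<J. K^3 * r^4)" by (intro sum_mono) auto
 also have "... = K^3 * (real J * r^4)" by simp
 also have "... <= K^3 * K" using JK K by (intro mult_left_mono) auto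
 also have "... = K^4" by (simp add: power4_eq_xxxx power3_eq_cube)
 finally show ?thesis .
qed

text \<open>Young's inequality absorbs half of the mass term and all of the gradient term of the
  error. The exact velocity contributes \<open>dt\<close> times O(1), that is O(r^8), the
  consistency error O(r^6), and division by masses of size \<open>r^4\<close> leaves O(r^2).\<close>

lemma \<eta>_bound: "(\<Sum>j<J. (\<eta> j)^2) <= 3 * K^6 * r^2"
proof -
 let ?D = "%j. t j - t (prv J j) - m j *\<^sub>R V j"
 have a: "(?D j \<bullet> nb j) * \<eta> j <= (norm (?D j))^2 / m j / 2 + m j * (\<eta> j)^2 / 2" if j: "j < J" for j
 proof -
  have "norm (nb j) <= 1" unfolding nb_def using \<epsilon> tb(2)[OF j] by auto
  then have "\<bar>?D j \<bullet> nb j\<bar> <= norm (?D j) * 1"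
   by (intro order_trans[OF Cauchy_Schwarz_ineq2] mult_left_mono) auto
  then have "(?D j \<bullet> nb j) * \<eta> j <= norm (?D j) * \<bar>\<eta> j\<bar>"
   by (intro order_trans[OF abs_ge_self[of "(?D j \<bullet> nb j) * \<eta> j"]]) (simp add: abs_mult mult_right_mono)
  also have "... <= (norm (?D j))^2 / m j / 2 + m j * (\<eta> j)^2 / 2"
  proof -
   have mp: "0 < m j" by (rule m_pos[OF j])
   have "0 <= (norm (?D j) - m j * \<bar>\<eta> j\<bar>)^2 / m j" using mp by simp
   also have "... = (norm (?D j))^2 / m j + m j * (\<eta> j)^2 - 2 * (norm (?D j) * \<bar>\<eta> j\<bar>)"
    using mp by (simp add: power2_diff power_mult_distrib field_simps power2_eq_square)
   finally show ?thesis by simp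
  qed
  finally show ?thesis .
 qed
 have b: "- ((V (nxt J j) - V j) \<bullet> (z (nxt J j) - z j) / l j) <= (norm (V (nxt J j) - V j))^2 / l j + (norm (z (nxt J j) - z j))^2 / l j" if j: "j < J" for j
 proof -
  \<comment> \<open>Expanded, this nonnegative sum is twice the difference of the two sides of the
    next inequality.\<close>
  have "0 <= (norm ((V (nxt J j) - V j) + (z (nxt J j) - z j)))^2 + (norm (V (nxt J j) - V j))^2 + (norm (z (nxt J j) - z j))^2" by simp
  then have "- ((V (nxt J j) - V j) \<bullet> (z (nxt J j) - z j)) <= (norm (V (nxt J j) - V j))^2 + (norm (z (nxt J j) - z j))^2"
   unfolding power2_norm_eq_inner inner_add_left inner_add_right
   by (simp only: inner_commute[of "z (nxt J j) - z j" "V (nxt J j) - V j"])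
  then have "- ((V (nxt J j) - V j) \<bullet> (z (nxt J j) - z j)) / l j <= ((norm (V (nxt J j) - V j))^2 + (norm (z (nxt J j) - z j))^2) / l j"
   using l_pos[OF j] by (intro divide_right_mono) auto
  then show ?thesis by (simp add: add_divide_distrib)
 qed
 have A: "(\<Sum>j<J. (?D j \<bullet> nb j) * \<eta> j) <= (\<Sum>j<J. (norm (?D j))^2 / m j) / 2 + (\<Sum>j<J. m j * (\<eta> j)^2) / 2"
  unfolding sum_divide_distrib sum.distrib[symmetric] using a by (intro sum_mono) auto
 have B: "- (\<Sum>j<J. (V (nxt J j) - V j) \<bullet> (z (nxt J j) - z j) / l j) <= (\<Sum>j<J. (norm (V (nxt J j) - V j))^2 / l j) + (\<Sum>j<J. (norm (z (nxt J j) - z j))^2 / l j)"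
  unfolding sum.distrib[symmetric] sum_negf[symmetric] using b by (intro sum_mono) auto
 have C: "(\<Sum>j<J. (norm (?D j))^2 / m j) <= K * r^6" using cons unfolding m_def .
 have B': "- (dt * (\<Sum>j<J. (V (nxt J j) - V j) \<bullet> (z (nxt J j) - z j) / l j)) <= dt * K^4 + dt * (\<Sum>j<J. (norm (z (nxt J j) - z j))^2 / l j)"
 proof -
  have "dt * - (\<Sum>j<J. (V (nxt J j) - V j) \<bullet> (z (nxt J j) - z j) / l j) <= dt * (K^4 + (\<Sum>j<J. (norm (z (nxt J j) - z j))^2 / l j))"
   using B V_energy dt by (intro mult_left_mono) auto
  then show ?thesis by (simp add: distrib_left)
 qed
 have "(\<Sum>j<J. m j * (\<eta> j)^2) <= K * r^6 + 2 * (dt * K^4)"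
  using energy_identity A C B' by linarith
 also have "dt * K^4 <= K * r^8 * K^4" using dt K by (intro mult_right_mono) auto
 also have "... = K^5 * r^8" by (simp add: eval_nat_numeral)
 finally have s: "(\<Sum>j<J. m j * (\<eta> j)^2) <= K * r^6 + 2 * (K^5 * r^8)" by simp
 have "(r^4 / K) * (\<Sum>j<J. (\<eta> j)^2) <= (\<Sum>j<J. m j * (\<eta> j)^2)"
  unfolding sum_distrib_left using m_lower by (intro sum_mono mult_right_mono) auto
 then have "(r^4 / K) * (\<Sum>j<J. (\<eta> j)^2) <= K * r^6 + 2 * (K^5 * r^8)" using s by linarith
 then have "(\<Sum>j<J. (\<eta> j)^2) <= (K * r^6 + 2 * (K^5 * r^8)) / (r^4 / K)"
  using r K by (subst pos_le_divide_eq) (auto simp: mult.commute)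
 also have "... = K^2 * r^2 + 2 * K^6 * r^4" using r K by (simp add: field_simps eval_nat_numeral)
 also have "... <= K^6 * r^2 + 2 * (K^6 * r^2)"
 proof -
  have "K^2 <= K^6" "r^4 <= r^2" using K r by (auto intro: power_increasing power_decreasing)
  then have "K^2 * r^2 <= K^6 * r^2" "K^6 * r^4 <= K^6 * r^2"
   using K r by (auto intro: mult_right_mono mult_left_mono)
  then show ?thesis by linarith
 qed
 finally show ?thesis by (simp add: mult_ac)
qed

lemma \<beta>_bound: "(\<Sum>j<J. (\<beta> j)^2) <= (7 * K^3 * r)^2"
proof -
 have "(\<beta> j)^2 <= 16 * (\<eta> j)^2" if "j < J" for j
  using power_mono[OF \<beta>_\<eta>[OF that], of 2] by (simp add: power_mult_distrib)
 then have "(\<Sum>j<J. (\<beta> j)^2) <= (\<Sum>j<J. 16 * (\<eta> j)^2)" by (intro sum_mono) auto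
 also have "... = 16 * (\<Sum>j<J. (\<eta> j)^2)" by (simp only: sum_distrib_left)
 also have "... <= 16 * (3 * K^6 * r^2)" using \<eta>_bound by (simp add: mult_ac)
 \<comment> \<open>From 16 * 3 = 48, enlarged to a square.\<close>
 also have "... <= 49 * (K^6 * r^2)" using K by simp
 also have "... = (7 * K^3 * r)^2" by (simp add: eval_nat_numeral)
 finally show ?thesis .
qed

section \<open>The tangential component of the velocity error\<close>

definition "Q = sqrt (\<Sum>j<J. (norm (A (nxt J j) - A j))^2 / l j)"

lemma Q_sq: "Q^2 = (\<Sum>j<J. (norm (A (nxt J j) - A j))^2 / l j)" and Q_nonneg: "0 <= Q"
 using l_pos unfolding Q_def by (auto intro!: real_sqrt_pow2 sum_nonneg divide_nonneg_pos real_sqrt_ge_zero)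

lemma \<Delta>A_l2: "(\<Sum>j<J. (norm (A (nxt J j) - A j))^2) <= K * r^4 * Q^2"
proof -
 have "(norm (A (nxt J j) - A j))^2 <= K * r^4 * ((norm (A (nxt J j) - A j))^2 / l j)" if j: "j < J" for j
 proof -
  have "(norm (A (nxt J j) - A j))^2 = l j * ((norm (A (nxt J j) - A j))^2 / l j)" using l_pos[OF j] by simp
  also have "... <= K * r^4 * ((norm (A (nxt J j) - A j))^2 / l j)"
   using l(2)[OF j] l_pos[OF j] by (intro mult_right_mono) auto
  finally show ?thesis .
 qed
 then show ?thesis unfolding Q_sq sum_distrib_left by (intro sum_mono) auto
qed

lemma weighted_sq: "(\<Sum>j<J. (norm (A (nxt J j) - A j) / sqrt (l j))^2) <= Q^2"
proof -
 have "(norm (A (nxt J j) - A j) / sqrt (l j))^2 = (norm (A (nxt J j) - A j))^2 / l j" if "j < J" for j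
  using l_pos[OF that] by (simp add: power_divide)
 then show ?thesis unfolding Q_sq by (simp cong: sum.cong_simp)
qed

lemma variation_A: "(\<Sum>j<J. norm (A (nxt J j) - A j)) <= K * Q"
proof -
 have "(\<Sum>j<J. (sqrt (l j))^2) <= (\<Sum>j<J. K * r^4)" using l l_pos by (intro sum_mono) (auto simp: less_imp_le)
 also have "... = K * (real J * r^4)" by simp
 also have "... <= K * K" using JK K by (intro mult_left_mono) auto
 finally have "(\<Sum>j<J. (sqrt (l j))^2) <= K^2" by (simp add: power2_eq_square)
 from cauchy_schwarz_sum[OF this weighted_sq]
 have "(\<Sum>j<J. \<bar>sqrt (l j)\<bar> * \<bar>norm (A (nxt J j) - A j) / sqrt (l j)\<bar>) <= K * Q" using K Q_nonneg by simp
 moreover have "\<bar>sqrt (l j)\<bar> * \<bar>norm (A (nxt J j) - A j) / sqrt (l j)\<bar> = norm (A (nxt J j) - A j)" if "j < J" for j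
  using l_pos[OF that] by simp
 ultimately show ?thesis by (simp cong: sum.cong_simp)
qed

text \<open>A Poincare inequality without mean value: with \<open>e\<close> the direction of
  \<open>A i\<close>, \<open>turns\<close> provides a node whose averaged direction is nearly
  orthogonal to \<open>e\<close>, so that the component of \<open>A j\<close> along \<open>e\<close>
  is at most half its length. The total variation of \<open>A\<close> covers the way from
  \<open>j\<close> to \<open>i\<close>.\<close>

lemma A_bound: "i < J ==> norm (A i) <= 3 * K * Q"
proof (cases "A i = 0")
 case True
 then show ?thesis using K Q_nonneg by simp
next
 case False
 assume i: "i < J"
 define e where "e = (1 / norm (A i)) *\<^sub>R A i"
 have e: "norm e = 1" "A i \<bullet> e = norm (A i)"
  unfolding e_def using False by (simp_all add: power2_norm_eq_inner[symmetric] power2_eq_square)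
 obtain j where j: "j < J" "\<bar>tb j \<bullet> e\<bar> <= 1 / 4" using turns[OF e(1)] by blast
 have d: "norm (A i - A j) <= K * Q" using total_variation[OF i j(1), of A] variation_A by linarith
 have "\<bar>A j \<bullet> e\<bar> = \<bar>\<alpha> j\<bar> * \<bar>tb j \<bullet> e\<bar>" unfolding A_def by (simp add: abs_mult)
 also have "... <= (2 * norm (A j)) * (1 / 4)" using \<alpha>_A[OF j(1)] j(2) by (intro mult_mono) auto
 finally have 1: "\<bar>A j \<bullet> e\<bar> <= norm (A j) / 2" by simp
 have 2: "norm (A j) <= norm (A i) + K * Q" using d norm_triangle_ineq2[of "A j" "A i"] by (simp add: norm_minus_commute)
 have "(A i - A j) \<bullet> e <= norm (A i - A j) * norm e" by (rule norm_cauchy_schwarz)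
 then have 3: "(A i - A j) \<bullet> e <= K * Q" using d e by simp
 have "norm (A i) = A j \<bullet> e + (A i - A j) \<bullet> e" using e by (simp add: inner_diff_left)
 then show ?thesis using 1 2 3 by linarith
qed

lemma \<alpha>_bound: "i < J ==> \<bar>\<alpha> i\<bar> <= 6 * K * Q"
 using \<alpha>_A[of i] A_bound[of i] by linarith

text \<open>A discrete curvature: up to the lengths of the averaged directions, the sine of the
  turning angle divided by the edge length.\<close>

definition "g j = rot (tb j) \<bullet> tb (nxt J j) / l j"

text \<open>Since \<open>A\<close> is orthogonal to all averaged normals, mass term and right-hand
  side vanish, and \<open>dt\<close> can be divided out. Pairing increments of the normal part with
  those of \<open>A\<close> leaves products of neighbouring nodes, and an index shift collects them
  at \<open>\<beta> j\<close>.\<close>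

lemma Q_identity:
 "Q^2 = - (\<Sum>j<J. (V (nxt J j) - V j) \<bullet> (A (nxt J j) - A j) / l j) - (\<Sum>j<J. \<beta> j * (g (prv J j) * \<alpha> (prv J j) - g j * \<alpha> (nxt J j)))"
proof -
 have An: "A j \<bullet> (\<epsilon> *\<^sub>R rot (tb j)) = 0" for j unfolding A_def by simp
 have "dt * (\<Sum>j<J. (v (nxt J j) - v j) \<bullet> (A (nxt J j) - A j) / l j) = 0"
  using weak[of A] unfolding An by simp
 then have 0: "(\<Sum>j<J. (v (nxt J j) - v j) \<bullet> (A (nxt J j) - A j) / l j) = 0" using dt by simp
 have "(\<Sum>j<J. (v (nxt J j) - v j) \<bullet> (A (nxt J j) - A j) / l j) =
  (\<Sum>j<J. (norm (A (nxt J j) - A j))^2 / l j + (V (nxt J j) - V j) \<bullet> (A (nxt J j) - A j) / l j + (g j * \<beta> (nxt J j) * \<alpha> j - g j * \<beta> j * \<alpha> (nxt J j)))"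
 proof (rule sum.cong)
  fix j assume "j \<in> {..<J}"
  then have j: "j < J" by simp
  let ?n = "nxt J j"
  define B where "B = (%j. \<beta> j *\<^sub>R rot (tb j))"
  have vs: "v i = V i + A i + B i" if "i < J" for i using z_split[OF that] unfolding z_def B_def by (simp add: algebra_simps)
  have vd: "v ?n - v j = (A ?n - A j) + (V ?n - V j) + (B ?n - B j)" unfolding vs[OF j] vs[OF idx(2)] by simp
  \<comment> \<open>Products at a single node drop out because \<open>rot (tb j)\<close> is
    orthogonal to \<open>tb j\<close>.\<close>
  have BA: "(B ?n - B j) \<bullet> (A ?n - A j) = (rot (tb j) \<bullet> tb ?n) * (\<beta> ?n * \<alpha> j - \<beta> j * \<alpha> ?n)"
   unfolding B_def A_def using rot_inner_swap[of "tb ?n" "tb j"]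
   by (simp add: inner_diff_left inner_diff_right inner_commute algebra_simps)
  show "(v ?n - v j) \<bullet> (A ?n - A j) / l j = (norm (A ?n - A j))^2 / l j + (V ?n - V j) \<bullet> (A ?n - A j) / l j + (g j * \<beta> ?n * \<alpha> j - g j * \<beta> j * \<alpha> ?n)"
   unfolding vd inner_add_left BA g_def by (simp add: power2_norm_eq_inner add_divide_distrib algebra_simps diff_divide_distrib)
 qed simp
 also have "... = Q^2 + (\<Sum>j<J. (V (nxt J j) - V j) \<bullet> (A (nxt J j) - A j) / l j) + ((\<Sum>j<J. g j * \<beta> (nxt J j) * \<alpha> j) - (\<Sum>j<J. g j * \<beta> j * \<alpha> (nxt J j)))"
  unfolding Q_sq by (simp add: sum.distrib sum_subtractf)
 also have "(\<Sum>j<J. g j * \<beta> (nxt J j) * \<alpha> j) = (\<Sum>j<J. g (prv J (nxt J j)) * \<beta> (nxt J j) * \<alpha> (prv J (nxt J j)))"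
  by (rule sum.cong) auto
 also have "... = (\<Sum>j<J. g (prv J j) * \<beta> j * \<alpha> (prv J j))" by (rule sum_nxt)
 also have "(\<Sum>j<J. g (prv J j) * \<beta> j * \<alpha> (prv J j)) - (\<Sum>j<J. g j * \<beta> j * \<alpha> (nxt J j)) = (\<Sum>j<J. \<beta> j * (g (prv J j) * \<alpha> (prv J j) - g j * \<alpha> (nxt J j)))"
  unfolding sum_subtractf[symmetric] by (rule sum.cong) (simp_all add: algebra_simps)
 finally show ?thesis using 0 by linarith
qed

lemma \<Delta>\<alpha>: "j < J ==> \<bar>\<alpha> (nxt J j) - \<alpha> j\<bar> <= 2 * norm (A (nxt J j) - A j) + 12 * (K^2 * Q * r^4)"
proof -
 assume j: "j < J"
 let ?n = "nxt J j"
 have "(1/2)^2 <= (norm (tb ?n))^2" using tb(1)[OF idx(2), of j] unfolding power2_norm_eq_inner by (simp add: power2_eq_square)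
 then have half: "1/2 <= norm (tb ?n)" by (rule power2_le_imp_le) simp
 have "(\<alpha> ?n - \<alpha> j) *\<^sub>R tb ?n = (A ?n - A j) - \<alpha> j *\<^sub>R (tb ?n - tb j)" unfolding A_def by (simp add: algebra_simps)
 then have "\<bar>\<alpha> ?n - \<alpha> j\<bar> * norm (tb ?n) <= norm (A ?n - A j) + \<bar>\<alpha> j\<bar> * norm (tb ?n - tb j)"
  by (metis norm_scaleR norm_triangle_ineq4)
 also have "\<bar>\<alpha> j\<bar> * norm (tb ?n - tb j) <= (6 * K * Q) * (K * r^4)"
  using \<alpha>_bound[OF j] tb(3)[OF j] K Q_nonneg by (intro mult_mono) auto
 finally have "\<bar>\<alpha> ?n - \<alpha> j\<bar> * norm (tb ?n) <= norm (A ?n - A j) + 6 * (K^2 * Q * r^4)" by (simp add: power2_eq_square algebra_simps)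
 then have "2 * (\<bar>\<alpha> ?n - \<alpha> j\<bar> * norm (tb ?n)) <= 2 * (norm (A ?n - A j) + 6 * (K^2 * Q * r^4))" by (rule mult_left_mono) simp
 moreover have "\<bar>\<alpha> ?n - \<alpha> j\<bar> * (1/2) <= \<bar>\<alpha> ?n - \<alpha> j\<bar> * norm (tb ?n)" using half by (intro mult_left_mono) auto
 then have "\<bar>\<alpha> ?n - \<alpha> j\<bar> <= 2 * (\<bar>\<alpha> ?n - \<alpha> j\<bar> * norm (tb ?n))" by simp
 ultimately have "\<bar>\<alpha> ?n - \<alpha> j\<bar> <= 2 * (norm (A ?n - A j) + 6 * (K^2 * Q * r^4))" by (rule order_trans[rotated])
 then show ?thesis by (simp add: distrib_left)
qed

lemma g_bound: "j < J ==> \<bar>g j\<bar> <= K^2"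
proof -
 assume j: "j < J"
 have "rot (tb j) \<bullet> tb (nxt J j) = rot (tb j) \<bullet> (tb (nxt J j) - tb j)" by (simp add: inner_diff_right)
 then have "\<bar>rot (tb j) \<bullet> tb (nxt J j)\<bar> <= norm (rot (tb j)) * norm (tb (nxt J j) - tb j)" by (simp only: Cauchy_Schwarz_ineq2)
 also have "... <= 1 * (K * r^4)" using tb(2,3)[OF j] by (intro mult_mono) auto
 finally have "\<bar>g j\<bar> <= (K * r^4) / (r^4 / K)"
  unfolding g_def abs_divide using l(1)[OF j] l_pos[OF j] r K by (intro frac_le) auto
 then show ?thesis using r K by (simp add: power2_eq_square)
qed

text \<open>A discrete product rule: the jump of the curvature is O(r) by \<open>curv\<close>, and
  the jump of \<open>\<alpha>\<close> is bounded by increments of \<open>A\<close> up to a term of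
  order \<open>r^4 * Q\<close>.\<close>

lemma jump_bound:
 assumes j: "j < J"
 shows "\<bar>g (prv J j) * \<alpha> (prv J j) - g j * \<alpha> (nxt J j)\<bar> <= 30 * K^4 * Q * r
   + 2 * K^2 * norm (A (nxt J j) - A j) + 2 * K^2 * norm (A j - A (prv J j))"
proof -
 let ?p = "prv J j" and ?n = "nxt J j"
 have r4: "r^4 <= r" using r power_decreasing[of 1 4 r] by simp
 have np: "nxt J ?p = j" using j by simp
 have 1: "\<bar>(g ?p - g j) * \<alpha> ?p\<bar> <= (K * r) * (6 * K * Q)"
  unfolding abs_mult using curv[OF j] \<alpha>_bound[OF idx(1), of j] r K np unfolding g_def by (intro mult_mono) (auto simp: abs_minus_commute)
 have "\<bar>\<alpha> ?p - \<alpha> ?n\<bar> <= 2 * norm (A ?n - A j) + 2 * norm (A j - A ?p) + 24 * (K^2 * Q * r^4)"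
  using \<Delta>\<alpha>[OF j] \<Delta>\<alpha>[OF idx(1), of j] unfolding np by linarith
 also have "24 * (K^2 * Q * r^4) <= 24 * (K^2 * Q * r)" using r4 Q_nonneg by (intro mult_left_mono) auto
 finally have "\<bar>\<alpha> ?p - \<alpha> ?n\<bar> <= 2 * norm (A ?n - A j) + 2 * norm (A j - A ?p) + 24 * (K^2 * Q * r)" by simp
 then have 2: "\<bar>g j * (\<alpha> ?p - \<alpha> ?n)\<bar> <= K^2 * (2 * norm (A ?n - A j) + 2 * norm (A j - A ?p) + 24 * (K^2 * Q * r))"
  unfolding abs_mult using g_bound[OF j] by (intro mult_mono) auto
 have "g ?p * \<alpha> ?p - g j * \<alpha> ?n = (g ?p - g j) * \<alpha> ?p + g j * (\<alpha> ?p - \<alpha> ?n)" by (simp add: algebra_simps)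
 then have "\<bar>g ?p * \<alpha> ?p - g j * \<alpha> ?n\<bar> <= (K * r) * (6 * K * Q) + K^2 * (2 * norm (A ?n - A j) + 2 * norm (A j - A ?p) + 24 * (K^2 * Q * r))"
  using 1 2 by linarith
 also have "... = 6 * (K^2 * (Q * r)) + 24 * (K^4 * (Q * r)) + 2 * K^2 * norm (A ?n - A j) + 2 * K^2 * norm (A j - A ?p)"
  by (simp add: power2_eq_square power4_eq_xxxx algebra_simps)
 also have "K^2 * (Q * r) <= K^4 * (Q * r)" using K Q_nonneg r by (intro mult_right_mono power_increasing) auto
 finally show ?thesis by (simp add: algebra_simps)
qed

text \<open>Cauchy-Schwarz with the l2 norm O(r) of \<open>\<beta>\<close>. Against the constant
  part of the jumps, of size \<open>r * Q\<close>, the square root of the number of nodes costs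
  O(r^-2), and the powers of \<open>r\<close> just balance. The result is a bound of
  \<open>Q^2\<close> by a constant times \<open>Q\<close>.\<close>

lemma Q_bound: "Q <= 239 * K^8"
proof -
 have J1: "(\<Sum>j<J. (1::real)^2) <= (K / r^2)^2"
 proof -
  have "real J <= K / r^4" using JK r by (simp add: field_simps)
  also have "... <= K^2 / r^4" using K r by (intro divide_right_mono) (auto simp: power2_eq_square)
  also have "... = (K / r^2)^2" by (simp add: power_divide)
  finally show ?thesis by simp
 qed
 have A2: "(\<Sum>j<J. (norm (A (nxt J j) - A j))^2) <= (K * Q)^2"
 proof -
  have "K * r^4 * Q^2 <= K^2 * 1 * Q^2"
   using K r by (intro mult_right_mono mult_mono) (auto simp: power2_eq_square power_le_one)
  then show ?thesis using \<Delta>A_l2 by (simp add: power_mult_distrib)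
 qed
 have A3: "(\<Sum>j<J. (norm (A j - A (prv J j)))^2) <= (K * Q)^2"
 proof -
  have "(\<Sum>j<J. (norm (A j - A (prv J j)))^2) = (\<Sum>j<J. (norm (A (nxt J (prv J j)) - A (prv J j)))^2)"
   by (rule sum.cong) auto
  also have "... = (\<Sum>j<J. (norm (A (nxt J j) - A j))^2)" by (rule sum_prv)
  finally show ?thesis using A2 by simp
 qed
 have pos: "0 <= 7 * K^3 * r" "0 <= K / r^2" "0 <= K * Q" using K r Q_nonneg by auto
 have s1: "(\<Sum>j<J. \<bar>\<beta> j\<bar> * \<bar>1\<bar>) <= (7 * K^3 * r) * (K / r^2)" by (rule cauchy_schwarz_sum[OF \<beta>_bound J1 pos(1,2)])
 have s2: "(\<Sum>j<J. \<bar>\<beta> j\<bar> * \<bar>norm (A (nxt J j) - A j)\<bar>) <= (7 * K^3 * r) * (K * Q)" by (rule cauchy_schwarz_sum[OF \<beta>_bound A2 pos(1,3)])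
 have s3: "(\<Sum>j<J. \<bar>\<beta> j\<bar> * \<bar>norm (A j - A (prv J j))\<bar>) <= (7 * K^3 * r) * (K * Q)" by (rule cauchy_schwarz_sum[OF \<beta>_bound A3 pos(1,3)])
 have "- (\<Sum>j<J. \<beta> j * (g (prv J j) * \<alpha> (prv J j) - g j * \<alpha> (nxt J j)))
   <= (\<Sum>j<J. \<bar>\<beta> j\<bar> * (30 * K^4 * Q * r + 2 * K^2 * norm (A (nxt J j) - A j) + 2 * K^2 * norm (A j - A (prv J j))))"
  unfolding sum_negf[symmetric]
 proof (rule sum_mono)
  fix j assume "j \<in> {..<J}"
  then have j: "j < J" by simp
  have "- (\<beta> j * (g (prv J j) * \<alpha> (prv J j) - g j * \<alpha> (nxt J j))) <= \<bar>\<beta> j * (g (prv J j) * \<alpha> (prv J j) - g j * \<alpha> (nxt J j))\<bar>"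
   by (rule abs_ge_minus_self)
  also have "... <= \<bar>\<beta> j\<bar> * (30 * K^4 * Q * r + 2 * K^2 * norm (A (nxt J j) - A j) + 2 * K^2 * norm (A j - A (prv J j)))"
   unfolding abs_mult by (rule mult_left_mono[OF jump_bound[OF j]]) simp
  finally show "- (\<beta> j * (g (prv J j) * \<alpha> (prv J j) - g j * \<alpha> (nxt J j))) <= ..." .
 qed
 also have "... = 30 * K^4 * Q * r * (\<Sum>j<J. \<bar>\<beta> j\<bar> * \<bar>1\<bar>) + 2 * K^2 * (\<Sum>j<J. \<bar>\<beta> j\<bar> * \<bar>norm (A (nxt J j) - A j)\<bar>) + 2 * K^2 * (\<Sum>j<J. \<bar>\<beta> j\<bar> * \<bar>norm (A j - A (prv J j))\<bar>)"
  by (simp add: sum_distrib_left sum.distrib algebra_simps)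
 also have "... <= 30 * K^4 * Q * r * ((7 * K^3 * r) * (K / r^2)) + 2 * K^2 * ((7 * K^3 * r) * (K * Q)) + 2 * K^2 * ((7 * K^3 * r) * (K * Q))"
  using s1 s2 s3 K r Q_nonneg by (intro add_mono mult_left_mono) auto
 \<comment> \<open>210 = 30 * 7 and 28 = 2 * (2 * 7). Together with one unit from the exact velocity
   below this makes 239.\<close>
 also have "... = 210 * K^8 * Q + 28 * (K^6 * r * Q)" using r by (simp add: field_simps eval_nat_numeral)
 also have "K^6 * r * Q <= K^8 * 1 * Q" using K r Q_nonneg by (intro mult_right_mono mult_mono power_increasing) auto
 finally have X: "- (\<Sum>j<J. \<beta> j * (g (prv J j) * \<alpha> (prv J j) - g j * \<alpha> (nxt J j))) <= 238 * K^8 * Q" by (simp add: mult_ac)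
 have V2: "(\<Sum>j<J. (norm (V (nxt J j) - V j) / sqrt (l j))^2) <= (K^2)^2"
 proof -
  have "(norm (V (nxt J j) - V j) / sqrt (l j))^2 = (norm (V (nxt J j) - V j))^2 / l j" if "j < J" for j
   using l_pos[OF that] by (simp add: power_divide)
  then show ?thesis using V_energy by (simp cong: sum.cong_simp)
 qed
 have "- (\<Sum>j<J. (V (nxt J j) - V j) \<bullet> (A (nxt J j) - A j) / l j) <= (\<Sum>j<J. \<bar>norm (V (nxt J j) - V j) / sqrt (l j)\<bar> * \<bar>norm (A (nxt J j) - A j) / sqrt (l j)\<bar>)"
  unfolding sum_negf[symmetric]
 proof (rule sum_mono)
  fix j assume "j \<in> {..<J}"
  then have lp: "0 < l j" using l_pos by simp
  have "- ((V (nxt J j) - V j) \<bullet> (A (nxt J j) - A j)) <= norm (V (nxt J j) - V j) * norm (A (nxt J j) - A j)"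
   using Cauchy_Schwarz_ineq2[of "V (nxt J j) - V j" "A (nxt J j) - A j"] by linarith
  then have "- ((V (nxt J j) - V j) \<bullet> (A (nxt J j) - A j)) / l j <= norm (V (nxt J j) - V j) * norm (A (nxt J j) - A j) / l j"
   using lp by (intro divide_right_mono) auto
  also have "... = \<bar>norm (V (nxt J j) - V j) / sqrt (l j)\<bar> * \<bar>norm (A (nxt J j) - A j) / sqrt (l j)\<bar>" using lp by simp
  finally show "- ((V (nxt J j) - V j) \<bullet> (A (nxt J j) - A j) / l j) <= ..." by simp
 qed
 also have "... <= K^2 * Q" by (rule cauchy_schwarz_sum[OF V2 weighted_sq]) (use K Q_nonneg in auto)
 also have "... <= K^8 * Q" using K Q_nonneg by (intro mult_right_mono power_increasing) auto
 finally have "Q * Q <= (239 * K^8) * Q" using X Q_identity by (simp add: power2_eq_square)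
 then show ?thesis using Q_nonneg K by (cases "Q = 0") (auto simp: mult_le_cancel_right)
qed

text \<open>The common constant 60000 dominates 3 * 239 = 717, 239^2 = 57121 and 49.\<close>

lemma velocity_estimates:
 "!!j. j < J ==> v j = V j + A j + \<beta> j *\<^sub>R rot (tb j)"
 "!!j. j < J ==> norm (A j) <= 60000 * K^17"
 "(\<Sum>j<J. (norm (A (nxt J j) - A j))^2) <= 60000 * K^17 * r^4"
 "(\<Sum>j<J. (\<beta> j)^2) <= 60000 * K^17 * r^2"
proof -
 show "v j = V j + A j + \<beta> j *\<^sub>R rot (tb j)" if "j < J" for j
  using z_split[OF that] unfolding z_def by (simp add: algebra_simps)
 show "norm (A j) <= 60000 * K^17" if "j < J" for j
 proof -
  have "norm (A j) <= 3 * K * (239 * K^8)" using A_bound[OF that] mult_left_mono[OF Q_bound, of "3 * K"] K by linarith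
  also have "... = 717 * K^9" by (simp add: eval_nat_numeral)
  also have "... <= 60000 * K^17" using K by (intro mult_mono power_increasing) auto
  finally show ?thesis .
 qed
 have "K * r^4 * Q^2 <= K * r^4 * (239 * K^8)^2" using K r Q_bound Q_nonneg by (intro mult_left_mono power_mono) auto
 also have "... = 57121 * (K^17 * r^4)" by (simp add: eval_nat_numeral)
 also have "... <= 60000 * (K^17 * r^4)" using K r by (intro mult_right_mono) auto
 finally show "(\<Sum>j<J. (norm (A (nxt J j) - A j))^2) <= 60000 * K^17 * r^4" using \<Delta>A_l2 by simp
 have "(7 * K^3 * r)^2 = 49 * (K^6 * r^2)" by (simp add: eval_nat_numeral)
 also have "... <= 60000 * (K^17 * r^2)"
 proof -
  have "K^6 * r^2 <= K^17 * r^2" using K by (intro mult_right_mono power_increasing) auto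
  moreover have "0 <= K^17 * r^2" using K by simp
  ultimately show ?thesis by linarith
 qed
 finally show "(\<Sum>j<J. (\<beta> j)^2) <= 60000 * K^17 * r^2" using \<beta>_bound by simp
qed

end

section \<open>Geometry of a time level\<close>

lemma unit_vector_perturb:
 fixes a b :: "'a::real_normed_vector"
 assumes "a ~= 0" "b ~= 0"
 shows "norm ((1 / norm a) *\<^sub>R a - (1 / norm b) *\<^sub>R b) <= 2 * norm (a - b) / norm b"
proof -
 have a: "0 < norm a" and b: "0 < norm b" using assms by auto
 have "(1 / norm a) *\<^sub>R a - (1 / norm b) *\<^sub>R b = (1 / norm b) *\<^sub>R (a - b) + ((norm b - norm a) / (norm a * norm b)) *\<^sub>R a"
  using a b by (simp add: diff_divide_distrib scaleR_diff_left scaleR_diff_right)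
 also have "norm ... <= norm (a - b) / norm b + \<bar>norm b - norm a\<bar> / norm b"
  by (rule order_trans[OF norm_triangle_ineq]) (use a b in \<open>simp add: abs_mult\<close>)
 also have "... <= norm (a - b) / norm b + norm (a - b) / norm b"
  using b norm_triangle_ineq3[of b a] by (intro add_left_mono divide_right_mono) (auto simp: norm_minus_commute)
 finally show ?thesis by simp
qed

lemma sum_square_le3:
 fixes a b c :: real
 shows "(a + b + c)^2 <= 3 * (a^2 + b^2 + c^2)"
proof -
 have "0 <= (a - b)^2 + (a - c)^2 + (b - c)^2" by simp
 then show ?thesis by (simp add: power2_eq_square algebra_simps)
qed

lemma convex_combination_bound:
 fixes u w :: "'a::real_normed_vector"
 assumes "norm u <= M" "norm w <= M" "0 < a" "0 < b"
 shows "norm ((1 / (a + b)) *\<^sub>R (b *\<^sub>R u + a *\<^sub>R w)) <= M"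
proof -
 have "norm (b *\<^sub>R u + a *\<^sub>R w) <= b * M + a * M"
  by (rule order_trans[OF norm_triangle_ineq]) (use assms in \<open>auto intro!: add_mono mult_left_mono\<close>)
 then have "norm ((1 / (a + b)) *\<^sub>R (b *\<^sub>R u + a *\<^sub>R w)) <= (b * M + a * M) / (a + b)"
  using assms by (simp add: divide_right_mono)
 also have "... = M" using assms by (simp add: field_simps)
 finally show ?thesis .
qed

lemma rpow_mono:
 fixes r :: real
 assumes "0 <= r" "r <= 1" "n <= m" "0 <= c" "c <= C"
 shows "c * r ^ m <= C * r ^ n"
 using assms by (intro mult_mono power_decreasing) auto

text \<open>Exponents count powers of \<open>r\<close>, the fourth root of the mesh size h. The
  Lipschitz part of the induction hypothesis gives slopes of order h^(5/4), hence edge increments of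
  the error of order \<open>r^9\<close>; the H^1 part gives squared increments with a sum of order
  \<open>r^18\<close>. \<open>Tg\<close> and \<open>V\<close> stand for exact tangents and
  velocities at the nodes, \<open>a\<close> for arc lengths to first order.\<close>

locale level_geometry =
 fixes J :: nat and r K :: real and x q Tg V :: "nat => real^2" and a :: "nat => real"
 assumes x: "simple_closed_polygon J x" and q: "simple_closed_polygon J q"
  and r: "0 < r" and K: "1 <= K" and small: "40 * K^4 * r <= 1"
  and a: "!!j. j < J ==> r^4 / K <= a j" "!!j. j < J ==> a j <= K * r^4"
  and Tg: "!!j. j < J ==> norm (Tg j) = 1"
  and V: "!!j. j < J ==> norm (V j) <= K" "!!j. j < J ==> norm (V (nxt J j) - V j) <= K * r^4"
  and dT: "!!j. j < J ==> norm (Tg (nxt J j) - Tg j - a j *\<^sub>R V j) <= K * r^8"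
  and lq: "!!j. j < J ==> \<bar>edge_len J q j - a j\<bar> <= K * r^8"
  and tq: "!!j. j < J ==> norm (edge_dir J q j - Tg j - (a j / 2) *\<^sub>R V j) <= K * r^8"
  and e: "!!j. j < J ==> norm ((x (nxt J j) - q (nxt J j)) - (x j - q j)) <= K * r^9"
   "(\<Sum>j<J. (norm ((x (nxt J j) - q (nxt J j)) - (x j - q j)))^2) <= K * r^18"
  and JK: "real J * r^4 <= K"
  and turn: "!!e. norm e = 1 ==> \<exists>j<J. \<bar>Tg j \<bullet> e\<bar> <= K * r^4"
begin

definition "\<delta> j = norm ((x (nxt J j) - q (nxt J j)) - (x j - q j))"
abbreviation "l \<equiv> edge_len J x"
abbreviation "t \<equiv> edge_dir J x"
abbreviation "tb \<equiv> avg_dir J x"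

lemma J0: "0 < J" using x unfolding simple_closed_polygon_def by simp
lemma idx [simp]: "prv J j < J" "nxt J j < J" using J0 by auto
lemma Kpow: "1 <= K^n" "0 < K^n" using K by (auto intro: one_le_power zero_less_power)
lemma r1: "r <= 1"
 using small Kpow(1)[of 4] r mult_right_mono[of 1 "K^4" r] by linarith
lemma rpos: "0 < r^n" using r by simp
lemma \<delta>: "j < J ==> \<delta> j <= K * r^9" "0 <= \<delta> j"
 using e(1) unfolding \<delta>_def by auto
lemma up: "n <= m ==> 0 <= c ==> c <= C ==> c * r ^ m <= C * r ^ n"
 using rpow_mono[of r n m c C] r r1 by simp
lemma Kup: "n <= m ==> K^n <= K^m" using K by (rule power_increasing[rotated])
lemma r4: "4 * K^2 * r^4 <= 1"
proof -
 have "K^2 <= K^4" by (rule Kup) simp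
 then have "4 * K^2 <= 40 * K^4" using Kpow(2)[of 4] by linarith
 then have "4 * K^2 * r^4 <= (40 * K^4) * r^1" using Kpow(2)[of 2] by (intro up) auto
 also have "... = 40 * K^4 * r" by simp
 also have "... <= 1" by (rule small)
 finally show ?thesis .
qed

lemma l_gap: "j < J ==> \<bar>l j - a j\<bar> <= K * r^8 + \<delta> j" "j < J ==> \<bar>l j - a j\<bar> <= 2 * K * r^8"
proof -
 have "\<bar>l j - edge_len J q j\<bar> <= \<delta> j" unfolding edge_len_norm \<delta>_def
  by (rule order_trans[OF norm_triangle_ineq3]) (simp add: algebra_simps)
 then show g: "\<bar>l j - a j\<bar> <= K * r^8 + \<delta> j" if "j < J" using lq[OF that] by linarith
 have "K * r^9 <= K * r^8" using K by (intro up) auto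
 then show "\<bar>l j - a j\<bar> <= 2 * K * r^8" if "j < J" using g[OF that] \<delta>(1)[OF that] by linarith
qed

lemma r8: "2 * K * r^8 <= r^4 / (2 * K)"
proof -
 have "r^4 * (4 * K^2 * r^4) <= r^4 * 1" using r4 rpos[of 4] by (intro mult_left_mono) auto
 then have "2 * K * r^8 * (2 * K) <= r^4" by (simp add: power2_eq_square algebra_simps flip: power_add)
 then show ?thesis using K by (simp add: pos_le_divide_eq)
qed

lemma r8': "2 * K * r^8 <= K * r^4"
proof -
 have "r^4 / (2 * K) <= r^4 * K" using K rpos[of 4] mult_mono[of 1 K 1 K] by (simp add: field_simps)
 then show ?thesis using r8 by (simp add: mult.commute)
qed

lemma half: "r^4 / (2 * K) = r^4 / K / 2" by simp

lemma l_bounds: "j < J ==> r^4 / (2 * K) <= l j" "j < J ==> l j <= 2 * K * r^4"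
proof -
 assume j: "j < J"
 show "r^4 / (2 * K) <= l j" using l_gap(2)[OF j] a(1)[OF j] r8 half by linarith
 show "l j <= 2 * K * r^4" using l_gap(2)[OF j] a(2)[OF j] r8' by linarith
qed

lemma lq_lower: "j < J ==> r^4 / (2 * K) <= edge_len J q j"
 using lq[of j] a(1)[of j] r8 half K rpos[of 8] mult_nonneg_nonneg[of K "r^8"] by linarith

lemma t_gap:
 assumes j: "j < J"
 shows "norm (t j - edge_dir J q j) <= 4 * K * (\<delta> j / r^4)"
proof -
 have "norm (t j - edge_dir J q j) <= 2 * norm ((x (nxt J j) - x j) - (q (nxt J j) - q j)) / norm (q (nxt J j) - q j)"
  unfolding edge_dir_def edge_len_norm using edge_len_pos[OF x j] edge_len_pos[OF q j] unfolding edge_len_norm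
  by (intro unit_vector_perturb) auto
 also have "... = 2 * \<delta> j / edge_len J q j" unfolding \<delta>_def edge_len_norm by (simp add: algebra_simps)
 also have "... <= 2 * \<delta> j / (r^4 / (2 * K))"
  using lq_lower[OF j] edge_len_pos[OF q j] \<delta>(2)[of j] K rpos[of 4] by (intro divide_left_mono mult_pos_pos) auto
 also have "... = 4 * K * (\<delta> j / r^4)" by simp
 finally show ?thesis .
qed

text \<open>\<open>u\<close> and \<open>w\<close> are the residuals of the outgoing and the incoming
  edge direction at node \<open>j\<close> against the tangent turned by half an edge forwards and
  backwards.\<close>

definition "u j = t j - Tg j - (a j / 2) *\<^sub>R V j"
definition "w j = t (prv J j) - Tg j + (a (prv J j) / 2) *\<^sub>R V (prv J j)"

lemma u_bound: "j < J ==> norm (u j) <= K * r^8 + 4 * K * (\<delta> j / r^4)"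
proof -
 assume j: "j < J"
 have "u j = (edge_dir J q j - Tg j - (a j / 2) *\<^sub>R V j) + (t j - edge_dir J q j)" unfolding u_def by simp
 then show ?thesis using norm_triangle_mono[OF tq[OF j] t_gap[OF j]] by simp
qed

lemma w_bound: "j < J ==> norm (w j) <= 2 * K * r^8 + 4 * K * (\<delta> (prv J j) / r^4)"
proof -
 assume j: "j < J"
 let ?p = "prv J j"
 have "w j = u ?p - (Tg (nxt J ?p) - Tg ?p - a ?p *\<^sub>R V ?p)" unfolding w_def u_def using j
  by (simp add: algebra_simps flip: scaleR_add_left)
 then have "norm (w j) <= norm (u ?p) + norm (Tg (nxt J ?p) - Tg ?p - a ?p *\<^sub>R V ?p)"
  by (simp only: norm_triangle_ineq4)
 then show ?thesis using u_bound[OF idx(1), of j] dT[OF idx(1), of j] by linarith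
qed

lemma \<delta>_ratio: "j < J ==> 4 * K * (\<delta> j / r^4) <= 4 * K^2 * r^5"
proof -
 assume j: "j < J"
 have "\<delta> j / r^4 <= K * r^9 / r^4" using \<delta>(1)[OF j] rpos[of 4] by (intro divide_right_mono) auto
 also have "... = K * r^5" using r by (simp add: field_simps flip: power_add)
 finally have "4 * K * (\<delta> j / r^4) <= 4 * K * (K * r^5)" using K by (intro mult_left_mono) auto
 then show ?thesis by (simp add: power2_eq_square algebra_simps)
qed

lemma uw_bound: "j < J ==> norm (u j) <= 6 * K^2 * r^5" "j < J ==> norm (w j) <= 6 * K^2 * r^5"
proof -
 assume j: "j < J"
 have "K <= K^2" using Kup[of 1 2] by simp
 then have "2 * K * r^8 <= 2 * K^2 * r^5" using K by (intro up) auto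
 moreover have "0 <= K * r^8" using K r by simp
 ultimately show "norm (u j) <= 6 * K^2 * r^5" "norm (w j) <= 6 * K^2 * r^5"
  using u_bound[OF j] w_bound[OF j] \<delta>_ratio[OF j] \<delta>_ratio[OF idx(1), of j] by linarith+
qed

lemma Vp: "j < J ==> norm (V j - V (prv J j)) <= K * r^4"
 using V(2)[of "prv J j"] by simp

text \<open>The two half turns in \<open>u\<close> and \<open>w\<close> add up to the exact turning
  at the node. Besides these residuals, the defect comes from replacing the lengths \<open>a\<close>
  by true edge lengths and from comparing \<open>V\<close> at adjacent nodes.\<close>

lemma consistency_node:
 assumes j: "j < J"
 shows "norm (t j - t (prv J j) - ((l (prv J j) + l j) / 2) *\<^sub>R V j) <= 6 * K^2 * r^8 + 5 * K * (\<delta> j / r^4) + 5 * K * (\<delta> (prv J j) / r^4)"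
proof -
 let ?p = "prv J j"
 have eq: "t j - t ?p - ((l ?p + l j) / 2) *\<^sub>R V j = (u j - w j) + (((a j - l j) / 2) *\<^sub>R V j + ((a ?p - l ?p) / 2) *\<^sub>R V j) + (a ?p / 2) *\<^sub>R (V ?p - V j)"
  unfolding u_def w_def by (simp add: algebra_simps diff_divide_distrib add_divide_distrib)
 have h: "norm (((a i - l i) / 2) *\<^sub>R V j) <= K^2 * r^8 / 2 + K * (\<delta> i / r^4) / 2" if i: "i < J" for i
 proof -
  have "norm (((a i - l i) / 2) *\<^sub>R V j) = \<bar>l i - a i\<bar> / 2 * norm (V j)" by (simp add: abs_minus_commute)
  also have "... <= (K * r^8 + \<delta> i) / 2 * K" using l_gap(1)[OF i] V(1)[OF j] by (intro mult_mono) auto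
  also have "... = K^2 * r^8 / 2 + K * \<delta> i / 2" by (simp add: power2_eq_square algebra_simps add_divide_distrib)
  also have "... <= K^2 * r^8 / 2 + K * (\<delta> i / r^4) / 2"
  proof -
   have "\<delta> i * r^4 <= \<delta> i * 1" using \<delta>(2)[of i] r r1 by (intro mult_left_mono) (auto intro: power_le_one)
   then have "\<delta> i <= \<delta> i / r^4" using rpos[of 4] by (simp add: pos_le_divide_eq)
   then show ?thesis using K by (intro add_left_mono divide_right_mono mult_left_mono) auto
  qed
  finally show ?thesis .
 qed
 have v: "norm ((a ?p / 2) *\<^sub>R (V ?p - V j)) <= K^2 * r^8 / 2"
 proof -
  have ap: "0 <= a ?p" using a(1)[OF idx(1), of j] K rpos[of 4] by (smt (verit) divide_nonneg_pos)
  have "norm ((a ?p / 2) *\<^sub>R (V ?p - V j)) = a ?p / 2 * norm (V j - V ?p)" using ap by (simp add: norm_minus_commute)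
  also have "... <= (K * r^4) / 2 * (K * r^4)" using a(2)[OF idx(1), of j] Vp[OF j] ap by (intro mult_mono) auto
  also have "... = K^2 * r^8 / 2" by (simp add: power2_eq_square algebra_simps flip: power_add)
  finally show ?thesis .
 qed
 have "norm (t j - t ?p - ((l ?p + l j) / 2) *\<^sub>R V j) <= (norm (u j) + norm (w j)) + (norm (((a j - l j) / 2) *\<^sub>R V j) + norm (((a ?p - l ?p) / 2) *\<^sub>R V j)) + norm ((a ?p / 2) *\<^sub>R (V ?p - V j))"
  unfolding eq by (intro norm_triangle_mono norm_triangle_ineq4 order_refl)
 moreover have "K * r^8 <= K^2 * r^8" using Kup[of 1 2] K by (intro up) auto
 moreover have "0 <= K^2 * r^8" by simp
 moreover define X Y where "X = K * (\<delta> j / r^4)" and "Y = K * (\<delta> ?p / r^4)"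
 moreover have "0 <= X" "0 <= Y" unfolding X_def Y_def using \<delta>(2) K rpos[of 4] by auto
 moreover have "norm (u j) <= K * r^8 + 4 * X" "norm (w j) <= 2 * (K * r^8) + 4 * Y"
  using u_bound[OF j] w_bound[OF j] unfolding X_def Y_def by (simp_all only: mult.assoc)
 ultimately have "norm (t j - t ?p - ((l ?p + l j) / 2) *\<^sub>R V j) <= 6 * (K^2 * r^8) + 5 * X + 5 * Y"
  using h[OF j, folded X_def] h[OF idx(1), of j, folded Y_def] v by linarith
 then show ?thesis unfolding X_def Y_def by (simp only: mult.assoc)
qed

text \<open>The dominant part is the squared edge increments of the error divided by
  \<open>r^12\<close>: \<open>r^8\<close> from normalising edge directions and \<open>r^4\<close>
  from the masses. With a sum of order \<open>r^18\<close> this gives \<open>r^6\<close>.\<close>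

lemma consistency: "(\<Sum>j<J. (norm (t j - t (prv J j) - ((l (prv J j) + l j) / 2) *\<^sub>R V j))^2 / ((l (prv J j) + l j) / 2)) <= 1000 * K^9 * r^6"
proof -
 have node: "(norm (t j - t (prv J j) - ((l (prv J j) + l j) / 2) *\<^sub>R V j))^2 / ((l (prv J j) + l j) / 2)
   <= 216 * (K^5 * r^12) + 150 * (K^3 / r^12) * (\<delta> j)^2 + 150 * (K^3 / r^12) * (\<delta> (prv J j))^2" (is "?n^2 / ?m <= _") if j: "j < J" for j
 proof -
  let ?A = "6 * K^2 * r^8" and ?B = "5 * K * (\<delta> j / r^4)" and ?C = "5 * K * (\<delta> (prv J j) / r^4)"
  have mean: "c <= (a + b) / 2" if "c <= a" "c <= b" for a b c :: real using that by simp
  have m: "r^4 / (2 * K) <= ?m" by (rule mean[OF l_bounds(1)[OF idx(1)] l_bounds(1)[OF j]])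
  have mp: "0 < r^4 / (2 * K)" using rpos[of 4] K by simp
  have "?n^2 <= (?A + ?B + ?C)^2" by (rule power_mono[OF consistency_node[OF j]]) simp
  also have "... <= 3 * (?A^2 + ?B^2 + ?C^2)"
   by (rule sum_square_le3)
  finally have s: "?n^2 <= 3 * (?A^2 + ?B^2 + ?C^2)" .
  have "?n^2 / ?m <= 3 * (?A^2 + ?B^2 + ?C^2) / (r^4 / (2 * K))"
   by (rule frac_le[OF _ s mp m]) simp
  \<comment> \<open>216 = 3 * 36 * 2 and 150 = 3 * 25 * 2, where the last factor stems from the
    lower bound for the masses.\<close>
  also have "... = 216 * (K^5 * r^12) + 150 * (K^3 / r^12) * (\<delta> j)^2 + 150 * (K^3 / r^12) * (\<delta> (prv J j))^2"
   using r K by (simp add: power_mult_distrib power_divide field_simps flip: power_add power_mult) (simp add: power_numeral_reduce)?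
  finally show ?thesis .
 qed
 have S: "(\<Sum>j<J. (\<delta> j)^2) <= K * r^18" using e(2) unfolding \<delta>_def .
 have S': "(\<Sum>j<J. (\<delta> (prv J j))^2) <= K * r^18" using S sum_prv[of "%j. (\<delta> j)^2" J] by simp
 have "(\<Sum>j<J. (norm (t j - t (prv J j) - ((l (prv J j) + l j) / 2) *\<^sub>R V j))^2 / ((l (prv J j) + l j) / 2))
   <= (\<Sum>j<J. 216 * (K^5 * r^12) + 150 * (K^3 / r^12) * (\<delta> j)^2 + 150 * (K^3 / r^12) * (\<delta> (prv J j))^2)"
  using node by (intro sum_mono) auto
 also have "... = 216 * (K^5 * r^8) * (real J * r^4) + 150 * (K^3 / r^12) * (\<Sum>j<J. (\<delta> j)^2) + 150 * (K^3 / r^12) * (\<Sum>j<J. (\<delta> (prv J j))^2)"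
  by (simp add: sum.distrib sum_distrib_left sum_divide_distrib algebra_simps flip: power_add)
 also have "... <= 216 * (K^5 * r^8) * K + 150 * (K^3 / r^12) * (K * r^18) + 150 * (K^3 / r^12) * (K * r^18)"
  using JK S S' Kpow[of 5] Kpow[of 3] rpos[of 8] rpos[of 12] by (intro add_mono mult_left_mono) auto
 also have "... = 216 * K^6 * r^8 + 300 * K^4 * r^6"
 proof -
  have "r^18 = r^12 * r^6" by (simp flip: power_add)
  then show ?thesis using r by (simp add: power_numeral_reduce)
 qed
 also have "... <= 216 * K^9 * r^6 + 300 * K^9 * r^6"
  using Kup[of 6 9] Kup[of 4 9] Kpow(2)[of 6] Kpow(2)[of 4] by (intro add_mono up) auto
 also have "... <= 1000 * K^9 * r^6" using Kpow(2)[of 9] rpos[of 6] mult_pos_pos[of "K^9" "r^6"] by (simp add: algebra_simps)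
 finally show ?thesis .
qed

lemma lpos: "j < J ==> 0 < l j" by (rule edge_len_pos[OF x])

text \<open>The crossed weights make the first-order deviations of the two edge directions cancel up
  to \<open>Z\<close>: each direction is off by O(r^4), the average only by the residuals, which are
  O(r^5).\<close>

lemma tb_T:
 assumes j: "j < J"
 shows "norm (tb j - Tg j) <= 9 * K^4 * r^5"
proof -
 let ?p = "prv J j"
 let ?s = "l ?p + l j"
 have p: "0 < l ?p" "0 < l j" using lpos[OF idx(1)] lpos[OF j] by auto
 define Z where "Z = (l ?p - a ?p) *\<^sub>R (a j *\<^sub>R V j) - (l j - a j) *\<^sub>R (a ?p *\<^sub>R V ?p) + (a ?p * a j) *\<^sub>R (V j - V ?p)"
 have "?s *\<^sub>R Tg j = l j *\<^sub>R Tg j + l ?p *\<^sub>R Tg j" by (simp add: algebra_simps)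
 then have T: "Tg j = (1 / ?s) *\<^sub>R (l j *\<^sub>R Tg j + l ?p *\<^sub>R Tg j)" using p by (metis add_pos_pos less_irrefl nonzero_divide_eq_eq real_vector.scale_one scaleR_scaleR)
 have "tb j - Tg j = (1 / ?s) *\<^sub>R (l j *\<^sub>R w j + l ?p *\<^sub>R u j) + (1 / (2 * ?s)) *\<^sub>R Z"
 proof -
  have "tb j - Tg j = (1 / ?s) *\<^sub>R ((l j *\<^sub>R t ?p + l ?p *\<^sub>R t j) - (l j *\<^sub>R Tg j + l ?p *\<^sub>R Tg j))"
   unfolding avg_dir_def scaleR_diff_right T[symmetric] ..
  also have "(l j *\<^sub>R t ?p + l ?p *\<^sub>R t j) - (l j *\<^sub>R Tg j + l ?p *\<^sub>R Tg j) = (l j *\<^sub>R w j + l ?p *\<^sub>R u j) + (1/2) *\<^sub>R Z"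
   unfolding w_def u_def Z_def by (simp add: algebra_simps)
  finally show ?thesis by (simp add: scaleR_add_right)
 qed
 moreover have "norm ((1 / ?s) *\<^sub>R (l j *\<^sub>R w j + l ?p *\<^sub>R u j)) <= 6 * K^2 * r^5"
  by (rule convex_combination_bound[OF uw_bound(2)[OF j] uw_bound(1)[OF j] p])
 moreover have "norm ((1 / (2 * ?s)) *\<^sub>R Z) <= 3 * K^4 * r^8"
 proof -
  have ab: "0 <= a i" "a i <= K * r^4" "norm (a i *\<^sub>R V i) <= K^2 * r^4" if i: "i < J" for i
  proof -
   show a0: "0 <= a i" using a(1)[OF i] K rpos[of 4] by (smt (verit) divide_nonneg_pos)
   show "a i <= K * r^4" by (rule a(2)[OF i])
   have "norm (a i *\<^sub>R V i) = a i * norm (V i)" using a0 by simp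
   also have "... <= (K * r^4) * K" using a0 a(2)[OF i] V(1)[OF i] by (intro mult_mono) auto
   finally show "norm (a i *\<^sub>R V i) <= K^2 * r^4" by (simp add: power2_eq_square algebra_simps)
  qed
  have 1: "norm ((l i - a i) *\<^sub>R (a k *\<^sub>R V k)) <= (2 * K * r^8) * (K^2 * r^4)" if "i < J" "k < J" for i k
   unfolding norm_scaleR[of "l i - a i"] using l_gap(2)[OF that(1)] ab(3)[OF that(2)] by (intro mult_mono) auto
  have 2: "norm ((a ?p * a j) *\<^sub>R (V j - V ?p)) <= (K * r^4 * (K * r^4)) * (K * r^4)"
   unfolding norm_scaleR abs_mult using ab(1,2)[OF idx(1), of j] ab(1,2)[OF j] Vp[OF j] K rpos[of 4]
   by (intro mult_mono) auto
  have "norm Z <= (2 * K * r^8) * (K^2 * r^4) + (2 * K * r^8) * (K^2 * r^4) + (K * r^4 * (K * r^4)) * (K * r^4)"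
   unfolding Z_def
   by (rule norm_triangle_mono[OF order_trans[OF norm_triangle_ineq4 add_mono[OF 1[OF idx(1) j] 1[OF j idx(1)]]] 2])
  also have "... = 5 * K^3 * r^12" by (simp add: power_numeral_reduce)
  finally have Z: "norm Z <= 5 * K^3 * r^12" .
  have sl: "2 * r^4 / K <= 2 * ?s" using l_bounds(1)[OF j] l_bounds(1)[OF idx(1), of j] half by (simp add: field_simps)
  have "norm ((1 / (2 * ?s)) *\<^sub>R Z) = norm Z / (2 * ?s)" using p by simp
  also have "... <= 5 * K^3 * r^12 / (2 * r^4 / K)"
   using Z sl K r by (intro frac_le) auto
  also have "... = 5 / 2 * (K^4 * r^8)" using r K by (simp add: power_numeral_reduce)
  also have "... <= 3 * K^4 * r^8" using Kpow(2)[of 4] rpos[of 8] mult_pos_pos[of "K^4" "r^8"] by simp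
  finally show ?thesis .
 qed
 moreover have "6 * K^2 * r^5 <= 6 * K^4 * r^5" using Kup[of 2 4] Kpow(2)[of 2] by (intro up) auto
 moreover have "3 * K^4 * r^8 <= 3 * K^4 * r^5" using Kpow(2)[of 4] by (intro up) auto
 ultimately show ?thesis using norm_triangle_le[of "(1 / ?s) *\<^sub>R (l j *\<^sub>R w j + l ?p *\<^sub>R u j)" "(1 / (2 * ?s)) *\<^sub>R Z" "9 * K^4 * r^5"] by simp
qed

lemma r5: "9 * K^4 * r^5 <= 9 / 40" "40 * K^4 * r^4 <= 1"
proof -
 have "9 * K^4 * r^5 <= (9 * K^4) * r^1" using Kpow(2)[of 4] by (intro up) auto
 then show "9 * K^4 * r^5 <= 9 / 40" using small by simp
 have "40 * K^4 * r^4 <= (40 * K^4) * r^1" using Kpow(2)[of 4] by (intro up) auto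
 then show "40 * K^4 * r^4 <= 1" using small by simp
qed

lemma tb_bounds: "j < J ==> 1 / 4 <= tb j \<bullet> tb j" "j < J ==> norm (tb j) <= 1"
proof -
 assume j: "j < J"
 have "norm (Tg j) <= norm (tb j) + norm (tb j - Tg j)" using norm_triangle_ineq4[of "tb j" "tb j - Tg j"] by simp
 then have "1 / 2 <= norm (tb j)" using Tg[OF j] tb_T[OF j] r5(1) by linarith
 then have "(1/2)^2 <= (norm (tb j))^2" by (rule power_mono) simp
 then show "1 / 4 <= tb j \<bullet> tb j" by (simp add: power2_norm_eq_inner power_divide)
 show "norm (tb j) <= 1" unfolding avg_dir_def
  using edge_dir_norm[OF x idx(1)] edge_dir_norm[OF x j] lpos[OF j] lpos[OF idx(1)]
  by (intro convex_combination_bound) simp_all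
qed

lemma dT_bound: "j < J ==> norm (Tg (nxt J j) - Tg j) <= 2 * K^2 * r^4"
proof -
 assume j: "j < J"
 have a0: "0 <= a j" using a(1)[OF j] K rpos[of 4] by (smt (verit) divide_nonneg_pos)
 have "norm (a j *\<^sub>R V j) <= (K * r^4) * K" unfolding norm_scaleR using a0 a(2)[OF j] V(1)[OF j] by (intro mult_mono) auto
 then have "norm (a j *\<^sub>R V j) <= K^2 * r^4" by (simp add: power2_eq_square algebra_simps)
 moreover have "K * r^8 <= K^2 * r^4" using Kup[of 1 2] K by (intro up) auto
 moreover have "norm (Tg (nxt J j) - Tg j) <= norm (Tg (nxt J j) - Tg j - a j *\<^sub>R V j) + norm (a j *\<^sub>R V j)"
  using norm_triangle_ineq[of "Tg (nxt J j) - Tg j - a j *\<^sub>R V j" "a j *\<^sub>R V j"] by simp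
 ultimately show ?thesis using dT[OF j] by linarith
qed

lemma dtb: "j < J ==> norm (tb (nxt J j) - tb j) <= 20 * K^4 * r^4"
proof -
 assume j: "j < J"
 have eq: "tb (nxt J j) - tb j = (Tg (nxt J j) - Tg j) + ((tb (nxt J j) - Tg (nxt J j)) - (tb j - Tg j))" by simp
 have "norm (tb (nxt J j) - tb j) <= 2 * K^2 * r^4 + (9 * K^4 * r^5 + 9 * K^4 * r^5)"
  unfolding eq by (rule norm_triangle_mono[OF dT_bound[OF j] order_trans[OF norm_triangle_ineq4 add_mono[OF tb_T[OF idx(2)] tb_T[OF j]]]])
 also have "... <= 2 * K^4 * r^4 + (9 * K^4 * r^4 + 9 * K^4 * r^4)"
  using Kup[of 2 4] Kpow(2)[of 4] by (intro add_mono up) auto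
 finally show ?thesis by simp
qed

text \<open>Two unit vectors at distance at most 1 have a positive inner product; this is what the
  comparison of adjacent outward normals needs.\<close>

lemma turning: "j < J ==> 0 < t j \<bullet> t (nxt J j)"
proof -
 assume j: "j < J"
 let ?n = "nxt J j"
 have n: "prv J ?n = j" using j by simp
 have eq: "t ?n - t j = (u ?n - w ?n) + ((a ?n / 2) *\<^sub>R V ?n + (a j / 2) *\<^sub>R V j)"
  unfolding u_def w_def n by (simp add: algebra_simps)
 have av: "norm ((a i / 2) *\<^sub>R V i) <= K^2 * r^4 / 2" if i: "i < J" for i
 proof -
  have a0: "0 <= a i" using a(1)[OF i] K rpos[of 4] by (smt (verit) divide_nonneg_pos)
  have "norm ((a i / 2) *\<^sub>R V i) <= (K * r^4 / 2) * K" unfolding norm_scaleR using a0 a(2)[OF i] V(1)[OF i] by (intro mult_mono) auto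
  then show ?thesis by (simp add: power2_eq_square algebra_simps)
 qed
 have "norm (t ?n - t j) <= (6 * K^2 * r^5 + 6 * K^2 * r^5) + (K^2 * r^4 / 2 + K^2 * r^4 / 2)"
  unfolding eq by (intro norm_triangle_mono order_trans[OF norm_triangle_ineq4 add_mono] uw_bound av) (simp_all add: j)
 also have "... <= (6 * K^4 * r^4 + 6 * K^4 * r^4) + (K^4 * r^4 / 2 + K^4 * r^4 / 2)"
  using Kup[of 2 4] Kpow(2)[of 4] Kpow(2)[of 2] by (intro add_mono up divide_right_mono) auto
 also have "... <= 1" using r5(2) by simp
 finally have "(norm (t ?n - t j))^2 <= 1^2" by (intro power_mono) auto
 moreover have "(norm (t ?n - t j))^2 = 1 + 1 - 2 * (t j \<bullet> t ?n)"
  using edge_dir_norm[OF x j] edge_dir_norm[OF x idx(2), of j]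
  by (simp add: power2_norm_eq_inner inner_diff_left inner_diff_right inner_commute norm_eq_1)
 ultimately show ?thesis by simp
qed

text \<open>Expanding \<open>tb\<close> around the exact tangent leaves the edge length times
  \<open>rot (Tg j)\<close> paired with \<open>V j\<close>, the signed curvature. The error O(r^5)
  of averaged directions over an edge length of order \<open>r^4\<close> gives the order
  \<open>r\<close>.\<close>

lemma curvature_node:
 assumes j: "j < J"
 shows "\<bar>rot (tb j) \<bullet> tb (nxt J j) / l j - rot (Tg j) \<bullet> V j\<bar> <= 402 * K^9 * r"
proof -
 let ?n = "nxt J j"
 let ?\<kappa> = "rot (Tg j) \<bullet> V j"
 have eq: "rot (tb j) \<bullet> tb ?n - l j * ?\<kappa> = rot (Tg j) \<bullet> (Tg ?n - Tg j - a j *\<^sub>R V j) + (a j - l j) * ?\<kappa>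
   + rot (Tg j) \<bullet> ((tb ?n - Tg ?n) - (tb j - Tg j)) + rot (tb j - Tg j) \<bullet> (tb ?n - tb j)"
  by (simp add: rot_diff inner_diff_right inner_diff_left algebra_simps)
 have 1: "\<bar>rot (Tg j) \<bullet> (Tg ?n - Tg j - a j *\<^sub>R V j)\<bar> <= K * r^8"
  by (rule order_trans[OF Cauchy_Schwarz_ineq2]) (simp add: Tg[OF j] dT[OF j])
 have \<kappa>: "\<bar>?\<kappa>\<bar> <= K" by (rule order_trans[OF Cauchy_Schwarz_ineq2]) (simp add: Tg[OF j] V(1)[OF j])
 have 2: "\<bar>(a j - l j) * ?\<kappa>\<bar> <= (2 * K * r^8) * K"
  unfolding abs_mult using l_gap(2)[OF j] \<kappa> by (intro mult_mono) auto
 have 3: "\<bar>rot (Tg j) \<bullet> ((tb ?n - Tg ?n) - (tb j - Tg j))\<bar> <= 9 * K^4 * r^5 + 9 * K^4 * r^5"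
  by (rule order_trans[OF Cauchy_Schwarz_ineq2])
   (simp add: Tg[OF j], use order_trans[OF norm_triangle_ineq4 add_mono[OF tb_T[OF idx(2)] tb_T[OF j]]] in simp)
 have 4: "\<bar>rot (tb j - Tg j) \<bullet> (tb ?n - tb j)\<bar> <= (9 * K^4 * r^5) * (20 * K^4 * r^4)"
  by (rule order_trans[OF Cauchy_Schwarz_ineq2]) (use mult_mono[OF tb_T[OF j] dtb[OF j]] Kpow(2)[of 4] r in simp)
 have e2: "(2 * K * r^8) * K = 2 * K^2 * r^8" "(9 * K^4 * r^5) * (20 * K^4 * r^4) = 180 * K^8 * r^9" by (simp_all add: power_numeral_reduce)
 have "\<bar>rot (tb j) \<bullet> tb ?n - l j * ?\<kappa>\<bar> <= K * r^8 + (2 * K * r^8) * K + (9 * K^4 * r^5 + 9 * K^4 * r^5) + (9 * K^4 * r^5) * (20 * K^4 * r^4)"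
  unfolding eq using 1 2 3 4 by linarith
 also have "... <= K^8 * r^5 + 2 * K^8 * r^5 + (9 * K^8 * r^5 + 9 * K^8 * r^5) + 180 * K^8 * r^5"
  unfolding e2 using Kup[of 1 8] Kup[of 2 8] Kup[of 4 8] Kpow(2)[of 8] Kpow(2)[of 4] Kpow(2)[of 2] K
  by (intro add_mono up) auto
 also have "... = 201 * K^8 * r^5" by simp
 finally have b: "\<bar>rot (tb j) \<bullet> tb ?n - l j * ?\<kappa>\<bar> <= 201 * K^8 * r^5" .
 have "\<bar>rot (tb j) \<bullet> tb ?n / l j - ?\<kappa>\<bar> = \<bar>rot (tb j) \<bullet> tb ?n - l j * ?\<kappa>\<bar> / l j"
  (is "?L = _")
 proof -
  have "rot (tb j) \<bullet> tb ?n / l j - ?\<kappa> = (rot (tb j) \<bullet> tb ?n - l j * ?\<kappa>) / l j"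
   using lpos[OF j] by (simp add: diff_divide_distrib)
  then show ?thesis using lpos[OF j] by (simp only: abs_divide abs_of_pos)
 qed
 also have "... <= 201 * K^8 * r^5 / (r^4 / (2 * K))"
  using b l_bounds(1)[OF j] r K by (intro frac_le) auto
 also have "... = 402 * K^9 * r" using r K by (simp add: power_numeral_reduce)
 finally show ?thesis .
qed

lemma curvature:
 assumes j: "j < J"
 shows "\<bar>rot (tb j) \<bullet> tb (nxt J j) / l j - rot (tb (prv J j)) \<bullet> tb j / l (prv J j)\<bar> <= 1000 * K^9 * r"
proof -
 let ?p = "prv J j"
 have n: "nxt J ?p = j" using j by simp
 have eq: "rot (Tg j) \<bullet> V j - rot (Tg ?p) \<bullet> V ?p = rot (Tg j) \<bullet> (V j - V ?p) + rot (Tg j - Tg ?p) \<bullet> V ?p"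
  by (simp add: rot_diff inner_diff_right inner_diff_left)
 have 1: "\<bar>rot (Tg j) \<bullet> (V j - V ?p)\<bar> <= K * r^4"
  by (rule order_trans[OF Cauchy_Schwarz_ineq2]) (simp add: Tg[OF j] Vp[OF j])
 have 2: "\<bar>rot (Tg j - Tg ?p) \<bullet> V ?p\<bar> <= (2 * K^2 * r^4) * K"
  by (rule order_trans[OF Cauchy_Schwarz_ineq2]) (use mult_mono[OF dT_bound[OF idx(1), of j] V(1)[OF idx(1), of j]] n in simp)
 have e2: "(2 * K^2 * r^4) * K = 2 * K^3 * r^4" by (simp add: power_numeral_reduce)
 have "\<bar>rot (Tg j) \<bullet> V j - rot (Tg ?p) \<bullet> V ?p\<bar> <= K * r^4 + 2 * K^3 * r^4" unfolding eq using 1 2 e2 by linarith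
 also have "... <= K^9 * r^1 + 2 * K^9 * r^1" using Kup[of 1 9] Kup[of 3 9] Kpow(2)[of 3] K by (intro add_mono up) auto
 finally have "\<bar>rot (Tg j) \<bullet> V j - rot (Tg ?p) \<bullet> V ?p\<bar> <= 3 * K^9 * r" by (simp add: mult.commute)
 moreover have "0 <= K^9 * r" using Kpow(2)[of 9] r by simp
 ultimately show ?thesis using curvature_node[OF j] curvature_node[OF idx(1), of j] unfolding n by linarith
qed

lemma turn_tb:
 assumes "norm e = 1"
 shows "\<exists>j<J. \<bar>tb j \<bullet> e\<bar> <= 1 / 4"
proof -
 obtain j where j: "j < J" "\<bar>Tg j \<bullet> e\<bar> <= K * r^4" using turn[OF assms] by blast
 have "\<bar>(tb j - Tg j) \<bullet> e\<bar> <= 9 * K^4 * r^5"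
  by (rule order_trans[OF Cauchy_Schwarz_ineq2]) (simp add: assms tb_T[OF j(1)])
 moreover have "tb j \<bullet> e = Tg j \<bullet> e + (tb j - Tg j) \<bullet> e" by (simp add: inner_diff_left)
 moreover have "K * r^4 <= K^4 * r^4" using Kup[of 1 4] K by (intro up) auto
 ultimately have "\<bar>tb j \<bullet> e\<bar> <= 1 / 4" using j(2) r5 by linarith
 then show ?thesis using j(1) by blast
qed

lemma Kbig: "K <= 1000 * K^9" "2 * K <= 1000 * K^9" "20 * K^4 <= 1000 * K^9"
 using Kup[of 1 9] Kup[of 4 9] Kpow(2)[of 9] by (simp_all add: K)

lemma velocity_bounds:
 assumes sch: "scheme_step J dt x y" and dt: "0 < dt" "dt <= K * r^8"
 obtains A \<beta> where "!!j. j < J ==> (1 / dt) *\<^sub>R (y j - x j) = V j + A j + \<beta> j *\<^sub>R rot (tb j)"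
  "!!j. j < J ==> norm (A j) <= 60000 * (1000 * K^9)^17"
  "(\<Sum>j<J. (norm (A (nxt J j) - A j))^2) <= 60000 * (1000 * K^9)^17 * r^4"
  "(\<Sum>j<J. (\<beta> j)^2) <= 60000 * (1000 * K^9)^17 * r^2"
proof -
 obtain \<epsilon> :: real where \<epsilon>: "\<epsilon> \<in> {1, -1}" and weak: "!!\<phi>. (\<Sum>j<J. node_mass J x j * ((1 / dt) *\<^sub>R (y j - x j) \<bullet> (\<epsilon> *\<^sub>R rot (avg_dir J x j))) * (\<phi> j \<bullet> (\<epsilon> *\<^sub>R rot (avg_dir J x j))))
    + dt * (\<Sum>j<J. ((1 / dt) *\<^sub>R (y (nxt J j) - x (nxt J j)) - (1 / dt) *\<^sub>R (y j - x j)) \<bullet> (\<phi> (nxt J j) - \<phi> j) / edge_len J x j)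
   = (\<Sum>j<J. ((edge_dir J x j - edge_dir J x (prv J j)) \<bullet> (\<epsilon> *\<^sub>R rot (avg_dir J x j))) * (\<phi> j \<bullet> (\<epsilon> *\<^sub>R rot (avg_dir J x j))))"
  using scheme_weak[OF x sch dt(1) turning] by blast
 \<comment> \<open>The constant \<open>1000 * K^9\<close> serves every hypothesis of
   \<open>velocity_data\<close>; it is dictated by \<open>consistency\<close> and
   \<open>curvature\<close>.\<close>
 interpret vd: velocity_data J dt r "1000 * K^9" \<epsilon> l t tb V "%j. (1 / dt) *\<^sub>R (y j - x j)"
 proof
  have up': "c * r^n <= 1000 * K^9 * r^n" if "c <= 1000 * K^9" for c n using that rpos[of n] by (intro mult_right_mono) auto
  show "0 < J" by (rule J0)
  show "0 < r" "r <= 1" using r r1 by auto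
  show "1 <= 1000 * K^9" using Kpow(1)[of 9] by simp
  show "0 < dt" by (rule dt(1))
  show "dt <= 1000 * K^9 * r^8" using dt(2) up'[OF Kbig(1), of 8] by linarith
  show "\<epsilon> \<in> {1, -1}" by (rule \<epsilon>)
  show "(\<Sum>j<J. (l (prv J j) + l j) / 2 * ((1 / dt) *\<^sub>R (y j - x j) \<bullet> (\<epsilon> *\<^sub>R rot (tb j))) * (\<phi> j \<bullet> (\<epsilon> *\<^sub>R rot (tb j))))
    + dt * (\<Sum>j<J. ((1 / dt) *\<^sub>R (y (nxt J j) - x (nxt J j)) - (1 / dt) *\<^sub>R (y j - x j)) \<bullet> (\<phi> (nxt J j) - \<phi> j) / l j)
   = (\<Sum>j<J. ((t j - t (prv J j)) \<bullet> (\<epsilon> *\<^sub>R rot (tb j))) * (\<phi> j \<bullet> (\<epsilon> *\<^sub>R rot (tb j))))" for \<phi>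
   using weak[of \<phi>] unfolding node_mass_def .
  fix j assume j: "j < J"
  have "r^4 / (1000 * K^9) <= r^4 / (2 * K)" using Kbig(2) K r by (intro divide_left_mono mult_pos_pos) auto
  then show "r^4 / (1000 * K^9) <= l j" using l_bounds(1)[OF j] by linarith
  show "l j <= 1000 * K^9 * r^4" using l_bounds(2)[OF j] up'[OF Kbig(2), of 4] by linarith
  show "norm (V (nxt J j) - V j) <= 1000 * K^9 * r^4" using V(2)[OF j] up'[OF Kbig(1), of 4] by linarith
  show "1 / 4 <= tb j \<bullet> tb j" "norm (tb j) <= 1" by (rule tb_bounds[OF j])+
  show "norm (tb (nxt J j) - tb j) <= 1000 * K^9 * r^4" using dtb[OF j] up'[OF Kbig(3), of 4] by linarith
  show "\<bar>rot (tb j) \<bullet> tb (nxt J j) / l j - rot (tb (prv J j)) \<bullet> tb j / l (prv J j)\<bar> <= 1000 * K^9 * r" by (rule curvature[OF j])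
 next
  show "(\<Sum>j<J. (norm (t j - t (prv J j) - ((l (prv J j) + l j) / 2) *\<^sub>R V j))^2 / ((l (prv J j) + l j) / 2)) <= 1000 * K^9 * r^6" by (rule consistency)
  show "real J * r^4 <= 1000 * K^9" using JK Kbig(1) by linarith
  show "\<exists>j<J. \<bar>tb j \<bullet> e\<bar> <= 1 / 4" if "norm e = 1" for e by (rule turn_tb[OF that])
 qed
 show ?thesis by (rule that) (fact vd.velocity_estimates)+
qed

end

lemma interval_step:
 fixes f :: "nat => real"
 assumes "f 0 <= s" "s <= f n" "0 < n"
 shows "\<exists>k<n. f k <= s \<and> s <= f (Suc k)"
 using assms
proof (induction n)
 case (Suc n)
 show ?case
 proof (cases "n = 0 \<or> f n <= s")
  case True
  then show ?thesis using Suc.prems by (intro exI[of _ n]) auto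
 next
  case False
  then obtain k where "k < n" "f k <= s" "s <= f (Suc k)" using Suc by auto
  then show ?thesis by (intro exI[of _ k]) auto
 qed
qed simp

section \<open>The exact curve as a source of level geometries\<close>

context curve_flow
begin

text \<open>The direction bound is recovered from the quadratic order of \<open>arc_gap\<close>:
  taking away the moment integral and the expansion of the tangent leaves the chord direction
  compared with half a turn of the tangent.\<close>

lemma chord_bounds:
 obtains C d0 where "1 <= C" "0 < d0" "d0 <= 1"
  "!!th d t. t \<in> {0..T} ==> 0 < d ==> d <= d0 ==>
    norm ((1 / norm (crv (th + d) t - crv th t)) *\<^sub>R (crv (th + d) t - crv th t) - tang th t - (d / 2) *\<^sub>R tang1 th t) <= C * d^2"
  "!!th d t. t \<in> {0..T} ==> 0 < d ==> d <= d0 ==> \<bar>norm (crv (th + d) t - crv th t) - d * norm (D 1 0 th t)\<bar> <= C * d^2"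
  "!!th d t. t \<in> {0..T} ==> 0 < d ==> d <= d0 ==> norm (tang (th + d) t - tang th t - d *\<^sub>R tang1 th t) <= C * d^2"
proof -
 obtain R d0 c g where R: "strip3 1 T R" and d0: "0 < d0" "d0 <= 1"
  and g: "BL (par_box d0 T \<times> {0..1}) g"
  and ch: "!!th z t. t \<in> {0..T} ==> \<bar>z\<bar> <= 1 ==> D 0 0 (th + z) t = D 0 0 th t + z *\<^sub>R D 1 0 th t + z^2 *\<^sub>R R th z t"
  and S: "!!th d t y. t \<in> {0..T} ==> 0 < d ==> d <= d0 ==> y \<in> {0..1} ==> chord_coord th d t y = y + d * g ((th, d, t), y)"
  by (rule chord_expansion) (rule that, assumption+)
 obtain RT where RT: "strip3 1 T RT" "!!th z t. t \<in> {0..T} ==> \<bar>z\<bar> <= 1 ==> tang (th + z) t = tang th t + z *\<^sub>R tang1 th t + z^2 *\<^sub>R RT th z t"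
  using hadamard2[of T tang tang1 tang2 1, OF tang_deriv tang1_deriv tang1_BL tang2_BL] by blast
 obtain KT where KT: "BL (par_box d0 T) KT" "!!th d t. t \<in> {0..T} ==> 0 < d ==> d <= d0 ==>
   integral {0..1} (%y. chord_coord th d t y *\<^sub>R tang1 (th + d * y) t) = (1/2) *\<^sub>R tang1 th t + d *\<^sub>R KT (th, d, t)"
  by (rule moment_expansion[OF tang1_BL tang2_BL tang1_deriv g d0 S]) (assumption | rule that, assumption+)+
 obtain e0 g0 g1 g2 where e0: "0 < e0" "e0 <= 1" and g2: "BL (par_box e0 T) g2"
   "!!th d t. t \<in> {0..T} ==> 0 < d ==> d <= e0 ==> arc_gap th d t = d^2 *\<^sub>R g2 (th, d, t)"
  by (rule edge_expansions) (rule that, assumption+)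
 obtain C1 where C1: "1 <= C1" "!!p. p \<in> par_box 1 T ==> norm (R (fst p) (fst (snd p)) (snd (snd p))) <= C1"
  by (rule BLE[OF R[unfolded strip3_def]]) (rule that, assumption+)
 obtain C2 where C2: "1 <= C2" "!!p. p \<in> par_box 1 T ==> norm (RT (fst p) (fst (snd p)) (snd (snd p))) <= C2"
  by (rule BLE[OF RT(1)[unfolded strip3_def]]) (rule that, assumption+)
 obtain C3 where C3: "1 <= C3" "!!p. p \<in> par_box d0 T ==> norm (KT p) <= C3"
  by (rule BLE[OF KT(1)]) (rule that, assumption+)
 obtain C4 where C4: "1 <= C4" "!!p. p \<in> par_box e0 T ==> norm (g2 p) <= C4"
  by (rule BLE[OF g2(1)]) (rule that, assumption+)
 let ?C = "C1 + C2 + C3 + C4" and ?d = "min d0 e0"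
 have Cs: "C1 <= ?C" "C2 <= ?C" "C4 + C2 + C3 <= ?C" using C1 C2 C3 C4 by auto
 show ?thesis
 proof
  show "1 <= ?C" using C1(1) C2(1) C3(1) C4(1) by linarith
  show "0 < ?d" "?d <= 1" using d0 e0 by auto
  fix th d t assume t: "t \<in> {0..T}" and d: "0 < d" "d <= ?d"
  have d1: "\<bar>d\<bar> <= 1" "d <= d0" "d <= e0" using d d0 by auto
  have R1: "norm (R th d t) <= C1" using C1(2)[of "(th, d, t)"] t d d1 by auto
  have R2: "norm (RT th d t) <= C2" using C2(2)[of "(th, d, t)"] t d d1 by auto
  have R3: "norm (KT (th, d, t)) <= C3" using C3(2)[of "(th, d, t)"] t d d1 by auto
  have R4: "norm (g2 (th, d, t)) <= C4" using C4(2)[of "(th, d, t)"] t d d1 by auto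
  have sc: "norm (d^2 *\<^sub>R (w :: real^2)) <= ?C * d^2" if "norm w <= c" "c <= ?C" for w c
   using that mult_right_mono[of "norm w" ?C "d^2"] by (simp add: mult.commute)
  show "norm (tang (th + d) t - tang th t - d *\<^sub>R tang1 th t) <= ?C * d^2"
   unfolding RT(2)[OF t d1(1)] using sc[OF R2 Cs(2)] by simp
  have "\<bar>norm (crv (th + d) t - crv th t) - norm (d *\<^sub>R D 1 0 th t)\<bar> <= norm (d^2 *\<^sub>R R th d t)"
   by (rule order_trans[OF norm_triangle_ineq3]) (simp add: ch[OF t d1(1)])
  then show "\<bar>norm (crv (th + d) t - crv th t) - d * norm (D 1 0 th t)\<bar> <= ?C * d^2"
   using order_trans[OF _ sc[OF R1 Cs(1)]] d by simp
  have "(1 / norm (crv (th + d) t - crv th t)) *\<^sub>R (crv (th + d) t - crv th t) - tang th t - (d / 2) *\<^sub>R tang1 th t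
   = d^2 *\<^sub>R (g2 (th, d, t) + RT th d t - KT (th, d, t))"
  proof -
   have rearrange: "U - tg - (d / 2) *\<^sub>R T1 = d^2 *\<^sub>R (G + RR - KK)"
    if "U - (tg + d *\<^sub>R T1 + d^2 *\<^sub>R RR) + d *\<^sub>R ((1/2) *\<^sub>R T1 + d *\<^sub>R KK) = d^2 *\<^sub>R G" for U tg T1 G RR KK :: "real^2"
   proof -
    have h: "d *\<^sub>R T1 = (d / 2) *\<^sub>R T1 + (d / 2) *\<^sub>R T1" by (simp flip: scaleR_add_left)
    have "d^2 *\<^sub>R (G + RR - KK) = d^2 *\<^sub>R G + d^2 *\<^sub>R RR - d^2 *\<^sub>R KK" by (simp add: algebra_simps)
    also have "... = U - tg - (d / 2) *\<^sub>R T1" unfolding that[symmetric] h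
     by (simp add: scaleR_add_right power2_eq_square)
    finally show ?thesis by simp
   qed
   show ?thesis
    using g2(2)[OF t d(1) d1(3)] unfolding arc_gap_def KT(2)[OF t d(1) d1(2)] RT(2)[OF t d1(1)]
    by (rule rearrange)
  qed
  moreover have "norm (g2 (th, d, t) + RT th d t - KT (th, d, t)) <= C4 + C2 + C3"
   by (intro order_trans[OF norm_triangle_ineq4] add_mono order_trans[OF norm_triangle_ineq] R2 R3 R4)
  ultimately show "norm ((1 / norm (crv (th + d) t - crv th t)) *\<^sub>R (crv (th + d) t - crv th t) - tang th t - (d / 2) *\<^sub>R tang1 th t) <= ?C * d^2"
   using sc[OF _ Cs(3)] by simp
 qed
qed

lemma speed_bounds:
 obtains B where "1 <= B" "!!th t. t \<in> {0..T} ==> 1 / B <= norm (D 1 0 th t)" "!!th t. t \<in> {0..T} ==> norm (D 1 0 th t) <= B"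
proof -
 obtain c where c: "0 < c" "!!th t. t \<in> {0..T} ==> c <= norm (D 1 0 th t)" using speed_lower by blast
 obtain B where B: "1 <= B" "!!th t. t \<in> {0..T} ==> norm (D 1 0 th t) <= B"
  by (rule D_bound_ge1[of 1 0]) (rule that, assumption+)
 show ?thesis
 proof (rule that[of "max B (1 / c)"])
  show "1 <= max B (1 / c)" using B(1) by simp
  fix th t assume t: "t \<in> {0..T}"
  have "1 / max B (1 / c) <= 1 / (1 / c)" using c(1) by (intro divide_left_mono mult_pos_pos) (auto simp: less_max_iff_disj)
  then show "1 / max B (1 / c) <= norm (D 1 0 th t)" using c(2)[OF t, of th] by simp
  show "norm (D 1 0 th t) <= max B (1 / c)" using B(2)[OF t, of th] by simp
 qed
qed

text \<open>The height of the closed curve in direction \<open>e\<close> has a maximum, and there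
  the tangent is orthogonal to \<open>e\<close>. This is the origin of the assumption
  \<open>turns\<close>.\<close>

lemma tangent_orthogonal:
 assumes t: "t \<in> {0..T}"
 obtains th where "a <= th" "th <= a + 1" "tang th t \<bullet> e = 0"
proof -
 have der: "((%r. crv r t \<bullet> e) has_field_derivative D 1 0 th t \<bullet> e) (at th)" for th
  using bounded_linear.has_vector_derivative[OF bounded_linear_inner_left[of e] D_der(1)[OF t, of th]]
  by (simp add: has_real_derivative_iff_has_vector_derivative)
 have cont: "continuous_on {a..a + 1} (%r. crv r t \<bullet> e)"
  by (rule DERIV_continuous_on) (rule has_field_derivative_at_within[OF der])
 obtain th where th: "th \<in> {a..a + 1}" "!!r. r \<in> {a..a + 1} ==> crv r t \<bullet> e <= crv th t \<bullet> e"
  using continuous_attains_sup[OF compact_Icc _ cont] by auto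
 have max: "crv r t \<bullet> e <= crv th t \<bullet> e" for r
 proof -
  have "r + of_int (- \<lfloor>r - a\<rfloor>) \<in> {a..a + 1}" by (simp add: algebra_simps) linarith
  then show ?thesis using th(2) D_periodic[OF t, of 0 0 r] by metis
 qed
 have "D 1 0 th t \<bullet> e = 0"
  by (rule DERIV_local_max[OF der[of th], of 1]) (use max in auto)
 then show ?thesis using that[of th] th(1) unfolding tang_def by simp
qed

lemma good_arcs_tang:
 assumes g: "good_arcs t J q th d" and j: "j < J"
 shows "D a b (th (nxt J j)) t = D a b (th j + d j) t" "tang (th (nxt J j)) t = tang (th j + d j) t"
proof -
 have n: "nxt J j < J" using good_arcsD(5)[OF g] by simp
 have "crv (th (nxt J j)) t = crv (th j + d j) t" using good_arcsD(7)[OF g n] good_arcsD(8)[OF g j] by simp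
 from crv_shift_eq[OF good_arcsD(2)[OF g] this, of _ _ 0]
 have eq: "D i k (th (nxt J j)) t = D i k (th j + d j) t" for i k by simp
 then show "D a b (th (nxt J j)) t = D a b (th j + d j) t" "tang (th (nxt J j)) t = tang (th j + d j) t"
  unfolding tang_def by simp_all
qed

text \<open>Some arc contains a parameter at which the tangent is orthogonal to \<open>e\<close>; at
  the first node of this arc the tangent differs from it by at most \<open>L\<close> times the
  parameter length of the arc.\<close>

lemma good_arcs_turn:
 assumes g: "good_arcs t J q th d" and L: "!!th th'. norm (tang th t - tang th' t) <= L * \<bar>th - th'\<bar>" "0 <= L"
  and e: "norm e = 1"
 shows "\<exists>j<J. \<bar>tang (th j) t \<bullet> e\<bar> <= L * d j"
proof -
 note t = good_arcsD(2)[OF g]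
 obtain s where s: "th 0 <= s" "s <= th 0 + 1" "tang s t \<bullet> e = 0" by (rule tangent_orthogonal[OF t])
 obtain k where k: "k < J" "breaks th d k <= s" "s <= breaks th d (Suc k)"
  using interval_step[of "breaks th d" s J] s breaks_total[OF g] good_arcsD(5)[OF g] by (auto simp: breaks_def)
 have "D 1 0 (breaks th d k) t = D 1 0 (th k) t" using breaks_shift(2)[OF g k(1), of 1 0 0] by simp
 then have eq: "tang (th k) t = tang (breaks th d k) t" unfolding tang_def by simp
 have "\<bar>tang (th k) t \<bullet> e\<bar> = \<bar>(tang (breaks th d k) t - tang s t) \<bullet> e\<bar>" unfolding eq using s(3) by (simp add: inner_diff_left)
 also have "... <= norm (tang (breaks th d k) t - tang s t)"
  by (rule order_trans[OF Cauchy_Schwarz_ineq2]) (simp add: e)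
 also have "... <= L * \<bar>breaks th d k - s\<bar>" by (rule L(1))
 also have "... <= L * d k" using k L(2) by (intro mult_left_mono) (auto simp: breaks_Suc)
 finally show ?thesis using k(1) by blast
qed

lemma tang_lipschitz:
 obtains L where "1 <= L" "!!th th' t. t \<in> {0..T} ==> norm (tang th t - tang th' t) <= L * \<bar>th - th'\<bar>"
proof -
 obtain B where B: "1 <= B" "!!p q. p \<in> UNIV \<times> {0..T} ==> q \<in> UNIV \<times> {0..T} ==> norm (tang (fst p) (snd p) - tang (fst q) (snd q)) <= B * dist p q"
  by (rule BLE[OF tang_BL[unfolded strip2_def]]) (rule that, assumption+)
 show ?thesis
 proof (rule that[OF B(1)])
  fix th th' t assume "t \<in> {0..T}"
  then show "norm (tang th t - tang th' t) <= B * \<bar>th - th'\<bar>"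
   using B(2)[of "(th, t)" "(th', t)"] by (simp add: dist_Pair_Pair dist_real_def)
 qed
qed

lemma good_arcs_count:
 assumes g: "good_arcs t J q th d" and K: "0 < K" and d: "!!j. j < J ==> h / K <= d j"
 shows "real J * h <= K"
proof -
 have "(\<Sum>j<J. d j) = 1" using breaks_total[OF g] by (simp add: breaks_def)
 moreover have "(\<Sum>j<J. h / K) <= (\<Sum>j<J. d j)" using d by (intro sum_mono) auto
 ultimately show ?thesis using K by (simp add: field_simps)
qed

lemma level_geometry_arcs:
 assumes K: "1 <= K"
 obtains K' where "K <= K'" "!!r t J x q th d. good_arcs t J q th d ==> simple_closed_polygon J x ==> 0 < r ==> 40 * K'^4 * r <= 1 ==>
   (!!j. j < J ==> r^4 / K <= d j) ==> (!!j. j < J ==> d j <= K * r^4) ==>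
   (!!j. j < J ==> norm ((x (nxt J j) - q (nxt J j)) - (x j - q j)) <= K * r^9) ==>
   (\<Sum>j<J. (norm ((x (nxt J j) - q (nxt J j)) - (x j - q j)))^2) <= K * r^18 ==>
   level_geometry J r K' x q (%j. tang (th j) t) (%j. D 0 1 (th j) t) (%j. d j * norm (D 1 0 (th j) t))"
proof -
 obtain C d0 where C: "1 <= C" and d0: "0 < d0" "d0 <= 1" and
  ch1: "!!th d t. t \<in> {0..T} ==> 0 < d ==> d <= d0 ==>
    norm ((1 / norm (crv (th + d) t - crv th t)) *\<^sub>R (crv (th + d) t - crv th t) - tang th t - (d / 2) *\<^sub>R tang1 th t) <= C * d^2" and
  ch2: "!!th d t. t \<in> {0..T} ==> 0 < d ==> d <= d0 ==> \<bar>norm (crv (th + d) t - crv th t) - d * norm (D 1 0 th t)\<bar> <= C * d^2" and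
  ch3: "!!th d t. t \<in> {0..T} ==> 0 < d ==> d <= d0 ==> norm (tang (th + d) t - tang th t - d *\<^sub>R tang1 th t) <= C * d^2"
  by (rule chord_bounds) (rule that, assumption+)
 obtain B where B: "1 <= B" "!!th t. t \<in> {0..T} ==> 1 / B <= norm (D 1 0 th t)" "!!th t. t \<in> {0..T} ==> norm (D 1 0 th t) <= B"
  by (rule speed_bounds) (rule that, assumption+)
 obtain E where E: "1 <= E" "!!th t. t \<in> {0..T} ==> norm (D 0 1 th t) <= E"
  "!!th th' t t'. t \<in> {0..T} ==> t' \<in> {0..T} ==> norm (D 0 1 th t - D 0 1 th' t') <= E * (\<bar>th - th'\<bar> + \<bar>t - t'\<bar>)"
  by (rule D_bound_ge1[of 0 1]) (rule that, assumption+)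
 obtain L where L: "1 <= L" "!!th th' t. t \<in> {0..T} ==> norm (tang th t - tang th' t) <= L * \<bar>th - th'\<bar>"
  by (rule tang_lipschitz) (rule that, assumption+)
 define M where "M = K^2 * C + K * B + K * E + K * L + K / d0"
 have KK: "K <= K^2" using K by (simp add: power2_eq_square)
 have nn: "0 <= K^2 * C" "0 <= K * B" "0 <= K * E" "0 <= K * L" "0 <= K / d0" using K C B(1) E(1) L(1) d0 by auto
 have KB: "K <= K * B" "E <= K * E" using K B(1) E(1) by (simp_all add: mult_le_cancel_left1 mult_le_cancel_right1)
 have M: "K <= M" "K^2 * C <= M" "K * B <= M" "E <= M" "K * E <= M" "K * L <= M" "K / d0 <= M"
  unfolding M_def using nn KB by linarith+
 have M1: "1 <= M" using K M(1) by linarith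
 show ?thesis
 proof (rule that[OF M(1)])
  fix r :: real and t :: real and J :: nat and x q :: "nat => real^2" and th d :: "nat => real"
  assume g: "good_arcs t J q th d" and x: "simple_closed_polygon J x" and r: "0 < r" "40 * M^4 * r <= 1"
   and d: "!!j. j < J ==> r^4 / K <= d j" "!!j. j < J ==> d j <= K * r^4"
   and e: "!!j. j < J ==> norm ((x (nxt J j) - q (nxt J j)) - (x j - q j)) <= K * r^9"
    "(\<Sum>j<J. (norm ((x (nxt J j) - q (nxt J j)) - (x j - q j)))^2) <= K * r^18"
  note t = good_arcsD(2)[OF g]
  have idx: "nxt J j < J" for j using good_arcsD(5)[OF g] by simp
  have Mp: "1 <= M^4" "M <= M^4" using M1 power_increasing[of 1 4 M] by (auto intro: one_le_power)
  have r1: "r <= 1" using r Mp(1) mult_right_mono[of 1 "M^4" r] by linarith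
  \<comment> \<open>The summand \<open>K / d0\<close> of \<open>M\<close> is there for this bound:
    \<open>r\<close> small relative to \<open>M\<close> makes the increments short enough for the
    expansions.\<close>
  have dd: "d j <= d0" if "j < J" for j
  proof -
   have "K <= M * d0" using M(7) d0 by (simp add: field_simps)
   then have "K * r^4 <= (M * d0) * r^1" using r(1) r1 K by (intro rpow_mono) auto
   also have "... <= (M^4 * d0) * r" using Mp d0 r by (intro mult_mono) auto
   also have "... <= d0 * (40 * M^4 * r)" using Mp d0 r by (simp add: mult.commute mult.left_commute)
   also have "... <= d0 * 1" using r d0 by (intro mult_left_mono) auto
   finally show ?thesis using d(2)[OF that] by linarith
  qed
  have d2: "C * (d j)^2 <= M * r^8" if j: "j < J" for j
  proof -
   have "(d j)^2 <= (K * r^4)^2" using d(2)[OF j] good_arcsD(9)[OF g j] by (intro power_mono) auto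
   then have "C * (d j)^2 <= C * (K * r^4)^2" using C by (intro mult_left_mono) auto
   also have "... = (K^2 * C) * r^8" by (simp add: power_mult_distrib mult.commute mult.left_commute flip: power_mult)
   also have "... <= M * r^8" using M(2) by (intro mult_right_mono) auto
   finally show ?thesis .
  qed
  have t1: "tang1 a t = norm (D 1 0 a t) *\<^sub>R D 0 1 a t" for a by (simp add: tang1_def)
  have qd: "q (nxt J j) - q j = crv (th j + d j) t - crv (th j) t" if "j < J" for j
   using good_arcsD(7)[OF g that] good_arcsD(8)[OF g that] by simp
  have mr: "c * r^n <= M * r^n" if "c <= M" for c n using that r(1) by (intro mult_right_mono) auto
  show "level_geometry J r M x q (%j. tang (th j) t) (%j. D 0 1 (th j) t) (%j. d j * norm (D 1 0 (th j) t))"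
  proof
   show "simple_closed_polygon J x" "0 < r" "1 <= M" "40 * M^4 * r <= 1" by fact+
   show "simple_closed_polygon J q" by (rule good_arcsD(3)[OF g])
   show "real J * r^4 <= M" using good_arcs_count[OF g _ d(1)] K M(1) by force
   show "\<exists>j<J. \<bar>tang (th j) t \<bullet> e\<bar> <= M * r^4" if ne: "norm e = 1" for e
   proof -
    obtain j where j: "j < J" "\<bar>tang (th j) t \<bullet> e\<bar> <= L * d j"
     using good_arcs_turn[OF g L(2)[OF t] _ ne] L(1) by auto
    have "L * d j <= L * (K * r^4)" using d(2)[OF j(1)] L(1) by (intro mult_left_mono) auto
    also have "... = (K * L) * r^4" by simp
    also have "... <= M * r^4" by (rule mr[OF M(6)])
    finally show ?thesis using j by (meson order_trans)
   qed
   have "K * r^18 <= M * r^18" by (rule mr[OF M(1)])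
   then show "(\<Sum>j<J. (norm ((x (nxt J j) - q (nxt J j)) - (x j - q j)))^2) <= M * r^18" using e(2) by linarith
   fix j assume j: "j < J"
   note dj = good_arcsD(9)[OF g j] dd[OF j]
   show "norm (tang (th j) t) = 1" by (rule norm_tang[OF t])
   show "norm (D 0 1 (th j) t) <= M" using E(2)[OF t, of "th j"] M(4) by linarith
   have "norm (D 0 1 (th (nxt J j)) t - D 0 1 (th j) t) <= E * d j"
    unfolding good_arcs_tang(1)[OF g j] using E(3)[OF t t, of "th j + d j" "th j"] dj by simp
   also have "... <= E * (K * r^4)" using d(2)[OF j] E(1) by (intro mult_left_mono) auto
   also have "... = (K * E) * r^4" by simp
   also have "... <= M * r^4" by (rule mr[OF M(5)])
   finally show "norm (D 0 1 (th (nxt J j)) t - D 0 1 (th j) t) <= M * r^4" .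
   show "norm ((x (nxt J j) - q (nxt J j)) - (x j - q j)) <= M * r^9" using e(1)[OF j] mr[OF M(1), of 9] by linarith
   have "r^4 / M <= r^4 / (K * B)" using M(3) K B(1) r M1 by (intro divide_left_mono mult_pos_pos) auto
   also have "... = r^4 / K * (1 / B)" by simp
   also have "... <= d j * norm (D 1 0 (th j) t)" using d(1)[OF j] B(1) B(2)[OF t, of "th j"] dj K r by (intro mult_mono) auto
   finally show "r^4 / M <= d j * norm (D 1 0 (th j) t)" .
   have "d j * norm (D 1 0 (th j) t) <= (K * r^4) * B" using d(2)[OF j] B(3)[OF t, of "th j"] dj K r by (intro mult_mono) auto
   also have "... = (K * B) * r^4" by simp
   also have "... <= M * r^4" by (rule mr[OF M(3)])
   finally show "d j * norm (D 1 0 (th j) t) <= M * r^4" .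
   show "norm (tang (th (nxt J j)) t - tang (th j) t - (d j * norm (D 1 0 (th j) t)) *\<^sub>R D 0 1 (th j) t) <= M * r^8"
    unfolding good_arcs_tang(2)[OF g j] using ch3[OF t dj, of "th j"] d2[OF j] unfolding t1 by simp
   show "\<bar>edge_len J q j - d j * norm (D 1 0 (th j) t)\<bar> <= M * r^8"
    unfolding edge_len_norm qd[OF j] using ch2[OF t dj, of "th j"] d2[OF j] by simp
   show "norm (edge_dir J q j - tang (th j) t - (d j * norm (D 1 0 (th j) t) / 2) *\<^sub>R D 0 1 (th j) t) <= M * r^8"
    unfolding edge_dir_def edge_len_norm qd[OF j] using ch1[OF t dj, of "th j"] d2[OF j] unfolding t1 by simp
  qed
 qed
qed

end

section \<open>Foot points after one time step\<close>

lemma inner_product_diff: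
 fixes a b :: "'a::real_inner"
 shows "\<bar>a \<bullet> b - a' \<bullet> b'\<bar> <= norm (a - a') * norm b + norm a' * norm (b - b')"
proof -
 have "a \<bullet> b - a' \<bullet> b' = (a - a') \<bullet> b + a' \<bullet> (b - b')" by (simp add: inner_diff_left inner_diff_right)
 then show ?thesis using Cauchy_Schwarz_ineq2[of "a - a'" b] Cauchy_Schwarz_ineq2[of a' "b - b'"] by linarith
qed

text \<open>\<open>sg\<close> and \<open>sg'\<close> solve scalar linear equations, the first with
  coefficient bounded below by \<open>c\<close>. Subtraction bounds their difference by differences
  of the data, except for \<open>\<rho>\<close> and \<open>\<rho>'\<close>, which enter with their
  own size.\<close>

lemma quotient_difference:
 fixes R R' G G' S S' P P' Q Q' e e' w w' :: "'a::real_inner"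
 assumes eq: "sg * (R \<bullet> G - e \<bullet> S) = w \<bullet> G + \<rho> - P \<bullet> G + e \<bullet> Q" "sg' * (R' \<bullet> G' - e' \<bullet> S') = w' \<bullet> G' + \<rho>' - P' \<bullet> G' + e' \<bullet> Q'"
  and c: "c <= R \<bullet> G - e \<bullet> S" and B: "1 <= B"
  and b: "norm G <= B" "norm S <= B" "norm Q <= B" "norm R' <= B" "norm P' <= B"
  and d: "norm (R - R') <= B * \<delta>" "norm (G - G') <= B * \<delta>" "norm (S - S') <= B * \<delta>" "norm (P - P') <= B * \<delta>" "norm (Q - Q') <= B * \<delta>"
  and M: "1 <= M" "norm w' <= M" "\<bar>sg'\<bar> <= M" "norm e' <= 1" and \<delta>: "0 <= \<delta>"
 shows "c * \<bar>sg - sg'\<bar> <= 10 * B^2 * M * (\<delta> + norm (e - e') + norm (w - w') + \<bar>\<rho>\<bar> + \<bar>\<rho>'\<bar>)"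
proof -
 let ?E = "R \<bullet> G - e \<bullet> S" and ?E' = "R' \<bullet> G' - e' \<bullet> S'"
 define de dw where "de = norm (e - e')" and "dw = norm (w - w')"
 have nn: "0 <= de" "0 <= dw" unfolding de_def dw_def by auto
 have B0: "0 <= B" "0 <= B * \<delta>" using B \<delta> by auto
 have ip: "\<bar>a \<bullet> b - a' \<bullet> b'\<bar> <= A * B + C * (B * \<delta>)" if "norm (a - a') <= A" "norm b <= B" "norm a' <= C" "norm (b - b') <= B * \<delta>" for a b a' b' :: 'a and A C
 proof -
  have "0 <= A" "0 <= C" using that(1,3) by (auto intro: order_trans[OF norm_ge_zero])
  then have "norm (a - a') * norm b <= A * B" "norm a' * norm (b - b') <= C * (B * \<delta>)"
   using that by (auto intro!: mult_mono)
  then show ?thesis using inner_product_diff[of a b a' b'] by linarith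
 qed
 have 1: "\<bar>w \<bullet> G - w' \<bullet> G'\<bar> <= dw * B + M * (B * \<delta>)" unfolding dw_def by (rule ip) (use b d M in auto)
 have 2: "\<bar>P \<bullet> G - P' \<bullet> G'\<bar> <= (B * \<delta>) * B + B * (B * \<delta>)" by (rule ip) (use b d in auto)
 have 3: "\<bar>e \<bullet> Q - e' \<bullet> Q'\<bar> <= de * B + 1 * (B * \<delta>)" unfolding de_def by (rule ip) (use b d M in auto)
 have 4: "\<bar>R \<bullet> G - R' \<bullet> G'\<bar> <= (B * \<delta>) * B + B * (B * \<delta>)" by (rule ip) (use b d in auto)
 have 5: "\<bar>e \<bullet> S - e' \<bullet> S'\<bar> <= de * B + 1 * (B * \<delta>)" unfolding de_def by (rule ip) (use b d M in auto)
 have 6: "\<bar>sg' * (?E - ?E')\<bar> <= M * ((B * \<delta>) * B + B * (B * \<delta>) + (de * B + 1 * (B * \<delta>)))"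
  unfolding abs_mult using M 4 5 by (intro mult_mono) linarith+
 have "(sg - sg') * ?E = sg * ?E - sg' * ?E' - sg' * (?E - ?E')" by (simp add: algebra_simps)
 also have "... = (w \<bullet> G - w' \<bullet> G') - (P \<bullet> G - P' \<bullet> G') + (e \<bullet> Q - e' \<bullet> Q') + \<rho> - \<rho>' - sg' * (?E - ?E')" unfolding eq by simp
 finally have id: "(sg - sg') * ?E = (w \<bullet> G - w' \<bullet> G') - (P \<bullet> G - P' \<bullet> G') + (e \<bullet> Q - e' \<bullet> Q') + \<rho> - \<rho>' - sg' * (?E - ?E')" .
 have "c * \<bar>sg - sg'\<bar> <= \<bar>?E\<bar> * \<bar>sg - sg'\<bar>" using c by (intro mult_right_mono) auto
 also have "... = \<bar>(sg - sg') * ?E\<bar>" by (simp add: abs_mult mult.commute)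
 also have "... <= (dw * B + M * (B * \<delta>)) + ((B * \<delta>) * B + B * (B * \<delta>)) + (de * B + 1 * (B * \<delta>)) + \<bar>\<rho>\<bar> + \<bar>\<rho>'\<bar> + M * ((B * \<delta>) * B + B * (B * \<delta>) + (de * B + 1 * (B * \<delta>)))"
  unfolding id using 1 2 3 6 by linarith
 also have "... <= 10 * B^2 * M * (\<delta> + de + dw + \<bar>\<rho>\<bar> + \<bar>\<rho>'\<bar>)"
 proof -
  define U where "U = B^2 * M"
  have BB: "B <= B^2" "1 <= B^2" using B by (simp_all add: power2_eq_square mult_le_cancel_left1) (smt (verit) mult_le_cancel_left1)
  have "1 * 1 <= B^2 * M" "B * 1 <= B^2 * M" "B * M <= B^2 * M" "B^2 * 1 <= B^2 * M" using BB M(1) B by (intro mult_mono; simp)+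
  then have U: "1 <= U" "B <= U" "B * M <= U" "B^2 <= U" unfolding U_def by simp_all
  have "dw * B <= U * dw" "de * B <= U * de" "\<delta> * B <= U * \<delta>" "\<delta> * (B * M) <= U * \<delta>" "de * (B * M) <= U * de" "\<delta> * B^2 <= U * \<delta>" "\<delta> * (B^2 * M) <= U * \<delta>"
   using U nn \<delta> unfolding mult.commute[of U] U_def[symmetric] by (auto intro!: mult_left_mono mult_right_mono)
  moreover have "1 * \<bar>\<rho>\<bar> <= U * \<bar>\<rho>\<bar>" "1 * \<bar>\<rho>'\<bar> <= U * \<bar>\<rho>'\<bar>"
   using U(1) by (intro mult_right_mono; simp)+
  moreover have "0 <= U * dw" "0 <= U * de" "0 <= U * \<delta>" "0 <= U * \<bar>\<rho>\<bar>" "0 <= U * \<bar>\<rho>'\<bar>" using U(1) nn \<delta> by auto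
  ultimately have "dw * B + \<delta> * (B * M) + 2 * (\<delta> * B^2) + de * B + \<delta> * B + \<bar>\<rho>\<bar> + \<bar>\<rho>'\<bar> + 2 * (\<delta> * (B^2 * M)) + de * (B * M) + \<delta> * (B * M)
    <= 10 * (U * \<delta>) + 10 * (U * de) + 10 * (U * dw) + 10 * (U * \<bar>\<rho>\<bar>) + 10 * (U * \<bar>\<rho>'\<bar>)" by linarith
  then show ?thesis unfolding U_def by (simp add: algebra_simps power2_eq_square)
 qed
 finally show ?thesis unfolding de_def dw_def .
qed

context curve_flow
begin

text \<open>\<open>th + dt * sg\<close> is the parameter of the foot point at time \<open>t + dt\<close> of the point that had foot
 parameter \<open>th\<close> and distance vector \<open>e\<close> at time \<open>t\<close> and has moved with velocity \<open>v\<close>.\<close>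

definition foot_data :: "real => real => real => real => real^2 => real^2 => real => bool" where
 "foot_data z0 t dt th e v sg \<longleftrightarrow> t \<in> {0..T} \<and> t + dt \<in> {0..T} \<and> 0 < dt \<and> norm e <= z0 \<and> \<bar>dt * sg\<bar> <= z0 \<and> e \<bullet> D 1 0 th t = 0
   \<and> (crv th t + e + dt *\<^sub>R v - crv (th + dt * sg) (t + dt)) \<bullet> D 1 0 (th + dt * sg) (t + dt) = 0"

text \<open>The mean value theorem in the parameter is applied to the time increment: one further
  parameter derivative, Lipschitz in time, supplies the factor \<open>dt\<close> that the division
  removes.\<close>

lemma time_quotient:
 obtains B where "1 <= B"
  "!!th t dt. t \<in> {0..T} ==> t + dt \<in> {0..T} ==> 0 < dt ==> norm ((1 / dt) *\<^sub>R (D i j th (t + dt) - D i j th t)) <= B"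
  "!!th th' t dt. t \<in> {0..T} ==> t + dt \<in> {0..T} ==> 0 < dt ==>
   norm ((1 / dt) *\<^sub>R (D i j th (t + dt) - D i j th t) - (1 / dt) *\<^sub>R (D i j th' (t + dt) - D i j th' t)) <= B * \<bar>th - th'\<bar>"
proof -
 obtain B1 where B1: "1 <= B1" "!!th th' t t'. t \<in> {0..T} ==> t' \<in> {0..T} ==> norm (D i j th t - D i j th' t') <= B1 * (\<bar>th - th'\<bar> + \<bar>t - t'\<bar>)"
  by (rule D_bound_ge1[of i j]) (rule that, assumption+)
 obtain B2 where B2: "1 <= B2" "!!th th' t t'. t \<in> {0..T} ==> t' \<in> {0..T} ==> norm (D (Suc i) j th t - D (Suc i) j th' t') <= B2 * (\<bar>th - th'\<bar> + \<bar>t - t'\<bar>)"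
  by (rule D_bound_ge1[of "Suc i" j]) (rule that, assumption+)
 show ?thesis
 proof (rule that[of "max B1 B2"])
  show "1 <= max B1 B2" using B1(1) by simp
  fix th t dt :: real assume t: "t \<in> {0..T}" "t + dt \<in> {0..T}" "0 < dt"
  have "norm (D i j th (t + dt) - D i j th t) <= max B1 B2 * dt"
   using order_trans[OF B1(2)[OF t(2,1), of th th] mult_right_mono[of B1 "max B1 B2"]] t(3) by simp
  then show "norm ((1 / dt) *\<^sub>R (D i j th (t + dt) - D i j th t)) <= max B1 B2"
   using t(3) by (simp add: pos_divide_le_eq)
  fix th' :: real
  have "norm ((D i j th (t + dt) - D i j th t) - (D i j th' (t + dt) - D i j th' t)) <= (B2 * dt) * \<bar>th - th'\<bar>"
  proof (rule deriv_bound[of UNIV])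
   fix r :: real
   show "((%r. D i j r (t + dt) - D i j r t) has_vector_derivative D (Suc i) j r (t + dt) - D (Suc i) j r t) (at r within UNIV)"
    using D_space[OF t(2)] D_space[OF t(1)] by (intro has_vector_derivative_diff) auto
   show "norm (D (Suc i) j r (t + dt) - D (Suc i) j r t) <= B2 * dt" using B2(2)[OF t(2,1), of r r] t(3) by simp
  qed auto
  also have "... <= (max B1 B2 * dt) * \<bar>th - th'\<bar>" using t(3) by (intro mult_right_mono) auto
  finally have "norm ((D i j th (t + dt) - D i j th t) - (D i j th' (t + dt) - D i j th' t)) / dt <= max B1 B2 * \<bar>th - th'\<bar>"
   using t(3) by (simp add: pos_divide_le_eq mult.commute mult.left_commute)
  then show "norm ((1 / dt) *\<^sub>R (D i j th (t + dt) - D i j th t) - (1 / dt) *\<^sub>R (D i j th' (t + dt) - D i j th' t)) <= max B1 B2 * \<bar>th - th'\<bar>"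
   using t(3) by (simp flip: scaleR_diff_right)
 qed
qed

text \<open>The new orthogonality relation is expanded around \<open>th\<close> in the displacement
  \<open>dt * sg\<close>, and the old one removes the part without a factor \<open>dt\<close>;
  division by \<open>dt\<close> leaves a linear equation for \<open>sg\<close>. The component
  \<open>b\<close> is kept apart since only its product with the new tangent counts.\<close>

lemma foot_step:
 obtains z0 c B where "0 < z0" "z0 <= 1" "0 < c" "1 <= B"
  "!!t dt th e v sg. foot_data z0 t dt th e v sg ==> c * \<bar>sg\<bar> <= B * (norm v + 1)"
  "!!t dt th e w b sg th' e' w' b' sg' M. foot_data z0 t dt th e (w + b) sg ==> foot_data z0 t dt th' e' (w' + b') sg' ==>
    1 <= M ==> norm w' <= M ==> \<bar>sg'\<bar> <= M ==> 2 * B * M * dt <= c ==>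
    c * \<bar>sg - sg'\<bar> <= B * M * (\<bar>th - th'\<bar> + norm (e - e') + norm (w - w')
     + \<bar>b \<bullet> D 1 0 (th + dt * sg) (t + dt)\<bar> + \<bar>b' \<bullet> D 1 0 (th' + dt * sg') (t + dt)\<bar>)"
proof -
 obtain R where R: "strip3 1 T R" "!!th z t. t \<in> {0..T} ==> \<bar>z\<bar> <= 1 ==> crv (th + z) t = crv th t + z *\<^sub>R D 1 0 th t + z^2 *\<^sub>R R th z t"
  using hadamard2[OF D_der(1) D_der(2) D_strip2 D_strip2, where M = 1] by blast
 obtain S where S: "strip3 1 T S" "!!th z t. t \<in> {0..T} ==> D 1 0 (th + z) t = D 1 0 th t + z *\<^sub>R S th z t"
  using hadamard1[OF D_der(2) D_strip2, where M = 1] by blast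
 define R1 where "R1 = (%p. D 1 0 (fst p + 0 * fst (snd p)) (snd (snd p)) + fst (snd p) *\<^sub>R R (fst p) (fst (snd p)) (snd (snd p)))"
 define S1 where "S1 = (%p. S (fst p) (fst (snd p)) (snd (snd p)))"
 define G1 where "G1 = (%p. D 1 0 (fst p + 1 * fst (snd p)) (snd (snd p)))"
 have BL1: "BL (par_box 1 T) R1" unfolding R1_def
  by (intro BL_add strip2_aff[OF D_strip2] BL_scaleR BL_coord_z R(1)[unfolded strip3_def])
 have BL2: "BL (par_box 1 T) S1" unfolding S1_def by (rule S(1)[unfolded strip3_def])
 have BL3: "BL (par_box 1 T) G1" unfolding G1_def by (rule strip2_aff[OF D_strip2])
 obtain C1 where C1: "1 <= C1" "!!p. p \<in> par_box 1 T ==> norm (R1 p) <= C1" "!!p q. p \<in> par_box 1 T ==> q \<in> par_box 1 T ==> norm (R1 p - R1 q) <= C1 * dist p q"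
  by (rule BLE[OF BL1]) (rule that, assumption+)
 obtain C2 where C2: "1 <= C2" "!!p. p \<in> par_box 1 T ==> norm (S1 p) <= C2" "!!p q. p \<in> par_box 1 T ==> q \<in> par_box 1 T ==> norm (S1 p - S1 q) <= C2 * dist p q"
  by (rule BLE[OF BL2]) (rule that, assumption+)
 obtain C3 where C3: "1 <= C3" "!!p. p \<in> par_box 1 T ==> norm (G1 p) <= C3" "!!p q. p \<in> par_box 1 T ==> q \<in> par_box 1 T ==> norm (G1 p - G1 q) <= C3 * dist p q"
  by (rule BLE[OF BL3]) (rule that, assumption+)
 obtain C4 where C4: "1 <= C4" "!!th t dt. t \<in> {0..T} ==> t + dt \<in> {0..T} ==> 0 < dt ==> norm ((1 / dt) *\<^sub>R (crv th (t + dt) - crv th t)) <= C4"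
  "!!th th' t dt. t \<in> {0..T} ==> t + dt \<in> {0..T} ==> 0 < dt ==>
   norm ((1 / dt) *\<^sub>R (crv th (t + dt) - crv th t) - (1 / dt) *\<^sub>R (crv th' (t + dt) - crv th' t)) <= C4 * \<bar>th - th'\<bar>"
  by (rule time_quotient[of 0 0]) (rule that, assumption+)
 obtain C5 where C5: "1 <= C5" "!!th t dt. t \<in> {0..T} ==> t + dt \<in> {0..T} ==> 0 < dt ==> norm ((1 / dt) *\<^sub>R (D 1 0 th (t + dt) - D 1 0 th t)) <= C5"
  "!!th th' t dt. t \<in> {0..T} ==> t + dt \<in> {0..T} ==> 0 < dt ==>
   norm ((1 / dt) *\<^sub>R (D 1 0 th (t + dt) - D 1 0 th t) - (1 / dt) *\<^sub>R (D 1 0 th' (t + dt) - D 1 0 th' t)) <= C5 * \<bar>th - th'\<bar>"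
  by (rule time_quotient[of 1 0]) (rule that, assumption+)
 obtain C6 where C6: "1 <= C6" "!!th t. t \<in> {0..T} ==> 1 / C6 <= norm (D 1 0 th t)"
  by (rule speed_bounds) (rule that, assumption+)
 define B where "B = C1 + C2 + C3 + C4 + C5 + C6"
 have Bs: "C1 <= B" "C2 <= B" "C3 <= B" "C4 <= B" "C5 <= B" "C6 <= B" "1 <= B"
  unfolding B_def using C1(1) C2(1) C3(1) C4(1) C5(1) C6(1) by linarith+
 \<comment> \<open>Unperturbed, the coefficient of \<open>sg\<close> is a squared speed and at least
   \<open>1 / B^2\<close>. Perturbations of size \<open>z0\<close> change it by at most
   \<open>3 * (B^2 * z0)\<close>, less than half of that.\<close>
 define c where "c = 1 / (2 * B^2)"
 define z0 where "z0 = 1 / (20 * B^4)"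
 have Bp: "1 <= B^n" "0 < B^n" for n using Bs(7) by (auto intro: one_le_power zero_less_power)
 have c: "0 < c" unfolding c_def using Bp(2)[of 2] by simp
 have z0: "0 < z0" "z0 <= 1" unfolding z0_def using Bp[of 4] by (auto simp: divide_le_eq)
 define EQ where "EQ = (%t dt th e v sg. let p = (th, dt * sg, t + dt) in
   sg * (R1 p \<bullet> G1 p - e \<bullet> S1 p) = v \<bullet> G1 p - ((1 / dt) *\<^sub>R (crv th (t + dt) - crv th t)) \<bullet> G1 p + e \<bullet> ((1 / dt) *\<^sub>R (D 1 0 th (t + dt) - D 1 0 th t))
   \<and> c <= R1 p \<bullet> G1 p - e \<bullet> S1 p \<and> p \<in> par_box 1 T \<and> norm e <= 1 \<and> t \<in> {0..T} \<and> t + dt \<in> {0..T} \<and> 0 < dt)"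
 have eq: "EQ t dt th e v sg" if f: "foot_data z0 t dt th e v sg" for t dt th e v sg
 proof -
  define z where "z = dt * sg"
  define p where "p = (th, z, t + dt)"
  have t: "t \<in> {0..T}" "t + dt \<in> {0..T}" "0 < dt" and e: "norm e <= z0" "e \<bullet> D 1 0 th t = 0" and z: "\<bar>z\<bar> <= z0"
   and o: "(crv th t + e + dt *\<^sub>R v - crv (th + z) (t + dt)) \<bullet> D 1 0 (th + z) (t + dt) = 0"
   using f unfolding foot_data_def z_def by auto
  have z1: "\<bar>z\<bar> <= 1" using z z0 by linarith
  have p: "p \<in> par_box 1 T" unfolding p_def using z1 t by auto
  have G: "G1 p = D 1 0 (th + z) (t + dt)" unfolding G1_def p_def by simp
  have Gexp: "D 1 0 (th + z) (t + dt) = D 1 0 th (t + dt) + z *\<^sub>R S1 p" unfolding S1_def p_def using S(2)[OF t(2), of th z] by simp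
  have gexp: "crv (th + z) (t + dt) = crv th (t + dt) + z *\<^sub>R R1 p" unfolding R1_def p_def using R(2)[OF t(2) z1, of th]
   by (simp add: algebra_simps power2_eq_square)
  have eG: "e \<bullet> G1 p = e \<bullet> (D 1 0 th (t + dt) - D 1 0 th t) + z * (e \<bullet> S1 p)"
   unfolding G Gexp using e(2) by (simp add: inner_add_right inner_diff_right)
  have "z * (R1 p \<bullet> G1 p) + (crv th (t + dt) - crv th t) \<bullet> G1 p = dt * (v \<bullet> G1 p) + e \<bullet> G1 p"
   using o unfolding gexp G[symmetric] by (simp add: inner_diff_left inner_add_left algebra_simps)
  then have "z * (R1 p \<bullet> G1 p - e \<bullet> S1 p) = dt * (v \<bullet> G1 p) - (crv th (t + dt) - crv th t) \<bullet> G1 p + e \<bullet> (D 1 0 th (t + dt) - D 1 0 th t)"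
   unfolding eG by (simp add: algebra_simps)
  then have "(1 / dt) * (z * (R1 p \<bullet> G1 p - e \<bullet> S1 p)) = (1 / dt) * (dt * (v \<bullet> G1 p) - (crv th (t + dt) - crv th t) \<bullet> G1 p + e \<bullet> (D 1 0 th (t + dt) - D 1 0 th t))" by simp
  then have main: "sg * (R1 p \<bullet> G1 p - e \<bullet> S1 p) = v \<bullet> G1 p - ((1 / dt) *\<^sub>R (crv th (t + dt) - crv th t)) \<bullet> G1 p + e \<bullet> ((1 / dt) *\<^sub>R (D 1 0 th (t + dt) - D 1 0 th t))"
   unfolding z_def using t(3) by (simp add: distrib_left right_diff_distrib)
  have nb: "norm (R1 p) <= B" "norm (S1 p) <= B" "norm (G1 p) <= B"
   using C1(2)[OF p] C2(2)[OF p] C3(2)[OF p] Bs by linarith+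
  define D0 where "D0 = D 1 0 th (t + dt)"
  have p0: "(th, 0, t + dt) \<in> par_box 1 T" using t by auto
  have D0: "1 / B <= norm D0" "norm (R1 p - D0) <= B * z0" "norm (G1 p - D0) <= B * z0" "norm D0 <= B"
  proof -
   have "1 / B <= 1 / C6" using Bs C6(1) by (intro divide_left_mono mult_pos_pos) auto
   then show "1 / B <= norm D0" using C6(2)[OF t(2), of th] unfolding D0_def by linarith
   have dist: "dist p (th, 0, t + dt) = \<bar>z\<bar>" unfolding p_def by (simp add: dist_Pair_Pair)
   have "R1 (th, 0, t + dt) = D0" "G1 (th, 0, t + dt) = D0" unfolding R1_def G1_def D0_def by simp_all
   then have "norm (R1 p - D0) <= C1 * \<bar>z\<bar>" "norm (G1 p - D0) <= C3 * \<bar>z\<bar>" "norm D0 <= C3"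
    using C1(3)[OF p p0] C3(3)[OF p p0] C3(2)[OF p0] unfolding dist by simp_all
   moreover have "C1 * \<bar>z\<bar> <= B * z0" "C3 * \<bar>z\<bar> <= B * z0" using Bs z by (auto intro!: mult_mono)
   ultimately show "norm (R1 p - D0) <= B * z0" "norm (G1 p - D0) <= B * z0" "norm D0 <= B" using Bs by linarith+
  qed
  have "\<bar>R1 p \<bullet> G1 p - D0 \<bullet> D0\<bar> <= (B * z0) * B + B * (B * z0)"
   by (rule order_trans[OF inner_product_diff add_mono[OF mult_mono mult_mono]]) (use D0 nb Bs z0 in auto)
  moreover have "\<bar>e \<bullet> S1 p\<bar> <= z0 * B"
   by (rule order_trans[OF Cauchy_Schwarz_ineq2 mult_mono]) (use e nb z0 in auto)
  moreover have "1 / B^2 <= D0 \<bullet> D0"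
  proof -
   have "(1 / B)^2 <= (norm D0)^2" using D0(1) Bs by (intro power_mono) auto
   then show ?thesis by (simp add: power_divide power2_norm_eq_inner)
  qed
  moreover have "(B * z0) * B + B * (B * z0) + z0 * B <= 1 / (2 * B^2)"
  proof -
   have "B <= B^2" using power_increasing[of 1 2 B] Bs by simp
   then have "(B * z0) * B + B * (B * z0) + z0 * B <= 3 * (B^2 * z0)" using z0 by (simp add: power2_eq_square algebra_simps) (use mult_left_mono[of B "B^2" z0] z0 in \<open>simp add: power2_eq_square algebra_simps\<close>)
   also have "B^2 * z0 = 1 / (20 * B^2)" unfolding z0_def using Bp(2)[of 1] by (simp add: power2_eq_square power4_eq_xxxx)
   also have "3 * (1 / (20 * B^2)) <= 1 / (2 * B^2)" using Bp(2)[of 2] by (simp add: field_simps)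
   finally show ?thesis .
  qed
  moreover have "1 / B^2 = 1 / (2 * B^2) + 1 / (2 * B^2)" by simp
  ultimately have "c <= R1 p \<bullet> G1 p - e \<bullet> S1 p" unfolding c_def by linarith
  moreover have "norm e <= 1" using e z0 by linarith
  ultimately show ?thesis using main p t unfolding EQ_def Let_def p_def z_def by simp
 qed
 show ?thesis
 proof (rule that[OF z0 c, of "20 * B^2"])
  show "1 <= 20 * B^2" using Bp(1)[of 2] by simp
  fix t dt th e v sg assume "foot_data z0 t dt th e v sg"
  from eq[OF this] have E: "EQ t dt th e v sg" .
  define p where "p = (th, dt * sg, t + dt)"
  let ?P = "(1 / dt) *\<^sub>R (crv th (t + dt) - crv th t)" and ?Q = "(1 / dt) *\<^sub>R (D 1 0 th (t + dt) - D 1 0 th t)"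
  from E have main: "sg * (R1 p \<bullet> G1 p - e \<bullet> S1 p) = v \<bullet> G1 p - ?P \<bullet> G1 p + e \<bullet> ?Q"
   and cE: "c <= R1 p \<bullet> G1 p - e \<bullet> S1 p" and p: "p \<in> par_box 1 T" and e: "norm e <= 1" and t: "t \<in> {0..T}" "t + dt \<in> {0..T}" "0 < dt"
   unfolding EQ_def Let_def p_def by auto
  have b: "norm (G1 p) <= B" "norm ?P <= B" "norm ?Q <= B"
   using C3(2)[OF p] C4(2)[OF t, of th] C5(2)[OF t, of th] Bs by linarith+
  have "c * \<bar>sg\<bar> <= \<bar>R1 p \<bullet> G1 p - e \<bullet> S1 p\<bar> * \<bar>sg\<bar>" using cE by (intro mult_right_mono) auto
  also have "... = \<bar>v \<bullet> G1 p - ?P \<bullet> G1 p + e \<bullet> ?Q\<bar>" unfolding main[symmetric] by (simp only: abs_mult mult.commute)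
  also have "... <= norm v * B + B * B + 1 * B"
  proof -
   have "\<bar>v \<bullet> G1 p\<bar> <= norm v * B" "\<bar>?P \<bullet> G1 p\<bar> <= B * B" "\<bar>e \<bullet> ?Q\<bar> <= 1 * B"
    by (rule order_trans[OF Cauchy_Schwarz_ineq2 mult_mono[OF _ _ _ norm_ge_zero]], use b e Bs in linarith, use b e Bs in linarith, use Bs in \<open>simp; fail\<close>)+
   then show ?thesis by linarith
  qed
  also have "... <= 20 * B^2 * (norm v + 1)"
  proof -
   have BB: "B <= B^2" using power_increasing[of 1 2 B] Bs by simp
   then have "norm v * B <= norm v * B^2" by (rule mult_left_mono) simp
   then have "norm v * B + B * B + 1 * B <= norm v * B^2 + B^2 + B^2" using BB by (simp add: power2_eq_square)
   also have "... <= 20 * (norm v * B^2) + 20 * B^2" using Bp(2)[of 2] mult_nonneg_nonneg[of "norm v" "B^2"] by simp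
   finally show ?thesis by (simp add: algebra_simps)
  qed
  finally show "c * \<bar>sg\<bar> <= 20 * B^2 * (norm v + 1)" .
 next
  fix t dt th :: real and e w b :: "real^2" and sg th' :: real and e' w' b' :: "real^2" and sg' M :: real
  assume f: "foot_data z0 t dt th e (w + b) sg" "foot_data z0 t dt th' e' (w' + b') sg'"
   and M: "1 <= M" "norm w' <= M" "\<bar>sg'\<bar> <= M" and dt: "2 * (20 * B^2) * M * dt <= c"
  define p where "p = (th, dt * sg, t + dt)"
  define p' where "p' = (th', dt * sg', t + dt)"
  let ?P = "%th. (1 / dt) *\<^sub>R (crv th (t + dt) - crv th t)" and ?Q = "%th. (1 / dt) *\<^sub>R (D 1 0 th (t + dt) - D 1 0 th t)"
  from eq[OF f(1)] have main: "sg * (R1 p \<bullet> G1 p - e \<bullet> S1 p) = (w + b) \<bullet> G1 p - ?P th \<bullet> G1 p + e \<bullet> ?Q th"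
   and cE: "c <= R1 p \<bullet> G1 p - e \<bullet> S1 p" and p: "p \<in> par_box 1 T" and t: "t \<in> {0..T}" "t + dt \<in> {0..T}" "0 < dt"
   unfolding EQ_def Let_def p_def by auto
  from eq[OF f(2)] have main': "sg' * (R1 p' \<bullet> G1 p' - e' \<bullet> S1 p') = (w' + b') \<bullet> G1 p' - ?P th' \<bullet> G1 p' + e' \<bullet> ?Q th'"
   and p': "p' \<in> par_box 1 T" and e': "norm e' <= 1"
   unfolding EQ_def Let_def p'_def by auto
  \<comment> \<open>The displaced arguments also differ by \<open>dt\<close> times the unknown
    difference of \<open>sg\<close> and \<open>sg'\<close>; the smallness of \<open>dt\<close> lets
    this part be absorbed at the end.\<close>
  define \<delta> where "\<delta> = \<bar>th - th'\<bar> + dt * \<bar>sg - sg'\<bar>"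
  have \<delta>: "dist p p' <= \<delta>" "\<bar>th - th'\<bar> <= \<delta>" "0 <= \<delta>"
  proof -
   have "dist p p' <= dist th th' + dist (dt * sg, t + dt) (dt * sg', t + dt)" unfolding p_def p'_def by (rule dist_prod_le)
   also have "... <= \<bar>th - th'\<bar> + (\<bar>dt * sg - dt * sg'\<bar> + 0)"
    using dist_prod_le[of "dt * sg" "t + dt" "dt * sg'" "t + dt"] by (simp add: dist_real_def)
   also have "... = \<delta>" unfolding \<delta>_def using t(3) by (simp add: abs_mult flip: right_diff_distrib)
   finally show "dist p p' <= \<delta>" .
   show "\<bar>th - th'\<bar> <= \<delta>" "0 <= \<delta>" unfolding \<delta>_def using t(3) by auto
  qed
  have lip: "norm X <= B * \<delta>" if "norm X <= C * s" "C <= B" "s <= \<delta>" "1 <= C" for X :: "real^2" and C s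
  proof -
   have "C * s <= C * \<delta>" using that by (intro mult_left_mono) auto
   also have "... <= B * \<delta>" using that \<delta> by (intro mult_right_mono) auto
   finally show ?thesis using that(1) by linarith
  qed
  have G: "G1 p = D 1 0 (th + dt * sg) (t + dt)" "G1 p' = D 1 0 (th' + dt * sg') (t + dt)" unfolding G1_def p_def p'_def by simp_all
  have "c * \<bar>sg - sg'\<bar> <= 10 * B^2 * M * (\<delta> + norm (e - e') + norm (w - w') + \<bar>b \<bullet> G1 p\<bar> + \<bar>b' \<bullet> G1 p'\<bar>)"
  proof (rule quotient_difference)
   show "sg * (R1 p \<bullet> G1 p - e \<bullet> S1 p) = w \<bullet> G1 p + b \<bullet> G1 p - ?P th \<bullet> G1 p + e \<bullet> ?Q th"
    unfolding main inner_add_left[of w b] ..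
   show "sg' * (R1 p' \<bullet> G1 p' - e' \<bullet> S1 p') = w' \<bullet> G1 p' + b' \<bullet> G1 p' - ?P th' \<bullet> G1 p' + e' \<bullet> ?Q th'"
    unfolding main' inner_add_left[of w' b'] ..
   show "c <= R1 p \<bullet> G1 p - e \<bullet> S1 p" "1 <= B" "1 <= M" "norm w' <= M" "\<bar>sg'\<bar> <= M" "norm e' <= 1" "0 <= \<delta>" by fact+
   show "norm (G1 p) <= B" "norm (S1 p) <= B" "norm (?Q th) <= B" "norm (R1 p') <= B" "norm (?P th') <= B"
    using C3(2)[OF p] C2(2)[OF p] C5(2)[OF t, of th] C1(2)[OF p'] C4(2)[OF t, of th'] Bs by linarith+
   show "norm (R1 p - R1 p') <= B * \<delta>" by (rule lip[OF C1(3)[OF p p'] Bs(1) \<delta>(1) C1(1)])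
   show "norm (G1 p - G1 p') <= B * \<delta>" by (rule lip[OF C3(3)[OF p p'] Bs(3) \<delta>(1) C3(1)])
   show "norm (S1 p - S1 p') <= B * \<delta>" by (rule lip[OF C2(3)[OF p p'] Bs(2) \<delta>(1) C2(1)])
   show "norm (?P th - ?P th') <= B * \<delta>" by (rule lip[OF C4(3)[OF t] Bs(4) \<delta>(2) C4(1)])
   show "norm (?Q th - ?Q th') <= B * \<delta>" by (rule lip[OF C5(3)[OF t] Bs(5) \<delta>(2) C5(1)])
  qed
  moreover define X where "X = \<bar>th - th'\<bar> + norm (e - e') + norm (w - w') + \<bar>b \<bullet> G1 p\<bar> + \<bar>b' \<bullet> G1 p'\<bar>"
  ultimately have "c * \<bar>sg - sg'\<bar> <= 10 * B^2 * M * (X + dt * \<bar>sg - sg'\<bar>)" unfolding \<delta>_def by (simp add: add.commute add.left_commute)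
  also have "... = 10 * B^2 * M * X + (10 * B^2 * M * dt) * \<bar>sg - sg'\<bar>" by (simp add: distrib_left)
  also have "... <= 10 * B^2 * M * X + (c / 2) * \<bar>sg - sg'\<bar>"
   using dt c by (intro add_left_mono mult_right_mono) (auto simp: mult.assoc)
  finally have "c * \<bar>sg - sg'\<bar> <= 20 * B^2 * M * X" by (simp add: field_simps)
  then show "c * \<bar>sg - sg'\<bar> <= 20 * B^2 * M * (\<bar>th - th'\<bar> + norm (e - e') + norm (w - w')
     + \<bar>b \<bullet> D 1 0 (th + dt * sg) (t + dt)\<bar> + \<bar>b' \<bullet> D 1 0 (th' + dt * sg') (t + dt)\<bar>)"
   unfolding X_def G .
 qed
qed

lemma crv_shift_eq':
 assumes "t \<in> {0..T}" "t' \<in> {0..T}" "crv a t = crv b t"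
 shows "D i j (a + z) t' = D i j (b + z) t'"
proof -
 obtain k :: int where "b = a + of_int k" using D_inj[OF assms(1,3)] by blast
 then have "b + z = (a + z) + of_int k" by simp
 then show ?thesis using D_periodic[OF assms(2), of i j "a + z" k] by (simp only:)
qed

text \<open>Lets neighbouring nodes be compared through parameters that differ by the small
  increment \<open>d j\<close>, although \<open>th\<close> itself may jump by an integer.\<close>

lemma foot_data_shift:
 assumes "foot_data z0 t dt a e v sg" "crv a t = crv b t"
 shows "foot_data z0 t dt b e v sg"
proof -
 have t: "t \<in> {0..T}" "t + dt \<in> {0..T}" using assms(1) unfolding foot_data_def by auto
 have "D 1 0 b t = D 1 0 a t" using crv_shift_eq'[OF t(1) t(1) assms(2), of 1 0 0] by simp
 then show ?thesis using assms(1) unfolding foot_data_def assms(2) crv_shift_eq'[OF t assms(2)] by simp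
qed

end

lemma sum_square_le4:
 fixes a b c d :: real
 shows "(a + b + c + d)^2 <= 4 * (a^2 + b^2 + c^2 + d^2)"
proof -
 have "0 <= (a - b)^2 + (a - c)^2 + (a - d)^2 + (b - c)^2 + (b - d)^2 + (c - d)^2" by simp
 then show ?thesis by (simp add: power2_eq_square algebra_simps)
qed

context curve_flow
begin

lemma tang_rot_D: "t \<in> {0..T} ==> rot (tang th t) \<bullet> D 1 0 th t = 0"
 unfolding tang_def by (simp add: rot_scaleR)

text \<open>The turned tangent is orthogonal to \<open>D 1 0\<close> at the same point, so only the
  deviations of \<open>b\<close> from the tangent and of \<open>G\<close> from \<open>D 1 0\<close>
  contribute.\<close>

lemma normal_leak:
 assumes t: "t \<in> {0..T}"
 shows "\<bar>rot b \<bullet> G\<bar> <= norm (b - tang th t) * norm G + norm (G - D 1 0 th t)"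
proof -
 have "rot b \<bullet> G = rot (b - tang th t) \<bullet> G + rot (tang th t) \<bullet> (G - D 1 0 th t)"
  using tang_rot_D[OF t, of th] by (simp add: rot_diff inner_diff_left inner_diff_right)
 moreover have "\<bar>rot (b - tang th t) \<bullet> G\<bar> <= norm (b - tang th t) * norm G"
  by (rule order_trans[OF Cauchy_Schwarz_ineq2]) simp
 moreover have "\<bar>rot (tang th t) \<bullet> (G - D 1 0 th t)\<bar> <= norm (G - D 1 0 th t)"
  by (rule order_trans[OF Cauchy_Schwarz_ineq2]) (simp add: norm_tang[OF t])
 ultimately show ?thesis by linarith
qed

text \<open>The foot equations at the two ends of an edge are compared. Squared increments of
  parameters, errors and exact velocities are O(r^8) per edge and hence O(r^4) in total; for
  \<open>A\<close> and the normal component the sums come from the velocity bounds.\<close>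

lemma projected_step:
 assumes K: "1 <= K"
 obtains C r0 where "1 <= C" "0 < r0" "!!r dt t J x y q q' th d. 0 < r ==> r <= r0 ==> 0 < dt ==> dt <= K * r^8 ==> t + dt \<in> {0..T} ==>
   good_arcs t J q th d ==> simple_closed_polygon J x ==> scheme_step J dt x y ==>
   (!!j. j < J ==> r^4 / K <= d j) ==> (!!j. j < J ==> d j <= K * r^4) ==>
   (!!j. j < J ==> norm (x j - q j) <= r^7) ==>
   (!!j. j < J ==> norm ((x (nxt J j) - q (nxt J j)) - (x j - q j)) <= K * r^9) ==>
   (\<Sum>j<J. (norm ((x (nxt J j) - q (nxt J j)) - (x j - q j)))^2) <= K * r^18 ==>
   (!!j. j < J ==> (x j - q j) \<bullet> D 1 0 (th j) t = 0) ==>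
   (!!j. j < J ==> q' j = closest_point (\<Gamma> (t + dt)) (y j)) ==> simple_closed_polygon J q' ==>
   bij_betw (closest_point (\<Gamma> (t + dt))) (polygon_set J q') (\<Gamma> (t + dt)) ==>
   \<exists>sg. good_arcs (t + dt) J q' (%j. th j + dt * sg j) (%j. d j + dt * (sg (nxt J j) - sg j))
    \<and> (\<forall>j<J. \<bar>sg j\<bar> <= C \<and> d j + dt * (sg (nxt J j) - sg j) <= 2 * K * r^4)
    \<and> (\<Sum>j<J. (sg (nxt J j) - sg j)^2) <= C * r^4"
proof -
 obtain K' where K': "K <= K'" and lg: "!!r t J x q th d. good_arcs t J q th d ==> simple_closed_polygon J x ==> 0 < r ==> 40 * K'^4 * r <= 1 ==>
   (!!j. j < J ==> r^4 / K <= d j) ==> (!!j. j < J ==> d j <= K * r^4) ==>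
   (!!j. j < J ==> norm ((x (nxt J j) - q (nxt J j)) - (x j - q j)) <= K * r^9) ==>
   (\<Sum>j<J. (norm ((x (nxt J j) - q (nxt J j)) - (x j - q j)))^2) <= K * r^18 ==>
   level_geometry J r K' x q (%j. tang (th j) t) (%j. D 0 1 (th j) t) (%j. d j * norm (D 1 0 (th j) t))"
  using level_geometry_arcs[OF K] by blast
 obtain z0 c B where z0: "0 < z0" "z0 <= 1" and c: "0 < c" and B: "1 <= B" and
  fs1: "!!t dt th e v sg. foot_data z0 t dt th e v sg ==> c * \<bar>sg\<bar> <= B * (norm v + 1)" and
  fs2: "!!t dt th e w b sg th' e' w' b' sg' M. foot_data z0 t dt th e (w + b) sg ==> foot_data z0 t dt th' e' (w' + b') sg' ==>
    1 <= M ==> norm w' <= M ==> \<bar>sg'\<bar> <= M ==> 2 * B * M * dt <= c ==>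
    c * \<bar>sg - sg'\<bar> <= B * M * (\<bar>th - th'\<bar> + norm (e - e') + norm (w - w')
     + \<bar>b \<bullet> D 1 0 (th + dt * sg) (t + dt)\<bar> + \<bar>b' \<bullet> D 1 0 (th' + dt * sg') (t + dt)\<bar>)"
  by (rule foot_step) (rule that, assumption+)
 obtain d1 where d1: "0 < d1" "d1 <= 1" "!!th d t. t \<in> {0..T} ==> 0 < d ==> d <= d1 ==> chord_ok th d t"
  by (rule chord_ok_small) (rule that, assumption+)
 obtain cc where cc: "0 < cc" "!!th t p. t \<in> {0..T} ==> \<exists>ps. closest_point (\<Gamma> t) p = crv ps t \<and> cc * \<bar>ps - th\<bar> <= norm (p - crv th t)
   \<and> (p - crv ps t) \<bullet> D 1 0 ps t = 0 \<and> norm (p - crv ps t) <= norm (p - crv th t)"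
  by (rule closest_near) (rule that, assumption+)
 obtain Bg where Bg: "1 <= Bg" "!!th th' t t'. t \<in> {0..T} ==> t' \<in> {0..T} ==> norm (crv th t - crv th' t') <= Bg * (\<bar>th - th'\<bar> + \<bar>t - t'\<bar>)"
  by (rule D_bound_ge1[of 0 0]) (rule that, assumption+)
 obtain Bd where Bd: "1 <= Bd" "!!th t. t \<in> {0..T} ==> norm (D 1 0 th t) <= Bd"
  "!!th th' t t'. t \<in> {0..T} ==> t' \<in> {0..T} ==> norm (D 1 0 th t - D 1 0 th' t') <= Bd * (\<bar>th - th'\<bar> + \<bar>t - t'\<bar>)"
  by (rule D_bound_ge1[of 1 0]) (rule that, assumption+)
 define W where "W = 60000 * (1000 * K'^9)^17"
 define Mv where "Mv = K' + 2 * W"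
 define M where "M = Mv + B * (Mv + 1) / c"
 define F where "F = Bd * (9 * K'^4) + Bd * (K * (M + 1))"
 define N where "N = (2 * K + K')^2 * K + W + 2 * (F^2 * W)"
 define C where "C = M + (B * M / c)^2 * (4 * N)"
 \<comment> \<open>Thresholds for \<open>r\<close>: \<open>s1\<close> for the level geometry,
   \<open>s2\<close> and \<open>s3\<close> for foot displacement and error below \<open>z0\<close>,
   \<open>s4\<close> for absorbing the time step, \<open>s5\<close> for increments that stay
   positive, \<open>s6\<close> for arcs short enough for \<open>chord_ok\<close>.\<close>
 define s1 s2 s3 s4 s5 s6 where "s1 = 40 * K'^4" and "s2 = (K * Mv + 1 + Bg * K) / (cc * z0)" and "s3 = 1 / z0"
  and "s4 = 2 * B * M * K / c" and "s5 = 4 * K^2 * M" and "s6 = 4 * K / d1"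
 have K1: "1 <= K'" using K K' by linarith
 have W: "1 <= W"
 proof -
  have "1 <= 1000 * K'^9" using one_le_power[OF K1, of 9] by linarith
  then show ?thesis unfolding W_def using one_le_power[of "1000 * K'^9" 17] by linarith
 qed
 have Mv: "1 <= Mv" "K' + 2 * W <= Mv" unfolding Mv_def using K1 W by auto
 have M: "1 <= M" "Mv <= M" "B * (Mv + 1) / c <= M"
 proof -
  have "0 <= B * (Mv + 1) / c" using Mv(1) B c by simp
  then show "1 <= M" "Mv <= M" "B * (Mv + 1) / c <= M" unfolding M_def using Mv(1) by linarith+
 qed
 have F: "0 <= F" unfolding F_def using Bd(1) K M(1) K1 by simp
 have N: "0 <= N" unfolding N_def using K W by simp
 have C: "M <= C" "(B * M / c)^2 * (4 * N) <= C" unfolding C_def using N M by auto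
 have s: "0 <= s1" "0 <= s2" "0 <= s3" "0 <= s4" "0 <= s5" "0 <= s6"
  unfolding s1_def s2_def s3_def s4_def s5_def s6_def using K Mv(1) Bg(1) cc(1) z0 B M(1) c d1 by auto
 define S where "S = 1 + s1 + s2 + s3 + s4 + s5 + s6"
 have S: "1 <= S" "s1 <= S" "s2 <= S" "s3 <= S" "s4 <= S" "s5 <= S" "s6 <= S" unfolding S_def using s by linarith+
 show ?thesis
 proof (rule that[of C "1 / S"])
  show "1 <= C" "0 < 1 / S" using C M S by auto
  fix r dt t :: real and J :: nat and x y q q' :: "nat => real^2" and th d :: "nat => real"
  assume r: "0 < r" "r <= 1 / S" and dt: "0 < dt" "dt <= K * r^8" and t': "t + dt \<in> {0..T}"
   and g: "good_arcs t J q th d" and x: "simple_closed_polygon J x" and sch: "scheme_step J dt x y"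
   and d: "!!j. j < J ==> r^4 / K <= d j" "!!j. j < J ==> d j <= K * r^4"
   and e: "!!j. j < J ==> norm (x j - q j) <= r^7"
    "!!j. j < J ==> norm ((x (nxt J j) - q (nxt J j)) - (x j - q j)) <= K * r^9"
    "(\<Sum>j<J. (norm ((x (nxt J j) - q (nxt J j)) - (x j - q j)))^2) <= K * r^18"
   and orth: "!!j. j < J ==> (x j - q j) \<bullet> D 1 0 (th j) t = 0"
   and q': "!!j. j < J ==> q' j = closest_point (\<Gamma> (t + dt)) (y j)" "simple_closed_polygon J q'"
    "bij_betw (closest_point (\<Gamma> (t + dt))) (polygon_set J q') (\<Gamma> (t + dt))"
  note t = good_arcsD(2)[OF g]
  have idx: "nxt J j < J" for j using good_arcsD(5)[OF g] by simp
  have rS: "r * S <= 1" using r S(1) by (simp add: field_simps)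
  have sm: "a * r <= 1" if "a <= S" for a
   using order_trans[OF mult_right_mono[OF that, of r]] r rS by (simp add: mult.commute)
  have r1: "r <= 1" using sm[OF S(1)] by simp
  have sm': "a * r^n <= 1" if "a <= S" "1 <= n" "0 <= a" for a n
   using rpow_mono[of r 1 n a a] r r1 that sm[OF that(1)] by simp
  have up: "a * r^n <= b * r^m" if "m <= n" "0 <= a" "a <= b" for a b n m
   using rpow_mono[of r m n a b] r r1 that by simp
  interpret lg: level_geometry J r K' x q "%j. tang (th j) t" "%j. D 0 1 (th j) t" "%j. d j * norm (D 1 0 (th j) t)"
   by (rule lg[OF g x r(1) sm[OF S(2), unfolded s1_def] d e(2,3)])
  have dt': "dt <= K' * r^8" by (rule order_trans[OF dt(2) mult_right_mono[OF K']]) (use r(1) in simp)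
  obtain A \<beta> where vel: "!!j. j < J ==> (1 / dt) *\<^sub>R (y j - x j) = D 0 1 (th j) t + A j + \<beta> j *\<^sub>R rot (avg_dir J x j)"
   and A: "!!j. j < J ==> norm (A j) <= W" "(\<Sum>j<J. (norm (A (nxt J j) - A j))^2) <= W * r^4"
   and \<beta>: "(\<Sum>j<J. (\<beta> j)^2) <= W * r^2"
   by (rule lg.velocity_bounds[OF sch dt(1) dt', folded W_def]) (rule that, assumption+)
  define v where "v j = (1 / dt) *\<^sub>R (y j - x j)" for j
  define w where "w j = D 0 1 (th j) t + A j" for j
  define b where "b j = \<beta> j *\<^sub>R rot (avg_dir J x j)" for j
  have vwb: "v j = w j + b j" if "j < J" for j unfolding v_def w_def b_def by (rule vel[OF that])
  have wM: "norm (w j) <= K' + W" if j: "j < J" for j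
   unfolding w_def by (rule norm_triangle_mono[OF lg.V(1)[OF j] A(1)[OF j]])
  have \<beta>W: "\<bar>\<beta> j\<bar> <= W" if j: "j < J" for j
  proof -
   have "(\<beta> j)^2 <= (\<Sum>j<J. (\<beta> j)^2)" using j by (intro member_le_sum) auto
   also have "... <= W * r^2" by (rule \<beta>)
   also have "... <= W * 1" using r r1 W by (intro mult_left_mono power_le_one) auto
   also have "... <= W^2" using W by (simp add: power2_eq_square)
   finally show ?thesis using W by (simp add: abs_le_square_iff[symmetric])
  qed
  have vM: "norm (v j) <= Mv" if j: "j < J" for j
  proof -
   have "norm (b j) <= W * 1" unfolding b_def norm_scaleR norm_rot using \<beta>W[OF j] lg.tb_bounds(2)[OF j] W by (intro mult_mono) auto
   then show ?thesis using norm_triangle_mono[OF wM[OF j], of "b j" W] Mv(2) unfolding vwb[OF j] by simp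
  qed
  have "\<forall>j. \<exists>ps. j < J \<longrightarrow> closest_point (\<Gamma> (t + dt)) (y j) = crv ps (t + dt) \<and> cc * \<bar>ps - th j\<bar> <= norm (y j - crv (th j) (t + dt))
   \<and> (y j - crv ps (t + dt)) \<bullet> D 1 0 ps (t + dt) = 0"
  proof
   fix j
   show "\<exists>ps. j < J \<longrightarrow> closest_point (\<Gamma> (t + dt)) (y j) = crv ps (t + dt) \<and> cc * \<bar>ps - th j\<bar> <= norm (y j - crv (th j) (t + dt))
   \<and> (y j - crv ps (t + dt)) \<bullet> D 1 0 ps (t + dt) = 0"
    using cc(2)[OF t', of "y j" "th j"] by blast
  qed
  from choice[OF this] obtain ps where ps: "!!j. j < J ==> closest_point (\<Gamma> (t + dt)) (y j) = crv (ps j) (t + dt)"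
   "!!j. j < J ==> cc * \<bar>ps j - th j\<bar> <= norm (y j - crv (th j) (t + dt))"
   "!!j. j < J ==> (y j - crv (ps j) (t + dt)) \<bullet> D 1 0 (ps j) (t + dt) = 0" by blast
  define sg where "sg j = (ps j - th j) / dt" for j
  have thsg: "th j + dt * sg j = ps j" for j unfolding sg_def using dt(1) by simp
  define ee where "ee j = x j - q j" for j
  have yv: "y j = q j + ee j + dt *\<^sub>R v j" for j unfolding v_def ee_def using dt(1) by simp
  have foot: "foot_data z0 t dt (th j) (ee j) (v j) (sg j)" if j: "j < J" for j
   unfolding foot_data_def thsg
  proof (intro conjI)
   show "t \<in> {0..T}" "t + dt \<in> {0..T}" "0 < dt" by fact+
   have r7: "s3 * r^7 <= 1" by (rule sm'[OF S(4) _ s(3)]) simp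
   then have "r^7 <= z0" unfolding s3_def using z0 by (simp add: field_simps)
   then show "norm (ee j) <= z0" unfolding ee_def using e(1)[OF j] by linarith
   show "ee j \<bullet> D 1 0 (th j) t = 0" unfolding ee_def by (rule orth[OF j])
   have qj: "crv (th j) t = q j" using good_arcsD(7)[OF g j] by simp
   show "(crv (th j) t + ee j + dt *\<^sub>R v j - crv (ps j) (t + dt)) \<bullet> D 1 0 (ps j) (t + dt) = 0"
    unfolding qj yv[symmetric] by (rule ps(3)[OF j])
   have "cc * \<bar>ps j - th j\<bar> <= norm (y j - crv (th j) (t + dt))" by (rule ps(2)[OF j])
   also have "y j - crv (th j) (t + dt) = (dt *\<^sub>R v j + ee j) + (crv (th j) t - crv (th j) (t + dt))" unfolding yv qj by simp
   also have "norm ... <= ((K * r^8) * Mv + r^7) + Bg * (K * r^8)"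
   proof (intro norm_triangle_mono)
    show "norm (dt *\<^sub>R v j) <= (K * r^8) * Mv" unfolding norm_scaleR using dt vM[OF j] by (intro mult_mono) auto
    show "norm (ee j) <= r^7" unfolding ee_def by (rule e(1)[OF j])
    have "norm (crv (th j) t - crv (th j) (t + dt)) <= Bg * dt" using Bg(2)[OF t t', of "th j" "th j"] dt(1) by simp
    also have "... <= Bg * (K * r^8)" using dt(2) Bg(1) by (intro mult_left_mono) auto
    finally show "norm (crv (th j) t - crv (th j) (t + dt)) <= Bg * (K * r^8)" .
   qed
   also have "... <= (K * Mv) * r^7 + 1 * r^7 + (Bg * K) * r^7"
   proof -
    have "(K * Mv) * r^8 <= (K * Mv) * r^7" "(Bg * K) * r^8 <= (Bg * K) * r^7"
     using K Mv(1) Bg(1) by (intro up; simp)+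
    moreover have "(K * r^8) * Mv = (K * Mv) * r^8" "Bg * (K * r^8) = (Bg * K) * r^8" by simp_all
    ultimately show ?thesis by linarith
   qed
   also have "... = (cc * z0) * (s2 * r^7)"
   proof -
    have "(cc * z0) * s2 = K * Mv + 1 + Bg * K" unfolding s2_def using cc(1) z0 by simp
    then have "(cc * z0) * (s2 * r^7) = (K * Mv + 1 + Bg * K) * r^7" by (simp only: mult.assoc[symmetric])
    then show ?thesis by (simp only: distrib_right)
   qed
   also have "... <= (cc * z0) * 1" using sm'[OF S(3) _ s(2), of 7] cc(1) z0 by (intro mult_left_mono) auto
   finally have "cc * \<bar>ps j - th j\<bar> <= cc * z0" by simp
   then have "\<bar>ps j - th j\<bar> <= z0" using cc(1) by simp
   then show "\<bar>dt * sg j\<bar> <= z0" unfolding sg_def using dt(1) by simp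
  qed
  have sgM: "\<bar>sg j\<bar> <= M" if j: "j < J" for j
  proof -
   have "c * \<bar>sg j\<bar> <= B * (norm (v j) + 1)" by (rule fs1[OF foot[OF j]])
   also have "... <= B * (Mv + 1)" using vM[OF j] B by (intro mult_left_mono) auto
   finally have "\<bar>sg j\<bar> <= B * (Mv + 1) / c" using c by (simp add: field_simps)
   then show ?thesis using M(3) by linarith
  qed
  \<comment> \<open>The averaged direction is tangent up to O(r^5), and in one step the tangent
    turns only by O(\<open>dt\<close>), which is O(r^8).\<close>
  have \<rho>: "\<bar>b j \<bullet> D 1 0 (th j + dt * sg j) (t + dt)\<bar> <= F * r^5 * \<bar>\<beta> j\<bar>" if j: "j < J" for j
  proof -
   let ?G = "D 1 0 (th j + dt * sg j) (t + dt)"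
   have "\<bar>rot (avg_dir J x j) \<bullet> ?G\<bar> <= norm (avg_dir J x j - tang (th j) t) * norm ?G + norm (?G - D 1 0 (th j) t)"
    by (rule normal_leak[OF t])
   also have "... <= (9 * K'^4 * r^5) * Bd + Bd * (dt * M + dt)"
   proof (intro add_mono)
    show "norm (avg_dir J x j - tang (th j) t) * norm ?G <= (9 * K'^4 * r^5) * Bd"
     by (rule mult_mono[OF lg.tb_T[OF j] Bd(2)[OF t'] _ norm_ge_zero]) (use r(1) in simp)
    have "norm (?G - D 1 0 (th j) t) <= Bd * (\<bar>dt * sg j\<bar> + dt)"
     using Bd(3)[OF t' t, of "th j + dt * sg j" "th j"] dt(1) by simp
    also have "... <= Bd * (dt * M + dt)"
     using Bd(1) sgM[OF j] dt(1) by (intro mult_left_mono add_right_mono) (auto simp: abs_mult)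
    finally show "norm (?G - D 1 0 (th j) t) <= Bd * (dt * M + dt)" .
   qed
   also have "... = (9 * K'^4 * r^5) * Bd + dt * (Bd * (M + 1))" by (simp add: algebra_simps)
   also have "... <= (9 * K'^4 * r^5) * Bd + (K * r^5) * (Bd * (M + 1))"
    using order_trans[OF dt(2) up[of 5 8 K K]] K Bd(1) M(1) by (intro add_left_mono mult_right_mono) auto
   also have "... = F * r^5" unfolding F_def by (simp add: algebra_simps)
   finally have "\<bar>rot (avg_dir J x j) \<bullet> ?G\<bar> <= F * r^5" .
   then have "\<bar>\<beta> j\<bar> * \<bar>rot (avg_dir J x j) \<bullet> ?G\<bar> <= \<bar>\<beta> j\<bar> * (F * r^5)" by (rule mult_left_mono) simp
   then show ?thesis unfolding b_def by (simp only: inner_scaleR_left abs_mult mult.commute)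
  qed
  have node: "crv (th (nxt J j)) t = crv (th j + d j) t" if j: "j < J" for j
   using good_arcs_tang(1)[OF g j, of 0 0] .
  have dtsmall: "2 * B * M * dt <= c"
  proof -
   have "2 * B * M * dt <= 2 * B * M * (K * r^8)" using dt(2) B M(1) by (intro mult_left_mono) auto
   also have "... = c * (s4 * r^8)" unfolding s4_def using c by simp
   also have "... <= c * 1" using sm'[OF S(5) _ s(4), of 8] c by (intro mult_left_mono) auto
   finally show ?thesis by simp
  qed
  have step: "\<bar>sg (nxt J j) - sg j\<bar> <= (B * M / c) * ((2 * K + K') * r^4 + norm (A (nxt J j) - A j) + F * r^5 * \<bar>\<beta> j\<bar> + F * r^5 * \<bar>\<beta> (nxt J j)\<bar>)"
   if j: "j < J" for j
  proof -
   let ?n = "nxt J j"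
   have f2: "foot_data z0 t dt (th j + d j) (ee ?n) (w ?n + b ?n) (sg ?n)"
    unfolding vwb[OF idx, symmetric] by (rule foot_data_shift[OF foot[OF idx] node[OF j]])
   have f1: "foot_data z0 t dt (th j) (ee j) (w j + b j) (sg j)" using foot[OF j] unfolding vwb[OF j] .
   have Deq: "D 1 0 (th j + d j + dt * sg ?n) (t + dt) = D 1 0 (th ?n + dt * sg ?n) (t + dt)"
    by (rule crv_shift_eq'[OF t t' node[OF j, symmetric]])
   have "c * \<bar>sg ?n - sg j\<bar> <= B * M * (\<bar>th j + d j - th j\<bar> + norm (ee ?n - ee j) + norm (w ?n - w j)
     + \<bar>b ?n \<bullet> D 1 0 (th j + d j + dt * sg ?n) (t + dt)\<bar> + \<bar>b j \<bullet> D 1 0 (th j + dt * sg j) (t + dt)\<bar>)"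
    by (rule fs2[OF f2 f1 M(1) _ sgM[OF j] dtsmall]) (use wM[OF j] Mv(2) M(2) W in linarith)
   also have "... <= B * M * ((2 * K + K') * r^4 + norm (A ?n - A j) + F * r^5 * \<bar>\<beta> j\<bar> + F * r^5 * \<bar>\<beta> ?n\<bar>)"
   proof (rule mult_left_mono)
    have "norm (w ?n - w j) <= K' * r^4 + norm (A ?n - A j)"
     unfolding w_def using norm_triangle_mono[OF lg.V(2)[OF j] order_refl[of "norm (A ?n - A j)"]] by (simp add: algebra_simps)
    moreover have "norm (ee ?n - ee j) <= K * r^4" unfolding ee_def by (rule order_trans[OF e(2)[OF j] up]) (use K in auto)
    moreover have "\<bar>th j + d j - th j\<bar> <= K * r^4" using d(2)[OF j] good_arcsD(9)[OF g j] by simp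
    ultimately show "\<bar>th j + d j - th j\<bar> + norm (ee ?n - ee j) + norm (w ?n - w j)
     + \<bar>b ?n \<bullet> D 1 0 (th j + d j + dt * sg ?n) (t + dt)\<bar> + \<bar>b j \<bullet> D 1 0 (th j + dt * sg j) (t + dt)\<bar>
     <= (2 * K + K') * r^4 + norm (A ?n - A j) + F * r^5 * \<bar>\<beta> j\<bar> + F * r^5 * \<bar>\<beta> ?n\<bar>"
     unfolding Deq distrib_right using \<rho>[OF j] \<rho>[OF idx, of j] by linarith
    show "0 <= B * M" using B M(1) by simp
   qed
   finally show ?thesis using c by (simp add: field_simps)
  qed
  have sum: "(\<Sum>j<J. (sg (nxt J j) - sg j)^2) <= C * r^4"
  proof -
   have sq: "(sg (nxt J j) - sg j)^2 <= (B * M / c)^2 * (4 * (((2 * K + K') * r^4)^2 + (norm (A (nxt J j) - A j))^2 + (F * r^5)^2 * (\<beta> j)^2 + (F * r^5)^2 * (\<beta> (nxt J j))^2))"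
    if j: "j < J" for j
   proof -
    have "(sg (nxt J j) - sg j)^2 = \<bar>sg (nxt J j) - sg j\<bar>^2" by simp
    also have "... <= ((B * M / c) * ((2 * K + K') * r^4 + norm (A (nxt J j) - A j) + F * r^5 * \<bar>\<beta> j\<bar> + F * r^5 * \<bar>\<beta> (nxt J j)\<bar>))^2"
     by (rule power_mono[OF step[OF j]]) simp
    also have "... = (B * M / c)^2 * ((2 * K + K') * r^4 + norm (A (nxt J j) - A j) + F * r^5 * \<bar>\<beta> j\<bar> + F * r^5 * \<bar>\<beta> (nxt J j)\<bar>)^2"
     by (rule power_mult_distrib)
    also have "... <= (B * M / c)^2 * (4 * (((2 * K + K') * r^4)^2 + (norm (A (nxt J j) - A j))^2 + (F * r^5 * \<bar>\<beta> j\<bar>)^2 + (F * r^5 * \<bar>\<beta> (nxt J j)\<bar>)^2))"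
     by (intro mult_left_mono sum_square_le4) simp
    finally show ?thesis unfolding power_mult_distrib[of "F * r^5"] power2_abs .
   qed
   have "(\<Sum>j<J. (sg (nxt J j) - sg j)^2) <= (\<Sum>j<J. (B * M / c)^2 * (4 * (((2 * K + K') * r^4)^2 + (norm (A (nxt J j) - A j))^2 + (F * r^5)^2 * (\<beta> j)^2 + (F * r^5)^2 * (\<beta> (nxt J j))^2)))"
    using sq by (intro sum_mono) auto
   also have "... = (B * M / c)^2 * (4 * (real J * ((2 * K + K') * r^4)^2 + (\<Sum>j<J. (norm (A (nxt J j) - A j))^2) + (F * r^5)^2 * (\<Sum>j<J. (\<beta> j)^2) + (F * r^5)^2 * (\<Sum>j<J. (\<beta> (nxt J j))^2)))"
    by (simp only: sum_distrib_left[symmetric] sum.distrib sum_constant card_lessThan)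
   also have "... <= (B * M / c)^2 * (4 * (((2 * K + K')^2 * K) * r^4 + W * r^4 + (F^2 * W) * r^4 + (F^2 * W) * r^4))"
   proof (intro mult_left_mono add_mono)
    have "real J * ((2 * K + K') * r^4)^2 = ((2 * K + K')^2 * r^4) * (real J * r^4)" by (simp add: power_mult_distrib power2_eq_square)
    also have "... <= ((2 * K + K')^2 * r^4) * K" using good_arcs_count[OF g _ d(1)] K r(1) by (intro mult_left_mono) auto
    finally show "real J * ((2 * K + K') * r^4)^2 <= ((2 * K + K')^2 * K) * r^4" by (simp add: mult.commute mult.left_commute)
    show "(\<Sum>j<J. (norm (A (nxt J j) - A j))^2) <= W * r^4" by (rule A(2))
    have bb: "(F * r^5)^2 * X <= (F^2 * W) * r^4" if "X <= W * r^2" for X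
    proof -
     have "(F * r^5)^2 * X <= (F * r^5)^2 * (W * r^2)" using that by (intro mult_left_mono) auto
     also have "... = (F^2 * W) * r^12" by (simp add: power_mult_distrib mult.commute mult.left_commute flip: power_add power_mult)
     also have "... <= (F^2 * W) * r^4" using W by (intro up) auto
     finally show ?thesis .
    qed
    show "(F * r^5)^2 * (\<Sum>j<J. (\<beta> j)^2) <= (F^2 * W) * r^4" by (rule bb[OF \<beta>])
    show "(F * r^5)^2 * (\<Sum>j<J. (\<beta> (nxt J j))^2) <= (F^2 * W) * r^4"
     by (rule bb) (use \<beta> sum_nxt[of "%j. (\<beta> j)^2" J] in simp)
   qed auto
   also have "... = ((B * M / c)^2 * (4 * N)) * r^4" unfolding N_def by (simp add: algebra_simps)
   also have "... <= C * r^4" using C(2) r(1) by (intro mult_right_mono) auto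
   finally show ?thesis .
  qed
  define d' where "d' j = d j + dt * (sg (nxt J j) - sg j)" for j
  \<comment> \<open>One step changes an increment by at most half its lower bound
    \<open>r^4 / K\<close>, so the arcs stay positively oriented.\<close>
  have dd: "\<bar>dt * (sg (nxt J j) - sg j)\<bar> <= r^4 / (2 * K)" if j: "j < J" for j
  proof -
   have "\<bar>sg (nxt J j) - sg j\<bar> <= 2 * M" using sgM[OF j] sgM[OF idx, of j] by linarith
   then have "\<bar>dt * (sg (nxt J j) - sg j)\<bar> <= (K * r^8) * (2 * M)" unfolding abs_mult using dt K r(1) by (intro mult_mono) auto
   also have "... = (r^4 / (2 * K)) * (s5 * r^4)" unfolding s5_def using K by (simp add: power2_eq_square flip: power_add)
   also have "... <= (r^4 / (2 * K)) * 1" using sm'[OF S(6) _ s(5), of 4] K r(1) by (intro mult_left_mono) auto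
   finally show ?thesis by simp
  qed
  have rK: "r^4 / (2 * K) <= K * r^4" "0 < r^4 / (2 * K)" "r^4 / K = r^4 / (2 * K) + r^4 / (2 * K)"
  proof -
   have "r^4 <= r^4 * (2 * K * K)" using r(1) K mult_mono[of 1 K 1 K] by (simp add: mult_le_cancel_left1)
   then show "r^4 / (2 * K) <= K * r^4" using K by (simp add: pos_divide_le_eq mult.commute mult.left_commute)
   show "0 < r^4 / (2 * K)" using K r(1) by simp
  qed simp
  have d'b: "0 < d' j" "d' j <= 2 * K * r^4" "d' j <= d1 / 2" if j: "j < J" for j
  proof -
   show "0 < d' j" unfolding d'_def using dd[OF j] d(1)[OF j] rK by linarith
   show a: "d' j <= 2 * K * r^4" unfolding d'_def using dd[OF j] d(2)[OF j] rK by linarith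
   have "2 * K * r^4 = d1 / 2 * (s6 * r^4)" unfolding s6_def using d1 by simp
   also have "... <= d1 / 2 * 1" using sm'[OF S(7) _ s(6), of 4] d1 by (intro mult_left_mono) auto
   finally show "d' j <= d1 / 2" using a by linarith
  qed
  have "good_arcs (t + dt) J q' (%j. th j + dt * sg j) d'"
   unfolding good_arcs_def arcs_def
  proof (intro conjI allI impI)
   show "t + dt \<in> {0..T}" "simple_closed_polygon J q'" "bij_betw (closest_point (\<Gamma> (t + dt))) (polygon_set J q') (\<Gamma> (t + dt))" by fact+
   have qsg: "q' j = crv (th j + dt * sg j) (t + dt)" if j: "j < J" for j unfolding thsg q'(1)[OF j] by (rule ps(1)[OF j])
   fix j assume j: "j < J"
   show "q' j = crv (th j + dt * sg j) (t + dt)" by (rule qsg[OF j])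
   have "q' (nxt J j) = crv (th (nxt J j) + dt * sg (nxt J j)) (t + dt)" by (rule qsg[OF idx])
   also have "... = crv (th j + d j + dt * sg (nxt J j)) (t + dt)" by (rule crv_shift_eq'[OF t t' node[OF j]])
   finally show "q' (nxt J j) = crv (th j + dt * sg j + d' j) (t + dt)" unfolding d'_def by (simp add: algebra_simps)
   show "0 < d' j" by (rule d'b(1)[OF j])
   show "d' j < 1" using d'b(3)[OF j] d1 by linarith
   show "chord_ok (th j + dt * sg j) (d' j) (t + dt)"
    by (rule d1(3)[OF t' d'b(1)[OF j]]) (use d'b(3)[OF j] d1 in linarith)
  qed
  moreover have "\<forall>j<J. \<bar>sg j\<bar> <= C \<and> d j + dt * (sg (nxt J j) - sg j) <= 2 * K * r^4"
  proof (intro allI impI conjI)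
   fix j assume j: "j < J"
   show "\<bar>sg j\<bar> <= C" using sgM[OF j] C(1) by linarith
   show "d j + dt * (sg (nxt J j) - sg j) <= 2 * K * r^4" using d'b(2)[OF j] unfolding d'_def .
  qed
  ultimately show "\<exists>sg. good_arcs (t + dt) J q' (%j. th j + dt * sg j) (%j. d j + dt * (sg (nxt J j) - sg j))
    \<and> (\<forall>j<J. \<bar>sg j\<bar> <= C \<and> d j + dt * (sg (nxt J j) - sg j) <= 2 * K * r^4)
    \<and> (\<Sum>j<J. (sg (nxt J j) - sg j)^2) <= C * r^4"
   using sum unfolding d'_def by blast
 qed
qed

end

section \<open>Increments of the functionals\<close>

text \<open>The edge weights scale the sums: squares of \<open>U\<close> add up to O(N^2 / r^4),
  those of \<open>V\<close> to O(r^4 * N^2), those of \<open>X\<close> to O(r^4).\<close>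

lemma weighted_cauchy:
 fixes X U V l :: "nat => real"
 assumes r: "0 < r" and C: "1 <= C" and K: "1 <= K" and N: "0 <= N"
  and X: "(\<Sum>j<J. (X j)^2) <= C * r^4"
  and l: "!!j. j < J ==> r^4 / K <= l j" "!!j. j < J ==> l j <= K * r^4"
  and U: "(\<Sum>j<J. l j * (U j)^2) / 6 <= N^2" and V: "(\<Sum>j<J. (V j)^2 / l j) <= N^2"
 shows "(\<Sum>j<J. \<bar>X j\<bar> * \<bar>U j\<bar>) <= 6 * C * K * N" "(\<Sum>j<J. \<bar>X j\<bar> * \<bar>V j\<bar>) <= C * K * r^4 * N"
proof -
 have lp: "0 < l j" if "j < J" for j by (rule less_le_trans[OF _ l(1)[OF that]]) (use r K in simp)
 have CC: "C <= C^2" "K <= K^2" using C K by (simp_all add: power2_eq_square)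
 have "C * r^4 <= C^2 * r^4" using CC r by (intro mult_right_mono) auto
 then have X2: "(\<Sum>j<J. (X j)^2) <= (C * r^2)^2" using X by (simp add: power_mult_distrib flip: power_mult)
 have "(\<Sum>j<J. (U j)^2) <= (\<Sum>j<J. (K / r^4) * (l j * (U j)^2))"
 proof (rule sum_mono)
  fix j assume j: "j \<in> {..<J}"
  have "1 <= (K / r^4) * l j" using l(1)[of j] j r K by (simp add: field_simps)
  from mult_right_mono[OF this, of "(U j)^2"] show "(U j)^2 <= (K / r^4) * (l j * (U j)^2)" by (simp add: mult.assoc)
 qed
 also have "... = (K / r^4) * (\<Sum>j<J. l j * (U j)^2)" by (rule sum_distrib_left[symmetric])
 also have "... <= (K / r^4) * (6 * N^2)" using U r K by (intro mult_left_mono) auto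
 also have "... = (6 * K) * (N / r^2)^2" by (simp add: power_divide flip: power_mult)
 also have "... <= (6 * K)^2 * (N / r^2)^2" using CC K by (intro mult_right_mono) (auto simp: power_mult_distrib)
 finally have U2: "(\<Sum>j<J. (U j)^2) <= (6 * K * (N / r^2))^2" by (simp only: power_mult_distrib)
 have "(\<Sum>j<J. (V j)^2) <= (\<Sum>j<J. (K * r^4) * ((V j)^2 / l j))"
 proof (rule sum_mono)
  fix j assume j: "j \<in> {..<J}"
  have "l j * ((V j)^2 / l j) <= (K * r^4) * ((V j)^2 / l j)" using l(2)[of j] lp[of j] j by (intro mult_right_mono) auto
  then show "(V j)^2 <= (K * r^4) * ((V j)^2 / l j)" using lp[of j] j by simp
 qed
 also have "... = (K * r^4) * (\<Sum>j<J. (V j)^2 / l j)" by (rule sum_distrib_left[symmetric])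
 also have "... <= (K * r^4) * N^2" using V r K by (intro mult_left_mono) auto
 also have "... <= (K^2 * r^4) * N^2" using CC r by (intro mult_right_mono) auto
 finally have V2: "(\<Sum>j<J. (V j)^2) <= (K * r^2 * N)^2" by (simp add: power_mult_distrib flip: power_mult)
 have "(\<Sum>j<J. \<bar>X j\<bar> * \<bar>U j\<bar>) <= (C * r^2) * (6 * K * (N / r^2))"
  by (rule cauchy_schwarz_sum[OF X2 U2]) (use C K N r in auto)
 also have "... = 6 * C * K * N" using r by simp
 finally show "(\<Sum>j<J. \<bar>X j\<bar> * \<bar>U j\<bar>) <= 6 * C * K * N" .
 have "(\<Sum>j<J. \<bar>X j\<bar> * \<bar>V j\<bar>) <= (C * r^2) * (K * r^2 * N)"
  by (rule cauchy_schwarz_sum[OF X2 V2]) (use C K N r in auto)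
 also have "... = C * K * r^4 * N" by (simp add: power2_eq_square power4_eq_xxxx)
 finally show "(\<Sum>j<J. \<bar>X j\<bar> * \<bar>V j\<bar>) <= C * K * r^4 * N" .
qed

section \<open>Change of the edge sums over one time step\<close>

context curve_flow
begin

text \<open>The difference of the powers of \<open>d\<close> costs one order in \<open>h\<close> but
  is proportional to \<open>s\<close>; the difference of the values of \<open>G\<close> keeps the
  full order. Both carry the factor \<open>dt\<close>.\<close>

lemma gap_increment:
 fixes G :: "real \<times> real \<times> real => real^2"
 assumes G: "!!p. p \<in> par_box d0 T ==> norm (G p) <= L" "!!p q. p \<in> par_box d0 T ==> q \<in> par_box d0 T ==> norm (G p - G q) <= L * dist p q"
  and L: "1 <= L" and M: "1 <= M" and n: "n = 1 \<or> n = 2"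
  and t: "t \<in> {0..T}" "t + dt \<in> {0..T}" "0 < dt" and h: "0 < h"
  and d: "0 < d" "d <= d0" "d <= M * h" "0 < d + dt * s" "d + dt * s <= d0" "d + dt * s <= M * h" and sg: "\<bar>sg\<bar> <= M" "\<bar>s\<bar> <= 2 * M"
 shows "norm ((d + dt * s) ^ Suc n *\<^sub>R G (th + dt * sg, d + dt * s, t + dt) - d ^ Suc n *\<^sub>R G (th, d, t))
  <= dt * (7 * L * M^4) * (h^n * (\<bar>s\<bar> + h))"
proof -
 define d' where "d' = d + dt * s"
 define p q where "p = (th + dt * sg, d', t + dt)" and "q = (th, d, t)"
 have pq: "p \<in> par_box d0 T" "q \<in> par_box d0 T" unfolding p_def q_def d'_def using d t by auto
 have d': "0 < d'" "d' <= M * h" "\<bar>d' - d\<bar> = dt * \<bar>s\<bar>" unfolding d'_def using d t by (auto simp: abs_mult)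
 have Mp: "M^k <= M^4" "1 <= M^4" if "k <= 4" for k using M that by (auto intro: power_increasing one_le_power)
 have pd: "\<bar>d' ^ Suc n - d ^ Suc n\<bar> <= 3 * (M * h)^n * (dt * \<bar>s\<bar>)"
 proof -
  have P: "\<bar>X\<bar> * (dt * \<bar>s\<bar>) <= Y * (dt * \<bar>s\<bar>)" if "\<bar>X\<bar> <= Y" for X Y using that t(3) by (intro mult_right_mono) auto
  from n show ?thesis
  proof
   assume [simp]: "n = 1"
   have "d' ^ Suc n - d ^ Suc n = (d' + d) * (d' - d)" by (simp add: power2_eq_square algebra_simps)
   then have "\<bar>d' ^ Suc n - d ^ Suc n\<bar> = \<bar>d' + d\<bar> * (dt * \<bar>s\<bar>)" by (simp only: abs_mult d'(3))
   also have "... <= (3 * (M * h)) * (dt * \<bar>s\<bar>)" by (rule P) (use d d' in auto)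
   finally show ?thesis by simp
  next
   assume [simp]: "n = 2"
   have "d' ^ Suc n - d ^ Suc n = (d' * d' + d' * d + d * d) * (d' - d)" by (simp add: power3_eq_cube algebra_simps)
   then have "\<bar>d' ^ Suc n - d ^ Suc n\<bar> = \<bar>d' * d' + d' * d + d * d\<bar> * (dt * \<bar>s\<bar>)" by (simp only: abs_mult d'(3))
   also have "... <= (3 * ((M * h) * (M * h))) * (dt * \<bar>s\<bar>)"
   proof (rule P)
    have "d' * d' <= (M * h) * (M * h)" "d' * d <= (M * h) * (M * h)" "d * d <= (M * h) * (M * h)"
     using d d' by (intro mult_mono; simp)+
    moreover have "0 <= d' * d'" "0 <= d' * d" "0 <= d * d" using d d' by auto
    ultimately show "\<bar>d' * d' + d' * d + d * d\<bar> <= 3 * ((M * h) * (M * h))" by linarith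
   qed
   finally show ?thesis by (simp add: power2_eq_square)
  qed
 qed
 have dist: "dist p q <= dt * (4 * M)"
 proof -
  have "dist p q <= dist (th + dt * sg) th + (dist d' d + dist (t + dt) t)" unfolding p_def q_def
   by (rule order_trans[OF dist_prod_le add_left_mono[OF dist_prod_le]])
  also have "... = dt * (\<bar>sg\<bar> + \<bar>s\<bar> + 1)" using t(3) d'(3) by (simp add: dist_real_def abs_mult algebra_simps)
  also have "... <= dt * (4 * M)" using sg M t(3) by (intro mult_left_mono) auto
  finally show ?thesis .
 qed
 have eq: "d' ^ Suc n *\<^sub>R G p - d ^ Suc n *\<^sub>R G q = (d' ^ Suc n - d ^ Suc n) *\<^sub>R G p + d ^ Suc n *\<^sub>R (G p - G q)" by (simp add: algebra_simps)
 have "norm (d' ^ Suc n *\<^sub>R G p - d ^ Suc n *\<^sub>R G q) <= (3 * (M * h)^n * (dt * \<bar>s\<bar>)) * L + (M * h) ^ Suc n * (L * (dt * (4 * M)))"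
  unfolding eq
 proof (intro norm_triangle_mono)
  show "norm ((d' ^ Suc n - d ^ Suc n) *\<^sub>R G p) <= (3 * (M * h)^n * (dt * \<bar>s\<bar>)) * L"
   unfolding norm_scaleR by (rule mult_mono[OF pd G(1)[OF pq(1)]]) (use M h t(3) in auto)
  have "norm (G p - G q) <= L * (dt * (4 * M))"
   using G(2)[OF pq] mult_left_mono[OF dist, of L] L by linarith
  moreover have "\<bar>d ^ Suc n\<bar> <= (M * h) ^ Suc n" using d(1,3) by (simp only: abs_of_pos zero_less_power) (rule power_mono; simp)
  ultimately show "norm (d ^ Suc n *\<^sub>R (G p - G q)) <= (M * h) ^ Suc n * (L * (dt * (4 * M)))"
   unfolding norm_scaleR by (intro mult_mono) (use M h in auto)
 qed
 also have "... = dt * L * h^n * (3 * M^n * \<bar>s\<bar> + 4 * M^(n+2) * h)"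
  by (simp add: power_mult_distrib algebra_simps)
 also have "... <= dt * L * h^n * (7 * M^4 * \<bar>s\<bar> + 7 * M^4 * h)"
 proof (intro mult_left_mono add_mono mult_right_mono)
  have "M^n <= M^4" "M^(n+2) <= M^4" "1 <= M^4" using n M by (auto intro: power_increasing one_le_power simp del: power_Suc power_add add_2_eq_Suc')
  then show "3 * M^n <= 7 * M^4" "4 * M^(n+2) <= 7 * M^4" by linarith+
 qed (use t L h in auto)
 also have "... = dt * (7 * L * M^4) * (h^n * (\<bar>s\<bar> + h))" by (simp add: algebra_simps)
 finally show ?thesis unfolding p_def q_def d'_def .
qed

definition quad_sum :: "real => nat => (nat => real) => (nat => real) => (nat => real^2) => real" where
 "quad_sum t J th d u = (\<Sum>j<J. quad_gap0 (th j) (d j) t \<bullet> u j + quad_gap1 (th j) (d j) t \<bullet> (u (nxt J j) - u j))"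

definition arc_sum :: "real => nat => (nat => real) => (nat => real) => (nat => real^2) => real" where
 "arc_sum t J th d u = (\<Sum>j<J. arc_gap (th j) (d j) t \<bullet> (u (nxt J j) - u j))"

text \<open>Nodal values come with the square of the mesh size, edge increments with its first
  power. By \<open>weighted_cauchy\<close> the corresponding sums are O(N) and O(r^4 * N), so both
  parts end at the order \<open>r^8 * N\<close>.\<close>

lemma functional_increments:
 assumes K: "1 <= K"
 obtains C r0 where "1 <= C" "0 < r0" "!!r dt t J x y q q' th d u N. 0 < r ==> r <= r0 ==> 0 < dt ==> dt <= K * r^8 ==> t + dt \<in> {0..T} ==>
   good_arcs t J q th d ==> simple_closed_polygon J x ==> scheme_step J dt x y ==>
   (!!j. j < J ==> r^4 / K <= d j) ==> (!!j. j < J ==> d j <= K * r^4) ==>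
   (!!j. j < J ==> norm (x j - q j) <= r^7) ==>
   (!!j. j < J ==> norm ((x (nxt J j) - q (nxt J j)) - (x j - q j)) <= K * r^9) ==>
   (\<Sum>j<J. (norm ((x (nxt J j) - q (nxt J j)) - (x j - q j)))^2) <= K * r^18 ==>
   (!!j. j < J ==> (x j - q j) \<bullet> D 1 0 (th j) t = 0) ==>
   (!!j. j < J ==> q' j = closest_point (\<Gamma> (t + dt)) (y j)) ==> simple_closed_polygon J q' ==>
   bij_betw (closest_point (\<Gamma> (t + dt))) (polygon_set J q') (\<Gamma> (t + dt)) ==>
   (!!j. j < J ==> r^4 / K <= edge_len J q j) ==> (!!j. j < J ==> edge_len J q j <= K * r^4) ==> 0 <= N ==>
   (\<Sum>j<J. edge_len J q j * (norm (u j))^2) / 6 <= N^2 ==> (\<Sum>j<J. (norm (u (nxt J j) - u j))^2 / edge_len J q j) <= N^2 ==>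
   \<exists>th' d'. good_arcs (t + dt) J q' th' d' \<and> \<bar>quad_sum (t + dt) J th' d' u - quad_sum t J th d u\<bar> <= dt * (C * r^8 * N)
    \<and> \<bar>arc_sum (t + dt) J th' d' u - arc_sum t J th d u\<bar> <= dt * (C * r^8 * N)"
proof (rule projected_step[OF K], goal_cases)
 case (1 Cs rs)
 note Cs = 1(2) and rs = 1(3) and step = 1(4)
 obtain d0 g0 g1 g2 where d0: "0 < d0" "d0 <= 1" and
  g: "BL (par_box d0 T) g0" "BL (par_box d0 T) g1" "BL (par_box d0 T) g2" and
  e0: "!!th d t. t \<in> {0..T} ==> 0 < d ==> d <= d0 ==> quad_gap0 th d t = d^3 *\<^sub>R g0 (th, d, t)" and
  e1: "!!th d t. t \<in> {0..T} ==> 0 < d ==> d <= d0 ==> quad_gap1 th d t = d^2 *\<^sub>R g1 (th, d, t)" and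
  e2: "!!th d t. t \<in> {0..T} ==> 0 < d ==> d <= d0 ==> arc_gap th d t = d^2 *\<^sub>R g2 (th, d, t)"
  by (rule edge_expansions) (rule that, assumption+)
 obtain L0 where L0: "1 <= L0" "!!p. p \<in> par_box d0 T ==> norm (g0 p) <= L0" "!!p q. p \<in> par_box d0 T ==> q \<in> par_box d0 T ==> norm (g0 p - g0 q) <= L0 * dist p q"
  by (rule BLE[OF g(1)]) (rule that, assumption+)
 obtain L1 where L1: "1 <= L1" "!!p. p \<in> par_box d0 T ==> norm (g1 p) <= L1" "!!p q. p \<in> par_box d0 T ==> q \<in> par_box d0 T ==> norm (g1 p - g1 q) <= L1 * dist p q"
  by (rule BLE[OF g(2)]) (rule that, assumption+)
 obtain L2 where L2: "1 <= L2" "!!p. p \<in> par_box d0 T ==> norm (g2 p) <= L2" "!!p q. p \<in> par_box d0 T ==> q \<in> par_box d0 T ==> norm (g2 p - g2 q) <= L2 * dist p q"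
  by (rule BLE[OF g(3)]) (rule that, assumption+)
 define M where "M = 2 * K + Cs"
 have M: "1 <= M" "K <= M" "2 * K <= M" "Cs <= M" unfolding M_def using K Cs by auto
 define E0 E1 E2 where "E0 = 7 * L0 * M^4" and "E1 = 7 * L1 * M^4" and "E2 = 7 * L2 * M^4"
 have E: "1 <= E0" "1 <= E1" "1 <= E2"
 proof -
  have "1 * 1 <= L * M^4" if "1 <= L" for L using that M(1) by (intro mult_mono one_le_power) auto
  from this[OF L0(1)] this[OF L1(1)] this[OF L2(1)] show "1 <= E0" "1 <= E1" "1 <= E2" unfolding E0_def E1_def E2_def by linarith+
 qed
 define Q where "Q = 2 * Cs + 2 * K"
 have Q: "1 <= Q" unfolding Q_def using K Cs by simp
 define C where "C = (E0 * (6 * Q * K) + E1 * (Q * K)) + E2 * (Q * K)"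
 have QK: "1 <= Q * K" using mult_mono[of 1 Q 1 K] Q K by simp
 have Cparts: "0 <= E0 * (6 * Q * K)" "0 <= E1 * (Q * K)" "0 <= E2 * (Q * K)" "1 <= E2 * (Q * K)"
  using E QK Q K mult_mono[of 1 E2 1 "Q * K"] by auto
 show ?thesis
 proof (rule that[of C "Min {rs, 1, d0 / M}"])
  show "1 <= C" unfolding C_def using Cparts by linarith
  show "0 < Min {rs, 1, d0 / M}" using rs d0 M(1) by simp
  fix r dt t :: real and J :: nat and x y q q' :: "nat => real^2" and th d :: "nat => real" and u :: "nat => real^2" and N :: real
  assume r0: "0 < r" "r <= Min {rs, 1, d0 / M}" and dt: "0 < dt" "dt <= K * r^8" and t': "t + dt \<in> {0..T}"
   and ga: "good_arcs t J q th d" and x: "simple_closed_polygon J x" and sch: "scheme_step J dt x y"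
   and d: "!!j. j < J ==> r^4 / K <= d j" "!!j. j < J ==> d j <= K * r^4"
   and e: "!!j. j < J ==> norm (x j - q j) <= r^7"
    "!!j. j < J ==> norm ((x (nxt J j) - q (nxt J j)) - (x j - q j)) <= K * r^9"
    "(\<Sum>j<J. (norm ((x (nxt J j) - q (nxt J j)) - (x j - q j)))^2) <= K * r^18"
   and orth: "!!j. j < J ==> (x j - q j) \<bullet> D 1 0 (th j) t = 0"
   and q': "!!j. j < J ==> q' j = closest_point (\<Gamma> (t + dt)) (y j)" "simple_closed_polygon J q'"
    "bij_betw (closest_point (\<Gamma> (t + dt))) (polygon_set J q') (\<Gamma> (t + dt))"
   and l: "!!j. j < J ==> r^4 / K <= edge_len J q j" "!!j. j < J ==> edge_len J q j <= K * r^4" and N: "0 <= N"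
   and u: "(\<Sum>j<J. edge_len J q j * (norm (u j))^2) / 6 <= N^2" "(\<Sum>j<J. (norm (u (nxt J j) - u j))^2 / edge_len J q j) <= N^2"
  have r: "0 < r" "r <= rs" "r <= 1" "r * M <= d0" using r0 M(1) by (auto simp: pos_le_divide_eq)
  note t = good_arcsD(2)[OF ga]
  have idx: "nxt J j < J" for j using good_arcsD(5)[OF ga] by simp
  from step[OF r(1,2) dt t' ga x sch d e orth q'] obtain sg where ga': "good_arcs (t + dt) J q' (%j. th j + dt * sg j) (%j. d j + dt * (sg (nxt J j) - sg j))"
   and sg: "\<forall>j<J. \<bar>sg j\<bar> <= Cs \<and> d j + dt * (sg (nxt J j) - sg j) <= 2 * K * r^4"
   and sg2: "(\<Sum>j<J. (sg (nxt J j) - sg j)^2) <= Cs * r^4"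
   by blast
  define h where "h = r^4"
  have h: "0 < h" "h <= 1" unfolding h_def using r by (auto intro: power_le_one)
  define s where "s j = sg (nxt J j) - sg j" for j
  \<comment> \<open>Both contributions of \<open>gap_increment\<close> in one weight. The constant
    \<open>h\<close> is as good as the increments of \<open>sg\<close>, since its squares over
    O(1/h) nodes add up to O(h).\<close>
  define X where "X j = \<bar>s j\<bar> + h" for j
  have Xp: "0 <= X j" for j unfolding X_def using h by simp
  have Mh: "M * h <= d0"
  proof -
   have "M * h <= M * r" unfolding h_def using rpow_mono[of r 1 4 M M] r M(1) by simp
   then show ?thesis using r(4) by (simp add: mult.commute)
  qed
  have X2: "(\<Sum>j<J. (X j)^2) <= Q * r^4"
  proof -
   have "(\<Sum>j<J. (X j)^2) <= (\<Sum>j<J. 2 * (s j)^2 + 2 * h^2)"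
   proof (rule sum_mono)
    fix j
    have "0 <= (\<bar>s j\<bar> - h)^2" by simp
    then show "(X j)^2 <= 2 * (s j)^2 + 2 * h^2" unfolding X_def by (simp add: power2_diff power2_sum)
   qed
   also have "... = 2 * (\<Sum>j<J. (s j)^2) + 2 * h * (real J * h)" by (simp add: sum.distrib sum_distrib_left power2_eq_square)
   also have "... <= 2 * (Cs * r^4) + 2 * h * K"
    using sg2 good_arcs_count[OF ga _ d(1)] K h unfolding s_def h_def by (intro add_mono mult_left_mono) auto
   finally show ?thesis unfolding Q_def h_def by (simp add: algebra_simps)
  qed
  have wc: "(\<Sum>j<J. \<bar>X j\<bar> * \<bar>norm (u j)\<bar>) <= 6 * Q * K * N" "(\<Sum>j<J. \<bar>X j\<bar> * \<bar>norm (u (nxt J j) - u j)\<bar>) <= Q * K * r^4 * N"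
   by (rule weighted_cauchy[OF r(1) Q K N X2 l u]; assumption)+
  have wc1: "(\<Sum>j<J. X j * norm (u j)) <= 6 * Q * K * N" and wc2: "(\<Sum>j<J. X j * norm (u (nxt J j) - u j)) <= Q * K * h * N"
   using wc unfolding abs_norm_cancel abs_of_nonneg[OF Xp] h_def by auto
  have data: "0 < d j" "d j <= d0" "d j <= M * h" "0 < d j + dt * s j" "d j + dt * s j <= d0" "d j + dt * s j <= M * h" "\<bar>sg j\<bar> <= M" "\<bar>s j\<bar> <= 2 * M"
   if j: "j < J" for j
  proof -
   have Kh: "K * h <= M * h" "2 * K * h <= M * h" using M h by (intro mult_right_mono; simp)+
   have sgj: "\<bar>sg j\<bar> <= Cs" "d j + dt * s j <= 2 * K * h" "\<bar>sg (nxt J j)\<bar> <= Cs" using sg j idx[of j] unfolding s_def h_def by blast+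
   show "0 < d j" by (rule good_arcsD(9)[OF ga j])
   show "0 < d j + dt * s j" unfolding s_def by (rule good_arcsD(9)[OF ga' j])
   show "d j <= M * h" "d j + dt * s j <= M * h" using d(2)[OF j] Kh sgj unfolding h_def by linarith+
   then show "d j <= d0" "d j + dt * s j <= d0" using Mh by linarith+
   show "\<bar>sg j\<bar> <= M" "\<bar>s j\<bar> <= 2 * M" unfolding s_def using sgj M by linarith+
  qed
  let ?th = "%j. th j + dt * sg j" and ?d = "%j. d j + dt * s j"
  have i0: "norm (quad_gap0 (?th j) (?d j) (t + dt) - quad_gap0 (th j) (d j) t) <= dt * E0 * (h^2 * X j)" if j: "j < J" for j
   unfolding e0[OF t' data(4,5)[OF j]] e0[OF t data(1,2)[OF j]] E0_def X_def
   using gap_increment[OF L0(2,3,1) M(1) _ t t' dt(1) h(1) data(1,2,3,4,5,6,7,8)[OF j], where n=2] by (simp add: numeral_3_eq_3)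
  have i1: "norm (quad_gap1 (?th j) (?d j) (t + dt) - quad_gap1 (th j) (d j) t) <= dt * E1 * (h^1 * X j)" if j: "j < J" for j
   unfolding e1[OF t' data(4,5)[OF j]] e1[OF t data(1,2)[OF j]] E1_def X_def
   using gap_increment[OF L1(2,3,1) M(1) _ t t' dt(1) h(1) data(1,2,3,4,5,6,7,8)[OF j], where n=1] by (simp add: numeral_2_eq_2)
  have i2: "norm (arc_gap (?th j) (?d j) (t + dt) - arc_gap (th j) (d j) t) <= dt * E2 * (h^1 * X j)" if j: "j < J" for j
   unfolding e2[OF t' data(4,5)[OF j]] e2[OF t data(1,2)[OF j]] E2_def X_def
   using gap_increment[OF L2(2,3,1) M(1) _ t t' dt(1) h(1) data(1,2,3,4,5,6,7,8)[OF j], where n=1] by (simp add: numeral_2_eq_2)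
  have ib: "\<bar>(a - b) \<bullet> w\<bar> <= dt * E * (H * (X j * norm w))" if "norm (a - b) <= dt * E * (H * X j)" for a b w :: "real^2" and E H j
   using order_trans[OF Cauchy_Schwarz_ineq2 mult_right_mono[OF that norm_ge_zero]] by (simp add: mult.assoc)
  have S2: "(\<Sum>j<J. dt * E * (h^1 * (X j * norm (u (nxt J j) - u j)))) <= dt * ((E * (Q * K)) * r^8 * N)" if E: "1 <= E" for E
  proof -
   have "(\<Sum>j<J. dt * E * (h^1 * (X j * norm (u (nxt J j) - u j)))) = (dt * E * h) * (\<Sum>j<J. X j * norm (u (nxt J j) - u j))"
    by (simp add: sum_distrib_left mult.assoc)
   also have "... <= (dt * E * h) * (Q * K * h * N)" using wc2 dt E h by (intro mult_left_mono) auto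
   also have "... = dt * ((E * (Q * K)) * r^8 * N)" unfolding h_def by (simp flip: power_add)
   finally show ?thesis .
  qed
  have S1: "(\<Sum>j<J. dt * E0 * (h^2 * (X j * norm (u j)))) <= dt * ((E0 * (6 * Q * K)) * r^8 * N)"
  proof -
   have "(\<Sum>j<J. dt * E0 * (h^2 * (X j * norm (u j)))) = (dt * E0 * h^2) * (\<Sum>j<J. X j * norm (u j))"
    by (simp add: sum_distrib_left mult.assoc)
   also have "... <= (dt * E0 * h^2) * (6 * Q * K * N)" using wc1 dt E h by (intro mult_left_mono) auto
   also have "... = dt * ((E0 * (6 * Q * K)) * r^8 * N)" unfolding h_def by (simp flip: power_mult)
   finally show ?thesis .
  qed
  have rN: "0 <= r^8 * N" using r N by simp
  have Cle: "dt * (a * r^8 * N) <= dt * (C * r^8 * N)" if "a <= C" for a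
   using mult_right_mono[OF that rN] dt(1) by (intro mult_left_mono) (auto simp: mult.assoc)
  have "\<bar>quad_sum (t + dt) J ?th ?d u - quad_sum t J th d u\<bar> = \<bar>\<Sum>j<J. (quad_gap0 (?th j) (?d j) (t + dt) - quad_gap0 (th j) (d j) t) \<bullet> u j
    + (quad_gap1 (?th j) (?d j) (t + dt) - quad_gap1 (th j) (d j) t) \<bullet> (u (nxt J j) - u j)\<bar>"
   unfolding quad_sum_def sum_subtractf[symmetric] by (intro arg_cong[where f = abs] sum.cong) (simp_all add: inner_diff_left)
  also have "... <= (\<Sum>j<J. dt * E0 * (h^2 * (X j * norm (u j))) + dt * E1 * (h^1 * (X j * norm (u (nxt J j) - u j))))"
  proof (rule order_trans[OF sum_abs sum_mono])
   fix j assume "j \<in> {..<J}"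
   then have j: "j < J" by simp
   show "\<bar>(quad_gap0 (?th j) (?d j) (t + dt) - quad_gap0 (th j) (d j) t) \<bullet> u j
    + (quad_gap1 (?th j) (?d j) (t + dt) - quad_gap1 (th j) (d j) t) \<bullet> (u (nxt J j) - u j)\<bar>
    <= dt * E0 * (h^2 * (X j * norm (u j))) + dt * E1 * (h^1 * (X j * norm (u (nxt J j) - u j)))"
    by (rule order_trans[OF abs_triangle_ineq add_mono[OF ib[OF i0[OF j]] ib[OF i1[OF j]]]])
  qed
  also have "... <= dt * ((E0 * (6 * Q * K)) * r^8 * N) + dt * ((E1 * (Q * K)) * r^8 * N)"
   unfolding sum.distrib by (rule add_mono[OF S1 S2[OF E(2)]])
  also have "... = dt * ((E0 * (6 * Q * K) + E1 * (Q * K)) * r^8 * N)" by (simp add: algebra_simps)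
  also have "... <= dt * (C * r^8 * N)" by (rule Cle) (use Cparts in \<open>unfold C_def, linarith\<close>)
  finally have R1: "\<bar>quad_sum (t + dt) J ?th ?d u - quad_sum t J th d u\<bar> <= dt * (C * r^8 * N)" .
  have "\<bar>arc_sum (t + dt) J ?th ?d u - arc_sum t J th d u\<bar> = \<bar>\<Sum>j<J. (arc_gap (?th j) (?d j) (t + dt) - arc_gap (th j) (d j) t) \<bullet> (u (nxt J j) - u j)\<bar>"
   unfolding arc_sum_def sum_subtractf[symmetric] by (intro arg_cong[where f = abs] sum.cong) (simp_all add: inner_diff_left)
  also have "... <= (\<Sum>j<J. dt * E2 * (h^1 * (X j * norm (u (nxt J j) - u j))))"
  proof (rule order_trans[OF sum_abs sum_mono])
   fix j assume "j \<in> {..<J}"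
   then have j: "j < J" by simp
   show "\<bar>(arc_gap (?th j) (?d j) (t + dt) - arc_gap (th j) (d j) t) \<bullet> (u (nxt J j) - u j)\<bar>
    <= dt * E2 * (h^1 * (X j * norm (u (nxt J j) - u j)))"
    by (rule ib[OF i2[OF j]])
  qed
  also have "... <= dt * ((E2 * (Q * K)) * r^8 * N)" by (rule S2[OF E(3)])
  also have "... <= dt * (C * r^8 * N)" by (rule Cle) (use Cparts in \<open>unfold C_def, linarith\<close>)
  finally have R2: "\<bar>arc_sum (t + dt) J ?th ?d u - arc_sum t J th d u\<bar> <= dt * (C * r^8 * N)" .
  show "\<exists>th' d'. good_arcs (t + dt) J q' th' d' \<and> \<bar>quad_sum (t + dt) J th' d' u - quad_sum t J th d u\<bar> <= dt * (C * r^8 * N)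
    \<and> \<bar>arc_sum (t + dt) J th' d' u - arc_sum t J th d u\<bar> <= dt * (C * r^8 * N)"
   using ga'[folded s_def] R1 R2 by blast
 qed
qed

text \<open>Foot parameters are chosen independently at the nodes. Then
  \<open>bilipschitz_mod1\<close> selects integers that bring consecutive ones close together, with
  increments comparable to the edge lengths.\<close>

lemma node_arcs:
 assumes K: "1 <= K"
 obtains K' r0 where "K <= K'" "0 < r0" "!!r t J x q. 0 < r ==> r <= r0 ==> t \<in> {0..T} ==> simple_closed_polygon J q ==>
   bij_betw (closest_point (\<Gamma> t)) (polygon_set J q) (\<Gamma> t) ==> (!!j. j < J ==> q j = closest_point (\<Gamma> t) (x j)) ==>
   (!!j. j < J ==> r^4 / K <= edge_len J q j) ==> (!!j. j < J ==> edge_len J q j <= K * r^4) ==>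
   \<exists>th d. arcs t J q th d \<and> (\<forall>j<J. (x j - q j) \<bullet> D 1 0 (th j) t = 0 \<and> r^4 / K' <= \<bar>d j\<bar> \<and> \<bar>d j\<bar> <= K' * r^4)
    \<and> ((\<forall>j<J. 0 < d j) \<or> (\<forall>j<J. d j < 0))"
proof -
 obtain c where c: "0 < c" "!!th th' t. t \<in> {0..T} ==> \<exists>k::int. c * \<bar>th' + of_int k - th\<bar> <= norm (crv th' t - crv th t)"
  by (rule bilipschitz_mod1) (rule that, assumption+)
 obtain cc where cc: "0 < cc" "!!th t p. t \<in> {0..T} ==> \<exists>ps. closest_point (\<Gamma> t) p = crv ps t \<and> cc * \<bar>ps - th\<bar> <= norm (p - crv th t)
   \<and> (p - crv ps t) \<bullet> D 1 0 ps t = 0 \<and> norm (p - crv ps t) <= norm (p - crv th t)"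
  by (rule closest_near) (rule that, assumption+)
 obtain B where B: "1 <= B" "!!th th' t t'. t \<in> {0..T} ==> t' \<in> {0..T} ==> norm (crv th t - crv th' t') <= B * (\<bar>th - th'\<bar> + \<bar>t - t'\<bar>)"
  by (rule D_bound_ge1[of 0 0]) (rule that, assumption+)
 obtain d1 where d1: "0 < d1" "!!t J q th d. arcs t J q th d ==> (!!j. j < J ==> d j ~= 0 \<and> \<bar>d j\<bar> <= d1) ==> (\<forall>j<J. 0 < d j) \<or> (\<forall>j<J. d j < 0)"
  using arcs_same_sign by blast
 define K' where "K' = K * B + K / c"
 have KB: "K <= K * B" "0 < K / c" using K B(1) c(1) by (simp_all add: mult_le_cancel_left1)
 have K': "K <= K'" "K * B <= K'" "K / c <= K'" unfolding K'_def using KB K by linarith+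
 have K1: "1 <= K'" using K K' by linarith
 show ?thesis
 proof (rule that[OF K'(1), of "min 1 (d1 / K')"])
  show "0 < min 1 (d1 / K')" using d1(1) K1 by simp
  fix r t :: real and J :: nat and x q :: "nat => real^2"
  assume r: "0 < r" "r <= min 1 (d1 / K')" and t: "t \<in> {0..T}" and q: "simple_closed_polygon J q"
   "bij_betw (closest_point (\<Gamma> t)) (polygon_set J q) (\<Gamma> t)" "!!j. j < J ==> q j = closest_point (\<Gamma> t) (x j)"
   and l: "!!j. j < J ==> r^4 / K <= edge_len J q j" "!!j. j < J ==> edge_len J q j <= K * r^4"
  have J: "nxt J j < J" for j using q(1) unfolding simple_closed_polygon_def by simp
  have "\<forall>j. \<exists>ps. closest_point (\<Gamma> t) (x j) = crv ps t \<and> (x j - crv ps t) \<bullet> D 1 0 ps t = 0" using cc(2)[OF t] by blast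
  from choice[OF this] obtain th where th: "!!j. closest_point (\<Gamma> t) (x j) = crv (th j) t" "!!j. (x j - crv (th j) t) \<bullet> D 1 0 (th j) t = 0" by blast
  have qth: "q j = crv (th j) t" if "j < J" for j using q(3)[OF that] th(1) by simp
  have "\<forall>j. \<exists>k::int. c * \<bar>th (nxt J j) + of_int k - th j\<bar> <= norm (crv (th (nxt J j)) t - crv (th j) t)" using c(2)[OF t] by blast
  from choice[OF this] obtain k :: "nat => int" where k: "!!j. c * \<bar>th (nxt J j) + of_int (k j) - th j\<bar> <= norm (crv (th (nxt J j)) t - crv (th j) t)" by blast
  define d where "d j = th (nxt J j) + of_int (k j) - th j" for j
  have thd: "crv (th j + d j) t = crv (th (nxt J j)) t" for j unfolding d_def using D_periodic[OF t, of 0 0 "th (nxt J j)" "k j"] by simp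
  have el: "edge_len J q j = norm (crv (th (nxt J j)) t - crv (th j) t)" if "j < J" for j
   unfolding edge_len_norm qth[OF that] qth[OF J] ..
  have up: "\<bar>d j\<bar> <= K' * r^4" if j: "j < J" for j
  proof -
   have "c * \<bar>d j\<bar> <= K * r^4" using k[of j] l(2)[OF j] unfolding el[OF j] d_def by linarith
   then have "\<bar>d j\<bar> <= (K / c) * r^4" using c(1) by (simp add: field_simps)
   also have "... <= K' * r^4" using K'(3) r by (intro mult_right_mono) auto
   finally show ?thesis .
  qed
  have low: "r^4 / K' <= \<bar>d j\<bar>" if j: "j < J" for j
  proof -
   have "r^4 / K <= B * \<bar>d j\<bar>" using l(1)[OF j] B(2)[OF t t, of "th j + d j" "th j"] unfolding el[OF j] thd by simp
   then have "r^4 / (K * B) <= \<bar>d j\<bar>" using B(1) K by (simp add: field_simps)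
   moreover have "r^4 / K' <= r^4 / (K * B)" using K'(2) K B(1) r K1 by (intro divide_left_mono mult_pos_pos) auto
   ultimately show ?thesis by linarith
  qed
  have ar: "arcs t J q th d" unfolding arcs_def using t q(1,2) qth thd J by simp
  have "d j ~= 0 \<and> \<bar>d j\<bar> <= d1" if j: "j < J" for j
  proof
   have "0 < r^4 / K'" using r K1 by simp
   then show "d j ~= 0" using low[OF j] by auto
   have "K' * r^4 <= K' * r^1" using r K1 by (intro rpow_mono) auto
   also have "... <= d1" using r K1 by (simp add: field_simps)
   finally show "\<bar>d j\<bar> <= d1" using up[OF j] by linarith
  qed
  from d1(2)[OF ar this] have sgn: "(\<forall>j<J. 0 < d j) \<or> (\<forall>j<J. d j < 0)" .
  have "\<forall>j<J. (x j - q j) \<bullet> D 1 0 (th j) t = 0 \<and> r^4 / K' <= \<bar>d j\<bar> \<and> \<bar>d j\<bar> <= K' * r^4"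
   using low up th(2) qth by simp
  with ar sgn show "\<exists>th d. arcs t J q th d \<and> (\<forall>j<J. (x j - q j) \<bullet> D 1 0 (th j) t = 0 \<and> r^4 / K' <= \<bar>d j\<bar> \<and> \<bar>d j\<bar> <= K' * r^4)
    \<and> ((\<forall>j<J. 0 < d j) \<or> (\<forall>j<J. d j < 0))" by blast
 qed
qed

end

section \<open>Forward and backward numbering of the nodes\<close>

lemma represents_cong:
 assumes "represents J x f u" "!!j. j < J ==> u j = w j" "0 < J"
 shows "represents J x f w"
 using assms unfolding represents_def edge_def by simp

context curve_flow
begin

interpretation R: curve_flow T "%i j th t. (-1)^i *\<^sub>R D i j (- th) t"
 by (rule curve_flow_reverse) unfold_locales

text \<open>\<open>quad_fun\<close> and \<open>grad_fun\<close> make no reference to arcs, so the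
  same expressions can be evaluated by arcs of either orientation.\<close>

definition quad_fun :: "real => nat => (nat => real^2) => (real^2 => real^2) => (nat => real^2) => real" where
 "quad_fun t J q f u = - (lumped_int J q (%p. f (closest_point (\<Gamma> t) p) \<bullet> fe J q u p)
   - poly_int J q (%p. f (closest_point (\<Gamma> t) p) \<bullet> fe J q u p))"

definition grad_fun :: "real => nat => (nat => real^2) => (nat => real^2) => real" where
 "grad_fun t J q u = poly_grad_int J q (fe J q q) (fe J q u)
   - integral {0..1} (gint t (lifted t J q (fe J q q)) (lifted t J q (fe J q u)))
   + integral {0..1} (gint t (%p. lifted t J q (nodal_interp J q (closest_point (\<Gamma> t))) p - closest_point (\<Gamma> t) p)
     (lifted t J q (fe J q u)))"

lemma nodal_interp_closest:
 assumes t: "t \<in> {0..T}" and q: "simple_closed_polygon J q" "!!j. j < J ==> q j \<in> \<Gamma> t"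
 shows "represents J q (nodal_interp J q (closest_point (\<Gamma> t))) q"
proof (rule represents_cong)
 show "represents J q (nodal_interp J q (closest_point (\<Gamma> t))) (%j. closest_point (\<Gamma> t) (q j))"
  unfolding nodal_interp_def by (rule fe_represents[OF q(1)])
 show "closest_point (\<Gamma> t) (q j) = q j" if "j < J" for j by (rule closest_point_self[OF q(2)[OF that]])
 show "0 < J" using q(1) unfolding simple_closed_polygon_def by simp
qed

lemma forward_values:
 assumes g: "good_arcs t J q th d" and f: "!!r. f (crv r t) = - D 0 1 r t"
 shows "quad_fun t J q f u = quad_sum t J th d u" "grad_fun t J q u = arc_sum t J th d u"
proof -
 note q = good_arcsD(3)[OF g]
 have "q j \<in> \<Gamma> t" if "j < J" for j using good_arcsD(7)[OF g that] by (simp add: \<Gamma>_def)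
 note n = nodal_interp_closest[OF good_arcsD(2)[OF g] q this]
 show "quad_fun t J q f u = quad_sum t J th d u" unfolding quad_fun_def quad_sum_def
  by (rule quad_functional[OF g f fe_represents[OF q]])
 show "grad_fun t J q u = arc_sum t J th d u" unfolding grad_fun_def arc_sum_def
  by (rule grad_functional_forward[OF g fe_represents[OF q] n fe_represents[OF q]])
qed

lemma backward_values:
 assumes g: "R.good_arcs t J q th d" and f: "!!r. f (crv r t) = - D 0 1 r t"
 shows "quad_fun t J q f u = R.quad_sum t J th d u" "grad_fun t J q u = R.arc_sum t J th d u"
proof -
 note q = R.good_arcsD(3)[OF g]
 have "q j \<in> \<Gamma> t" if "j < J" for j using R.good_arcsD(7)[OF g that] unfolding reverse_curve[symmetric] R.\<Gamma>_def by simp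
 note n = nodal_interp_closest[OF R.good_arcsD(2)[OF g] q this]
 show "quad_fun t J q f u = R.quad_sum t J th d u" unfolding quad_fun_def R.quad_sum_def reverse_curve[symmetric]
  by (rule R.quad_functional[OF g _ fe_represents[OF q]]) (simp add: f)
 show "grad_fun t J q u = R.arc_sum t J th d u" unfolding grad_fun_def R.arc_sum_def
  by (rule grad_functional_backward[OF g fe_represents[OF q] n fe_represents[OF q]])
qed

text \<open>The common sign of the parameter increments is found at the old time level only; that it
  persists is part of \<open>functional_increments\<close>. For negative increments the reversed
  flow is used on both levels.\<close>

lemma functional_estimate:
 assumes K: "1 <= K"
 obtains C r0 where "1 <= C" "0 < r0" "!!r dt t J x y q q' f f' u N. 0 < r ==> r <= r0 ==> 0 < dt ==> dt <= K * r^8 ==>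
   t \<in> {0..T} ==> t + dt \<in> {0..T} ==> simple_closed_polygon J x ==> scheme_step J dt x y ==>
   (!!j. j < J ==> q j = closest_point (\<Gamma> t) (x j)) ==> simple_closed_polygon J q ==>
   bij_betw (closest_point (\<Gamma> t)) (polygon_set J q) (\<Gamma> t) ==>
   (!!j. j < J ==> q' j = closest_point (\<Gamma> (t + dt)) (y j)) ==> simple_closed_polygon J q' ==>
   bij_betw (closest_point (\<Gamma> (t + dt))) (polygon_set J q') (\<Gamma> (t + dt)) ==>
   (!!j. j < J ==> norm (x j - q j) <= r^7) ==>
   (!!j. j < J ==> norm ((x (nxt J j) - q (nxt J j)) - (x j - q j)) <= K * r^9) ==>
   (\<Sum>j<J. (norm ((x (nxt J j) - q (nxt J j)) - (x j - q j)))^2) <= K * r^18 ==>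
   (!!j. j < J ==> r^4 / K <= edge_len J q j) ==> (!!j. j < J ==> edge_len J q j <= K * r^4) ==> 0 <= N ==>
   (\<Sum>j<J. edge_len J q j * (norm (u j))^2) / 6 <= N^2 ==> (\<Sum>j<J. (norm (u (nxt J j) - u j))^2 / edge_len J q j) <= N^2 ==>
   (!!r. f (crv r t) = - D 0 1 r t) ==> (!!r. f' (crv r (t + dt)) = - D 0 1 r (t + dt)) ==>
   \<bar>quad_fun (t + dt) J q' f' u - quad_fun t J q f u\<bar> <= dt * (C * r^8 * N)
    \<and> \<bar>grad_fun (t + dt) J q' u - grad_fun t J q u\<bar> <= dt * (C * r^8 * N)"
proof (rule node_arcs[OF K], goal_cases)
 case (1 K' r1)
 note K' = 1(2) and r1 = 1(3) and nodes = 1(4)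
 have K1: "1 <= K'" using K K' by linarith
 obtain d1 where d1: "0 < d1" "d1 <= 1" "!!th d t. t \<in> {0..T} ==> 0 < d ==> d <= d1 ==> chord_ok th d t"
  by (rule chord_ok_small) (rule that, assumption+)
 obtain d2 where d2: "0 < d2" "d2 <= 1" "!!th d t. t \<in> {0..T} ==> 0 < d ==> d <= d2 ==> R.chord_ok th d t"
  by (rule R.chord_ok_small) (rule that, assumption+)
 show ?case
 proof (rule functional_increments[OF K1], goal_cases)
  case (1 C1 r2)
  note C1 = 1(1) and r2 = 1(2) and inc = 1(3)
  show ?case
  proof (rule R.functional_increments[OF K1], goal_cases)
   case (1 C2 r3)
   note C2 = 1(1) and r3 = 1(2) and Rinc = 1(3)
   let ?m = "Min {r1, r2, r3, 1, d1 / (2 * K'), d2 / (2 * K')}"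
   show ?case
   proof (rule that[of "C1 + C2" ?m])
    show "1 <= C1 + C2" using C1 C2 by simp
    show "0 < ?m" using r1 r2 r3 d1 d2 K1 by simp
    fix r dt t :: real and J :: nat and x y q q' :: "nat => real^2" and f f' :: "real^2 => real^2" and u :: "nat => real^2" and N :: real
    assume r: "0 < r" "r <= ?m" and dt: "0 < dt" "dt <= K * r^8" and t: "t \<in> {0..T}" and t': "t + dt \<in> {0..T}"
     and x: "simple_closed_polygon J x" and sch: "scheme_step J dt x y"
     and q: "!!j. j < J ==> q j = closest_point (\<Gamma> t) (x j)" "simple_closed_polygon J q"
      "bij_betw (closest_point (\<Gamma> t)) (polygon_set J q) (\<Gamma> t)"
     and q': "!!j. j < J ==> q' j = closest_point (\<Gamma> (t + dt)) (y j)" "simple_closed_polygon J q'"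
      "bij_betw (closest_point (\<Gamma> (t + dt))) (polygon_set J q') (\<Gamma> (t + dt))"
     and e: "!!j. j < J ==> norm (x j - q j) <= r^7"
      "!!j. j < J ==> norm ((x (nxt J j) - q (nxt J j)) - (x j - q j)) <= K * r^9"
      "(\<Sum>j<J. (norm ((x (nxt J j) - q (nxt J j)) - (x j - q j)))^2) <= K * r^18"
     and l: "!!j. j < J ==> r^4 / K <= edge_len J q j" "!!j. j < J ==> edge_len J q j <= K * r^4" and N: "0 <= N"
     and u: "(\<Sum>j<J. edge_len J q j * (norm (u j))^2) / 6 <= N^2" "(\<Sum>j<J. (norm (u (nxt J j) - u j))^2 / edge_len J q j) <= N^2"
     and f: "!!r. f (crv r t) = - D 0 1 r t" "!!r. f' (crv r (t + dt)) = - D 0 1 r (t + dt)"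
    have rr: "r <= r1" "r <= r2" "r <= r3" "r <= 1" "r <= d1 / (2 * K')" "r <= d2 / (2 * K')" using r(2) by simp_all
    have up: "K * r^n <= K' * r^n" for n using K' r(1) by (intro mult_right_mono) auto
    have dt': "dt <= K' * r^8" by (rule order_trans[OF dt(2) up])
    have e': "!!j. j < J ==> norm ((x (nxt J j) - q (nxt J j)) - (x j - q j)) <= K' * r^9"
      "(\<Sum>j<J. (norm ((x (nxt J j) - q (nxt J j)) - (x j - q j)))^2) <= K' * r^18"
     by (rule order_trans[OF e(2) up], assumption) (rule order_trans[OF e(3) up])
    have dn: "r^4 / K' <= r^4 / K" using K K' r(1) K1 by (intro divide_left_mono mult_pos_pos) auto
    have l': "!!j. j < J ==> r^4 / K' <= edge_len J q j" "!!j. j < J ==> edge_len J q j <= K' * r^4"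
     by (rule order_trans[OF dn l(1)], assumption) (rule order_trans[OF l(2) up], assumption)
    from nodes[OF r(1) rr(1) t q(2,3,1) l] obtain th d where ar: "arcs t J q th d"
     and nd: "\<forall>j<J. (x j - q j) \<bullet> D 1 0 (th j) t = 0 \<and> r^4 / K' <= \<bar>d j\<bar> \<and> \<bar>d j\<bar> <= K' * r^4"
     and sgn: "(\<forall>j<J. 0 < d j) \<or> (\<forall>j<J. d j < 0)" by blast
    have orth: "(x j - q j) \<bullet> D 1 0 (th j) t = 0" and dl: "r^4 / K' <= \<bar>d j\<bar>" and du: "\<bar>d j\<bar> <= K' * r^4" if "j < J" for j
     using nd that by blast+
    have small: "\<bar>d j\<bar> <= d1" "\<bar>d j\<bar> < 1" "\<bar>d j\<bar> <= d2" if j: "j < J" for j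
    proof -
     have "K' * r^4 <= K' * r^1" using r(1) rr(4) K1 by (intro rpow_mono) auto
     moreover have "K' * r <= d1 / 2" "K' * r <= d2 / 2" using rr(5,6) K1 by (simp_all add: field_simps)
     ultimately show "\<bar>d j\<bar> <= d1" "\<bar>d j\<bar> < 1" "\<bar>d j\<bar> <= d2" using du[OF j] d1(1,2) d2(1) by auto
    qed
    have rN: "0 <= r^8 * N" using r(1) N by simp
    have enlarge: "\<bar>X\<bar> <= dt * ((C1 + C2) * r^8 * N)" if "\<bar>X\<bar> <= dt * (c * r^8 * N)" "c <= C1 + C2" for X c
    proof -
     have "c * (r^8 * N) <= (C1 + C2) * (r^8 * N)" by (rule mult_right_mono[OF that(2) rN])
     then have "dt * (c * r^8 * N) <= dt * ((C1 + C2) * r^8 * N)" using dt(1) by (intro mult_left_mono) (auto simp: mult.assoc)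
     then show ?thesis using that(1) by linarith
    qed
    from sgn show "\<bar>quad_fun (t + dt) J q' f' u - quad_fun t J q f u\<bar> <= dt * ((C1 + C2) * r^8 * N)
      \<and> \<bar>grad_fun (t + dt) J q' u - grad_fun t J q u\<bar> <= dt * ((C1 + C2) * r^8 * N)"
    proof
     assume pos: "\<forall>j<J. 0 < d j"
     have g: "good_arcs t J q th d" unfolding good_arcs_def
     proof (intro conjI allI impI ar)
      fix j assume j: "j < J"
      show dp: "0 < d j" using pos j by blast
      show "d j < 1" "chord_ok (th j) (d j) t" using small[OF j] d1(3)[OF t dp] dp by auto
     qed
     have db: "r^4 / K' <= d j" "d j <= K' * r^4" if j: "j < J" for j
      using dl[OF j] du[OF j] good_arcsD(9)[OF g j] by auto
     from inc[OF r(1) rr(2) dt(1) dt' t' g x sch db e(1) e' orth q' l' N u]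
     obtain th' d' where g': "good_arcs (t + dt) J q' th' d'" and b: "\<bar>quad_sum (t + dt) J th' d' u - quad_sum t J th d u\<bar> <= dt * (C1 * r^8 * N)"
      "\<bar>arc_sum (t + dt) J th' d' u - arc_sum t J th d u\<bar> <= dt * (C1 * r^8 * N)" by blast
     show ?thesis unfolding forward_values[OF g f(1)] forward_values[OF g' f(2)]
      using enlarge[OF b(1)] enlarge[OF b(2)] C2 by simp
    next
     assume neg: "\<forall>j<J. d j < 0"
     let ?th = "%j. - th j" and ?d = "%j. - d j"
     have g: "R.good_arcs t J q ?th ?d" unfolding R.good_arcs_def R.arcs_def reverse_curve
     proof (intro conjI allI impI t q(2,3))
      fix j assume j: "j < J"
      have a: "q j = crv (th j) t" "q (nxt J j) = crv (th j + d j) t" using ar j unfolding arcs_def by blast+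
      show "q j = (-1)^0 *\<^sub>R crv (- (- th j)) t" "q (nxt J j) = (-1)^0 *\<^sub>R crv (- (- th j + - d j)) t"
       unfolding a by (simp_all add: algebra_simps)
      show dp: "0 < - d j" using neg j by simp
      show "- d j < 1" "R.chord_ok (- th j) (- d j) t" using small[OF j] d2(3)[OF t dp] dp by auto
     qed
     have db: "r^4 / K' <= - d j" "- d j <= K' * r^4" if j: "j < J" for j
      using dl[OF j] du[OF j] R.good_arcsD(9)[OF g j] by auto
     have orth': "(x j - q j) \<bullet> ((-1)^1 *\<^sub>R D 1 0 (- (- th j)) t) = 0" if "j < J" for j using orth[OF that] by simp
     from Rinc[unfolded reverse_curve, OF r(1) rr(3) dt(1) dt' t' g x sch db e(1) e' orth' q' l' N u]
     obtain th' d' where g': "R.good_arcs (t + dt) J q' th' d'" and b: "\<bar>R.quad_sum (t + dt) J th' d' u - R.quad_sum t J ?th ?d u\<bar> <= dt * (C2 * r^8 * N)"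
      "\<bar>R.arc_sum (t + dt) J th' d' u - R.arc_sum t J ?th ?d u\<bar> <= dt * (C2 * r^8 * N)" by blast
     show ?thesis unfolding backward_values[OF g f(1)] backward_values[OF g' f(2)]
      using enlarge[OF b(1)] enlarge[OF b(2)] C1 by simp
    qed
   qed
  qed
 qed
qed

end

theorem lemma6p5:
 fixes \<gamma>0 :: "real \<Rightarrow> real^2" and X :: "real^2 \<Rightarrow> real \<Rightarrow> real^2"
  and n :: "real \<Rightarrow> real^2 \<Rightarrow> real^2" and H :: "real \<Rightarrow> real^2 \<Rightarrow> real"
  and T \<delta> c0 cq Cq Csh :: real
 assumes "exact_flow \<gamma>0 X n H T"
  and "tubular_width \<gamma>0 X T \<delta>"
  and "0 < c0" "0 < cq" "0 < Cq" "0 < Csh"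
 shows "\<forall>\<kappa>::real. \<exists>C>0. \<exists>h0>0.
  \<forall>(h::real) (\<tau>::real) (J::nat) (x :: nat \<Rightarrow> nat \<Rightarrow> real^2) (l::nat).
   standing_assms \<gamma>0 X T \<delta> c0 cq Cq Csh h \<tau> J x l
   \<and> mesh_reg \<gamma>0 X \<tau> J x l \<le> \<kappa> \<and> h \<le> h0 \<longrightarrow>
   (\<forall>m\<le>l. \<forall>\<phi> :: nat \<Rightarrow> real^2.
    let xh = proj_nodes \<gamma>0 X \<tau> x;
      d13 = (\<lambda>k. D13 \<gamma>0 X n H (real k * \<tau>) J (xh k));
      d22 = (\<lambda>k. D22 \<gamma>0 X (real k * \<tau>) J (xh k));
      d23 = (\<lambda>k. D23 \<gamma>0 X (real k * \<tau>) J (xh k));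
      N = H1_norm_on J (xh m) (fe J (xh m) \<phi>)
    in \<bar>dtau \<tau> d13 m \<phi>\<bar> \<le> C * h\<^sup>2 * N
     \<and> \<bar>dtau \<tau> d22 m \<phi> + dtau \<tau> d23 m \<phi>\<bar> \<le> C * h\<^sup>2 * N)"
proof (rule allI, goal_cases)
 case (1 \<kappa>)
 obtain D where cf: "curve_flow T D" and D0: "!!th t. D 0 0 th t = X (\<gamma>0 th) t"
  and D1: "!!th t. t \<in> {0..T} ==> D 0 1 th t = - (H t (X (\<gamma>0 th) t) *\<^sub>R n t (X (\<gamma>0 th) t))"
  by (rule exact_flow_curve_flow[OF assms(1)]) (rule that, assumption+)
 interpret curve_flow T D by (rule cf)
 have \<Gamma>: "flow_curve \<gamma>0 X t = \<Gamma> t" for t unfolding flow_curve_def \<Gamma>_def D0 by auto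
 have param: "flow_param \<gamma>0 X t = (%r. crv r t)" for t unfolding flow_param_def D0 by auto
 have fgrad: "flow_grad_int \<gamma>0 X t f g = integral {0..1} (gint t f g)" if "t \<in> {0..T}" for t f g
  unfolding flow_grad_int_def Let_def param by (rule grad_int_tgrad[OF that])
 have lift: "lift \<gamma>0 X t J q f = lifted t J q f" for t J q f unfolding lift_def lifted_def \<Gamma> ..
 have v13: "D13 \<gamma>0 X n H t J q u = quad_fun t J q (%p. H t p *\<^sub>R n t p) u" for t J q u
  unfolding D13_def Let_def inv_lift_def quad_fun_def \<Gamma> o_def ..
 have v2: "D22 \<gamma>0 X t J q u + D23 \<gamma>0 X t J q u = grad_fun t J q u" if "t \<in> {0..T}" for t J q u
  unfolding D22_def D23_def Let_def grad_fun_def \<Gamma> lift fgrad[OF that] by simp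
 have fv: "H t (crv r t) *\<^sub>R n t (crv r t) = - D 0 1 r t" if "t \<in> {0..T}" for t r
  unfolding D1[OF that] D0 by simp
 \<comment> \<open>Initial edges lie between \<open>cq * h\<close> and \<open>Cq * h\<close>, and
   projection changes them at most by the factor \<open>\<kappa>\<close> either way, hence the two
   middle terms; \<open>c0\<close> bounds the time step in units of \<open>h^2\<close>. Absolute
   values admit any real \<open>\<kappa>\<close>.\<close>
 define K where "K = 1 + \<bar>\<kappa>\<bar> * Cq + \<bar>\<kappa>\<bar> / cq + c0"
 have Kp: "0 <= \<bar>\<kappa>\<bar> * Cq" "0 <= \<bar>\<kappa>\<bar> / cq" using assms by auto
 have K: "1 <= K" "\<bar>\<kappa>\<bar> * Cq <= K" "\<bar>\<kappa>\<bar> / cq <= K" "c0 <= K" unfolding K_def using Kp assms by linarith+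
 show ?case
 proof (rule functional_estimate[OF K(1)], goal_cases)
  case (1 C r0)
  note C = 1(1) and r0 = 1(2) and est = 1(3)
  show ?case
  \<comment> \<open>The smallness condition \<open>r <= r0\<close> concerns the fourth root of
    \<open>h\<close>, so the threshold for \<open>h\<close> is \<open>r0^4\<close>.\<close>
  proof (rule exI[of _ C], rule conjI[OF _ exI[of _ "r0^4", OF conjI]], use C in linarith, use r0 in simp, intro allI impI, goal_cases)
   case (1 h dt J x l m \<phi>)
   note m = 1(2)
   from 1(1) have reg: "mesh_reg \<gamma>0 X dt J x l <= \<kappa>" and hr0: "h <= r0^4" and sa: "standing_assms \<gamma>0 X T \<delta> c0 cq Cq Csh h dt J x l" by auto
   note st = sa[unfolded standing_assms_def Let_def]
   have h: "0 < h" and dt: "0 < dt" "dt <= c0 * h^2" and lT: "int l <= \<lfloor>T / dt\<rfloor> - 1" using st by blast+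
   have xm: "simple_closed_polygon J (x m)" "scheme_step J dt (x m) (x (Suc m))" "simple_closed_polygon J (x 0)" using st m by blast+
   have lev: "simple_closed_polygon J (proj_nodes \<gamma>0 X dt x k)" "bij_betw (closest_point (\<Gamma> (real k * dt))) (polygon_set J (proj_nodes \<gamma>0 X dt x k)) (\<Gamma> (real k * dt))"
    if "k <= Suc l" for k using st that unfolding \<Gamma> by blast+
   have el0: "cq * h <= edge_len J (x 0) j" "edge_len J (x 0) j <= Cq * h" if "j < J" for j using st that by blast+
   have ih: "induction_hyp \<gamma>0 X h dt J x m" using st m by blast
   define q where "q = proj_nodes \<gamma>0 X dt x m"
   define q' where "q' = proj_nodes \<gamma>0 X dt x (Suc m)"
   define t where "t = real m * dt"
   define r where "r = h powr (1/4)"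
   define N where "N = H1_norm_on J q (fe J q \<phi>)"
   have t': "real (Suc m) * dt = t + dt" unfolding t_def by (simp add: algebra_simps)
   have rpow: "r ^ k = h powr (real k / 4)" for k unfolding r_def using h by (simp add: powr_powr flip: powr_realpow)
   have r: "0 < r" "r^4 = h" "r^8 = h^2" "h powr (7/4) = r^7" "h powr (1/2) = r^2"
   proof -
    show "0 < r" unfolding r_def using h by simp
    show r4: "r^4 = h" unfolding rpow using h by simp
    show "r^8 = h^2" unfolding r4[symmetric] by (simp flip: power_mult)
    show "h powr (7/4) = r^7" "h powr (1/2) = r^2" unfolding rpow by simp_all
   qed
   \<comment> \<open>The rule compares powers with exponent \<open>Suc n\<close>, so 3 stands for
     the fourth power.\<close>
   have rr0: "r <= r0" using power_le_imp_le_base[of r 3 r0] hr0 r0 unfolding r(2)[symmetric] by simp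
   have tT: "t \<in> {0..T}" "t + dt \<in> {0..T}"
   proof -
    \<comment> \<open>The bound on \<open>l\<close> leaves room for one more step, so level
      \<open>m + 1\<close> still lies in the time interval.\<close>
    have "int (Suc m) <= \<lfloor>T / dt\<rfloor>" using lT m by linarith
    then have "real (Suc m) <= T / dt" by (simp add: le_floor_iff)
    then have "t + dt <= T" unfolding t'[symmetric] using dt(1) by (simp add: pos_le_divide_eq)
    moreover have "0 <= t" unfolding t_def using dt(1) by simp
    ultimately show "t \<in> {0..T}" "t + dt \<in> {0..T}" using dt(1) by auto
   qed
   have q: "simple_closed_polygon J q" "bij_betw (closest_point (\<Gamma> t)) (polygon_set J q) (\<Gamma> t)"
    unfolding q_def t_def using lev[of m] m by auto
   have q': "simple_closed_polygon J q'" "bij_betw (closest_point (\<Gamma> (t + dt))) (polygon_set J q') (\<Gamma> (t + dt))"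
    unfolding q'_def t'[symmetric] using lev[of "Suc m"] m by auto
   have qj: "q j = closest_point (\<Gamma> t) (x m j)" "q' j = closest_point (\<Gamma> (t + dt)) (x (Suc m) j)" for j
    unfolding q_def q'_def t_def proj_nodes_def \<Gamma> t'[unfolded t_def] by simp_all
   have el: "edge_len J q j <= K * r^4" "r^4 / K <= edge_len J q j" if j: "j < J" for j
   proof -
    note mb = mesh_reg_bounds[OF reg m xm(3) q(1)[unfolded q_def] j, folded q_def]
    have e0: "0 <= edge_len J (x 0) j" "0 <= edge_len J q j" unfolding edge_len_def by auto
    have "edge_len J q j <= \<bar>\<kappa>\<bar> * (Cq * h)"
     by (rule order_trans[OF mb(1)], rule mult_mono) (use el0[OF j] e0 in auto)
    also have "... <= K * h" using K(2) h by (simp add: mult.assoc[symmetric])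
    finally show "edge_len J q j <= K * r^4" unfolding r(2) .
    have "cq * h <= \<bar>\<kappa>\<bar> * edge_len J q j"
     using order_trans[OF el0(1)[OF j] mb(2)] mult_right_mono[OF abs_ge_self[of \<kappa>] e0(2)] by linarith
    then have "h <= (\<bar>\<kappa>\<bar> / cq) * edge_len J q j" using assms by (simp add: field_simps)
    also have "... <= K * edge_len J q j" using K(3) e0 by (intro mult_right_mono) auto
    finally show "r^4 / K <= edge_len J q j" unfolding r(2) using K(1) by (simp add: field_simps)
   qed
   have err: "proj_err \<gamma>0 X dt x m j = x m j - q j" for j unfolding proj_err_def q_def ..
   note ib = induction_hyp_bounds[OF ih q(1)[unfolded q_def] h, unfolded err, folded q_def, unfolded r(4,5)]
   have e2: "norm ((x m (nxt J j) - q (nxt J j)) - (x m j - q j)) <= K * r^9" if j: "j < J" for j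
   proof -
    \<comment> \<open>The Lipschitz norm carries the weight \<open>r^2\<close> in the induction
      hypothesis; with an edge of length O(r^4) the order is \<open>r^7 * r^4 / r^2\<close>.\<close>
    have "r^2 * norm ((x m (nxt J j) - q (nxt J j)) - (x m j - q j)) <= r^7 * (K * r^4)"
     by (rule order_trans[OF ib(2)[OF j] mult_left_mono[OF el(1)[OF j]]]) (use r(1) in simp)
    also have "... = r^2 * (K * r^9)" by (simp flip: power_add)
    finally show ?thesis using r(1) by simp
   qed
   have e3: "(\<Sum>j<J. (norm ((x m (nxt J j) - q (nxt J j)) - (x m j - q j)))^2) <= K * r^18"
   proof -
    have "(\<Sum>j<J. (norm ((x m (nxt J j) - q (nxt J j)) - (x m j - q j)))^2)
     <= (\<Sum>j<J. (K * r^4) * ((norm ((x m (nxt J j) - q (nxt J j)) - (x m j - q j)))^2 / edge_len J q j))"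
    proof (rule sum_mono)
     fix j assume "j \<in> {..<J}"
     then have j: "j < J" by simp
     have "edge_len J q j * ((norm ((x m (nxt J j) - q (nxt J j)) - (x m j - q j)))^2 / edge_len J q j)
      <= (K * r^4) * ((norm ((x m (nxt J j) - q (nxt J j)) - (x m j - q j)))^2 / edge_len J q j)"
      using el(1)[OF j] edge_len_pos[OF q(1) j] by (intro mult_right_mono) auto
     then show "(norm ((x m (nxt J j) - q (nxt J j)) - (x m j - q j)))^2
      <= (K * r^4) * ((norm ((x m (nxt J j) - q (nxt J j)) - (x m j - q j)))^2 / edge_len J q j)"
      using edge_len_pos[OF q(1) j] by simp
    qed
    also have "... = (K * r^4) * (\<Sum>j<J. (norm ((x m (nxt J j) - q (nxt J j)) - (x m j - q j)))^2 / edge_len J q j)"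
     by (rule sum_distrib_left[symmetric])
    \<comment> \<open>\<open>r^7\<close> bounds the H^1 norm of the error, and \<open>r^4\<close> is
      the price for removing the division by the edge length.\<close>
    also have "... <= (K * r^4) * (r^7)^2" using ib(3) K(1) r(1) by (intro mult_left_mono) auto
    also have "... = K * r^18" by (simp flip: power_add power_mult)
    finally show ?thesis .
   qed
   note nb = H1_norm_represents[OF q(1) fe_represents[OF q(1)], of \<phi>, folded N_def]
   have dtK: "dt <= K * r^8" unfolding r(3) by (rule order_trans[OF dt(2) mult_right_mono[OF K(4)]]) simp
   have bounds: "\<bar>quad_fun (t + dt) J q' (%p. H (t + dt) p *\<^sub>R n (t + dt) p) \<phi> - quad_fun t J q (%p. H t p *\<^sub>R n t p) \<phi>\<bar> <= dt * (C * r^8 * N)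
     \<and> \<bar>grad_fun (t + dt) J q' \<phi> - grad_fun t J q \<phi>\<bar> <= dt * (C * r^8 * N)"
    by (rule est[OF r(1) rr0 dt(1) dtK tT xm(1,2) qj(1) q qj(2) q' ib(1) e2 e3 el(2,1) nb fv[OF tT(1)] fv[OF tT(2)]])
   have scale: "\<bar>(a - b) / dt\<bar> <= C * h^2 * N" if "\<bar>a - b\<bar> <= dt * (C * r^8 * N)" for a b
    using that dt(1) unfolding r(3) by (simp add: abs_divide pos_divide_le_eq mult.commute)
   have a13: "\<bar>dtau dt (%k. D13 \<gamma>0 X n H (real k * dt) J (proj_nodes \<gamma>0 X dt x k)) m \<phi>\<bar> <= C * h^2 * N"
    unfolding dtau_def t' v13 q_def[symmetric] q'_def[symmetric] t_def[symmetric] by (rule scale) (use bounds in blast)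
   have a2: "\<bar>dtau dt (%k. D22 \<gamma>0 X (real k * dt) J (proj_nodes \<gamma>0 X dt x k)) m \<phi> + dtau dt (%k. D23 \<gamma>0 X (real k * dt) J (proj_nodes \<gamma>0 X dt x k)) m \<phi>\<bar> <= C * h^2 * N"
   proof -
    have "dtau dt (%k. D22 \<gamma>0 X (real k * dt) J (proj_nodes \<gamma>0 X dt x k)) m \<phi> + dtau dt (%k. D23 \<gamma>0 X (real k * dt) J (proj_nodes \<gamma>0 X dt x k)) m \<phi>
     = (grad_fun (t + dt) J q' \<phi> - grad_fun t J q \<phi>) / dt"
     unfolding dtau_def t' q_def[symmetric] q'_def[symmetric] t_def[symmetric] v2[OF tT(1), symmetric] v2[OF tT(2), symmetric]
     by (simp add: diff_divide_distrib add_divide_distrib)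
    then show ?thesis using scale bounds by simp
   qed
   show ?case
    unfolding Let_def q_def[symmetric] N_def[symmetric] using a13 a2 by blast
  qed
 qed
qed

end
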